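(* Suppose that $f:I\to I$ satisfies (A1) and (A2), and that there exist constants $c_0,C_0>0$ such that $d_nE_n\ge C_0e^{c_0n}$ for all $n\ge1$ (for every critical point $c\in\mathcal C$, i.e. $\ell(c)>1$). Let $\mu$ be its ergodic absolutely continuous invariant probability measure and suppose that $f$ is mixing with respect to $\mu$. Then there exist $c>0$, $C>0$ such that $$|\rho_{v,w}(n)|\le C\|v\|\,|w|_\infty e^{-cn}$$ for all $v\in\mathrm{BV}$, $w\in L^\infty$, $n\ge1$, where $\rho_{v,w}(n)=\int_I v\,w\circ f^n\,d\mu-\int_I v\,d\mu\int_I w\,d\mu$.
   Context: **Maps.** $I=[0,1]$, $m$ is Lebesgue measure, $\mathrm{BV}$ is the space of functions $v:I\to\mathbb R$ of bounded variation with norm $\|v\|=|v|_\infty+\operatorname{var}(v)$. $f:I\to I$ is piecewise smooth: $I$ is a union of finitely many intervals such that $f$ is $C^2$ and monotone on the interior of each interval and extends continuously to the boundary of each interval. $\mathcal C$ is the (finite) set of one-sided critical/singular points $c^+$, $c^-$; write $c$ for a generic element (values of $f$ and its iterates at a one-sided point are one-sided limits). For $\delta>0$ let $\Delta(c^+,\delta)=(c^+,c^++\delta)$, $\Delta(c^-,\delta)=(c^--\delta,c^-)$, $\Delta=\bigcup_{c\in\mathcal C}\Delta(c,\delta)$. Write $u\approx v$ if $u/v$ is bounded above and below by positive constants uniformly on the stated domain. (A1) Each $c\in\mathcal C$ has a critical order $\ell=\ell(c)>0$, $\ell(c)\ne1$, such that $|f(x)-f(c)|\approx d(x,c)^{\ell}$,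 $|f'(x)|\approx d(x,c)^{\ell-1}$, $|f''(x)|\approx d(x,c)^{\ell-2}$ for all $x$ in some $\Delta(c,\delta)$. ($c$ is a critical point if $\ell(c)>1$, a singular point if $\ell(c)<1$.) (A2) There is $\kappa>0$, independent of $\delta$, such that $|(f^n)'(x)|\ge\kappa$ for every $x$ and $n\ge1$ with $d(f^jx,\mathcal C)>\delta$ for $0\le j\le n-1$ and $d(f^nx,\mathcal C)\le\delta$. Further, for every $\delta>0$ there are $c(\delta)>0$, $\lambda(\delta)>0$ with $|(f^n)'(x)|\ge c(\delta)e^{\lambda(\delta)n}$ for every $x$ and $n\ge1$ with $d(f^jx,\mathcal C)>\delta$ for $0\le j\le n-1$. For $c\in\mathcal C$ let $D_n=|(f^n)'(f c)|$, $E_n=D_{n-1}^{1/(2\ell(c)-1)}$, $d_n=d(f^nc,\mathcal C)$. For $p\ge0$: (A3$_p$) for every critical point $c$ (i.e. $\ell(c)>1$), $\sum_{n\ge1}n^p d_n^{-1}\log d_n^{-1}\,E_n^{-1}<\infty$. (A4$_p$) for every critical point $c$ (i.e. $\ell(c)>1$), $\sum_{n\ge1}n^pE_n^{-1}<\infty$. **The measure $\mu$.** Araújo, Luzzatto and Viana proved that (A1), (A2), (A3$_0$), (A4$_1$) imply the existence of the following inducing construction, which is fixed. For a sufficiently small $\delta>0$ each $x\in\Delta$ has an integer binding period $b(x)\ge1$; $q_0\ge1$ is a large fixed integer; $\ell_0(x)=\min\{j\ge0:f^jx\in\Delta\}$; $\tau(x)=q_0$ if $\ell_0(x)\ge q_0$,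 and $\tau(x)=\ell_0(x)+b(f^{\ell_0(x)}x)$ otherwise, in which case $x$ is said to have binding period $b(f^{\ell_0(x)}x)$. There is a finite or countable partition $\alpha$ of $I$ (mod $0$) into intervals such that binding period and $\tau$ are constant on elements, and on each $a\in\alpha$ the iterates $f^j$, $0\le j\le\tau(a)$, are continuous and monotone and $F=f^{\tau}$ is smooth, monotone and uniformly expanding. With $\alpha(b)$, $b\ge1$, the set of elements with points of binding period $b$ and $\alpha(0)$ the remaining elements, there are $C,M>0$ with $\#\alpha(b)\le M$; for $a\in\alpha(b)$, $b\ge2$, there is a critical point $c$ with $\sup_a|1/F'|\le CE_b^{-1}$ and $\operatorname{var}_a|1/F'|\le C(1+\log d_{b-1}^{-1})d_{b-1}^{-1}E_{b-1}^{-1}$; for $b\le1$ both quantities are at most $C$. $F$ has an ergodic absolutely continuous invariant probability measure $\hat\mu$ with density $h=d\hat\mu/dm\in\mathrm{BV}$, $\tau$ is Lebesgue integrable, and $\mu(A)=\big(\int\tau\,d\hat\mu\big)^{-1}\sum_{j\ge0}\hat\mu(\{\tau>j\}\cap f^{-j}A)$ is an ergodic absolutely continuous $f$-invariant probability measure. In the theorem, $\mu$ denotes this measure. *)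

theory Defs
  imports "HOL-Probability.Essential_Supremum" "HOL-Probability.Probability"
begin

section \<open>Function spaces on the unit interval\<close>

abbreviation leb :: "real measure" where
  "leb \<equiv> lebesgue_on {0..1}"

definition variation :: "real set \<Rightarrow> (real \<Rightarrow> real) \<Rightarrow> ennreal" where
  "variation S v =
     (SUP xs \<in> {xs. sorted xs \<and> set xs \<subseteq> S}.
        \<Sum>i<length xs - 1. ennreal \<bar>v (xs ! Suc i) - v (xs ! i)\<bar>)"

definition BV :: "(real \<Rightarrow> real) set" where
  "BV = {v. variation {0..1} v < \<infinity>}"

definition Linf :: "(real \<Rightarrow> real) set" where
  "Linf = {w \<in> borel_measurable leb. esssup leb (\<lambda>x. ereal \<bar>w x\<bar>) < \<infinity>}"

definition Linf_norm :: "(real \<Rightarrow> real) \<Rightarrow> real" where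
  "Linf_norm w = real_of_ereal (esssup leb (\<lambda>x. ereal \<bar>w x\<bar>))"

definition BV_norm :: "(real \<Rightarrow> real) \<Rightarrow> real" where
  "BV_norm v = Linf_norm v + enn2real (variation {0..1} v)"


section \<open>Piecewise smooth maps and their one-sided critical and singular points\<close>

definition C2_on :: "(real \<Rightarrow> real) \<Rightarrow> real set \<Rightarrow> bool" where
  "C2_on f S \<longleftrightarrow>
     (\<exists>D. (\<forall>x\<in>S. (f has_real_derivative D x) (at x)) \<and> D C1_differentiable_on S)"

definition monotone_map_on :: "real set \<Rightarrow> (real \<Rightarrow> real) \<Rightarrow> bool" where
  "monotone_map_on S f \<longleftrightarrow> mono_on S f \<or> antimono_on S f"

definition piecewise_smooth :: "(real \<Rightarrow> real) \<Rightarrow> bool" where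
  "piecewise_smooth f \<longleftrightarrow>
     f ` {0..1} \<subseteq> {0..1} \<and>
     (\<exists>\<J>. finite \<J> \<and> \<Union>\<J> = {0..1} \<and>
        (\<forall>J\<in>\<J>. is_interval J \<and> C2_on f (interior J) \<and> monotone_map_on (interior J) f \<and>
           (\<exists>g. continuous_on (closure J) g \<and> (\<forall>x\<in>interior J. g x = f x))))"

text \<open>\<open>RightOf x\<close> and \<open>LeftOf x\<close> are the one-sided points usually written $x^+$ and $x^-$.\<close>

datatype one_sided = RightOf real | LeftOf real

primrec pt :: "one_sided \<Rightarrow> real" where
  "pt (RightOf x) = x"
| "pt (LeftOf x) = x"

primrec side :: "one_sided \<Rightarrow> real filter" where
  "side (RightOf x) = at_right x"
| "side (LeftOf x) = at_left x"

primrec \<Delta>1 :: "one_sided \<Rightarrow> real \<Rightarrow> real set" where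
  "\<Delta>1 (RightOf x) \<delta> = {x<..<x + \<delta>}"
| "\<Delta>1 (LeftOf x) \<delta> = {x - \<delta><..<x}"

text \<open>A one-sided point of the interval is regular if \<open>f'\<close> has a finite nonzero one-sided limit
  there; the set $\mathcal{C}$ consists of the others, the critical ones (\<open>f'\<close> tends to 0) and
  the singular ones (\<open>f'\<close> has no finite limit). At regular points \<open>f\<close> may still be discontinuous.\<close>

definition crit :: "(real \<Rightarrow> real) \<Rightarrow> one_sided set" where
  "crit f = {c \<in> RightOf ` {0..<1} \<union> LeftOf ` {0<..1}.
               \<not> (\<exists>L. L \<noteq> 0 \<and> (deriv f \<longlongrightarrow> L) (side c))}"

definition \<Delta> :: "(real \<Rightarrow> real) \<Rightarrow> real \<Rightarrow> real set" where
  "\<Delta> f \<delta> = (\<Union>c\<in>crit f. \<Delta>1 c \<delta>)"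

text \<open>The distance $d(x,\mathcal{C})$; it is $\infty$ if $\mathcal{C}$ is empty.\<close>

definition crit_dist :: "(real \<Rightarrow> real) \<Rightarrow> real \<Rightarrow> ereal" where
  "crit_dist f x = (INF c\<in>crit f. ereal \<bar>x - pt c\<bar>)"

definition comparable_on :: "real set \<Rightarrow> (real \<Rightarrow> real) \<Rightarrow> (real \<Rightarrow> real) \<Rightarrow> bool" where
  "comparable_on S u v \<longleftrightarrow>
     (\<exists>K\<^sub>1>0. \<exists>K\<^sub>2>0. \<forall>x\<in>S. K\<^sub>1 \<le> u x / v x \<and> u x / v x \<le> K\<^sub>2)"

definition A1 :: "(real \<Rightarrow> real) \<Rightarrow> (one_sided \<Rightarrow> real) \<Rightarrow> bool" where
  "A1 f l \<longleftrightarrow>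
     (\<forall>c\<in>crit f. l c > 0 \<and> l c \<noteq> 1 \<and>
        (\<exists>\<delta>>0.
           comparable_on (\<Delta>1 c \<delta>) (\<lambda>x. \<bar>f x - Lim (side c) f\<bar>) (\<lambda>x. \<bar>x - pt c\<bar> powr l c) \<and>
           comparable_on (\<Delta>1 c \<delta>) (\<lambda>x. \<bar>deriv f x\<bar>) (\<lambda>x. \<bar>x - pt c\<bar> powr (l c - 1)) \<and>
           comparable_on (\<Delta>1 c \<delta>) (\<lambda>x. \<bar>deriv (deriv f) x\<bar>) (\<lambda>x. \<bar>x - pt c\<bar> powr (l c - 2))))"

text \<open>The derivative $(f^n)'(x)$ only makes sense if \<open>f\<close> is differentiable along the orbit segment
  of \<open>x\<close>, which fails when the orbit hits one of the finitely many exceptional points of \<open>f\<close>.\<close>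

definition diff_orbit :: "(real \<Rightarrow> real) \<Rightarrow> nat \<Rightarrow> real \<Rightarrow> bool" where
  "diff_orbit f n x \<longleftrightarrow> (\<forall>j<n. f field_differentiable at ((f ^^ j) x))"

definition A2 :: "(real \<Rightarrow> real) \<Rightarrow> bool" where
  "A2 f \<longleftrightarrow>
     (\<exists>\<kappa>>0. \<forall>\<delta>>0. \<forall>x\<in>{0..1}. \<forall>n\<ge>1. diff_orbit f n x \<longrightarrow>
        (\<forall>j<n. crit_dist f ((f ^^ j) x) > ereal \<delta>) \<longrightarrow> crit_dist f ((f ^^ n) x) \<le> ereal \<delta> \<longrightarrow>
        \<bar>deriv (f ^^ n) x\<bar> \<ge> \<kappa>) \<and>
     (\<forall>\<delta>>0. \<exists>K>0. \<exists>lam>0. \<forall>x\<in>{0..1}. \<forall>n\<ge>1. diff_orbit f n x \<longrightarrow>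
        (\<forall>j<n. crit_dist f ((f ^^ j) x) > ereal \<delta>) \<longrightarrow>
        \<bar>deriv (f ^^ n) x\<bar> \<ge> K * exp (lam * real n))"

text \<open>The quantities $D_n$, $E_n$ and $d_n$ of a one-sided point \<open>c\<close>. Iterates of \<open>f\<close> and their
  derivatives at \<open>c\<close> and at $f(c)$ are one-sided limits along \<open>c\<close>. The index \<open>n - 1\<close> in
  \<open>E\<close> is only relevant for \<open>n \<ge> 1\<close>.\<close>

definition D :: "(real \<Rightarrow> real) \<Rightarrow> one_sided \<Rightarrow> nat \<Rightarrow> real" where
  "D f c n = \<bar>Lim (side c) (\<lambda>x. deriv (f ^^ n) (f x))\<bar>"

definition E :: "(real \<Rightarrow> real) \<Rightarrow> (one_sided \<Rightarrow> real) \<Rightarrow> one_sided \<Rightarrow> nat \<Rightarrow> real" where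
  "E f l c n = D f c (n - 1) powr (1 / (2 * l c - 1))"

definition d :: "(real \<Rightarrow> real) \<Rightarrow> one_sided \<Rightarrow> nat \<Rightarrow> real" where
  "d f c n = real_of_ereal (crit_dist f (Lim (side c) (f ^^ n)))"


section \<open>Invariant measures\<close>

definition acip :: "(real \<Rightarrow> real) \<Rightarrow> real measure \<Rightarrow> bool" where
  "acip T \<nu> \<longleftrightarrow> sets \<nu> = sets leb \<and> prob_space \<nu> \<and> absolutely_continuous leb \<nu> \<and>
     T \<in> measurable \<nu> \<nu> \<and> distr \<nu> \<nu> T = \<nu>"

definition ergodic :: "(real \<Rightarrow> real) \<Rightarrow> real measure \<Rightarrow> bool" where
  "ergodic T \<nu> \<longleftrightarrow>
     (\<forall>A\<in>sets \<nu>. T -` A \<inter> space \<nu> = A \<longrightarrow> measure \<nu> A = 0 \<or> measure \<nu> A = 1)"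

definition mixing :: "(real \<Rightarrow> real) \<Rightarrow> real measure \<Rightarrow> bool" where
  "mixing T \<nu> \<longleftrightarrow>
     (\<forall>A\<in>sets \<nu>. \<forall>B\<in>sets \<nu>.
        (\<lambda>n. measure \<nu> (A \<inter> ((T ^^ n) -` B \<inter> space \<nu>))) \<longlonglongrightarrow> measure \<nu> A * measure \<nu> B)"

definition correlation ::
    "(real \<Rightarrow> real) \<Rightarrow> real measure \<Rightarrow> (real \<Rightarrow> real) \<Rightarrow> (real \<Rightarrow> real) \<Rightarrow> nat \<Rightarrow> real" where
  "correlation f \<mu> v w n =
     (\<integral>x. v x * w ((f ^^ n) x) \<partial>\<mu>) - (\<integral>x. v x \<partial>\<mu>) * (\<integral>x. w x \<partial>\<mu>)"


section \<open>The inducing construction\<close>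

text \<open>In this section \<open>b\<close> gives the binding period of a point of \<open>\<Delta> f \<delta>\<close>; its values elsewhere
  are irrelevant. The value \<open>binding f \<delta> b q\<^sub>0 x = 0\<close> encodes that \<open>x\<close> has no
  binding period, i.e. does not enter \<open>\<Delta> f \<delta>\<close> before time \<open>q\<^sub>0\<close>.\<close>

definition entry_time :: "(real \<Rightarrow> real) \<Rightarrow> real \<Rightarrow> real \<Rightarrow> enat" where
  "entry_time f \<delta> x = (INF j\<in>{j. (f ^^ j) x \<in> \<Delta> f \<delta>}. enat j)"

definition binding :: "(real \<Rightarrow> real) \<Rightarrow> real \<Rightarrow> (real \<Rightarrow> nat) \<Rightarrow> nat \<Rightarrow> real \<Rightarrow> nat" where
  "binding f \<delta> b q\<^sub>0 x =
     (if entry_time f \<delta> x \<ge> enat q\<^sub>0 then 0 else b ((f ^^ the_enat (entry_time f \<delta> x)) x))"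

definition tau :: "(real \<Rightarrow> real) \<Rightarrow> real \<Rightarrow> (real \<Rightarrow> nat) \<Rightarrow> nat \<Rightarrow> real \<Rightarrow> nat" where
  "tau f \<delta> b q\<^sub>0 x =
     (if entry_time f \<delta> x \<ge> enat q\<^sub>0 then q\<^sub>0
      else the_enat (entry_time f \<delta> x) + b ((f ^^ the_enat (entry_time f \<delta> x)) x))"

definition induced :: "(real \<Rightarrow> real) \<Rightarrow> (real \<Rightarrow> nat) \<Rightarrow> real \<Rightarrow> real" where
  "induced f \<tau> x = (f ^^ \<tau> x) x"

definition lifted_measure :: "(real \<Rightarrow> real) \<Rightarrow> (real \<Rightarrow> nat) \<Rightarrow> real measure \<Rightarrow> real measure" where
  "lifted_measure f \<tau> \<nu> =
     measure_of {0..1} (sets leb)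
       (\<lambda>A. (\<Sum>j. emeasure \<nu> ({x\<in>{0..1}. \<tau> x > j} \<inter> (f ^^ j) -` A)) /
            (\<integral>\<^sup>+x. of_nat (\<tau> x) \<partial>\<nu>))"

definition density_measure :: "(real \<Rightarrow> real) \<Rightarrow> real measure" where
  "density_measure h = density leb (\<lambda>x. ennreal (h x))"

text \<open>As \<open>\<alpha>\<close> is a partition modulo null sets, its elements are taken to be open intervals.\<close>

locale inducing_scheme =
  fixes f :: "real \<Rightarrow> real" and l :: "one_sided \<Rightarrow> real"
    and \<delta> :: real and b :: "real \<Rightarrow> nat" and q\<^sub>0 :: nat and \<alpha> :: "real set set"
    and h :: "real \<Rightarrow> real"
    and \<tau> :: "real \<Rightarrow> nat" and F :: "real \<Rightarrow> real" and \<alpha>b :: "nat \<Rightarrow> real set set"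
  defines "\<tau> \<equiv> tau f \<delta> b q\<^sub>0"
    and "F \<equiv> induced f \<tau>"
    and "\<alpha>b \<equiv> \<lambda>k. {a\<in>\<alpha>. \<exists>x\<in>a. binding f \<delta> b q\<^sub>0 x = k}"
  assumes \<delta>_pos: "\<delta> > 0"
    and b_ge_1: "\<And>x. x \<in> \<Delta> f \<delta> \<Longrightarrow> b x \<ge> 1"
    and q\<^sub>0_ge_1: "q\<^sub>0 \<ge> 1"
    and \<alpha>_countable: "countable \<alpha>"
    and \<alpha>_disjoint: "disjoint \<alpha>"
    and \<alpha>_intervals: "\<And>a. a \<in> \<alpha> \<Longrightarrow> open a \<and> is_interval a \<and> a \<noteq> {} \<and> a \<subseteq> {0..1}"
    and \<alpha>_covers: "{0..1} - \<Union>\<alpha> \<in> null_sets leb"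
    and binding_constant: "\<And>a. a \<in> \<alpha> \<Longrightarrow> binding f \<delta> b q\<^sub>0 constant_on a"
    and \<tau>_constant: "\<And>a. a \<in> \<alpha> \<Longrightarrow> \<tau> constant_on a"
    and iterates: "\<And>a x j. a \<in> \<alpha> \<Longrightarrow> x \<in> a \<Longrightarrow> j \<le> \<tau> x \<Longrightarrow>
                     continuous_on a (f ^^ j) \<and> monotone_map_on a (f ^^ j)"
    and F_smooth: "\<And>a. a \<in> \<alpha> \<Longrightarrow> C2_on F a \<and> monotone_map_on a F"
    and F_expanding: "\<exists>\<sigma>>1. \<forall>a\<in>\<alpha>. \<forall>x\<in>a. \<bar>deriv F x\<bar> \<ge> \<sigma>"
    and bounds: "\<exists>C>0. \<exists>M>0.
       (\<forall>k. finite (\<alpha>b k) \<and> card (\<alpha>b k) \<le> M) \<and>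
       (\<forall>k\<ge>2. \<forall>a\<in>\<alpha>b k. \<exists>c\<in>crit f. l c > 1 \<and>
          (\<forall>x\<in>a. \<bar>1 / deriv F x\<bar> \<le> C * inverse (E f l c k)) \<and>
          variation a (\<lambda>x. \<bar>1 / deriv F x\<bar>)
            \<le> ennreal (C * (1 + ln (inverse (d f c (k - 1)))) *
                         inverse (d f c (k - 1)) * inverse (E f l c (k - 1)))) \<and>
       (\<forall>k\<le>1. \<forall>a\<in>\<alpha>b k.
          (\<forall>x\<in>a. \<bar>1 / deriv F x\<bar> \<le> C) \<and> variation a (\<lambda>x. \<bar>1 / deriv F x\<bar>) \<le> ennreal C)"
    and h_BV: "h \<in> BV"
    and h_nonneg: "\<And>x. x \<in> {0..1} \<Longrightarrow> h x \<ge> 0"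
    and F_acip: "acip F (density_measure h)" "ergodic F (density_measure h)"
    and \<tau>_integrable: "integrable leb (\<lambda>x. real (\<tau> x))"
    and f_acip: "acip f (lifted_measure f \<tau> (density_measure h))"
                "ergodic f (lifted_measure f \<tau> (density_measure h))"

end

theory Submission
  imports Defs
begin

text \<open>
  The return map \<open>F = f\<^sup>\<tau>\<close> is uniformly expanding with countably many monotone branches. The growth condition on
  $d_n E_n$ makes the weights \<open>1 / F'\<close> of the branches and their variations decay exponentially in the binding
  period, hence in the return time: the only factor that is not bounded by the condition itself is $\log d_n^{-1}$, and it grows
  subexponentially (\<open>log_dist_subexponential\<close>), because a block of steps of fixed length can at most square
  the derivative along a critical orbit, up to a constant. So the weights remain contracting and summable when they are multiplied by
  \<open>exp (\<theta> * \<tau>)\<close> with a small \<open>\<theta> > 0\<close> (\<open>base_branch_scheme\<close>), and passing to a power of \<open>F\<close> makes them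
  as small as desired (\<open>branch_scheme_power\<close>).

  Correlations are then read off a renewal process. Mass on the base of the tower leaves along the branches, and
  branch \<open>i\<close> delivers its part \<open>t i\<close> steps later. A state of the process is a family \<open>G\<close> of densities, where
  \<open>G s\<close> is due to arrive in \<open>s\<close> steps, and \<open>step\<close> advances it by one unit of time. The integral of
  \<open>v \<cdot> w \<circ> f\<^sup>n\<close> against \<open>\<mu>\<close> is, up to a factor and an exponentially small error, an observation at time \<open>n\<close> of the state
  in which \<open>v\<close> is distributed over the levels of the tower (\<open>tower_observe\<close>). In the norm with weights \<open>exp (\<theta> * s)\<close>
  the operator \<open>step\<close> satisfies a Lasota--Yorke inequality (\<open>sum_push_lasota_yorke\<close>, \<open>strong_norm_step\<close>), and
  bounded sets of states are totally bounded in mean (\<open>states_net\<close>).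

  The states of mean zero need not contract in mean, since the return times may have a common divisor although
  \<open>f\<close> is mixing. But mixing makes the observations of a fixed state through a fixed \<open>w\<close> of mean zero tend to 0
  (\<open>observe_null\<close>). By the Lasota--Yorke inequality and total boundedness every orbit of \<open>step\<close> is precompact,
  so that some point of it is approached by infinitely many later points, whose observations are
  observations of the initial state at late times. In this way pointwise decay bounds the observations of
  a finite net of states uniformly in \<open>w\<close>, and the optimal constants in \<open>\<bar>observe n w G\<bar> \<le> A\<^sub>n * strong_norm G\<close> are halved, up
  to an exponentially small error, in a fixed number of steps (\<open>halving_step\<close>). This is exponential decay
  (\<open>exponential_decay\<close>), without any spectral theory of \<open>step\<close>.
\<close>

section \<open>Functions of bounded variation\<close>

text \<open>The nondecreasing half of a Jordan decomposition: \<open>v\<close> has variation at most \<open>V\<close> on \<open>S\<close> if and only if some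
  function with values between \<open>0\<close> and \<open>V\<close> controls it. Estimates of variations are made on control
  functions, which avoids manipulating finite sequences of points.\<close>

definition controls :: "(real \<Rightarrow> real) \<Rightarrow> real set \<Rightarrow> (real \<Rightarrow> real) \<Rightarrow> bool" where
  "controls W S v \<longleftrightarrow> (\<forall>x\<in>S. \<forall>y\<in>S. x \<le> y \<longrightarrow> \<bar>v y - v x\<bar> \<le> W y - W x)"

lemma controlsD: "controls W S v \<Longrightarrow> x \<in> S \<Longrightarrow> y \<in> S \<Longrightarrow> x \<le> y \<Longrightarrow> \<bar>v y - v x\<bar> \<le> W y - W x"
  by (auto simp: controls_def)

lemma controls_mono: "controls W S v \<Longrightarrow> mono_on S W"
  unfolding mono_on_def using controlsD by fastforce

lemma controls_subset: "controls W S v \<Longrightarrow> T \<subseteq> S \<Longrightarrow> controls W T v"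
  by (auto simp: controls_def)

lemma variation_leI:
  assumes W: "controls W S v" and V: "\<And>x. x \<in> S \<Longrightarrow> 0 \<le> W x \<and> W x \<le> V"
  shows "variation S v \<le> ennreal V"
  unfolding variation_def
proof (rule SUP_least, clarify)
  fix xs :: "real list" assume xs: "sorted xs" "set xs \<subseteq> S"
  show "(\<Sum>i<length xs - 1. ennreal \<bar>v (xs ! Suc i) - v (xs ! i)\<bar>) \<le> ennreal V"
  proof (cases "xs = []")
    case True then show ?thesis by simp
  next
    case False
    have "(\<Sum>i<length xs - 1. ennreal \<bar>v (xs ! Suc i) - v (xs ! i)\<bar>)
        = ennreal (\<Sum>i<length xs - 1. \<bar>v (xs ! Suc i) - v (xs ! i)\<bar>)"
      by (simp add: sum_ennreal)
    also have "\<dots> \<le> ennreal (\<Sum>i<length xs - 1. W (xs ! Suc i) - W (xs ! i))"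
      using xs by (intro ennreal_leI sum_mono controlsD[OF W])
        (auto intro!: sorted_nth_mono subsetD[OF xs(2)])
    also have "(\<Sum>i<length xs - 1. W (xs ! Suc i) - W (xs ! i)) = W (xs ! (length xs - 1)) - W (xs ! 0)"
      by (subst sum_lessThan_telescope[of "\<lambda>i. W (xs ! i)"]) simp
    also have "\<dots> \<le> V"
    proof -
      have "xs ! (length xs - 1) \<in> S" "xs ! 0 \<in> S" using False xs by (auto simp: subset_iff)
      then show ?thesis using V[of "xs ! (length xs - 1)"] V[of "xs ! 0"] by linarith
    qed
    finally show ?thesis by (simp add: ennreal_leI)
  qed
qed

lemma variation_mono: "S \<subseteq> T \<Longrightarrow> variation S v \<le> variation T v"
  unfolding variation_def by (rule SUP_subset_mono) auto

lemma variation_cong: "(\<And>x. x \<in> S \<Longrightarrow> u x = v x) \<Longrightarrow> variation S u = variation S v"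
  unfolding variation_def
  by (intro SUP_cong refl sum.cong arg_cong[of _ _ ennreal] arg_cong[of _ _ abs] arg_cong2[of _ _ _ _ minus])
     (auto simp: subset_iff)

text \<open>A finite sequence in \<open>S \<inter> {..x}\<close> may be prolonged by \<open>x\<close> and \<open>y\<close>, which adds the jump.\<close>

lemma variation_step:
  assumes "x \<in> S" "y \<in> S" "x \<le> y"
  shows "variation (S \<inter> {..x}) v + ennreal \<bar>v y - v x\<bar> \<le> variation (S \<inter> {..y}) v"
proof -
  have "variation (S \<inter> {..x}) v + ennreal \<bar>v y - v x\<bar> =
     (SUP xs \<in> {xs. sorted xs \<and> set xs \<subseteq> S \<inter> {..x}}.
        (\<Sum>i<length xs - 1. ennreal \<bar>v (xs ! Suc i) - v (xs ! i)\<bar>) + ennreal \<bar>v y - v x\<bar>)"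
    unfolding variation_def by (rule ennreal_SUP_add_left[symmetric]) (auto intro: exI[of _ "[]"])
  also have "\<dots> \<le> variation (S \<inter> {..y}) v"
  proof (rule SUP_least, clarify)
    fix xs :: "real list" assume xs: "sorted xs" "set xs \<subseteq> S \<inter> {..x}"
    let ?ys = "xs @ [x, y]"
    have ys: "sorted ?ys" "set ?ys \<subseteq> S \<inter> {..y}" using xs assms by (auto simp: sorted_append)
    have "(\<Sum>i<length xs - 1. ennreal \<bar>v (xs ! Suc i) - v (xs ! i)\<bar>) + ennreal \<bar>v y - v x\<bar>
       = (\<Sum>i<length xs - 1. ennreal \<bar>v (?ys ! Suc i) - v (?ys ! i)\<bar>)
         + (\<Sum>i\<in>{length xs}. ennreal \<bar>v (?ys ! Suc i) - v (?ys ! i)\<bar>)"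
      by (auto simp: nth_append intro!: sum.cong)
    also have "\<dots> = (\<Sum>i\<in>{..<length xs - 1} \<union> {length xs}. ennreal \<bar>v (?ys ! Suc i) - v (?ys ! i)\<bar>)"
      by (rule sum.union_disjoint[symmetric]) auto
    also have "\<dots> \<le> (\<Sum>i<length ?ys - 1. ennreal \<bar>v (?ys ! Suc i) - v (?ys ! i)\<bar>)"
      by (rule sum_mono2) auto
    also have "\<dots> \<le> variation (S \<inter> {..y}) v"
      unfolding variation_def using ys by (intro SUP_upper) auto
    finally show "(\<Sum>i<length xs - 1. ennreal \<bar>v (xs ! Suc i) - v (xs ! i)\<bar>) + ennreal \<bar>v y - v x\<bar>
      \<le> variation (S \<inter> {..y}) v" .
  qed
  finally show ?thesis .
qed

lemma variation_controls:
  assumes fin: "variation S v < \<infinity>"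
  shows "controls (\<lambda>x. enn2real (variation (S \<inter> {..x}) v)) S v"
    and "0 \<le> enn2real (variation (S \<inter> {..x}) v)"
    and "enn2real (variation (S \<inter> {..x}) v) \<le> enn2real (variation S v)"
proof -
  have f: "variation (S \<inter> {..x}) v < \<infinity>" for x
    using fin variation_mono[of "S \<inter> {..x}" S v] by (auto intro: le_less_trans)
  show "controls (\<lambda>x. enn2real (variation (S \<inter> {..x}) v)) S v"
    unfolding controls_def
  proof (intro ballI impI)
    fix x y assume xy: "x \<in> S" "y \<in> S" "x \<le> y"
    have "enn2real (variation (S \<inter> {..x}) v + ennreal \<bar>v y - v x\<bar>) \<le> enn2real (variation (S \<inter> {..y}) v)"
      using variation_step[OF xy, of v] f[of y] by (intro enn2real_mono) auto
    then show "\<bar>v y - v x\<bar> \<le> enn2real (variation (S \<inter> {..y}) v) - enn2real (variation (S \<inter> {..x}) v)"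
      using f[of x] by (subst (asm) enn2real_plus) auto
  qed
  show "0 \<le> enn2real (variation (S \<inter> {..x}) v)" by simp
  show "enn2real (variation (S \<inter> {..x}) v) \<le> enn2real (variation S v)"
    using fin by (intro enn2real_mono variation_mono) auto
qed

lemma variation_controlE:
  assumes "variation S v < \<infinity>"
  obtains W where "controls W S v" "\<And>x. x \<in> S \<Longrightarrow> 0 \<le> W x \<and> W x \<le> enn2real (variation S v)"
  using variation_controls[OF assms] by blast

lemma variation_add:
  "variation S (\<lambda>x. u x + v x) \<le> variation S u + variation S v"
proof (cases "variation S u < \<infinity> \<and> variation S v < \<infinity>")
  case True
  obtain U where U: "controls U S u" "\<And>x. x \<in> S \<Longrightarrow> 0 \<le> U x \<and> U x \<le> enn2real (variation S u)"
    using variation_controlE True by blast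
  obtain V where V: "controls V S v" "\<And>x. x \<in> S \<Longrightarrow> 0 \<le> V x \<and> V x \<le> enn2real (variation S v)"
    using variation_controlE True by blast
  have "variation S (\<lambda>x. u x + v x) \<le> ennreal (enn2real (variation S u) + enn2real (variation S v))"
  proof (rule variation_leI[of "\<lambda>x. U x + V x"])
    show "controls (\<lambda>x. U x + V x) S (\<lambda>x. u x + v x)"
      unfolding controls_def using controlsD[OF U(1)] controlsD[OF V(1)] by (smt (verit))
  qed (use U(2) V(2) in fastforce)
  then show ?thesis using True by (simp add: ennreal_plus)
next
  case False then show ?thesis by (auto simp: not_less top_unique)
qed

lemma variation_mult:
  assumes A: "\<And>x. x \<in> S \<Longrightarrow> \<bar>u x\<bar> \<le> A" and B: "\<And>x. x \<in> S \<Longrightarrow> \<bar>v x\<bar> \<le> B"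
    and fin: "variation S u < \<infinity>" "variation S v < \<infinity>"
  shows "variation S (\<lambda>x. u x * v x) \<le> ennreal A * variation S v + ennreal B * variation S u"
proof (cases "S = {}")
  case True
  have "variation S (\<lambda>x. u x * v x) = 0" unfolding variation_def True by (auto simp: SUP_constant)
  then show ?thesis by simp
next
  case False
  then have AB: "0 \<le> A" "0 \<le> B" using A B by (metis abs_ge_zero ex_in_conv order_trans)+
  obtain U where U: "controls U S u" "\<And>x. x \<in> S \<Longrightarrow> 0 \<le> U x \<and> U x \<le> enn2real (variation S u)"
    using variation_controlE fin by blast
  obtain V where V: "controls V S v" "\<And>x. x \<in> S \<Longrightarrow> 0 \<le> V x \<and> V x \<le> enn2real (variation S v)"
    using variation_controlE fin by blast
  have "variation S (\<lambda>x. u x * v x) \<le> ennreal (A * enn2real (variation S v) + B * enn2real (variation S u))"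
  proof (rule variation_leI[of "\<lambda>x. A * V x + B * U x"])
    show "controls (\<lambda>x. A * V x + B * U x) S (\<lambda>x. u x * v x)"
      unfolding controls_def
    proof (intro ballI impI)
      fix x y assume xy: "x \<in> S" "y \<in> S" "x \<le> y"
      have "u y * v y - u x * v x = u y * (v y - v x) + v x * (u y - u x)" by (simp add: algebra_simps)
      then have "\<bar>u y * v y - u x * v x\<bar> \<le> \<bar>u y\<bar> * \<bar>v y - v x\<bar> + \<bar>v x\<bar> * \<bar>u y - u x\<bar>"
        by (metis abs_mult abs_triangle_ineq)
      also have "\<dots> \<le> A * (V y - V x) + B * (U y - U x)"
        using A B xy AB controlsD[OF U(1) xy] controlsD[OF V(1) xy] by (intro add_mono mult_mono) auto
      finally show "\<bar>u y * v y - u x * v x\<bar> \<le> A * V y + B * U y - (A * V x + B * U x)"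
        by (simp add: algebra_simps)
    qed
    show "0 \<le> A * V x + B * U x \<and> A * V x + B * U x \<le> A * enn2real (variation S v) + B * enn2real (variation S u)"
      if "x \<in> S" for x using U(2)[OF that] V(2)[OF that] AB by (auto intro!: add_mono mult_left_mono)
  qed
  then show ?thesis using fin AB by (simp add: ennreal_plus ennreal_mult)
qed

lemma variation_cmult: "variation S (\<lambda>x. c * v x) = ennreal \<bar>c\<bar> * variation S v"
proof -
  have "variation S (\<lambda>x. c * v x) = (SUP xs \<in> {xs. sorted xs \<and> set xs \<subseteq> S}.
        ennreal \<bar>c\<bar> * (\<Sum>i<length xs - 1. ennreal \<bar>v (xs ! Suc i) - v (xs ! i)\<bar>))"
    unfolding variation_def
  proof (intro SUP_cong refl)
    fix xs :: "real list"
    have "ennreal \<bar>c * v (xs ! Suc i) - c * v (xs ! i)\<bar> = ennreal \<bar>c\<bar> * ennreal \<bar>v (xs ! Suc i) - v (xs ! i)\<bar>" for i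
      by (simp add: abs_mult flip: ennreal_mult right_diff_distrib)
    then show "(\<Sum>i<length xs - 1. ennreal \<bar>c * v (xs ! Suc i) - c * v (xs ! i)\<bar>) =
       ennreal \<bar>c\<bar> * (\<Sum>i<length xs - 1. ennreal \<bar>v (xs ! Suc i) - v (xs ! i)\<bar>)"
      by (simp add: sum_distrib_left del: sum_ennreal)
  qed
  also have "\<dots> = ennreal \<bar>c\<bar> * variation S v"
    unfolding variation_def by (rule SUP_mult_left_ennreal[symmetric])
  finally show ?thesis .
qed

lemma variation_const [simp]: "variation S (\<lambda>x. c) = 0"
  using variation_leI[of "\<lambda>_. 0" S "\<lambda>_. c" 0] by (simp add: controls_def)

lemma variation_suminf:
  assumes "\<And>x. x \<in> S \<Longrightarrow> summable (\<lambda>i. u i x)"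
  shows "variation S (\<lambda>x. \<Sum>i. u i x) \<le> (\<Sum>i. variation S (u i))"
  unfolding variation_def[of S "\<lambda>x. \<Sum>i. u i x"]
proof (rule SUP_least, clarify)
  fix xs :: "real list" assume xs: "sorted xs" "set xs \<subseteq> S"
  have "(\<Sum>k<length xs - 1. ennreal \<bar>(\<Sum>i. u i (xs ! Suc k)) - (\<Sum>i. u i (xs ! k))\<bar>)
     \<le> (\<Sum>k<length xs - 1. \<Sum>i. ennreal \<bar>u i (xs ! Suc k) - u i (xs ! k)\<bar>)"
  proof (rule sum_mono)
    fix k assume "k \<in> {..<length xs - 1}"
    then have k: "xs ! k \<in> S" "xs ! Suc k \<in> S" using xs by (auto simp: subset_iff)
    let ?a = "\<lambda>i. u i (xs ! Suc k) - u i (xs ! k)"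
    have sm: "summable ?a" using assms k by (intro summable_diff)
    have "(\<Sum>i. u i (xs ! Suc k)) - (\<Sum>i. u i (xs ! k)) = suminf ?a"
      using assms k by (intro suminf_diff)
    moreover have "ennreal \<bar>suminf ?a\<bar> \<le> (\<Sum>i. ennreal \<bar>?a i\<bar>)"
    proof -
      have "(\<lambda>n. ennreal \<bar>\<Sum>i<n. ?a i\<bar>) \<longlonglongrightarrow> ennreal \<bar>suminf ?a\<bar>"
        using summable_LIMSEQ[OF sm] by (intro tendsto_ennrealI tendsto_rabs)
      moreover have "\<forall>n\<ge>0. ennreal \<bar>\<Sum>i<n. ?a i\<bar> \<le> (\<Sum>i. ennreal \<bar>?a i\<bar>)"
      proof (intro allI impI)
        fix n :: nat
        have "ennreal \<bar>\<Sum>i<n. ?a i\<bar> \<le> ennreal (\<Sum>i<n. \<bar>?a i\<bar>)" by (intro ennreal_leI sum_abs)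
        also have "\<dots> = (\<Sum>i<n. ennreal \<bar>?a i\<bar>)" by (simp add: sum_ennreal)
        also have "\<dots> \<le> (\<Sum>i. ennreal \<bar>?a i\<bar>)" by (intro sum_le_suminf) auto
        finally show "ennreal \<bar>\<Sum>i<n. ?a i\<bar> \<le> (\<Sum>i. ennreal \<bar>?a i\<bar>)" .
      qed
      ultimately show ?thesis by (rule LIMSEQ_le_const2[OF _ exI[of _ 0]])
    qed
    ultimately show "ennreal \<bar>(\<Sum>i. u i (xs ! Suc k)) - (\<Sum>i. u i (xs ! k))\<bar>
      \<le> (\<Sum>i. ennreal \<bar>u i (xs ! Suc k) - u i (xs ! k)\<bar>)" by simp
  qed
  also have "\<dots> = (\<Sum>i. \<Sum>k<length xs - 1. ennreal \<bar>u i (xs ! Suc k) - u i (xs ! k)\<bar>)"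
    by (rule suminf_sum[symmetric]) auto
  also have "\<dots> \<le> (\<Sum>i. variation S (u i))"
    unfolding variation_def using xs by (intro suminf_le SUP_upper) auto
  finally show "(\<Sum>k<length xs - 1. ennreal \<bar>(\<Sum>i. u i (xs ! Suc k)) - (\<Sum>i. u i (xs ! k))\<bar>)
     \<le> (\<Sum>i. variation S (u i))" .
qed

lemma variation_comp:
  assumes "monotone_map_on S \<psi>" and sub: "\<psi> ` S \<subseteq> T"
  shows "variation S (\<lambda>x. v (\<psi> x)) \<le> variation T v"
proof (cases "variation T v < \<infinity>")
  case True
  then obtain W where W: "controls W T v" "\<And>x. x \<in> T \<Longrightarrow> 0 \<le> W x \<and> W x \<le> enn2real (variation T v)"
    using variation_controlE by blast
  from assms(1) have "variation S (\<lambda>x. v (\<psi> x)) \<le> ennreal (enn2real (variation T v))"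
    unfolding monotone_map_on_def
  proof
    assume m: "mono_on S \<psi>"
    show ?thesis
    proof (rule variation_leI[of "\<lambda>x. W (\<psi> x)"])
      show "controls (\<lambda>x. W (\<psi> x)) S (\<lambda>x. v (\<psi> x))"
        unfolding controls_def
      proof (intro ballI impI)
        fix x y assume xy: "x \<in> S" "y \<in> S" "x \<le> y"
        show "\<bar>v (\<psi> y) - v (\<psi> x)\<bar> \<le> W (\<psi> y) - W (\<psi> x)"
          using sub xy by (intro controlsD[OF W(1)] mono_onD[OF m]) auto
      qed
    qed (use W(2) sub in auto)
  next
    assume m: "antimono_on S \<psi>"
    have m': "\<psi> y \<le> \<psi> x" if "x \<in> S" "y \<in> S" "x \<le> y" for x y
      using m that by (simp add: monotone_on_def)
    show ?thesis
    proof (rule variation_leI[of "\<lambda>x. enn2real (variation T v) - W (\<psi> x)"])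
      show "controls (\<lambda>x. enn2real (variation T v) - W (\<psi> x)) S (\<lambda>x. v (\<psi> x))"
        unfolding controls_def
      proof (intro ballI impI)
        fix x y assume xy: "x \<in> S" "y \<in> S" "x \<le> y"
        show "\<bar>v (\<psi> y) - v (\<psi> x)\<bar> \<le> enn2real (variation T v) - W (\<psi> y) - (enn2real (variation T v) - W (\<psi> x))"
          using controlsD[OF W(1) _ _ m'[OF xy]] sub xy by (auto simp: abs_minus_commute)
      qed
    qed (use W(2) sub in auto)
  qed
  then show ?thesis using True by simp
qed (auto simp: not_less top_unique)

text \<open>Extending by 0 creates at most two jumps, one at each end of \<open>K\<close>, of size at most \<open>B\<close>.\<close>

lemma variation_extend_zero:
  assumes K: "is_interval K" and B: "\<And>x. x \<in> K \<Longrightarrow> \<bar>u x\<bar> \<le> B"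
  shows "variation T (\<lambda>x. if x \<in> K then u x else 0) \<le> variation K u + 2 * ennreal B"
proof (cases "variation K u < \<infinity> \<and> K \<noteq> {}")
  case True
  then have fin: "variation K u < \<infinity>" and ne: "K \<noteq> {}" by auto
  have B0: "0 \<le> B" using ne B by (metis abs_ge_zero ex_in_conv order_trans)
  obtain W where W: "controls W K u" "\<And>x. x \<in> K \<Longrightarrow> 0 \<le> W x \<and> W x \<le> enn2real (variation K u)"
    using variation_controlE fin by blast
  let ?V = "enn2real (variation K u)"
  have V0: "0 \<le> ?V" by simp
  \<comment> \<open>The jumps are charged at both ends of \<open>K\<close>: \<open>B\<close> on entering and \<open>B\<close> on leaving.\<close>
  define Z where "Z = (\<lambda>x. if x \<in> K then B + W x else if \<exists>y\<in>K. y < x then ?V + 2 * B else 0)"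
  have Kc: "z \<in> K" if "x \<in> K" "y \<in> K" "x \<le> z" "z \<le> y" for x y z
    using K that by (meson mem_is_interval_1_I)
  have "variation T (\<lambda>x. if x \<in> K then u x else 0) \<le> ennreal (?V + 2 * B)"
  proof (rule variation_leI[of Z])
    show "controls Z T (\<lambda>x. if x \<in> K then u x else 0)"
      unfolding controls_def
    proof (intro ballI impI)
      fix x y :: real assume xy: "x \<le> y"
      consider "x \<in> K" "y \<in> K" | "x \<in> K" "y \<notin> K" "\<exists>z\<in>K. z < y" | "x \<notin> K" "y \<in> K" "\<not> (\<exists>z\<in>K. z < x)"
        | "x \<notin> K" "y \<notin> K"
      proof (cases "x \<in> K")
        case True
        then show ?thesis using that xy by (cases "y \<in> K") (auto simp: less_le)
      next
        case False
        then show ?thesis using that Kc[of _ y x] xy by (cases "y \<in> K") force+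
      qed
      then show "\<bar>(if y \<in> K then u y else 0) - (if x \<in> K then u x else 0)\<bar> \<le> Z y - Z x"
      proof cases
        case 1 then show ?thesis using controlsD[OF W(1) 1 xy] by (simp add: Z_def)
      next
        case 2 then show ?thesis using B[OF 2(1)] W(2)[OF 2(1)] by (simp add: Z_def)
      next
        case 3 then show ?thesis using B[OF 3(2)] W(2)[OF 3(2)] by (simp add: Z_def)
      next
        case 4 then show ?thesis using B0 V0 xy by (auto simp: Z_def)
      qed
    qed
    show "0 \<le> Z x \<and> Z x \<le> ?V + 2 * B" for x
      using W(2)[of x] B0 V0 by (auto simp: Z_def)
  qed
  then show ?thesis using fin B0 by (simp add: ennreal_plus ennreal_mult)
next
  case False
  show ?thesis
  proof (cases "K = {}")
    case True then show ?thesis by simp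
  next
    case K: False
    with False show ?thesis by (auto simp: not_less top_unique)
  qed
qed

lemma variation_glue:
  assumes p: "p \<in> Q"
  shows "variation Q v \<le> variation (Q \<inter> {..p}) v + variation (Q \<inter> {p..}) v"
proof (cases "variation (Q \<inter> {..p}) v < \<infinity> \<and> variation (Q \<inter> {p..}) v < \<infinity>")
  case True
  obtain U where U: "controls U (Q \<inter> {..p}) v" "\<And>x. x \<in> Q \<inter> {..p} \<Longrightarrow> 0 \<le> U x \<and> U x \<le> enn2real (variation (Q \<inter> {..p}) v)"
    using variation_controlE True by blast
  obtain V where V: "controls V (Q \<inter> {p..}) v" "\<And>x. x \<in> Q \<inter> {p..} \<Longrightarrow> 0 \<le> V x \<and> V x \<le> enn2real (variation (Q \<inter> {p..}) v)"
    using variation_controlE True by blast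
  let ?a = "enn2real (variation (Q \<inter> {..p}) v)" and ?b = "enn2real (variation (Q \<inter> {p..}) v)"
  \<comment> \<open>The control function of the right part starts where that of the left part may end.\<close>
  define Z where "Z = (\<lambda>x. if x \<le> p then U x else ?a + V x)"
  have "variation Q v \<le> ennreal (?a + ?b)"
  proof (rule variation_leI[of Z])
    show "controls Z Q v"
      unfolding controls_def
    proof (intro ballI impI)
      fix x y assume xy: "x \<in> Q" "y \<in> Q" "x \<le> y"
      consider "y \<le> p" | "p < x" | "x \<le> p" "p < y" by linarith
      then show "\<bar>v y - v x\<bar> \<le> Z y - Z x"
      proof cases
        case 1 then show ?thesis using xy controlsD[OF U(1), of x y] by (auto simp: Z_def)
      next
        case 2 then show ?thesis using xy controlsD[OF V(1), of x y] by (auto simp: Z_def)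
      next
        case 3
        have "\<bar>v p - v x\<bar> \<le> U p - U x" "\<bar>v y - v p\<bar> \<le> V y - V p"
          using xy 3 p controlsD[OF U(1), of x p] controlsD[OF V(1), of p y] by auto
        moreover have "U p \<le> ?a" "0 \<le> V p" using U(2)[of p] V(2)[of p] p by auto
        ultimately show ?thesis using 3 by (auto simp: Z_def)
      qed
    qed
    show "0 \<le> Z x \<and> Z x \<le> ?a + ?b" if "x \<in> Q" for x
      using U(2)[of x] V(2)[of x] that by (auto simp: Z_def add_increasing add_increasing2)
  qed
  then show ?thesis using True by (simp add: ennreal_plus)
next
  case False then show ?thesis by (auto simp: not_less top_unique)
qed

lemma variation_split:
  assumes p: "p \<in> Q"
  shows "variation (Q \<inter> {..p}) v + variation (Q \<inter> {p..}) v \<le> variation Q v"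
proof (cases "variation Q v < \<infinity>")
  case True
  then obtain W where W: "controls W Q v" "\<And>x. x \<in> Q \<Longrightarrow> 0 \<le> W x \<and> W x \<le> enn2real (variation Q v)"
    using variation_controlE by blast
  have mono: "W x \<le> W y" if "x \<in> Q" "y \<in> Q" "x \<le> y" for x y
    using controlsD[OF W(1) that] by auto
  have "variation (Q \<inter> {..p}) v \<le> ennreal (W p)"
    using W p mono by (intro variation_leI[of W]) (auto intro: controls_subset)
  moreover have "variation (Q \<inter> {p..}) v \<le> ennreal (enn2real (variation Q v) - W p)"
    using W p mono by (intro variation_leI[of "\<lambda>x. W x - W p"]) (auto simp: controls_def)
  ultimately have "variation (Q \<inter> {..p}) v + variation (Q \<inter> {p..}) v \<le>
      ennreal (W p) + ennreal (enn2real (variation Q v) - W p)" by (rule add_mono)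
  also have "\<dots> = variation Q v"
    using W(2)[OF p] True by (simp flip: ennreal_plus)
  finally show ?thesis .
qed (auto simp: not_less top_unique)

text \<open>A control function is monotone, so it maps disjoint intervals into intervals that overlap in end points only.
  Their lengths, which bound the variations, add up to at most the length of the range.\<close>

lemma variation_disjoint_intervals:
  assumes J: "\<And>i. i \<in> I \<Longrightarrow> is_interval (J i)" and disj: "disjoint_family_on J I"
    and sub: "\<And>i. i \<in> I \<Longrightarrow> J i \<subseteq> S" and I: "finite I"
  shows "(\<Sum>i\<in>I. variation (J i) v) \<le> variation S v"
proof (cases "variation S v < \<infinity>")
  case True
  then obtain W where W: "controls W S v" "\<And>x. x \<in> S \<Longrightarrow> 0 \<le> W x \<and> W x \<le> enn2real (variation S v)"
    using variation_controlE by blast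
  have mono: "W x \<le> W y" if "x \<in> S" "y \<in> S" "x \<le> y" for x y
    using controlsD[OF W(1) that] by auto
  define I' where "I' = {i\<in>I. J i \<noteq> {}}"
  have bnd: "bdd_below (W ` J i)" "bdd_above (W ` J i)" if "i \<in> I" for i
    using W(2) sub[OF that] by (auto intro!: bdd_belowI2[of _ 0] bdd_aboveI2[of _ _ "enn2real (variation S v)"])
  define a b where "a = (\<lambda>i. Inf (W ` J i))" and "b = (\<lambda>i. Sup (W ` J i))"
  have ab: "a i \<le> W x \<and> W x \<le> b i" if "i \<in> I" "x \<in> J i" for i x
    using that bnd unfolding a_def b_def by (auto intro: cINF_lower cSUP_upper)
  have ab01: "0 \<le> a i \<and> b i \<le> enn2real (variation S v)" if "i \<in> I'" for i
    using that W(2) sub unfolding a_def b_def I'_def by (auto intro!: cINF_greatest cSUP_least)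
  have le: "a i \<le> b i" if "i \<in> I'" for i using ab that unfolding I'_def by force
  have dis: "disjoint_family_on (\<lambda>i. {a i<..<b i}) I'"
    unfolding disjoint_family_on_def
  proof (intro ballI impI)
    fix i j assume ij: "i \<in> I'" "j \<in> I'" "i \<noteq> j"
    obtain p q where pq: "p \<in> J i" "q \<in> J j" using ij by (auto simp: I'_def)
    have dj: "J i \<inter> J j = {}" using disj ij by (auto simp: disjoint_family_on_def I'_def)
    have key: "b i \<le> a j" if "i \<in> I'" "j \<in> I'" "J i \<inter> J j = {}" "p \<in> J i" "q \<in> J j" "p \<le> q" for i j p q
    proof -
      have I: "i \<in> I" "j \<in> I" using that by (auto simp: I'_def)
      have "x \<le> y" if "x \<in> J i" "y \<in> J j" for x y
      proof (rule ccontr)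
        assume "\<not> x \<le> y"
        then have "y < x" by simp
        show False
        proof (cases "y \<le> p")
          case True
          then have "p \<in> J j" using mem_is_interval_1_I[OF J[OF I(2)] \<open>y \<in> J j\<close> \<open>q \<in> J j\<close>] \<open>p \<le> q\<close> by auto
          then show False using \<open>p \<in> J i\<close> \<open>J i \<inter> J j = {}\<close> by auto
        next
          case False
          then have "p \<le> y" "y \<le> x" using \<open>y < x\<close> by auto
          then have "y \<in> J i" using mem_is_interval_1_I[OF J[OF I(1)] \<open>p \<in> J i\<close> \<open>x \<in> J i\<close>] by auto
          then show False using \<open>y \<in> J j\<close> \<open>J i \<inter> J j = {}\<close> by auto
        qed
      qed
      then have "W x \<le> W y" if "x \<in> J i" "y \<in> J j" for x y
        using that sub I by (blast intro: mono)
      then show ?thesis unfolding a_def b_def using that by (intro cSUP_least cINF_greatest) auto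
    qed
    show "{a i<..<b i} \<inter> {a j<..<b j} = {}"
    proof (cases "p \<le> q")
      case True
      then show ?thesis using key[OF ij(1,2) dj pq] by auto
    next
      case False
      then show ?thesis using key[OF ij(2,1) _ pq(2,1)] dj by (auto simp: Int_commute)
    qed
  qed
  have "(\<Sum>i\<in>I. variation (J i) v) = (\<Sum>i\<in>I'. variation (J i) v)"
  proof (rule sum.mono_neutral_right[OF I])
    show "\<forall>i\<in>I - I'. variation (J i) v = 0" by (auto simp: I'_def variation_def SUP_constant)
  qed (auto simp: I'_def)
  also have "\<dots> \<le> (\<Sum>i\<in>I'. ennreal (b i - a i))"
  proof (rule sum_mono)
    fix i assume i: "i \<in> I'"
    then have "i \<in> I" by (auto simp: I'_def)
    show "variation (J i) v \<le> ennreal (b i - a i)"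
    proof (rule variation_leI[of "\<lambda>x. W x - a i"])
      show "controls (\<lambda>x. W x - a i) (J i) v"
        using controls_subset[OF W(1) sub[OF \<open>i \<in> I\<close>]] by (simp add: controls_def)
      show "0 \<le> W x - a i \<and> W x - a i \<le> b i - a i" if "x \<in> J i" for x
        using ab[OF \<open>i \<in> I\<close> that] by simp
    qed
  qed
  also have "\<dots> = (\<Sum>i\<in>I'. emeasure lborel {a i<..<b i})"
    using le by (intro sum.cong) auto
  also have "\<dots> = emeasure lborel (\<Union>i\<in>I'. {a i<..<b i})"
    using dis I by (intro sum_emeasure) (auto simp: I'_def)
  also have "\<dots> \<le> emeasure lborel {0..enn2real (variation S v)}"
  proof (rule emeasure_mono)
    show "(\<Union>i\<in>I'. {a i<..<b i}) \<subseteq> {0..enn2real (variation S v)}"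
    proof clarify
      fix i x assume "i \<in> I'" "x \<in> {a i<..<b i}"
      then show "x \<in> {0..enn2real (variation S v)}" using ab01[of i] by auto
    qed
  qed auto
  also have "\<dots> = variation S v" using True by simp
  finally show ?thesis .
qed (auto simp: not_less top_unique)

text \<open>A control function of \<open>v\<close> and its difference with \<open>v\<close> are both monotone.\<close>

lemma BV_measurable:
  assumes fin: "variation {0..1} v < \<infinity>"
  shows "v \<in> borel_measurable leb"
proof -
  obtain W where W: "controls W {0..1} v"
    using variation_controlE fin by blast
  have m: "mono_on {0..1} W" using controls_mono[OF W] .
  have "mono_on {0..1} (\<lambda>x. W x - v x)"
    unfolding mono_on_def using controlsD[OF W] by force
  then have "(\<lambda>x. W x - v x) \<in> borel_measurable (restrict_space borel {0..1})"
    by (rule borel_measurable_mono_on_fnc)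
  moreover have "W \<in> borel_measurable (restrict_space borel {0..1})"
    using m by (rule borel_measurable_mono_on_fnc)
  ultimately have "(\<lambda>x. W x - (W x - v x)) \<in> borel_measurable (restrict_space borel {0..1})"
    by (rule borel_measurable_diff[rotated])
  then have *: "v \<in> borel_measurable (restrict_space borel {0..1})" by simp
  show ?thesis
  proof (rule measurableI)
    fix A :: "real set" assume "A \<in> sets borel"
    with measurable_sets[OF *] have "v -` A \<inter> {0..1} \<in> sets (restrict_space borel {0..1})"
      by (simp add: space_restrict_space)
    then have "v -` A \<inter> {0..1} \<in> sets borel"
      by (subst (asm) sets_restrict_space_iff) auto
    then have "v -` A \<inter> {0..1} \<in> sets lebesgue" by simp
    then show "v -` A \<inter> space leb \<in> sets leb"
      by (subst sets_restrict_space_iff) auto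
  qed auto
qed

text \<open>Average \<open>\<bar>g x\<bar> \<le> \<bar>g y\<bar> + variation Q g\<close> over \<open>y \<in> Q\<close>.\<close>

lemma variation_sup_bound:
  assumes x: "x \<in> Q" and Q: "Q \<in> sets leb" and g: "g \<in> borel_measurable leb"
  shows "ennreal \<bar>g x\<bar> * emeasure leb Q \<le> (\<integral>\<^sup>+y\<in>Q. ennreal \<bar>g y\<bar> \<partial>leb) + variation Q g * emeasure leb Q"
proof (cases "variation Q g < \<infinity>")
  case True
  then obtain W where W: "controls W Q g" "\<And>x. x \<in> Q \<Longrightarrow> 0 \<le> W x \<and> W x \<le> enn2real (variation Q g)"
    using variation_controlE by blast
  let ?V = "enn2real (variation Q g)"
  have *: "\<bar>g x\<bar> \<le> \<bar>g y\<bar> + ?V" if "y \<in> Q" for y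
    using controlsD[OF W(1) x that] controlsD[OF W(1) that x] W(2)[OF x] W(2)[OF that] by (cases "x \<le> y") auto
  have "ennreal \<bar>g x\<bar> * emeasure leb Q = (\<integral>\<^sup>+y\<in>Q. ennreal \<bar>g x\<bar> \<partial>leb)"
    using Q by (simp add: nn_integral_cmult_indicator)
  also have "\<dots> \<le> (\<integral>\<^sup>+y\<in>Q. (ennreal \<bar>g y\<bar> + ennreal ?V) \<partial>leb)"
    using * by (intro nn_integral_mono) (auto simp: indicator_def simp flip: ennreal_plus)
  also have "\<dots> = (\<integral>\<^sup>+y. ennreal \<bar>g y\<bar> * indicator Q y + ennreal ?V * indicator Q y \<partial>leb)"
    by (simp add: distrib_right)
  also have "\<dots> = (\<integral>\<^sup>+y\<in>Q. ennreal \<bar>g y\<bar> \<partial>leb) + (\<integral>\<^sup>+y\<in>Q. ennreal ?V \<partial>leb)"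
    using Q g by (intro nn_integral_add) auto
  also have "(\<integral>\<^sup>+y\<in>Q. ennreal ?V \<partial>leb) = ennreal ?V * emeasure leb Q"
    using Q by (simp add: nn_integral_cmult_indicator)
  finally show ?thesis using True by simp
next
  case False
  show ?thesis
  proof (cases "emeasure leb Q = 0")
    case True then show ?thesis by simp
  next
    case z: False
    with False show ?thesis by (auto simp: not_less top_unique ennreal_top_mult)
  qed
qed

section \<open>Uniform decay from pointwise decay and compactness\<close>

lemma root_power_div_bound:
  fixes s :: real
  assumes s: "0 < s" "s < 1" and M: "M > 0"
  shows "s ^ (n div M) \<le> (1 / s) * root M s ^ n"
proof -
  let ?p = "root M s"
  have p: "0 < ?p" "?p < 1" "?p ^ M = s" using s M by auto
  have "n \<le> M * (n div M) + M"
    using mult_div_mod_eq[of M n] mod_less_divisor[OF M, of n] by linarith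
  then have "?p ^ (M * (n div M) + M) \<le> ?p ^ n"
    using p by (intro power_decreasing) auto
  moreover have "?p ^ (M * (n div M) + M) = s ^ (n div M) * s"
    using p by (simp add: power_add power_mult)
  ultimately show ?thesis using s by (simp add: field_simps)
qed

text \<open>An operator \<open>P\<close> that contracts a strong norm up to a multiple of a weak norm, for which bounded sets
  are totally bounded, and readings \<open>\<psi> n w\<close> of a state at time \<open>n\<close> through a test \<open>w\<close>. Reading one step later
  is reading the image under \<open>P\<close>, up to an exponentially small error. No uniformity in \<open>w\<close> is asked of
  the decay of the readings of a single state; the theorem of this locale shows that uniformity, and an
  exponential rate, are automatic. The linear structure is given by \<open>sub\<close> and \<open>scl\<close> because the states will
  be a set of families of functions rather than a type.\<close>

locale approximate_contraction =
  fixes X :: "'a set" and sub :: "'a \<Rightarrow> 'a \<Rightarrow> 'a" and scl :: "real \<Rightarrow> 'a \<Rightarrow> 'a"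
    and nrm wk :: "'a \<Rightarrow> real" and P :: "'a \<Rightarrow> 'a"
    and W :: "'w set" and \<psi> :: "nat \<Rightarrow> 'w \<Rightarrow> 'a \<Rightarrow> real"
    and r B C q :: real
  assumes rates: "0 \<le> r" "r < 1" "0 \<le> B" "0 \<le> C" "0 < q" "q < 1"
    and sub_X: "\<And>G H. G \<in> X \<Longrightarrow> H \<in> X \<Longrightarrow> sub G H \<in> X"
    and scl_X: "\<And>c G. G \<in> X \<Longrightarrow> scl c G \<in> X"
    and P_X: "\<And>G. G \<in> X \<Longrightarrow> P G \<in> X"
    and nrm_sub: "\<And>G H. G \<in> X \<Longrightarrow> H \<in> X \<Longrightarrow> nrm (sub G H) \<le> nrm G + nrm H"
    and nrm_scl: "\<And>c G. G \<in> X \<Longrightarrow> nrm (scl c G) = \<bar>c\<bar> * nrm G"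
    and wk_le: "\<And>G. G \<in> X \<Longrightarrow> 0 \<le> wk G \<and> wk G \<le> nrm G"
    and wk_tri: "\<And>G H Z. G \<in> X \<Longrightarrow> H \<in> X \<Longrightarrow> Z \<in> X \<Longrightarrow> wk (sub G H) \<le> wk (sub G Z) + wk (sub H Z)"
    and wk_P: "\<And>G. G \<in> X \<Longrightarrow> wk (P G) \<le> wk G"
    and nrm_P: "\<And>G. G \<in> X \<Longrightarrow> nrm (P G) \<le> r * nrm G + B * wk G"
    and P_sub: "\<And>G H. G \<in> X \<Longrightarrow> H \<in> X \<Longrightarrow> P (sub G H) = sub (P G) (P H)"
    and \<psi>_sub: "\<And>n w G H. w \<in> W \<Longrightarrow> G \<in> X \<Longrightarrow> H \<in> X \<Longrightarrow> \<psi> n w (sub G H) = \<psi> n w G - \<psi> n w H"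
    and \<psi>_scl: "\<And>n w c G. w \<in> W \<Longrightarrow> G \<in> X \<Longrightarrow> \<psi> n w (scl c G) = c * \<psi> n w G"
    and \<psi>_le: "\<And>n w G. w \<in> W \<Longrightarrow> G \<in> X \<Longrightarrow> \<bar>\<psi> n w G\<bar> \<le> nrm G"
    and \<psi>_P: "\<And>n w G. w \<in> W \<Longrightarrow> G \<in> X \<Longrightarrow> \<bar>\<psi> (Suc n) w G - \<psi> n w (P G)\<bar> \<le> C * q ^ n * nrm G"
    and net: "\<And>R e. R > 0 \<Longrightarrow> e > 0 \<Longrightarrow> \<exists>U. finite U \<and> U \<subseteq> {G\<in>X. nrm G \<le> R} \<and>
                (\<forall>G\<in>X. nrm G \<le> R \<longrightarrow> (\<exists>H\<in>U. wk (sub G H) \<le> e))"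
    and \<psi>_null: "\<And>w G. w \<in> W \<Longrightarrow> G \<in> X \<Longrightarrow> (\<lambda>n. \<psi> n w G) \<longlonglongrightarrow> 0"
begin

text \<open>\<open>B'\<close> and \<open>K\<close> bound all iterates of \<open>P\<close> at once, and \<open>C'\<close> the errors of \<open>\<psi>_P\<close> accumulated over any number
  of steps.\<close>

definition B' where "B' = B / (1 - r)"
definition K where "K = 1 + B'"
definition C' where "C' = C * K / (1 - q)"

lemma B'_nonneg: "0 \<le> B'" and K_ge_1: "1 \<le> K" and C'_nonneg: "0 \<le> C'"
  using rates by (auto simp: B'_def K_def C'_def)

lemma nrm_nonneg: "G \<in> X \<Longrightarrow> 0 \<le> nrm G" using wk_le by (meson order_trans)

lemma Pn_X: "G \<in> X \<Longrightarrow> (P ^^ n) G \<in> X" by (induction n) (auto intro: P_X)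

lemma Pn_sub: "G \<in> X \<Longrightarrow> H \<in> X \<Longrightarrow> (P ^^ n) (sub G H) = sub ((P ^^ n) G) ((P ^^ n) H)"
  by (induction n) (auto simp: P_sub Pn_X)

lemma wk_Pn: "G \<in> X \<Longrightarrow> wk ((P ^^ n) G) \<le> wk G"
  by (induction n) (auto intro: order_trans[OF wk_P] Pn_X)

lemma nrm_Pn: 
  assumes "G \<in> X" shows "nrm ((P ^^ n) G) \<le> r ^ n * nrm G + B' * wk G"
proof (induction n)
  case 0 then show ?case using B'_nonneg wk_le[OF assms] by simp
next
  case (Suc n)
  have "nrm ((P ^^ Suc n) G) \<le> r * nrm ((P ^^ n) G) + B * wk ((P ^^ n) G)"
    using nrm_P[OF Pn_X[OF assms]] by simp
  also have "\<dots> \<le> r * (r ^ n * nrm G + B' * wk G) + B * wk G"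
    using Suc rates wk_Pn[OF assms] by (intro add_mono mult_left_mono) auto
  also have "\<dots> = r ^ Suc n * nrm G + B' * wk G"
  proof -
    have "r * B' + B = B'" using rates by (simp add: B'_def field_simps)
    then have "(r * B' + B) * wk G = B' * wk G" by simp
    then show ?thesis by (simp add: algebra_simps)
  qed
  finally show ?case .
qed

lemma nrm_Pn_K:
  assumes G: "G \<in> X" shows "nrm ((P ^^ n) G) \<le> K * nrm G"
proof -
  have "r ^ n * nrm G \<le> 1 * nrm G"
    using rates nrm_nonneg[OF G] by (intro mult_right_mono power_le_one) auto
  moreover have "B' * wk G \<le> B' * nrm G"
    using B'_nonneg wk_le[OF G] by (intro mult_left_mono) auto
  ultimately show ?thesis using nrm_Pn[OF G, of n] by (simp add: K_def algebra_simps)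
qed

lemma \<psi>_Pn:
  assumes w: "w \<in> W" and G: "G \<in> X"
  shows "\<bar>\<psi> (n + m) w G - \<psi> n w ((P ^^ m) G)\<bar> \<le> C' * q ^ n * nrm G"
proof (induction m arbitrary: n)
  case 0 then show ?case using C'_nonneg rates nrm_nonneg[OF G] by simp
next
  case (Suc m)
  have "\<bar>\<psi> (Suc n + m) w G - \<psi> (Suc n) w ((P ^^ m) G)\<bar> \<le> C' * q ^ Suc n * nrm G"
    by (rule Suc)
  moreover have "\<bar>\<psi> (Suc n) w ((P ^^ m) G) - \<psi> n w ((P ^^ Suc m) G)\<bar> \<le> C * q ^ n * nrm ((P ^^ m) G)"
    using \<psi>_P[OF w Pn_X[OF G]] by simp
  moreover have "C * q ^ n * nrm ((P ^^ m) G) \<le> C * q ^ n * (K * nrm G)"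
    using nrm_Pn_K[OF G] rates by (intro mult_left_mono) auto
  moreover have "C' * q ^ Suc n * nrm G + C * q ^ n * (K * nrm G) = C' * q ^ n * nrm G"
    using rates by (simp add: C'_def field_simps)
  ultimately show ?case by simp
qed

definition bounds_at :: "nat \<Rightarrow> real \<Rightarrow> bool" where
  "bounds_at n A \<longleftrightarrow> 0 \<le> A \<and> (\<forall>G\<in>X. \<forall>w\<in>W. \<bar>\<psi> n w G\<bar> \<le> A * nrm G)"

lemma bounds_at_mono:
  assumes "bounds_at n A" "A \<le> A'" shows "bounds_at n A'"
  unfolding bounds_at_def
proof (intro conjI ballI)
  show "0 \<le> A'" using assms by (simp add: bounds_at_def)
  fix G w assume G: "G \<in> X" and w: "w \<in> W"
  have "\<bar>\<psi> n w G\<bar> \<le> A * nrm G" using assms(1) G w by (simp add: bounds_at_def)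
  also have "\<dots> \<le> A' * nrm G" using assms(2) nrm_nonneg[OF G] by (rule mult_right_mono)
  finally show "\<bar>\<psi> n w G\<bar> \<le> A' * nrm G" .
qed

lemma bounds_at_add:
  assumes "bounds_at n A" shows "bounds_at (n + m) (A * K + C' * q ^ n)"
  unfolding bounds_at_def
proof (intro conjI ballI)
  show "0 \<le> A * K + C' * q ^ n"
    using assms K_ge_1 C'_nonneg rates by (auto simp: bounds_at_def)
  fix G w assume G: "G \<in> X" and w: "w \<in> W"
  have "\<bar>\<psi> n w ((P ^^ m) G)\<bar> \<le> A * nrm ((P ^^ m) G)"
    using assms w Pn_X[OF G] by (auto simp: bounds_at_def)
  also have "\<dots> \<le> A * (K * nrm G)"
    using nrm_Pn_K[OF G] assms by (intro mult_left_mono) (auto simp: bounds_at_def)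
  finally show "\<bar>\<psi> (n + m) w G\<bar> \<le> (A * K + C' * q ^ n) * nrm G"
    using \<psi>_Pn[OF w G, of n m] by (simp add: algebra_simps)
qed

lemma eventually_small_power:
  assumes "e > 0" shows "\<exists>m. r ^ m \<le> e"
proof -
  have "(\<lambda>m. r ^ m) \<longlonglongrightarrow> 0" using rates by (intro LIMSEQ_power_zero) auto
  then have "eventually (\<lambda>m. r ^ m < e) sequentially" using assms by (rule order_tendstoD)
  then show ?thesis by (auto simp: eventually_sequentially intro: less_imp_le)
qed

text \<open>Every orbit is precompact in the strong norm: weakly, infinitely many orbit points share one element of a
  finite net, and \<open>m\<close> more steps of \<open>P\<close> contract the strong norm of their differences, up to the weak norm.\<close>

lemma recurrent_orbit:
  assumes U: "U \<in> X" and U1: "nrm U \<le> 1" and \<eta>: "\<eta> > 0"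
  shows "\<exists>p. infinite {k. nrm (sub ((P ^^ p) U) ((P ^^ k) U)) \<le> \<eta>}"
proof -
  obtain m where m: "r ^ m \<le> \<eta> / (4 * K)" using eventually_small_power[of "\<eta> / (4 * K)"] \<eta> K_ge_1 by auto
  define e where "e = \<eta> / (4 * (B' + 1))"
  have e: "e > 0" using \<eta> B'_nonneg by (simp add: e_def)
  obtain V where V: "finite V" "V \<subseteq> X" "\<And>G. G \<in> X \<Longrightarrow> nrm G \<le> K \<Longrightarrow> \<exists>H\<in>V. wk (sub G H) \<le> e"
    using net[of K e] e K_ge_1 by (auto simp: subset_iff)
  have "K * nrm U \<le> K * 1" using U1 K_ge_1 by (intro mult_left_mono) auto
  then have KU: "nrm ((P ^^ k) U) \<le> K" for k
    using nrm_Pn_K[OF U, of k] by linarith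
  have "\<forall>k. \<exists>H. H \<in> V \<and> wk (sub ((P ^^ k) U) H) \<le> e" using V(3)[OF Pn_X[OF U] KU] by blast
  from choice[OF this] obtain c where c: "\<And>k. c k \<in> V" "\<And>k. wk (sub ((P ^^ k) U) (c k)) \<le> e" by blast
  have "finite (range c)" using V(1) c(1) by (auto intro: finite_subset)
  then have "\<exists>p\<in>UNIV. infinite {k \<in> UNIV. c k = c p}" by (intro pigeonhole_infinite) auto
  then obtain p H where H: "infinite {k. c k = H}" and p: "c p = H" by auto
  have HV: "H \<in> X" using c(1)[of p] V(2) p by auto
  have "(\<lambda>k. k + m) ` {k. c k = H} \<subseteq> {k. nrm (sub ((P ^^ (p + m)) U) ((P ^^ k) U)) \<le> \<eta>}"
  proof clarify
    fix k assume k: "H = c k"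
    let ?D = "sub ((P ^^ p) U) ((P ^^ k) U)"
    have D: "?D \<in> X" using sub_X Pn_X[OF U] by auto
    have "wk ?D \<le> wk (sub ((P ^^ p) U) H) + wk (sub ((P ^^ k) U) H)"
      using Pn_X[OF U] HV by (intro wk_tri)
    also have "\<dots> \<le> 2 * e" using c(2)[of p] c(2)[of k] p k by auto
    finally have wkD: "wk ?D \<le> 2 * e" .
    have nD: "nrm ?D \<le> 2 * K" using nrm_sub[OF Pn_X[OF U] Pn_X[OF U], of p k] KU[of p] KU[of k] by simp
    have "nrm ((P ^^ m) ?D) \<le> r ^ m * nrm ?D + B' * wk ?D" by (rule nrm_Pn[OF D])
    also have "\<dots> \<le> \<eta> / (4 * K) * (2 * K) + B' * (2 * e)"
      using m nD wkD wk_le[OF D] B'_nonneg nrm_nonneg[OF D] \<eta> K_ge_1 rates by (intro add_mono mult_mono) auto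
    also have "\<dots> \<le> \<eta> / 2 + \<eta> / 2"
    proof (intro add_mono)
      show "\<eta> / (4 * K) * (2 * K) \<le> \<eta> / 2" using K_ge_1 by simp
      show "B' * (2 * e) \<le> \<eta> / 2" using B'_nonneg \<eta> by (simp add: e_def field_simps)
    qed
    finally show "nrm (sub ((P ^^ (p + m)) U) ((P ^^ (k + m)) U)) \<le> \<eta>"
      using Pn_sub[OF Pn_X[OF U] Pn_X[OF U]]
      by (simp add: add.commute[of _ m] funpow_add)
  qed
  moreover have "infinite ((\<lambda>k. k + m) ` {k. c k = H})"
    using H by (subst finite_image_iff) (auto simp: inj_on_def)
  ultimately show ?thesis by (meson finite_subset)
qed

text \<open>At a recurrence time \<open>p\<close> the orbit point is close to infinitely many later ones, and reading \<open>(P ^^ k) U\<close>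
  at time \<open>n\<close> is reading \<open>U\<close> at time \<open>n + k\<close>, which tends to 0 as \<open>k\<close> grows. It matters that \<open>p\<close> does not depend
  on \<open>w\<close> and \<open>n\<close>: only the speed of convergence does.\<close>

lemma orbit_small:
  assumes U: "U \<in> X" and U1: "nrm U \<le> 1" and \<eta>: "\<eta> > 0"
  shows "\<exists>p. \<forall>n A. bounds_at n A \<longrightarrow> (\<forall>w\<in>W. \<bar>\<psi> n w ((P ^^ p) U)\<bar> \<le> \<eta> * A + C' * q ^ n)"
proof -
  obtain p where p: "infinite {k. nrm (sub ((P ^^ p) U) ((P ^^ k) U)) \<le> \<eta>}"
    using recurrent_orbit[OF assms] by auto
  have "\<bar>\<psi> n w ((P ^^ p) U)\<bar> \<le> \<eta> * A + C' * q ^ n" if A: "bounds_at n A" and w: "w \<in> W" for n A w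
  proof (rule field_le_epsilon)
    fix e :: real assume e: "e > 0"
    have "(\<lambda>k. \<psi> k w U) \<longlonglongrightarrow> 0" using \<psi>_null w U by blast
    from LIMSEQ_D[OF this e] have "\<exists>N. \<forall>k\<ge>N. \<bar>\<psi> k w U\<bar> < e" by simp
    then obtain N where N: "\<And>k. k \<ge> N \<Longrightarrow> \<bar>\<psi> k w U\<bar> < e" by auto
    obtain k where k: "k \<ge> N" "nrm (sub ((P ^^ p) U) ((P ^^ k) U)) \<le> \<eta>"
      using p[unfolded infinite_nat_iff_unbounded_le] by auto
    let ?D = "sub ((P ^^ p) U) ((P ^^ k) U)"
    have D: "?D \<in> X" using sub_X Pn_X[OF U] by auto
    have "\<bar>\<psi> n w ?D\<bar> \<le> A * nrm ?D" using A D w by (auto simp: bounds_at_def)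
    also have "\<dots> \<le> A * \<eta>" using k(2) A by (intro mult_left_mono) (auto simp: bounds_at_def)
    finally have 1: "\<bar>\<psi> n w ((P ^^ p) U) - \<psi> n w ((P ^^ k) U)\<bar> \<le> A * \<eta>"
      using \<psi>_sub[OF w Pn_X[OF U] Pn_X[OF U]] by simp
    have 2: "\<bar>\<psi> (n + k) w U - \<psi> n w ((P ^^ k) U)\<bar> \<le> C' * q ^ n"
    proof -
      have "C' * q ^ n * nrm U \<le> C' * q ^ n * 1"
        using U1 C'_nonneg rates by (intro mult_left_mono) auto
      then show ?thesis using \<psi>_Pn[OF w U, of n k] by simp
    qed
    have 3: "\<bar>\<psi> (n + k) w U\<bar> < e" using N k by auto
    show "\<bar>\<psi> n w ((P ^^ p) U)\<bar> \<le> \<eta> * A + C' * q ^ n + e"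
      using 1 2 3 by (simp add: mult.commute)
  qed
  then show ?thesis by blast
qed

text \<open>A state of norm at most 1 is the sum of an element \<open>U\<close> of a finite weak net and a weakly small \<open>?H\<close>. After
  \<open>m\<close> steps \<open>?H\<close> is strongly small, and each of the finitely many \<open>U\<close> is small at its recurrence time.
  The constants are such that each part contributes \<open>A / 4\<close>.\<close>

lemma halving_step:
  "\<exists>M>0. \<forall>n A. bounds_at n A \<longrightarrow> bounds_at (n + M) (A / 2 + 5 * C' * q ^ n)"
proof -
  obtain m where m: "r ^ m \<le> 1 / (16 * K)" using eventually_small_power[of "1 / (16 * K)"] K_ge_1 by auto
  define e where "e = 1 / (8 * K * (B' + 1))"
  have e: "e > 0" using K_ge_1 B'_nonneg by (simp add: e_def)
  obtain V where V: "finite V" "V \<subseteq> {G\<in>X. nrm G \<le> 1}"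
      "\<And>G. G \<in> X \<Longrightarrow> nrm G \<le> 1 \<Longrightarrow> \<exists>H\<in>V. wk (sub G H) \<le> e"
    using net[of 1 e] e by auto
  define \<eta> where "\<eta> = 1 / (4 * K)"
  have \<eta>: "\<eta> > 0" using K_ge_1 by (simp add: \<eta>_def)
  have "\<forall>U\<in>V. \<exists>p. \<forall>n A. bounds_at n A \<longrightarrow> (\<forall>w\<in>W. \<bar>\<psi> n w ((P ^^ p) U)\<bar> \<le> \<eta> * A + C' * q ^ n)"
    using orbit_small \<eta> V(2) by blast
  then obtain p where p: "\<And>U n A w. U \<in> V \<Longrightarrow> bounds_at n A \<Longrightarrow> w \<in> W \<Longrightarrow>
      \<bar>\<psi> n w ((P ^^ p U) U)\<bar> \<le> \<eta> * A + C' * q ^ n" by metis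
  define L where "L = Suc (\<Sum>U\<in>V. p U)"
  have L: "p U \<le> L" if "U \<in> V" for U
    using member_le_sum[OF that, of p] V(1) by (simp add: L_def)
  define M where "M = m + L"
  have qn: "C' * q ^ (n + k) \<le> C' * q ^ n" for n k
    using rates C'_nonneg by (intro mult_left_mono power_decreasing) auto
  have unit: "\<bar>\<psi> (n + M) w G\<bar> \<le> A / 2 + 5 * C' * q ^ n"
    if A: "bounds_at n A" and w: "w \<in> W" and G: "G \<in> X" "nrm G \<le> 1" for n A w G
  proof -
    have A0: "0 \<le> A" using A by (simp add: bounds_at_def)
    obtain U where U: "U \<in> V" "wk (sub G U) \<le> e" using V(3) G by blast
    have UX: "U \<in> X" "nrm U \<le> 1" using U V(2) by auto
    let ?H = "sub G U"
    have H: "?H \<in> X" "nrm ?H \<le> 2" using sub_X nrm_sub[OF G(1) UX(1)] G UX by auto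
    have "nrm ((P ^^ m) ?H) \<le> r ^ m * nrm ?H + B' * wk ?H" by (rule nrm_Pn[OF H(1)])
    also have "\<dots> \<le> 1 / (16 * K) * 2 + B' * e"
      using m U(2) H B'_nonneg nrm_nonneg[OF H(1)] wk_le[OF H(1)] rates K_ge_1 by (intro add_mono mult_mono) auto
    also have "\<dots> \<le> 1 / (8 * K) + 1 / (8 * K)"
    proof (intro add_mono)
      show "1 / (16 * K) * 2 \<le> 1 / (8 * K)" using K_ge_1 by simp
      have "B' * e = B' / (B' + 1) * (1 / (8 * K))" using B'_nonneg K_ge_1 by (simp add: e_def)
      also have "\<dots> \<le> 1 * (1 / (8 * K))" using B'_nonneg K_ge_1 by (intro mult_right_mono) auto
      finally show "B' * e \<le> 1 / (8 * K)" by simp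
    qed
    finally have small: "nrm ((P ^^ m) ?H) \<le> 1 / (4 * K)" by simp
    have "nrm ((P ^^ M) ?H) = nrm ((P ^^ L) ((P ^^ m) ?H))"
      by (simp add: M_def add.commute[of m] funpow_add)
    also have "\<dots> \<le> K * nrm ((P ^^ m) ?H)" by (rule nrm_Pn_K[OF Pn_X[OF H(1)]])
    also have "\<dots> \<le> K * (1 / (4 * K))" using small K_ge_1 by (intro mult_left_mono) auto
    also have "\<dots> = 1 / 4" using K_ge_1 by simp
    finally have "A * nrm ((P ^^ M) ?H) \<le> A * (1 / 4)" using A0 by (intro mult_left_mono) auto
    moreover have "\<bar>\<psi> n w ((P ^^ M) ?H)\<bar> \<le> A * nrm ((P ^^ M) ?H)"
      using A w Pn_X[OF H(1)] by (auto simp: bounds_at_def)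
    moreover have "\<bar>\<psi> (n + M) w ?H - \<psi> n w ((P ^^ M) ?H)\<bar> \<le> C' * q ^ n * nrm ?H"
      by (rule \<psi>_Pn[OF w H(1)])
    moreover have "C' * q ^ n * nrm ?H \<le> C' * q ^ n * 2"
      using H C'_nonneg rates by (intro mult_left_mono) auto
    ultimately have 1: "\<bar>\<psi> (n + M) w ?H\<bar> \<le> A / 4 + 2 * C' * q ^ n" by simp
    let ?k = "M - p U"
    have k: "n + M = (n + ?k) + p U" using L[OF U(1)] by (simp add: M_def)
    have "\<bar>\<psi> (n + ?k) w ((P ^^ p U) U)\<bar> \<le> \<eta> * (A * K + C' * q ^ n) + C' * q ^ (n + ?k)"
      by (rule p[OF U(1) bounds_at_add[OF A] w])
    also have "\<dots> \<le> A / 4 + C' * q ^ n + C' * q ^ n"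
    proof (intro add_mono)
      have "\<eta> * (A * K + C' * q ^ n) = A / 4 + \<eta> * (C' * q ^ n)"
        using K_ge_1 by (simp add: \<eta>_def field_simps)
      also have "\<dots> \<le> A / 4 + 1 * (C' * q ^ n)"
        using K_ge_1 C'_nonneg rates by (intro add_mono mult_right_mono) (auto simp: \<eta>_def)
      finally show "\<eta> * (A * K + C' * q ^ n) \<le> A / 4 + C' * q ^ n" by simp
    qed (rule qn)
    finally have 2: "\<bar>\<psi> (n + ?k) w ((P ^^ p U) U)\<bar> \<le> A / 4 + 2 * C' * q ^ n" by linarith
    have "\<bar>\<psi> (n + M) w U - \<psi> (n + ?k) w ((P ^^ p U) U)\<bar> \<le> C' * q ^ (n + ?k) * nrm U"
      by (subst k) (rule \<psi>_Pn[OF w UX(1)])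
    also have "\<dots> \<le> C' * q ^ (n + ?k) * 1"
      using UX C'_nonneg rates by (intro mult_left_mono) auto
    also have "\<dots> \<le> C' * q ^ n" using qn by simp
    finally have 3: "\<bar>\<psi> (n + M) w U - \<psi> (n + ?k) w ((P ^^ p U) U)\<bar> \<le> C' * q ^ n" .
    have "\<psi> (n + M) w ?H = \<psi> (n + M) w G - \<psi> (n + M) w U"
      by (rule \<psi>_sub[OF w G(1) UX(1)])
    then show ?thesis using 1 2 3 by simp
  qed
  have "bounds_at (n + M) (A / 2 + 5 * C' * q ^ n)" if A: "bounds_at n A" for n A
    unfolding bounds_at_def
  proof (intro conjI ballI)
    show "0 \<le> A / 2 + 5 * C' * q ^ n" using A C'_nonneg rates by (auto simp: bounds_at_def)
    fix G w assume G: "G \<in> X" and w: "w \<in> W"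
    show "\<bar>\<psi> (n + M) w G\<bar> \<le> (A / 2 + 5 * C' * q ^ n) * nrm G"
    proof (cases "nrm G = 0")
      case True then show ?thesis using \<psi>_le[OF w G, of "n + M"] by simp
    next
      case False
      then have pos: "nrm G > 0" using nrm_nonneg[OF G] by simp
      have "\<bar>\<psi> (n + M) w (scl (1 / nrm G) G)\<bar> \<le> A / 2 + 5 * C' * q ^ n"
        using pos nrm_scl[OF G, of "1 / nrm G"] by (intro unit[OF A w scl_X[OF G]]) simp
      then show ?thesis using pos \<psi>_scl[OF w G] by (simp add: abs_mult field_simps)
    qed
  qed
  moreover have "M > 0" by (simp add: M_def L_def)
  ultimately show ?thesis by blast
qed

theorem exponential_decay:
  "\<exists>K'\<ge>0. \<exists>p. 0 < p \<and> p < 1 \<and> (\<forall>G\<in>X. \<forall>w\<in>W. \<forall>n. \<bar>\<psi> n w G\<bar> \<le> K' * p ^ n * nrm G)"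
proof -
  obtain M where M: "M > 0" "\<And>n A. bounds_at n A \<Longrightarrow> bounds_at (n + M) (A / 2 + 5 * C' * q ^ n)"
    using halving_step by blast
  define s where "s = max (3 / 4) (q ^ M)"
  have s: "0 < s" "s < 1" "3 / 4 \<le> s" "q ^ M \<le> s"
    using rates M(1) by (auto simp: s_def power_less_one_iff)
  \<comment> \<open>With this constant and a ratio at least \<open>3 / 4\<close>, the bound \<open>A / 2 + 5 * C' * q ^ n\<close> of the halving step reproduces itself.\<close>
  define K\<^sub>0 where "K\<^sub>0 = 1 + 20 * C'"
  have K\<^sub>0: "1 \<le> K\<^sub>0" using C'_nonneg by (simp add: K\<^sub>0_def)
  have step: "bounds_at (i + k * M) (K\<^sub>0 * s ^ k)" for i k
  proof (induction k)
    case 0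
    show ?case unfolding bounds_at_def
    proof (intro conjI ballI)
      fix G w assume G: "G \<in> X" and w: "w \<in> W"
      have "1 * nrm G \<le> K\<^sub>0 * nrm G" using K\<^sub>0 nrm_nonneg[OF G] by (rule mult_right_mono)
      then show "\<bar>\<psi> (i + 0 * M) w G\<bar> \<le> K\<^sub>0 * s ^ 0 * nrm G"
        using \<psi>_le[OF w G, of i] by simp
    qed (use K\<^sub>0 in simp)
  next
    case (Suc k)
    have "bounds_at (i + k * M + M) (K\<^sub>0 * s ^ k / 2 + 5 * C' * q ^ (i + k * M))" using M(2)[OF Suc] .
    moreover have "K\<^sub>0 * s ^ k / 2 + 5 * C' * q ^ (i + k * M) \<le> K\<^sub>0 * s ^ Suc k"
    proof -
      have "q ^ (i + k * M) \<le> q ^ (k * M)" using rates by (intro power_decreasing) auto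
      also have "\<dots> = (q ^ M) ^ k" by (simp add: mult.commute flip: power_mult)
      also have "\<dots> \<le> s ^ k" using s rates by (intro power_mono) auto
      finally have "5 * C' * q ^ (i + k * M) \<le> 5 * C' * s ^ k" using C'_nonneg by (intro mult_left_mono) auto
      moreover have "K\<^sub>0 / 2 + 5 * C' \<le> K\<^sub>0 * (3 / 4)" by (simp add: K\<^sub>0_def)
      moreover have "K\<^sub>0 * (3 / 4) \<le> K\<^sub>0 * s" using s K\<^sub>0 by (intro mult_left_mono) auto
      ultimately have "(K\<^sub>0 / 2 + 5 * C') * s ^ k \<le> K\<^sub>0 * s * s ^ k" using s by (intro mult_right_mono) auto
      then show ?thesis using \<open>5 * C' * q ^ (i + k * M) \<le> 5 * C' * s ^ k\<close> by (simp add: algebra_simps)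
    qed
    ultimately have "bounds_at (i + k * M + M) (K\<^sub>0 * s ^ Suc k)"
      by (rule bounds_at_mono)
    then show ?case by (simp add: algebra_simps)
  qed
  define p where "p = root M s"
  have p: "0 < p" "p < 1" using s M by (auto simp: p_def)
  have "\<bar>\<psi> n w G\<bar> \<le> K\<^sub>0 / s * p ^ n * nrm G" if G: "G \<in> X" and w: "w \<in> W" for G w n
  proof -
    have "\<bar>\<psi> (n mod M + n div M * M) w G\<bar> \<le> K\<^sub>0 * s ^ (n div M) * nrm G"
      using step[of "n mod M" "n div M"] G w unfolding bounds_at_def by blast
    also have "\<dots> \<le> K\<^sub>0 * (1 / s * p ^ n) * nrm G"
      using root_power_div_bound[OF s(1,2) M(1), of n] K\<^sub>0 nrm_nonneg[OF G]
      by (intro mult_right_mono mult_left_mono) (auto simp: p_def)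
    finally show ?thesis by simp
  qed
  moreover have "0 \<le> K\<^sub>0 / s" using K\<^sub>0 s by simp
  ultimately show ?thesis using p by blast
qed

end

section \<open>Multiplication by a continuously controlled weight\<close>

abbreviation L1_norm :: "(real \<Rightarrow> real) \<Rightarrow> ennreal" where
  "L1_norm g \<equiv> \<integral>\<^sup>+x. ennreal \<bar>g x\<bar> \<partial>leb"

text \<open>A norm on functions of bounded variation, equivalent to \<open>BV_norm\<close> but extended-valued and with the mean in
  place of the supremum, because transport by a map does not increase means.\<close>

definition bv :: "(real \<Rightarrow> real) \<Rightarrow> ennreal" where
  "bv g = variation {0..1} g + L1_norm g"

lemma space_leb [simp]: "space leb = {0..1}"
  by (simp add: space_restrict_space)

lemma sets_leb_iff: "A \<in> sets leb \<longleftrightarrow> A \<in> sets lebesgue \<and> A \<subseteq> {0..1}"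
  by (subst sets_restrict_space_iff) auto

lemma emeasure_leb: "A \<in> sets leb \<Longrightarrow> emeasure leb A = emeasure lebesgue A"
  by (subst emeasure_restrict_space) (auto simp: sets_leb_iff)

lemma prob_space_leb: "prob_space leb"
  by (rule prob_spaceI) (subst space_leb, subst emeasure_leb, auto simp: sets_leb_iff)

interpretation leb: prob_space leb by (rule prob_space_leb)

lemma interval_sets_leb: "is_interval Q \<Longrightarrow> Q \<subseteq> {0..1} \<Longrightarrow> Q \<in> sets leb"
  unfolding sets_leb_iff using real_interval_borel_measurable[of Q] by auto

lemma interval_emeasure_pos:
  assumes "is_interval Q" "Q \<subseteq> {0..1}" "x \<in> Q" "y \<in> Q" "x < y"
  shows "emeasure leb Q > 0"
proof -
  have "{x..y} \<subseteq> Q" using mem_is_interval_1_I[OF assms(1,3,4)] by auto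
  then have "emeasure leb {x..y} \<le> emeasure leb Q"
    using interval_sets_leb[OF assms(1,2)] by (rule emeasure_mono)
  moreover have "emeasure leb {x..y} = ennreal (y - x)"
    using assms \<open>{x..y} \<subseteq> Q\<close> by (subst emeasure_leb) (auto simp: sets_leb_iff)
  ultimately show ?thesis using assms(5)
    by (metis ennreal_less_zero_iff diff_gt_0_iff_gt less_le_trans)
qed

lemma variation_sup_bound':
  assumes x: "x \<in> Q" and Q: "Q \<in> sets leb" and g: "g \<in> borel_measurable leb"
    and pos: "emeasure leb Q > 0"
  shows "ennreal \<bar>g x\<bar> \<le> variation Q g + ennreal (1 / measure leb Q) * L1_norm g"
proof -
  let ?m = "measure leb Q"
  have m: "emeasure leb Q = ennreal ?m" by (simp add: leb.emeasure_eq_measure)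
  have mp: "?m > 0" using pos m by (simp add: ennreal_less_zero_iff)
  have "(\<integral>\<^sup>+y\<in>Q. ennreal \<bar>g y\<bar> \<partial>leb) \<le> L1_norm g"
    by (rule nn_integral_mono) (auto simp: indicator_def)
  then have "ennreal \<bar>g x\<bar> * ennreal ?m \<le> L1_norm g + variation Q g * ennreal ?m"
    using order_trans[OF variation_sup_bound[OF x Q g] add_right_mono] unfolding m by blast
  then have "ennreal (1 / ?m) * (ennreal \<bar>g x\<bar> * ennreal ?m) \<le> ennreal (1 / ?m) * (L1_norm g + variation Q g * ennreal ?m)"
    by (rule mult_left_mono) simp
  moreover have "ennreal (1 / ?m) * (ennreal \<bar>g x\<bar> * ennreal ?m) = ennreal \<bar>g x\<bar>"
    using mp by (simp flip: ennreal_mult)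
  moreover have "ennreal (1 / ?m) * (L1_norm g + variation Q g * ennreal ?m) = variation Q g + ennreal (1 / ?m) * L1_norm g"
  proof -
    have "ennreal (1 / ?m) * ennreal ?m = 1" using mp by (simp flip: ennreal_mult ennreal_1)
    then have "ennreal (1 / ?m) * (variation Q g * ennreal ?m) = variation Q g"
      by (simp add: mult.left_commute[of "ennreal (1 / ?m)"])
    then show ?thesis by (simp add: distrib_left add.commute)
  qed
  ultimately show ?thesis by simp
qed

text \<open>The product rule, with the supremum of \<open>g\<close> bounded by its variation plus a multiple of its mean. Where the
  weight oscillates by at most \<open>\<epsilon>\<close>, this costs only a factor \<open>\<rho> + \<epsilon>\<close> in front of the variation of \<open>g\<close>.\<close>

lemma variation_mult_small:
  assumes W: "controls W Q \<phi>" "\<And>x y. x \<in> Q \<Longrightarrow> y \<in> Q \<Longrightarrow> x \<le> y \<Longrightarrow> W y - W x \<le> \<epsilon>"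
    and \<phi>: "\<And>x. x \<in> Q \<Longrightarrow> 0 \<le> \<phi> x \<and> \<phi> x \<le> \<rho>" and \<epsilon>: "\<epsilon> > 0"
    and Q: "Q \<in> sets leb" "emeasure leb Q > 0" and g: "g \<in> borel_measurable leb"
  shows "variation Q (\<lambda>x. g x * \<phi> x) \<le> ennreal (\<rho> + \<epsilon>) * variation Q g + ennreal (\<epsilon> / measure leb Q) * L1_norm g"
proof -
  have ne: "Q \<noteq> {}" using Q(2) by auto
  then have \<rho>0: "0 \<le> \<rho>" using \<phi> by fastforce
  have mp: "measure leb Q > 0" using Q(2) by (simp add: leb.emeasure_eq_measure ennreal_less_zero_iff)
  consider "variation Q g = \<infinity>" | "L1_norm g = \<infinity>" | "variation Q g < \<infinity>" "L1_norm g < \<infinity>"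
    by (metis infinity_ennreal_def top.not_eq_extremum)
  then show ?thesis
  proof cases
    case 1 then show ?thesis using \<rho>0 \<epsilon> by (simp add: ennreal_mult_top)
  next
    case 2 then show ?thesis using mp \<epsilon> by (simp add: ennreal_mult_top)
  next
    case 3
    obtain V where V: "variation Q g = ennreal V" "0 \<le> V" using 3 by (metis ennreal_cases less_top infinity_ennreal_def)
    obtain a where a: "L1_norm g = ennreal a" "0 \<le> a" using 3 by (metis ennreal_cases less_top infinity_ennreal_def)
    have var\<phi>: "variation Q \<phi> \<le> ennreal \<epsilon>"
    proof -
      have W_sub: "W x - \<epsilon> \<le> W y" if "x \<in> Q" "y \<in> Q" for x y
        using that W(2)[of y x] controls_mono[OF W(1)] \<epsilon> 
        by (cases "x \<le> y") (auto dest: mono_onD[where r=x and s=y])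
      obtain z where "z \<in> Q" using ne by auto
      then have bdd: "bdd_below (W ` Q)" using W_sub by (intro bdd_belowI2[of Q "W z - \<epsilon>"]) auto
      show ?thesis
      proof (rule variation_leI[of "\<lambda>x. W x - Inf (W ` Q)"])
        show "controls (\<lambda>x. W x - Inf (W ` Q)) Q \<phi>" using W(1) by (simp add: controls_def)
        fix x assume x: "x \<in> Q"
        have "W x - \<epsilon> \<le> Inf (W ` Q)" using ne W_sub[OF x] by (intro cINF_greatest) auto
        then show "0 \<le> W x - Inf (W ` Q) \<and> W x - Inf (W ` Q) \<le> \<epsilon>"
          using cINF_lower[OF bdd x] by auto
      qed
    qed
    define S where "S = V + 1 / measure leb Q * a"
    have S: "\<bar>g x\<bar> \<le> S" if "x \<in> Q" for x
    proof -
      have "ennreal \<bar>g x\<bar> \<le> ennreal V + ennreal (1 / measure leb Q) * ennreal a"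
        using variation_sup_bound'[OF that Q(1) g Q(2)] V a by simp
      also have "\<dots> = ennreal V + ennreal (1 / measure leb Q * a)"
        using a by (subst ennreal_mult) auto
      also have "\<dots> = ennreal S" using V a by (simp add: S_def ennreal_plus)
      finally show ?thesis using V a mp by (subst (asm) ennreal_le_iff) (auto simp: S_def)
    qed
    have S0: "0 \<le> S" using V a mp by (simp add: S_def)
    have "variation Q (\<lambda>x. g x * \<phi> x) \<le> ennreal S * variation Q \<phi> + ennreal \<rho> * variation Q g"
      using S \<phi> 3 var\<phi> by (intro variation_mult) (auto intro: le_less_trans)
    also have "\<dots> \<le> ennreal S * ennreal \<epsilon> + ennreal \<rho> * ennreal V"
      using var\<phi> V by (intro add_mono mult_left_mono) auto
    also have "\<dots> = ennreal (S * \<epsilon> + \<rho> * V)" using S0 \<epsilon> \<rho>0 V by (simp add: ennreal_plus ennreal_mult)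
    also have "S * \<epsilon> + \<rho> * V = (\<rho> + \<epsilon>) * V + \<epsilon> / measure leb Q * a"
      by (simp add: S_def algebra_simps)
    also have "ennreal \<dots> = ennreal (\<rho> + \<epsilon>) * ennreal V + ennreal (\<epsilon> / measure leb Q) * ennreal a"
    proof -
      have n: "0 \<le> (\<rho> + \<epsilon>) * V" "0 \<le> \<epsilon> / measure leb Q * a" "0 \<le> \<rho> + \<epsilon>" "0 \<le> \<epsilon> / measure leb Q"
        using \<rho>0 \<epsilon> V(2) a(2) mp by auto
      show ?thesis
        by (simp only: ennreal_plus[OF n(1,2)] ennreal_mult[OF n(3) V(2)] ennreal_mult[OF n(4) a(2)])
    qed
    finally show ?thesis using V a by simp
  qed
qed

text \<open>Cut \<open>Q\<close> into finitely many intervals on which the control function of the weight grows by at most \<open>\<epsilon>\<close>, at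
  the price of a larger multiple of the mean; the induction cuts off one interval at a time. The cuts
  exist because the control function is continuous. At a jump of the weight the factor would have to be larger.\<close>

lemma variation_mult_continuous_weight:
  assumes "is_interval Q" "Q \<subseteq> {0..1}" "emeasure leb Q > 0"
    and "controls W Q \<phi>" "continuous_on Q W"
    and "\<And>x y. x \<in> Q \<Longrightarrow> y \<in> Q \<Longrightarrow> x \<le> y \<Longrightarrow> W y - W x \<le> (real n + 1) * \<epsilon>"
    and \<phi>: "\<And>x. x \<in> Q \<Longrightarrow> 0 \<le> \<phi> x \<and> \<phi> x \<le> \<rho>" and \<epsilon>: "\<epsilon> > 0"
  shows "\<exists>B\<ge>0. \<forall>g\<in>borel_measurable leb.
      variation Q (\<lambda>x. g x * \<phi> x) \<le> ennreal (\<rho> + \<epsilon>) * variation Q g + ennreal B * L1_norm g"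
  using assms(1-7)
proof (induction n arbitrary: Q)
  case 0
  have "W y - W x \<le> \<epsilon>" if "x \<in> Q" "y \<in> Q" "x \<le> y" for x y using 0(6)[OF that] by simp
  note variation_mult_small[OF 0(4) this 0(7) \<epsilon> interval_sets_leb[OF 0(1,2)] 0(3)]
  moreover have "0 \<le> \<epsilon> / measure leb Q" using \<epsilon> by simp
  ultimately show ?case by blast
next
  case (Suc n)
  note Q = Suc.prems(1,2)
  have mono: "W x \<le> W y" if "x \<in> Q" "y \<in> Q" "x \<le> y" for x y
    using controlsD[OF Suc.prems(4) that] by auto
  show ?case
  proof (cases "\<forall>x\<in>Q. \<forall>y\<in>Q. x \<le> y \<longrightarrow> W y - W x \<le> \<epsilon>")
    case True
    then have "W y - W x \<le> \<epsilon>" if "x \<in> Q" "y \<in> Q" "x \<le> y" for x y using that by blast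
    note variation_mult_small[OF Suc.prems(4) this Suc.prems(7) \<epsilon> interval_sets_leb[OF Q] Suc.prems(3)]
    moreover have "0 \<le> \<epsilon> / measure leb Q" using \<epsilon> by simp
    ultimately show ?thesis by blast
  next
    case False
    then obtain x1 y1 where xy1: "x1 \<in> Q" "y1 \<in> Q" "x1 \<le> y1" "W y1 - W x1 > \<epsilon>" by force
    define i where "i = Inf (W ` Q)"
    have bd: "W z - (real (Suc n) + 1) * \<epsilon> \<le> W x" if "z \<in> Q" "x \<in> Q" for x z
    proof (cases "x \<le> z")
      case True then show ?thesis using Suc.prems(6)[OF that(2,1)] by simp
    next
      case False
      moreover have "0 \<le> (real (Suc n) + 1) * \<epsilon>" using \<epsilon> by simp
      ultimately show ?thesis using mono[OF that] by linarith
    qed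
    have bdd: "bdd_below (W ` Q)" using bd[OF xy1(1)] by (intro bdd_belowI2) auto
    have i_le: "i \<le> W x" if "x \<in> Q" for x unfolding i_def by (rule cINF_lower[OF bdd that])
    have "\<exists>x\<in>Q. W x < i + \<epsilon>"
    proof (rule ccontr)
      assume "\<not> ?thesis"
      then have "i + \<epsilon> \<le> i" unfolding i_def using xy1(1) by (intro cINF_greatest) (auto simp: not_less i_def)
      then show False using \<epsilon> by simp
    qed
    then obtain x' where x': "x' \<in> Q" "W x' < i + \<epsilon>" by auto
    have y1: "W y1 > i + \<epsilon>" using i_le[OF xy1(1)] xy1(4) by simp
    have x'y1: "x' \<le> y1" using mono[OF xy1(2) x'(1)] x'(2) y1 by linarith
    have sub: "{x'..y1} \<subseteq> Q" using mem_is_interval_1_I[OF Q(1) x'(1) xy1(2)] by auto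
    \<comment> \<open>The cut: here the control function has grown by exactly \<open>\<epsilon>\<close> from its infimum.\<close>
    have "\<exists>p\<ge>x'. p \<le> y1 \<and> W p = i + \<epsilon>"
      using x' y1 x'y1 continuous_on_subset[OF Suc.prems(5) sub] by (intro IVT') auto
    then obtain p where p: "x' \<le> p" "p \<le> y1" "W p = i + \<epsilon>" by auto
    have pQ: "p \<in> Q" using p sub by auto
    have "x' \<noteq> p" "p \<noteq> y1" using p(3) x'(2) y1 by auto
    then have lt: "x' < p" "p < y1" using p by auto
    let ?A = "Q \<inter> {..p}" and ?B = "Q \<inter> {p..}"
    have iA: "is_interval ?A" and iB: "is_interval ?B"
      using Q(1) by (auto intro: is_interval_Int simp: is_interval_ic is_interval_ci)
    have subs: "?A \<subseteq> {0..1}" "?B \<subseteq> {0..1}" using Q(2) by auto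
    have posA: "emeasure leb ?A > 0"
      by (rule interval_emeasure_pos[OF iA subs(1), of x' p]) (use x' pQ lt in auto)
    have posB: "emeasure leb ?B > 0"
      by (rule interval_emeasure_pos[OF iB subs(2), of p y1]) (use xy1 pQ lt in auto)
    have WA: "W y - W x \<le> \<epsilon>" if "x \<in> ?A" "y \<in> ?A" "x \<le> y" for x y
    proof -
      have "W y \<le> W p" "i \<le> W x" using that by (auto intro!: mono i_le pQ)
      then show ?thesis using p(3) by linarith
    qed
    define BA where "BA = \<epsilon> / measure leb ?A"
    have BA: "variation ?A (\<lambda>x. g x * \<phi> x) \<le> ennreal (\<rho> + \<epsilon>) * variation ?A g + ennreal BA * L1_norm g"
      if "g \<in> borel_measurable leb" for g
      unfolding BA_def
      by (rule variation_mult_small[OF controls_subset[OF Suc.prems(4)]])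
        (use WA Suc.prems(7) \<epsilon> interval_sets_leb[OF iA subs(1)] posA that in blast)+
    have BA0: "0 \<le> BA" using \<epsilon> by (simp add: BA_def)
    have "\<exists>B\<ge>0. \<forall>g\<in>borel_measurable leb.
      variation ?B (\<lambda>x. g x * \<phi> x) \<le> ennreal (\<rho> + \<epsilon>) * variation ?B g + ennreal B * L1_norm g"
    proof (rule Suc.IH[OF iB subs(2) posB])
      show "controls W ?B \<phi>" using Suc.prems(4) by (rule controls_subset) auto
      show "continuous_on ?B W" using Suc.prems(5) by (rule continuous_on_subset) auto
      show "0 \<le> \<phi> x \<and> \<phi> x \<le> \<rho>" if "x \<in> ?B" for x using Suc.prems(7) that by auto
      fix x y assume xy: "x \<in> ?B" "y \<in> ?B" "x \<le> y"
      have "W y - (real (Suc n) + 1) * \<epsilon> \<le> i" unfolding i_def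
      proof (rule cINF_greatest)
        show "W y - (real (Suc n) + 1) * \<epsilon> \<le> W z" if "z \<in> Q" for z using bd[of y z] xy that by blast
      qed (use xy in blast)
      moreover have "W p \<le> W x" using mono[OF pQ, of x] xy by auto
      ultimately show "W y - W x \<le> (real n + 1) * \<epsilon>" using p(3) by (simp add: algebra_simps)
    qed
    then obtain BB where BB0: "BB \<ge> 0" and BB: "\<forall>g\<in>borel_measurable leb. variation ?B (\<lambda>x. g x * \<phi> x)
      \<le> ennreal (\<rho> + \<epsilon>) * variation ?B g + ennreal BB * L1_norm g" by (elim exE conjE)
    have "variation Q (\<lambda>x. g x * \<phi> x) \<le> ennreal (\<rho> + \<epsilon>) * variation Q g + ennreal (BA + BB) * L1_norm g"
      if g: "g \<in> borel_measurable leb" for g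
    proof -
      have "variation Q (\<lambda>x. g x * \<phi> x) \<le> variation ?A (\<lambda>x. g x * \<phi> x) + variation ?B (\<lambda>x. g x * \<phi> x)"
        by (rule variation_glue[OF pQ])
      also have "\<dots> \<le> (ennreal (\<rho> + \<epsilon>) * variation ?A g + ennreal BA * L1_norm g) +
                     (ennreal (\<rho> + \<epsilon>) * variation ?B g + ennreal BB * L1_norm g)"
        by (intro add_mono BA BB[rule_format] g)
      also have "\<dots> = ennreal (\<rho> + \<epsilon>) * (variation ?A g + variation ?B g) + ennreal (BA + BB) * L1_norm g"
        using BA0 BB0 by (simp add: ennreal_plus distrib_left distrib_right ac_simps)
      also have "\<dots> \<le> ennreal (\<rho> + \<epsilon>) * variation Q g + ennreal (BA + BB) * L1_norm g"
        by (intro add_mono mult_left_mono variation_split[OF pQ]) auto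
      finally show ?thesis .
    qed
    then show ?thesis using BA0 BB0 by (intro exI[of _ "BA + BB"]) auto
  qed
qed

section \<open>Transport along expanding branches\<close>

lemma bv_sup:
  assumes g: "g \<in> borel_measurable leb" and x: "x \<in> {0..1}"
  shows "ennreal \<bar>g x\<bar> \<le> bv g"
proof -
  have "measure leb {0..1} = 1" using leb.prob_space by simp
  moreover have "emeasure leb {0..1} = 1" using leb.emeasure_space_1 by simp
  ultimately show ?thesis
    using variation_sup_bound'[OF x _ g] by (simp add: bv_def sets_leb_iff)
qed

lemma bv_measurable: "bv g < \<infinity> \<Longrightarrow> g \<in> borel_measurable leb"
  unfolding bv_def by (intro BV_measurable) (auto simp: less_top[symmetric])

lemma bv_bound:
  assumes "bv g < \<infinity>" "x \<in> {0..1}" shows "\<bar>g x\<bar> \<le> enn2real (bv g)"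
proof -
  have "enn2real (ennreal \<bar>g x\<bar>) \<le> enn2real (bv g)"
    using bv_sup[OF bv_measurable[OF assms(1)] assms(2)] assms(1) by (intro enn2real_mono) auto
  then show ?thesis by simp
qed

lemma L1_norm_le_bound:
  assumes "\<And>x. x \<in> {0..1} \<Longrightarrow> \<bar>g x\<bar> \<le> b" shows "L1_norm g \<le> ennreal b"
proof -
  have "L1_norm g \<le> (\<integral>\<^sup>+x. ennreal b \<partial>leb)"
    using assms by (intro nn_integral_mono ennreal_leI) auto
  also have "\<dots> = ennreal b" using leb.emeasure_space_1 by simp
  finally show ?thesis .
qed

lemma bounded_integrable_leb:
  fixes g :: "real \<Rightarrow> real"
  assumes "g \<in> borel_measurable leb" "\<And>x. x \<in> {0..1} \<Longrightarrow> \<bar>g x\<bar> \<le> b"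
  shows "integrable leb g"
  using assms by (intro leb.integrable_const_bound[of _ b] AE_I2) auto

lemma bv_integrable: "bv g < \<infinity> \<Longrightarrow> integrable leb g"
  by (rule bounded_integrable_leb[OF bv_measurable bv_bound])

lemma bv_add: 
  assumes "u \<in> borel_measurable leb" "v \<in> borel_measurable leb"
  shows "bv (\<lambda>x. u x + v x) \<le> bv u + bv v"
proof -
  have "L1_norm (\<lambda>x. u x + v x) \<le> (\<integral>\<^sup>+x. ennreal \<bar>u x\<bar> + ennreal \<bar>v x\<bar> \<partial>leb)"
    by (intro nn_integral_mono) (simp flip: ennreal_plus)
  also have "\<dots> = L1_norm u + L1_norm v" using assms by (intro nn_integral_add) auto
  finally show ?thesis unfolding bv_def using variation_add[of "{0..1}" u v]
    by (metis (no_types, lifting) add.assoc add.left_commute add_mono)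
qed

lemma L1_norm_cmult: "u \<in> borel_measurable leb \<Longrightarrow> L1_norm (\<lambda>x. c * u x) = ennreal \<bar>c\<bar> * L1_norm u"
  by (subst nn_integral_cmult[symmetric]) (auto simp: abs_mult ennreal_mult intro!: nn_integral_cong)

lemma bv_cmult: "u \<in> borel_measurable leb \<Longrightarrow> bv (\<lambda>x. c * u x) = ennreal \<bar>c\<bar> * bv u"
  by (simp add: bv_def variation_cmult L1_norm_cmult distrib_left)

text \<open>A return map \<open>F\<close> with countably many expanding branches \<open>J i\<close> and return times \<open>t i\<close>. Weighted by
  \<open>exp (\<theta> * t i)\<close>, the weights \<open>1 / F'\<close> are bounded by the contraction rate \<open>\<rho>\<close> and by the summable \<open>N i\<close>, which
  also bounds their control functions. The branches cover the set where \<open>h\<close> is nonzero, and \<open>F\<close> maps this set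
  into itself up to null sets; nothing is assumed outside. Intervals \<open>J i\<close> may be empty, so that finite
  families and compositions can be enumerated by \<open>nat\<close>.\<close>

locale branch_scheme =
  fixes f h :: "real \<Rightarrow> real" and \<theta> \<rho> :: real and F :: "real \<Rightarrow> real" and t :: "nat \<Rightarrow> nat"
    and J :: "nat \<Rightarrow> real set" and N :: "nat \<Rightarrow> real"
  assumes \<theta>_pos: "\<theta> > 0"
    and N_summable: "summable N" and N_nonneg: "\<And>i. 0 \<le> N i"
    and J_open: "\<And>i. open (J i)" and J_interval: "\<And>i. is_interval (J i)"
    and J_unit: "\<And>i. J i \<subseteq> {0..1}" and J_disjoint: "disjoint_family J"
    and F_unit: "\<And>i x. x \<in> J i \<Longrightarrow> F x \<in> {0..1}"
    and F_mono: "\<And>i. monotone_map_on (J i) F"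
    and F_deriv: "\<And>i x. x \<in> J i \<Longrightarrow> (F has_real_derivative deriv F x) (at x)"
    and F_deriv_nonzero: "\<And>i x. x \<in> J i \<Longrightarrow> deriv F x \<noteq> 0"
    and weight_le_\<rho>: "\<And>i x. x \<in> J i \<Longrightarrow> exp (\<theta> * real (t i)) * \<bar>1 / deriv F x\<bar> \<le> \<rho>"
    and weight_le_N: "\<And>i x. x \<in> J i \<Longrightarrow> exp (\<theta> * real (t i)) * \<bar>1 / deriv F x\<bar> \<le> N i"
    and weight_control: "\<And>i. \<exists>W. continuous_on (J i) W \<and> controls W (J i) (\<lambda>x. \<bar>1 / deriv F x\<bar>) \<and>
           (\<forall>x\<in>J i. 0 \<le> W x \<and> exp (\<theta> * real (t i)) * W x \<le> N i)"
    and f_measurable: "f \<in> measurable leb leb" and F_measurable: "F \<in> measurable leb leb"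
    and h_measurable: "h \<in> borel_measurable leb"
    and J_cover: "AE x in leb. h x \<noteq> 0 \<longrightarrow> x \<in> (\<Union>i. J i)"
    and F_nonsingular: "\<And>A. A \<in> sets leb \<Longrightarrow> AE x in leb. x \<in> A \<longrightarrow> h x = 0 \<Longrightarrow>
           AE x in leb. h x \<noteq> 0 \<longrightarrow> F x \<notin> A"
    and F_eq: "\<And>i x. x \<in> J i \<Longrightarrow> F x = (f ^^ t i) x"
    and t_pos: "\<And>i. t i \<ge> 1"
begin

text \<open>The transfer operator of branch \<open>i\<close>.\<close>

definition push :: "nat \<Rightarrow> (real \<Rightarrow> real) \<Rightarrow> real \<Rightarrow> real" where
  "push i g y = (if y \<in> F ` J i
     then g (inv_into (J i) F y) * \<bar>1 / deriv F (inv_into (J i) F y)\<bar> else 0)"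

lemma F_inj: "inj_on F (J i)"
proof -
  have "F x \<noteq> F y" if "x \<in> J i" "y \<in> J i" "x < y" for x y
  proof
    assume eq: "F x = F y"
    have sub: "z \<in> J i" if "x \<le> z" "z \<le> y" for z
      using mem_is_interval_1_I[OF J_interval] \<open>x \<in> J i\<close> \<open>y \<in> J i\<close> that by blast
    obtain z where "x < z" "z < y" "F y - F x = (y - x) * deriv F z"
      using MVT2[OF \<open>x < y\<close>, of F "deriv F"] F_deriv sub by blast
    then show False using eq \<open>x < y\<close> F_deriv_nonzero[of z i] sub[of z] by auto
  qed
  then show ?thesis by (intro linorder_inj_onI) auto
qed

lemma J_sets: "J i \<in> sets leb"
  using J_interval J_unit by (rule interval_sets_leb)

lemma F_cont: "continuous_on (J i) F"
  using F_deriv by (meson DERIV_isCont continuous_at_imp_continuous_on)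

lemma FJ_interval: "is_interval (F ` J i)"
  using F_cont J_interval by (metis connected_continuous_image is_interval_connected_1)

lemma FJ_unit: "F ` J i \<subseteq> {0..1}"
  using F_unit by (intro image_subsetI)

lemma push_F: "x \<in> J i \<Longrightarrow> push i g (F x) = g x * \<bar>1 / deriv F x\<bar>"
  using F_inj[of i] by (simp add: push_def inv_into_f_f)

lemma push_off: "y \<notin> F ` J i \<Longrightarrow> push i g y = 0"
  by (simp add: push_def)

lemma push_diff: "push i (\<lambda>x. u x - v x) y = push i u y - push i v y"
  by (simp add: push_def left_diff_distrib diff_divide_distrib)

lemma push_abs: "\<bar>push i u y\<bar> = push i (\<lambda>x. \<bar>u x\<bar>) y"
  by (simp add: push_def abs_mult)

text \<open>The change of variables \<open>y = F x\<close> on \<open>J i\<close>.\<close>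

lemma push_integral:
  assumes g: "integrable leb g" and u: "u \<in> borel_measurable leb" and c: "\<And>x. x \<in> {0..1} \<Longrightarrow> \<bar>u x\<bar> \<le> c"
  shows "integrable leb (\<lambda>y. push i g y * u y)"
    and "(\<integral>y. push i g y * u y \<partial>leb) = (\<integral>x. indicator (J i) x * (g x * u (F x)) \<partial>leb)"
proof -
  let ?p = "\<lambda>y. push i g y * u y"
  have Fsp: "F x \<in> {0..1}" if "x \<in> {0..1}" for x using measurable_space[OF F_measurable, of x] that by simp
  have uF: "(\<lambda>x. u (F x)) \<in> borel_measurable leb" using measurable_compose[OF F_measurable u] .
  have int1: "integrable leb (\<lambda>x. g x * u (F x))"
  proof (rule Bochner_Integration.integrable_bound)
    show "integrable leb (\<lambda>x. c * g x)" using g by simp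
    show "(\<lambda>x. g x * u (F x)) \<in> borel_measurable leb" using g uF by simp
    show "AE x in leb. norm (g x * u (F x)) \<le> norm (c * g x)"
    proof (rule AE_I2)
      fix x assume "x \<in> space leb"
      then have "\<bar>u (F x)\<bar> \<le> \<bar>c\<bar>" using c[of "F x"] Fsp by auto
      then show "norm (g x * u (F x)) \<le> norm (c * g x)"
        using mult_left_mono[of "\<bar>u (F x)\<bar>" "\<bar>c\<bar>" "\<bar>g x\<bar>"] by (simp add: abs_mult mult.commute)
    qed
  qed
  have int2: "integrable leb (\<lambda>x. indicator (J i) x * (g x * u (F x)))"
    using integrable_mult_indicator[OF J_sets int1] by simp
  have conv: "integrable leb k \<longleftrightarrow> set_integrable lebesgue A k"
     "(\<integral>x. k x \<partial>leb) = (\<integral>x. indicator A x * k x \<partial>lebesgue)"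
    if "A \<subseteq> {0..1}" "\<And>x. x \<notin> A \<Longrightarrow> k x = 0" for A and k :: "real \<Rightarrow> real"
  proof -
    have eq: "(\<lambda>x. indicator {0..1} x * k x) = (\<lambda>x. indicator A x * k x)"
      using that by (auto simp: fun_eq_iff indicator_def)
    show "integrable leb k \<longleftrightarrow> set_integrable lebesgue A k"
      unfolding set_integrable_def using eq by (subst integrable_restrict_space) auto
    show "(\<integral>x. k x \<partial>leb) = (\<integral>x. indicator A x * k x \<partial>lebesgue)"
      using eq by (subst integral_restrict_space) auto
  qed
  let ?k = "\<lambda>x. indicator (J i) x * (g x * u (F x))"
  have J_leb: "J i \<in> sets lebesgue" using J_sets sets_leb_iff by auto
  have k_set: "(\<lambda>x. g x * u (F x)) absolutely_integrable_on J i"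
    using int2 conv(1)[OF J_unit[of i], of ?k] by (simp add: set_integrable_def mult.assoc[symmetric])
       (simp add: indicator_inter_arith[symmetric])
  have eqJ: "\<bar>deriv F x\<bar> * ?p (F x) = g x * u (F x)" if "x \<in> J i" for x
    using push_F[OF that] F_deriv_nonzero[OF that] by simp
  have k_set': "(\<lambda>x. \<bar>deriv F x\<bar> * ?p (F x)) absolutely_integrable_on J i"
    using k_set by (rule set_integrable_cong[THEN iffD1, rotated -1]) (auto simp: eqJ)
  have cv: "?p absolutely_integrable_on F ` J i \<and> integral (F ` J i) ?p = integral (J i) (\<lambda>x. \<bar>deriv F x\<bar> * ?p (F x))"
    using has_absolute_integral_change_of_variables_1'[of "J i" F "deriv F" ?p
        "integral (J i) (\<lambda>x. \<bar>deriv F x\<bar> * ?p (F x))"] k_set' J_leb F_inj[of i]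
      F_deriv[THEN has_field_derivative_at_within] by blast
  show *: "integrable leb ?p"
    using cv conv(1)[OF FJ_unit, of i ?p] push_off by auto
  have "(\<integral>y. ?p y \<partial>leb) = integral (F ` J i) ?p"
    using cv conv(2)[OF FJ_unit, of i ?p] push_off set_lebesgue_integral_eq_integral(2)[of "F ` J i" ?p]
    by (auto simp: set_lebesgue_integral_def)
  also have "\<dots> = integral (J i) (\<lambda>x. g x * u (F x))"
    using cv by (simp add: eqJ cong: Henstock_Kurzweil_Integration.integral_cong)
  also have "\<dots> = (\<integral>x. indicator (J i) x * (g x * u (F x)) \<partial>leb)"
    using k_set conv(2)[of "J i" ?k] J_unit set_lebesgue_integral_eq_integral(2)[OF k_set]
    by (simp add: set_lebesgue_integral_def mult.assoc[symmetric]) (simp add: indicator_inter_arith[symmetric])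
  finally show "(\<integral>y. ?p y \<partial>leb) = (\<integral>x. indicator (J i) x * (g x * u (F x)) \<partial>leb)" .
qed

lemma push_integrable: "integrable leb g \<Longrightarrow> integrable leb (push i g)"
  using push_integral(1)[of g "\<lambda>_. 1" 1 i] by simp

lemma L1_norm_push:
  assumes g: "integrable leb g"
  shows "L1_norm (push i g) = (\<integral>\<^sup>+x\<in>J i. ennreal \<bar>g x\<bar> \<partial>leb)"
proof -
  have g': "integrable leb (\<lambda>x. \<bar>g x\<bar>)" using g by simp
  have "L1_norm (push i g) = ennreal (\<integral>y. \<bar>push i g y\<bar> \<partial>leb)"
    using push_integrable[OF g, of i] by (intro nn_integral_eq_integral) auto
  also have "(\<integral>y. \<bar>push i g y\<bar> \<partial>leb) = (\<integral>x. indicator (J i) x * \<bar>g x\<bar> \<partial>leb)"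
    using push_integral(2)[OF g', of "\<lambda>_. 1" 1 i] by (simp add: push_abs)
  also have "ennreal \<dots> = (\<integral>\<^sup>+x. ennreal (indicator (J i) x * \<bar>g x\<bar>) \<partial>leb)"
    using integrable_mult_indicator[OF J_sets g', of i]
    by (intro nn_integral_eq_integral[symmetric]) auto
  also have "\<dots> = (\<integral>\<^sup>+x\<in>J i. ennreal \<bar>g x\<bar> \<partial>leb)"
    by (intro nn_integral_cong) (auto simp: indicator_def)
  finally show ?thesis .
qed

lemma push_sup:
  assumes "\<And>x. x \<in> J i \<Longrightarrow> \<bar>g x\<bar> * \<bar>1 / deriv F x\<bar> \<le> b" and "0 \<le> b"
  shows "\<bar>push i g y\<bar> \<le> b"
proof (cases "y \<in> F ` J i")
  case True
  then obtain x where x: "x \<in> J i" "y = F x" by auto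
  then show ?thesis using push_F[OF x(1), of g] assms(1)[OF x(1)] by (simp add: abs_mult)
qed (use assms push_off in simp)

lemma inv_monotone: "monotone_map_on (F ` J i) (inv_into (J i) F)"
proof -
  have inv: "inv_into (J i) F (F x) = x" if "x \<in> J i" for x using F_inj that by (rule inv_into_f_f)
  from F_mono[of i] show ?thesis unfolding monotone_map_on_def
  proof
    assume m: "mono_on (J i) F"
    have "x \<le> y" if "x \<in> J i" "y \<in> J i" "F x \<le> F y" for x y
      using mono_onD[OF m that(2,1)] that inj_onD[OF F_inj[of i], of x y] by fastforce
    then have "mono_on (F ` J i) (inv_into (J i) F)" by (auto simp: mono_on_def inv)
    then show "mono_on (F ` J i) (inv_into (J i) F) \<or> antimono_on (F ` J i) (inv_into (J i) F)" ..
  next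
    assume m: "antimono_on (J i) F"
    have "y \<le> x" if "x \<in> J i" "y \<in> J i" "F x \<le> F y" for x y
      using monotone_onD[OF m that(1,2)] that inj_onD[OF F_inj[of i], of x y] by fastforce
    then have "antimono_on (F ` J i) (inv_into (J i) F)" by (auto simp: monotone_on_def inv)
    then show "mono_on (F ` J i) (inv_into (J i) F) \<or> antimono_on (F ` J i) (inv_into (J i) F)" ..
  qed
qed

lemma variation_push:
  assumes "\<And>x. x \<in> J i \<Longrightarrow> \<bar>g x\<bar> * \<bar>1 / deriv F x\<bar> \<le> b"
  shows "variation {0..1} (push i g) \<le> variation (J i) (\<lambda>x. g x * \<bar>1 / deriv F x\<bar>) + 2 * ennreal b"
proof -
  let ?u = "\<lambda>x. g x * \<bar>1 / deriv F x\<bar>"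
  have "variation {0..1} (push i g) \<le> variation (F ` J i) (\<lambda>y. ?u (inv_into (J i) F y)) + 2 * ennreal b"
    unfolding push_def
  proof (rule variation_extend_zero[OF FJ_interval])
    fix y assume "y \<in> F ` J i"
    then have "inv_into (J i) F y \<in> J i" by (rule inv_into_into)
    from assms[OF this] show "\<bar>?u (inv_into (J i) F y)\<bar> \<le> b" by (simp add: abs_mult)
  qed
  also have "variation (F ` J i) (\<lambda>y. ?u (inv_into (J i) F y)) \<le> variation (J i) ?u"
    using inv_monotone by (rule variation_comp) (auto intro: inv_into_into)
  finally show ?thesis by (simp add: add_mono)
qed

text \<open>The constant 5 counts two terms from the product rule, two jumps at the ends of \<open>F ` J i\<close>, and the mean.\<close>

lemma bv_push_le_local:
  assumes gb: "\<And>x. x \<in> J i \<Longrightarrow> \<bar>g x\<bar> \<le> b" and varg: "variation (J i) g \<le> ennreal b" and b: "0 \<le> b"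
  shows "ennreal (exp (\<theta> * real (t i))) * bv (push i g) \<le> ennreal (5 * N i * b)"
proof -
  define e where "e = exp (\<theta> * real (t i))"
  have e: "e > 0" by (simp add: e_def)
  define n where "n = N i / e"
  have n: "0 \<le> n" using N_nonneg[of i] e by (simp add: n_def)
  have \<phi>n: "\<bar>1 / deriv F x\<bar> \<le> n" if "x \<in> J i" for x
    using weight_le_N[OF that] e by (simp add: n_def e_def field_simps)
  obtain W where W: "controls W (J i) (\<lambda>x. \<bar>1 / deriv F x\<bar>)" "\<And>x. x \<in> J i \<Longrightarrow> 0 \<le> W x \<and> e * W x \<le> N i"
    using weight_control[of i] unfolding e_def by blast
  have var\<phi>: "variation (J i) (\<lambda>x. \<bar>1 / deriv F x\<bar>) \<le> ennreal n"
    using W(2) e by (intro variation_leI[OF W(1)]) (auto simp: n_def field_simps)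
  have g\<phi>: "\<bar>g x\<bar> * \<bar>1 / deriv F x\<bar> \<le> b * n" if "x \<in> J i" for x
    using gb[OF that] \<phi>n[OF that] b by (intro mult_mono) auto
  have "variation (J i) (\<lambda>x. g x * \<bar>1 / deriv F x\<bar>) \<le>
      ennreal b * variation (J i) (\<lambda>x. \<bar>1 / deriv F x\<bar>) + ennreal n * variation (J i) g"
    using gb \<phi>n varg var\<phi> by (intro variation_mult) (auto intro: le_less_trans)
  also have "\<dots> \<le> ennreal b * ennreal n + ennreal n * ennreal b"
    by (intro add_mono mult_left_mono var\<phi> varg) auto
  also have "\<dots> = ennreal (2 * (b * n))" using b n by (simp add: ennreal_mult[symmetric] ennreal_plus[symmetric] mult.commute del: ennreal_plus)
  finally have v: "variation (J i) (\<lambda>x. g x * \<bar>1 / deriv F x\<bar>) \<le> ennreal (2 * (b * n))" .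
  have "variation {0..1} (push i g) \<le> variation (J i) (\<lambda>x. g x * \<bar>1 / deriv F x\<bar>) + 2 * ennreal (b * n)"
    by (rule variation_push) (rule g\<phi>)
  also have "\<dots> \<le> ennreal (2 * (b * n)) + 2 * ennreal (b * n)" by (intro add_mono v) auto
  finally have 1: "variation {0..1} (push i g) \<le> ennreal (2 * (b * n)) + 2 * ennreal (b * n)" .
  have 2: "L1_norm (push i g) \<le> ennreal (b * n)"
    using b n by (intro L1_norm_le_bound push_sup g\<phi>) auto
  have "bv (push i g) \<le> ennreal (2 * (b * n)) + 2 * ennreal (b * n) + ennreal (b * n)"
    unfolding bv_def by (intro add_mono 1 2)
  also have "\<dots> = ennreal (5 * (b * n))"
  proof -
    have "2 * ennreal (b * n) = ennreal (2 * (b * n))" using b n by (simp add: ennreal_mult)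
    then show ?thesis using b n by (simp add: ennreal_plus[symmetric] del: ennreal_plus)
  qed
  finally have "ennreal e * bv (push i g) \<le> ennreal e * ennreal (5 * (b * n))" by (rule mult_left_mono) simp
  also have "\<dots> = ennreal (e * (5 * (b * n)))" using e b n by (intro ennreal_mult[symmetric]) auto
  also have "e * (5 * (b * n)) = 5 * N i * b" using e by (simp add: n_def)
  finally show ?thesis by (simp add: e_def)
qed

lemma bv_push_le:
  assumes g: "bv g < \<infinity>"
  shows "ennreal (exp (\<theta> * real (t i))) * bv (push i g) \<le> ennreal (5 * N i) * bv g"
proof -
  define b where "b = enn2real (bv g)"
  have b: "0 \<le> b" "bv g = ennreal b" using g by (auto simp: b_def)
  have "ennreal (exp (\<theta> * real (t i))) * bv (push i g) \<le> ennreal (5 * N i * b)"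
  proof (rule bv_push_le_local[OF _ _ b(1)])
    show "\<bar>g x\<bar> \<le> b" if "x \<in> J i" for x
      using bv_bound[OF g, of x] J_unit[of i] that by (auto simp: b_def)
    show "variation (J i) g \<le> ennreal b"
      unfolding b(2)[symmetric] bv_def using variation_mono[OF J_unit[of i], of g] by (rule add_increasing2[rotated]) simp
  qed
  also have "\<dots> = ennreal (5 * N i) * bv g" using b N_nonneg[of i] by (simp add: ennreal_mult)
  finally show ?thesis .
qed

text \<open>One \<open>\<rho>\<close> comes from multiplying \<open>g\<close> by the weight, two more from the jumps at the ends of \<open>F ` J i\<close>, where \<open>g\<close>
  is bounded by its variation plus a multiple of its mean. The multiple of the mean depends on the length of
  \<open>J i\<close>, so this is usable for finitely many branches only.\<close>

lemma bv_push_lasota_yorke: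
  assumes \<epsilon>: "\<epsilon> > 0" and \<rho>: "0 \<le> \<rho>"
  shows "\<exists>B\<ge>0. \<forall>g. bv g < \<infinity> \<longrightarrow> ennreal (exp (\<theta> * real (t i))) * bv (push i g) \<le>
           ennreal (3 * \<rho> + \<epsilon>) * variation (J i) g + ennreal B * L1_norm g"
proof (cases "J i = {}")
  case True
  have "bv (push i g) = 0" for g
  proof -
    have "push i g = (\<lambda>_. 0)" using True by (simp add: push_def fun_eq_iff)
    then show ?thesis by (simp add: bv_def)
  qed
  then show ?thesis by (intro exI[of _ 0]) simp
next
  case False
  define e where "e = exp (\<theta> * real (t i))"
  have e: "e > 0" by (simp add: e_def)
  obtain a c where ac: "a < c" "{a<..<c} \<subseteq> J i"
  proof -
    obtain x where "x \<in> J i" using False by auto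
    then obtain d where "d > 0" "ball x d \<subseteq> J i" using J_open openE by blast
    then show ?thesis using that[of "x - d" "x + d"] by (simp add: ball_eq_greaterThanLessThan)
  qed
  have pos: "emeasure leb (J i) > 0"
  proof (rule interval_emeasure_pos[OF J_interval J_unit])
    show "(2*a + c) / 3 \<in> J i" "(a + 2 * c) / 3 \<in> J i" using ac by (auto intro!: subsetD[OF ac(2)])
  qed (use ac in auto)
  have mp: "measure leb (J i) > 0" using pos by (simp add: leb.emeasure_eq_measure ennreal_less_zero_iff)
  let ?\<phi> = "\<lambda>x. e * \<bar>1 / deriv F x\<bar>"
  obtain W where W: "continuous_on (J i) W" "controls W (J i) (\<lambda>x. \<bar>1 / deriv F x\<bar>)"
      "\<And>x. x \<in> J i \<Longrightarrow> 0 \<le> W x \<and> e * W x \<le> N i"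
    using weight_control[of i] unfolding e_def by blast
  have We: "controls (\<lambda>x. e * W x) (J i) ?\<phi>"
    unfolding controls_def
  proof (intro ballI impI)
    fix x y assume "x \<in> J i" "y \<in> J i" "x \<le> y"
    then have "e * \<bar>\<bar>1 / deriv F y\<bar> - \<bar>1 / deriv F x\<bar>\<bar> \<le> e * (W y - W x)"
      using controlsD[OF W(2)] e by (intro mult_left_mono) auto
    then show "\<bar>?\<phi> y - ?\<phi> x\<bar> \<le> e * W y - e * W x"
      using e by (simp only: right_diff_distrib[symmetric] abs_mult abs_of_pos)
  qed
  obtain n where n: "N i / \<epsilon> < real n" using reals_Archimedean2 by blast
  have "\<exists>B\<ge>0. \<forall>g\<in>borel_measurable leb.
      variation (J i) (\<lambda>x. g x * ?\<phi> x) \<le> ennreal (\<rho> + \<epsilon>) * variation (J i) g + ennreal B * L1_norm g"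
  proof (rule variation_mult_continuous_weight[OF J_interval J_unit pos We _ _ _ \<epsilon>, where n=n])
    show "continuous_on (J i) (\<lambda>x. e * W x)" by (intro continuous_intros W)
    show "0 \<le> ?\<phi> x \<and> ?\<phi> x \<le> \<rho>" if "x \<in> J i" for x
      using weight_le_\<rho>[OF that] e by (simp add: e_def)
    fix x y assume xy: "x \<in> J i" "y \<in> J i"
    have "e * W y - e * W x \<le> N i" using W(3)[OF xy(1)] W(3)[OF xy(2)] e
      by (smt (verit) mult_nonneg_nonneg)
    also have "\<dots> \<le> (real n + 1) * \<epsilon>" using n \<epsilon> by (simp add: field_simps)
    finally show "e * W y - e * W x \<le> (real n + 1) * \<epsilon>" .
  qed
  then obtain B where B0: "B \<ge> 0" and B: "\<And>g. g \<in> borel_measurable leb \<Longrightarrow>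
      variation (J i) (\<lambda>x. g x * ?\<phi> x) \<le> ennreal (\<rho> + \<epsilon>) * variation (J i) g + ennreal B * L1_norm g"
    by (elim exE conjE) blast
  define B' where "B' = B + 2 * \<rho> / measure leb (J i) + e"
  have main: "ennreal e * bv (push i g) \<le> ennreal (3 * \<rho> + \<epsilon>) * variation (J i) g + ennreal B' * L1_norm g"
    if g: "bv g < \<infinity>" for g
  proof -
    have gm: "g \<in> borel_measurable leb" and gi: "integrable leb g" using bv_measurable bv_integrable g by auto
    obtain V where V: "variation (J i) g = ennreal V" "0 \<le> V"
    proof -
      have "variation (J i) g < \<infinity>"
        using g by (intro le_less_trans[OF variation_mono[OF J_unit[of i], of g]]) (auto simp: bv_def less_top[symmetric])
      then show ?thesis using that by (metis ennreal_cases less_top infinity_ennreal_def)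
    qed
    obtain a where a: "L1_norm g = ennreal a" "0 \<le> a"
    proof -
      have "L1_norm g < \<infinity>" using g unfolding bv_def by (auto simp: less_top[symmetric])
      then show ?thesis using that by (metis ennreal_cases less_top infinity_ennreal_def)
    qed
    define S where "S = V + 1 / measure leb (J i) * a"
    have S0: "0 \<le> S" using V a by (simp add: S_def)
    have gS: "\<bar>g x\<bar> \<le> S" if "x \<in> J i" for x
    proof -
      have "ennreal \<bar>g x\<bar> \<le> ennreal V + ennreal (1 / measure leb (J i)) * ennreal a"
        using variation_sup_bound'[OF that J_sets gm pos] V a by simp
      also have "\<dots> = ennreal V + ennreal (1 / measure leb (J i) * a)"
        using a by (subst ennreal_mult) auto
      also have "\<dots> = ennreal S" using V a by (simp add: S_def ennreal_plus)
      finally show ?thesis using S0 by (subst (asm) ennreal_le_iff)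
    qed
    have "\<bar>g x\<bar> * \<bar>1 / deriv F x\<bar> \<le> S * (\<rho> / e)" if "x \<in> J i" for x
    proof (rule mult_mono)
      show "\<bar>1 / deriv F x\<bar> \<le> \<rho> / e" using weight_le_\<rho>[OF that] e by (simp add: e_def field_simps)
    qed (use gS[OF that] S0 in auto)
    then have "variation {0..1} (push i g) \<le> variation (J i) (\<lambda>x. g x * \<bar>1 / deriv F x\<bar>) + 2 * ennreal (S * (\<rho> / e))"
      by (rule variation_push)
    then have "ennreal e * variation {0..1} (push i g) \<le>
        ennreal e * (variation (J i) (\<lambda>x. g x * \<bar>1 / deriv F x\<bar>) + 2 * ennreal (S * (\<rho> / e)))"
      by (rule mult_left_mono) simp
    also have "\<dots> = variation (J i) (\<lambda>x. g x * ?\<phi> x) + ennreal (2 * S * \<rho>)"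
    proof -
      have "ennreal e * variation (J i) (\<lambda>x. g x * \<bar>1 / deriv F x\<bar>) = variation (J i) (\<lambda>x. e * (g x * \<bar>1 / deriv F x\<bar>))"
        using e by (simp only: variation_cmult abs_of_pos)
      also have "\<dots> = variation (J i) (\<lambda>x. g x * ?\<phi> x)" by (rule variation_cong) simp
      finally have 1: "ennreal e * variation (J i) (\<lambda>x. g x * \<bar>1 / deriv F x\<bar>) = variation (J i) (\<lambda>x. g x * ?\<phi> x)" .
      have "ennreal (2 * (S * (\<rho> / e))) = 2 * ennreal (S * (\<rho> / e))"
        using S0 \<rho> e by (subst ennreal_mult) auto
      then have "ennreal e * (2 * ennreal (S * (\<rho> / e))) = ennreal e * ennreal (2 * (S * (\<rho> / e)))"
        by simp
      also have "\<dots> = ennreal (2 * S * \<rho>)" using S0 \<rho> e by (subst ennreal_mult[symmetric]) auto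
      finally show ?thesis using 1 by (simp add: distrib_left)
    qed
    also have "\<dots> \<le> (ennreal (\<rho> + \<epsilon>) * ennreal V + ennreal B * ennreal a) + ennreal (2 * S * \<rho>)"
      using B[OF gm] V a by (intro add_mono) auto
    also have "\<dots> = ennreal ((\<rho> + \<epsilon>) * V + B * a + 2 * S * \<rho>)"
    proof -
      have n: "0 \<le> (\<rho> + \<epsilon>) * V" "0 \<le> B * a" "0 \<le> 2 * S * \<rho>" using \<rho> \<epsilon> V a B0 S0 by auto
      show ?thesis using \<rho> \<epsilon> V(2) B0 a(2) n
        by (simp add: ennreal_mult[symmetric] ennreal_plus[symmetric] del: ennreal_plus)
    qed
    finally have 1: "ennreal e * variation {0..1} (push i g) \<le> ennreal ((\<rho> + \<epsilon>) * V + B * a + 2 * S * \<rho>)" .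
    have "L1_norm (push i g) \<le> L1_norm g"
      unfolding L1_norm_push[OF gi] by (intro nn_integral_mono) (auto simp: indicator_def)
    then have 2: "ennreal e * L1_norm (push i g) \<le> ennreal (e * a)"
      using a e by (simp add: ennreal_mult mult_left_mono)
    have "ennreal e * bv (push i g) \<le> ennreal ((\<rho> + \<epsilon>) * V + B * a + 2 * S * \<rho>) + ennreal (e * a)"
      unfolding bv_def distrib_left by (intro add_mono 1 2)
    also have "\<dots> = ennreal (((\<rho> + \<epsilon>) * V + B * a + 2 * S * \<rho>) + e * a)"
      using \<rho> \<epsilon> V a B0 S0 e by (intro ennreal_plus[symmetric]) auto
    also have "((\<rho> + \<epsilon>) * V + B * a + 2 * S * \<rho>) + e * a = (3 * \<rho> + \<epsilon>) * V + B' * a"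
      by (simp add: S_def B'_def algebra_simps)
    also have "ennreal \<dots> = ennreal (3 * \<rho> + \<epsilon>) * variation (J i) g + ennreal B' * L1_norm g"
    proof -
      have n: "0 \<le> B'" using B0 \<rho> mp e by (simp add: B'_def)
      have p: "0 \<le> 3 * \<rho> + \<epsilon>" using \<rho> \<epsilon> by simp
      have q: "0 \<le> (3 * \<rho> + \<epsilon>) * V" "0 \<le> B' * a" using p n V a by auto
      show ?thesis unfolding V(1) a(1) 
        by (simp only: ennreal_plus[OF q] ennreal_mult[OF p V(2)] ennreal_mult[OF n a(2)])
    qed
    finally show ?thesis .
  qed
  moreover have "0 \<le> B'" using B0 \<rho> mp e by (simp add: B'_def)
  ultimately show ?thesis unfolding e_def by blast
qed

text \<open>Late branches are negligible by summability of \<open>N\<close>, and for the others the variations over disjoint \<open>J i\<close>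
  add up. A bound for \<open>\<rho>\<close> below \<open>1/3\<close> is needed because of the factor \<open>3 * \<rho>\<close> of a single branch.\<close>

lemma sum_push_lasota_yorke:
  assumes \<rho>: "0 \<le> \<rho>" "\<rho> \<le> 1 / 4"
  shows "\<exists>B\<ge>0. \<forall>g. bv g < \<infinity> \<longrightarrow>
     (\<Sum>i. ennreal (exp (\<theta> * real (t i))) * bv (push i g)) \<le> ennreal (7 / 8) * bv g + ennreal B * L1_norm g"
proof -
  have "\<forall>i. \<exists>B\<ge>0. \<forall>g. bv g < \<infinity> \<longrightarrow> ennreal (exp (\<theta> * real (t i))) * bv (push i g) \<le>
           ennreal (3 * \<rho> + 1/16) * variation (J i) g + ennreal B * L1_norm g"
    using bv_push_lasota_yorke[of "1/16"] \<rho>(1) by simp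
  from choice[OF this] obtain B where B0: "\<And>i. B i \<ge> 0" and B: "\<And>i g. bv g < \<infinity> \<Longrightarrow>
      ennreal (exp (\<theta> * real (t i))) * bv (push i g) \<le> ennreal (3 * \<rho> + 1/16) * variation (J i) g + ennreal (B i) * L1_norm g"
    by blast
  \<comment> \<open>With the factor 5 of a single branch, the branches from \<open>n\<close> on contribute less than \<open>1/16\<close>.\<close>
  obtain n where "norm (\<Sum>i. N (i + n)) < 1/80"
    using suminf_exist_split[OF _ N_summable, of "1/80"] by auto
  then have n: "(\<Sum>i. N (i + n)) < 1/80" using abs_ge_self[of "\<Sum>i. N (i + n)"] by simp
  have bound: "(\<Sum>i. ennreal (exp (\<theta> * real (t i))) * bv (push i g)) \<le>
      ennreal (7 / 8) * bv g + ennreal (\<Sum>i<n. B i) * L1_norm g" if g: "bv g < \<infinity>" for g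
  proof -
    let ?a = "\<lambda>i. ennreal (exp (\<theta> * real (t i))) * bv (push i g)"
    have "(\<Sum>i. ?a i) = (\<Sum>i. ?a (i + n)) + (\<Sum>i<n. ?a i)"
      by (rule suminf_offset) auto
    also have "(\<Sum>i. ?a (i + n)) \<le> (\<Sum>i. ennreal (5 * N (i + n)) * bv g)"
      by (intro suminf_le bv_push_le g) auto
    also have "\<dots> = ennreal (\<Sum>i. 5 * N (i + n)) * bv g"
    proof -
      have "summable (\<lambda>i. 5 * N (i + n))" using N_summable by (intro summable_mult summable_ignore_initial_segment)
      then show ?thesis using N_nonneg by (simp add: suminf_ennreal2)
    qed
    also have "\<dots> \<le> ennreal (1/16) * bv g"
    proof (intro mult_right_mono ennreal_leI)
      have "(\<Sum>i. 5 * N (i + n)) = 5 * (\<Sum>i. N (i + n))"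
        using N_summable by (intro suminf_mult summable_ignore_initial_segment)
      then show "(\<Sum>i. 5 * N (i + n)) \<le> 1/16" using n by simp
    qed simp
    also have "(\<Sum>i<n. ?a i) \<le> (\<Sum>i<n. ennreal (3 * \<rho> + 1/16) * variation (J i) g + ennreal (B i) * L1_norm g)"
      by (intro sum_mono B g)
    also have "\<dots> = ennreal (3 * \<rho> + 1/16) * (\<Sum>i<n. variation (J i) g) + ennreal (\<Sum>i<n. B i) * L1_norm g"
      using B0 by (simp add: sum.distrib sum_distrib_left sum_distrib_right sum_ennreal[symmetric] del: sum_ennreal)
    also have "\<dots> \<le> ennreal (13/16) * bv g + ennreal (\<Sum>i<n. B i) * L1_norm g"
    proof (intro add_mono mult_mono)
      have "(\<Sum>i<n. variation (J i) g) \<le> variation {0..1} g"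
        using J_interval J_unit J_disjoint
        by (intro variation_disjoint_intervals) (auto simp: disjoint_family_on_def)
      then show "(\<Sum>i<n. variation (J i) g) \<le> bv g" unfolding bv_def by (rule add_increasing2[rotated]) simp
      show "ennreal (3 * \<rho> + 1/16) \<le> ennreal (13/16)" using \<rho> by (intro ennreal_leI) simp
    qed auto
    finally have "(\<Sum>i. ?a i) \<le> ennreal (1/16) * bv g + (ennreal (13/16) * bv g + ennreal (\<Sum>i<n. B i) * L1_norm g)"
      by (simp add: add_mono)
    also have "\<dots> = (ennreal (1/16) + ennreal (13/16)) * bv g + ennreal (\<Sum>i<n. B i) * L1_norm g"
      by (simp only: distrib_right add.assoc)
    also have "ennreal (1/16) + ennreal (13/16) = ennreal (7/8)" by (subst ennreal_plus[symmetric]) auto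
    finally show ?thesis .
  qed
  have "0 \<le> (\<Sum>i<n. B i)" using B0 by (intro sum_nonneg) auto
  then show ?thesis using bound by blast
qed

end

section \<open>The renewal process of returns\<close>

lemma ennreal_suminf_swap:
  fixes a :: "nat \<Rightarrow> nat \<Rightarrow> ennreal"
  shows "(\<Sum>i. \<Sum>j. a i j) = (\<Sum>j. \<Sum>i. a i j)"
  using nn_integral_suminf[of "\<lambda>j i. a i j" "count_space UNIV"]
  by (simp add: nn_integral_count_space_nat)

lemma suminf_single_ennreal: "(\<Sum>s. if s = k then c else (0::ennreal)) = c"
  using suminf_finite[of "{k}" "\<lambda>s. if s = k then c else 0"] by simp

lemma L1_norm_suminf:
  assumes m: "\<And>i. u i \<in> borel_measurable leb" and s: "\<And>x. x \<in> {0..1} \<Longrightarrow> summable (\<lambda>i. \<bar>u i x\<bar>)"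
  shows "L1_norm (\<lambda>x. \<Sum>i. u i x) \<le> (\<Sum>i. L1_norm (u i))"
proof -
  have "L1_norm (\<lambda>x. \<Sum>i. u i x) \<le> (\<integral>\<^sup>+x. (\<Sum>i. ennreal \<bar>u i x\<bar>) \<partial>leb)"
  proof (rule nn_integral_mono)
    fix x assume "x \<in> space leb"
    then have sx: "summable (\<lambda>i. \<bar>u i x\<bar>)" using s by simp
    have "ennreal \<bar>\<Sum>i. u i x\<bar> \<le> ennreal (\<Sum>i. \<bar>u i x\<bar>)"
      using summable_rabs[OF sx] by (rule ennreal_leI)
    also have "\<dots> = (\<Sum>i. ennreal \<bar>u i x\<bar>)" by (rule suminf_ennreal2[symmetric]) (use sx in auto)
    finally show "ennreal \<bar>\<Sum>i. u i x\<bar> \<le> (\<Sum>i. ennreal \<bar>u i x\<bar>)" .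
  qed
  also have "\<dots> = (\<Sum>i. L1_norm (u i))" using m by (intro nn_integral_suminf) auto
  finally show ?thesis .
qed

text \<open>Bounded sets of functions of bounded variation are totally bounded in mean: rounded values on a grid take
  finitely many values, and determine such a function up to a small error in mean.\<close>

definition grid_code :: "nat \<Rightarrow> (real \<Rightarrow> real) \<Rightarrow> nat \<Rightarrow> int" where
  "grid_code K g = (\<lambda>k\<in>{..<K}. \<lfloor>g (real k / real K) * real K\<rfloor>)"

lemma grid_code_finite:
  "finite (grid_code K ` {g. \<forall>x\<in>{0..1}. \<bar>g x\<bar> \<le> b})"
proof (rule finite_subset)
  show "finite (PiE {..<K} (\<lambda>_. {- \<lceil>b * real K\<rceil> - 1..\<lceil>b * real K\<rceil>}))" by (intro finite_PiE) auto
  show "grid_code K ` {g. \<forall>x\<in>{0..1}. \<bar>g x\<bar> \<le> b} \<subseteq> PiE {..<K} (\<lambda>_. {- \<lceil>b * real K\<rceil> - 1..\<lceil>b * real K\<rceil>})"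
  proof clarify
    fix g :: "real \<Rightarrow> real" assume g: "\<forall>x\<in>{0..1}. \<bar>g x\<bar> \<le> b"
    have "- \<lceil>b * real K\<rceil> - 1 \<le> \<lfloor>g (real k / real K) * real K\<rfloor> \<and> \<lfloor>g (real k / real K) * real K\<rfloor> \<le> \<lceil>b * real K\<rceil>"
      if "k < K" for k
    proof -
      have "\<bar>g (real k / real K)\<bar> \<le> b" using g that by auto
      then have "\<bar>g (real k / real K) * real K\<bar> \<le> b * real K" by (simp add: abs_mult mult_right_mono)
      then show ?thesis by linarith
    qed
    then show "grid_code K g \<in> PiE {..<K} (\<lambda>_. {- \<lceil>b * real K\<rceil> - 1..\<lceil>b * real K\<rceil>})"
      by (auto simp: grid_code_def)
  qed
qed

lemma grid_code_close:
  assumes K: "K > 0" and eq: "grid_code K g = grid_code K g'"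
    and g: "variation {0..1} g \<le> ennreal b" and g': "variation {0..1} g' \<le> ennreal b" and b: "0 \<le> b"
  shows "L1_norm (\<lambda>x. g x - g' x) \<le> ennreal ((2 * b + 1) / real K)"
proof -
  obtain W where W: "controls W {0..1} g" "\<And>x. x \<in> {0..1} \<Longrightarrow> 0 \<le> W x \<and> W x \<le> b"
  proof -
    have fin: "variation {0..1} g < \<infinity>" using g by (auto intro: le_less_trans)
    have "enn2real (variation {0..1} g) \<le> b" using g b by (rule enn2real_leI[rotated])
    then show ?thesis using variation_controlE[OF fin] that by (metis order_trans)
  qed
  obtain W' where W': "controls W' {0..1} g'" "\<And>x. x \<in> {0..1} \<Longrightarrow> 0 \<le> W' x \<and> W' x \<le> b"
  proof -
    have fin: "variation {0..1} g' < \<infinity>" using g' by (auto intro: le_less_trans)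
    have "enn2real (variation {0..1} g') \<le> b" using g' b by (rule enn2real_leI[rotated])
    then show ?thesis using variation_controlE[OF fin] that by (metis order_trans)
  qed
  define p where "p = (\<lambda>k. real k / real K)"
  define c where "c = (\<lambda>k. (W (p (Suc k)) - W (p k)) + (W' (p (Suc k)) - W' (p k)) + 1 / real K)"
  have p01: "p k \<in> {0..1}" if "k \<le> K" for k using that K by (auto simp: p_def)
  have p_mono: "p k \<le> p (Suc k)" for k using K by (auto simp: p_def divide_right_mono)
  have monoW: "W x \<le> W y" "W' x \<le> W' y" if "x \<in> {0..1}" "y \<in> {0..1}" "x \<le> y" for x y
    using controlsD[OF W(1) that] controlsD[OF W'(1) that] by auto
  have c0: "0 \<le> c k" if "k < K" for k
    using monoW[OF p01 p01 p_mono, of k] that by (simp add: c_def)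
  have pt: "\<bar>g x - g' x\<bar> \<le> c k" if k: "k < K" and x: "x \<in> {p k..p (Suc k)}" for k x
  proof -
    have x01: "x \<in> {0..1}" using x p01[of k] p01[of "Suc k"] k by auto
    have "\<lfloor>g (p k) * real K\<rfloor> = \<lfloor>g' (p k) * real K\<rfloor>"
      using fun_cong[OF eq, of k] k by (simp add: grid_code_def p_def)
    then have "\<bar>g (p k) * real K - g' (p k) * real K\<bar> \<le> 1" by linarith
    then have "\<bar>g (p k) - g' (p k)\<bar> * real K \<le> 1" by (simp add: left_diff_distrib[symmetric] abs_mult)
    then have 1: "\<bar>g (p k) - g' (p k)\<bar> \<le> 1 / real K" using K by (simp add: field_simps)
    have "\<bar>g x - g (p k)\<bar> \<le> W x - W (p k)" "\<bar>g' x - g' (p k)\<bar> \<le> W' x - W' (p k)"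
      using x k x01 p01[of k] by (auto intro!: controlsD[OF W(1)] controlsD[OF W'(1)])
    moreover have "W x \<le> W (p (Suc k))" "W' x \<le> W' (p (Suc k))"
      using x k x01 p01[of "Suc k"] by (auto intro!: monoW)
    ultimately show ?thesis using 1 by (simp add: c_def)
  qed
  have "L1_norm (\<lambda>x. g x - g' x) \<le> (\<integral>\<^sup>+x. (\<Sum>k<K. ennreal (c k) * indicator {p k..p (Suc k)} x) \<partial>leb)"
  proof (rule nn_integral_mono)
    fix x assume "x \<in> space leb"
    then have x: "0 \<le> x" "x \<le> 1" by auto
    define k where "k = min (K - 1) (nat \<lfloor>x * real K\<rfloor>)"
    have kK: "k < K" using K by (simp add: k_def)
    have "x \<in> {p k..p (Suc k)}"
    proof (cases "x = 1")
      case True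
      then have "k = K - 1" using K by (simp add: k_def)
      then show ?thesis using K True by (auto simp: p_def field_simps)
    next
      case False
      then have "x * real K < real K" using x K by simp
      then have "\<lfloor>x * real K\<rfloor> < int K" by (simp add: floor_less_iff)
      then have "nat \<lfloor>x * real K\<rfloor> < K" using K by (simp add: nat_less_iff)
      then have k': "k = nat \<lfloor>x * real K\<rfloor>" by (simp add: k_def)
      have "real k \<le> x * real K" "x * real K \<le> real (Suc k)" using x K unfolding k' by (auto simp: le_nat_floor) linarith+
      then show ?thesis using K by (auto simp: p_def field_simps)
    qed
    then have "ennreal \<bar>g x - g' x\<bar> \<le> ennreal (c k) * indicator {p k..p (Suc k)} x"
      using pt[OF kK, of x] by (simp add: ennreal_leI)
    also have "\<dots> \<le> (\<Sum>k<K. ennreal (c k) * indicator {p k..p (Suc k)} x)"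
      using kK by (intro member_le_sum) auto
    finally show "ennreal \<bar>g x - g' x\<bar> \<le> (\<Sum>k<K. ennreal (c k) * indicator {p k..p (Suc k)} x)" .
  qed
  also have "\<dots> = (\<Sum>k<K. \<integral>\<^sup>+x. ennreal (c k) * indicator {p k..p (Suc k)} x \<partial>leb)"
  proof (rule nn_integral_sum)
    fix k assume "k \<in> {..<K}"
    then have "{p k..p (Suc k)} \<in> sets leb" using p01[of k] p01[of "Suc k"] by (auto simp: sets_leb_iff)
    then show "(\<lambda>x. ennreal (c k) * indicator {p k..p (Suc k)} x) \<in> borel_measurable leb" by simp
  qed
  also have "\<dots> = (\<Sum>k<K. ennreal (c k / real K))"
  proof (rule sum.cong[OF refl])
    fix k assume k: "k \<in> {..<K}"
    then have s: "{p k..p (Suc k)} \<in> sets leb" using p01[of k] p01[of "Suc k"] by (auto simp: sets_leb_iff)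
    have "emeasure leb {p k..p (Suc k)} = ennreal (1 / real K)"
      using s p_mono[of k] K by (subst emeasure_leb) (auto simp: p_def diff_divide_distrib[symmetric])
    then show "(\<integral>\<^sup>+x. ennreal (c k) * indicator {p k..p (Suc k)} x \<partial>leb) = ennreal (c k / real K)"
      using s c0[of k] k by (simp add: nn_integral_cmult_indicator flip: ennreal_mult)
  qed
  also have "\<dots> = ennreal (\<Sum>k<K. c k / real K)" using c0 by (intro sum_ennreal) auto
  also have "(\<Sum>k<K. c k / real K) = (\<Sum>k<K. c k) / real K" by (simp add: sum_divide_distrib)
  also have "(\<Sum>k<K. c k) = (W (p K) - W (p 0)) + (W' (p K) - W' (p 0)) + 1"
    using K sum_lessThan_telescope[of "\<lambda>k. W (p k)" K] sum_lessThan_telescope[of "\<lambda>k. W' (p k)" K]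
    by (simp add: c_def sum.distrib)
  also have "ennreal (\<dots> / real K) \<le> ennreal ((2 * b + 1) / real K)"
    using W(2)[OF p01, of K] W(2)[OF p01, of 0] W'(2)[OF p01, of K] W'(2)[OF p01, of 0]
    by (intro ennreal_leI divide_right_mono) auto
  finally show ?thesis .
qed

context branch_scheme
begin

definition collect :: "(nat \<Rightarrow> bool) \<Rightarrow> (nat \<Rightarrow> real \<Rightarrow> real) \<Rightarrow> real \<Rightarrow> real" where
  "collect c g y = (\<Sum>i. if c i then push i (g i) y else 0)"

definition transfer :: "nat \<Rightarrow> (real \<Rightarrow> real) \<Rightarrow> real \<Rightarrow> real" where
  "transfer s g = collect (\<lambda>i. t i = s) (\<lambda>_. g)"

definition strong_norm :: "(nat \<Rightarrow> real \<Rightarrow> real) \<Rightarrow> ennreal" where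
  "strong_norm G = (\<Sum>s. ennreal (exp (\<theta> * real s)) * bv (G s))"

definition weak_norm :: "(nat \<Rightarrow> real \<Rightarrow> real) \<Rightarrow> ennreal" where
  "weak_norm G = (\<Sum>s. L1_norm (G s))"

text \<open>A state describes mass in transit: \<open>G s\<close> is the density that arrives at the base after \<open>s\<close> more steps. The
  exponential weights in \<open>strong_norm\<close> make late arrivals negligible. Densities vanish where \<open>h\<close> does,
  since the branches and the mixing hypothesis control the set where \<open>h\<close> is nonzero only.\<close>

definition states :: "(nat \<Rightarrow> real \<Rightarrow> real) set" where
  "states = {G. strong_norm G < \<infinity> \<and> (\<forall>s. AE x in leb. h x = 0 \<longrightarrow> G s x = 0)}"

text \<open>In one unit of time all arrivals come one step nearer, and the mass at the base leaves along the branches.\<close>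

definition step :: "(nat \<Rightarrow> real \<Rightarrow> real) \<Rightarrow> nat \<Rightarrow> real \<Rightarrow> real" where
  "step G s y = G (Suc s) y + transfer (Suc s) (G 0) y"

text \<open>Mass that arrives after \<open>s \<le> n\<close> steps moves on under \<open>f\<close> for the remaining \<open>n - s\<close> steps and is then paired with
  \<open>w\<close>. Mass still in transit at time \<open>n\<close> is not seen.\<close>

definition observe :: "nat \<Rightarrow> (real \<Rightarrow> real) \<Rightarrow> (nat \<Rightarrow> real \<Rightarrow> real) \<Rightarrow> real" where
  "observe n w G = (\<Sum>s\<le>n. \<integral>x. G s x * w ((f ^^ (n - s)) x) \<partial>leb)"

lemma push_bound:
  assumes g: "\<And>x. x \<in> {0..1} \<Longrightarrow> \<bar>g x\<bar> \<le> b" and b: "0 \<le> b"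
  shows "exp (\<theta> * real (t i)) * \<bar>push i g y\<bar> \<le> N i * b"
proof -
  have "\<bar>push i g y\<bar> \<le> N i * b / exp (\<theta> * real (t i))"
  proof (rule push_sup)
    fix x assume x: "x \<in> J i"
    have "\<bar>g x\<bar> * (exp (\<theta> * real (t i)) * \<bar>1 / deriv F x\<bar>) \<le> b * N i"
      using g[of x] x J_unit[of i] weight_le_N[OF x] b by (intro mult_mono) auto
    then show "\<bar>g x\<bar> * \<bar>1 / deriv F x\<bar> \<le> N i * b / exp (\<theta> * real (t i))"
      by (simp add: field_simps)
  qed (use N_nonneg[of i] b in simp)
  then show ?thesis by (simp add: field_simps)
qed

lemma exp_t_ge_1: "1 \<le> exp (\<theta> * real (t i))" using \<theta>_pos by simp

lemma push_bound': 
  assumes g: "\<And>x. x \<in> {0..1} \<Longrightarrow> \<bar>g x\<bar> \<le> b" and b: "0 \<le> b"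
  shows "\<bar>push i g y\<bar> \<le> N i * b"
proof -
  have "1 * \<bar>push i g y\<bar> \<le> exp (\<theta> * real (t i)) * \<bar>push i g y\<bar>"
    using exp_t_ge_1[of i] by (intro mult_right_mono) auto
  then show ?thesis using push_bound[where g=g and b=b and i=i and y=y, OF g b] by simp
qed

lemma collect_summable:
  assumes g: "\<And>i x. x \<in> {0..1} \<Longrightarrow> \<bar>g i x\<bar> \<le> b" and b: "0 \<le> b"
  shows "summable (\<lambda>i. \<bar>if c i then push i (g i) y else 0\<bar>)"
proof (rule summable_comparison_test'[where N=0])
  show "summable (\<lambda>i. N i * b)" by (intro summable_mult2 N_summable)
  show "norm \<bar>if c n then push n (g n) y else 0\<bar> \<le> N n * b" for n
    using push_bound'[where g="g n" and i=n and y=y, OF g b] N_nonneg[of n] b by simp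
qed

lemma transfer_summable: "bv g < \<infinity> \<Longrightarrow> summable (\<lambda>i. \<bar>if t i = s then push i g y else 0\<bar>)"
  by (rule collect_summable[of "\<lambda>_. g" "enn2real (bv g)"]) (simp_all add: bv_bound)

lemma bv_push_finite: "bv g < \<infinity> \<Longrightarrow> bv (push i g) < \<infinity>"
proof -
  assume g: "bv g < \<infinity>"
  have "1 * bv (push i g) \<le> ennreal (exp (\<theta> * real (t i))) * bv (push i g)"
    using exp_t_ge_1[of i] by (intro mult_right_mono) (simp_all flip: ennreal_1)
  also have "\<dots> \<le> ennreal (5 * N i) * bv g" by (rule bv_push_le[OF g])
  also have "\<dots> < \<infinity>" using g by (simp add: ennreal_mult_less_top)
  finally show ?thesis by simp
qed

lemma push_measurable: "bv g < \<infinity> \<Longrightarrow> push i g \<in> borel_measurable leb"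
  by (intro bv_measurable bv_push_finite)

lemma if_measurable: "push i g \<in> borel_measurable leb \<Longrightarrow> (\<lambda>y. if c then push i g y else 0) \<in> borel_measurable leb"
  by (cases c) auto

lemma L1_norm_collect:
  assumes g: "\<And>i x. x \<in> {0..1} \<Longrightarrow> \<bar>g i x\<bar> \<le> b" and b: "0 \<le> b" and m: "\<And>i. push i (g i) \<in> borel_measurable leb"
  shows "L1_norm (collect c g) \<le> (\<Sum>i. if c i then L1_norm (push i (g i)) else 0)"
proof -
  have "L1_norm (collect c g) \<le> (\<Sum>i. L1_norm (\<lambda>y. if c i then push i (g i) y else 0))"
    unfolding collect_def by (intro L1_norm_suminf if_measurable m collect_summable[OF g b])
  also have "\<dots> = (\<Sum>i. if c i then L1_norm (push i (g i)) else 0)"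
    by (intro suminf_cong) auto
  finally show ?thesis .
qed

lemma bv_collect:
  assumes g: "\<And>i x. x \<in> {0..1} \<Longrightarrow> \<bar>g i x\<bar> \<le> b" and b: "0 \<le> b" and m: "\<And>i. push i (g i) \<in> borel_measurable leb"
  shows "bv (collect c g) \<le> (\<Sum>i. if c i then bv (push i (g i)) else 0)"
proof -
  have "variation {0..1} (collect c g) \<le> (\<Sum>i. variation {0..1} (\<lambda>y. if c i then push i (g i) y else 0))"
    unfolding collect_def
    by (intro variation_suminf summable_rabs_cancel[OF collect_summable[OF g b]])
  also have "\<dots> = (\<Sum>i. if c i then variation {0..1} (push i (g i)) else 0)"
    by (intro suminf_cong) auto
  finally have "bv (collect c g) \<le> (\<Sum>i. if c i then variation {0..1} (push i (g i)) else 0) +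
      (\<Sum>i. if c i then L1_norm (push i (g i)) else 0)"
    unfolding bv_def by (intro add_mono L1_norm_collect[OF g b m])
  also have "\<dots> = (\<Sum>i. (if c i then variation {0..1} (push i (g i)) else 0) + (if c i then L1_norm (push i (g i)) else 0))"
    by (rule suminf_add) auto
  also have "\<dots> = (\<Sum>i. if c i then bv (push i (g i)) else 0)"
    by (intro suminf_cong) (auto simp: bv_def)
  finally show ?thesis .
qed

lemma L1_norm_transfer: "bv g < \<infinity> \<Longrightarrow> L1_norm (transfer s g) \<le> (\<Sum>i. if t i = s then L1_norm (push i g) else 0)"
  unfolding transfer_def by (rule L1_norm_collect[of "\<lambda>_. g" "enn2real (bv g)"]) (simp_all add: bv_bound push_measurable)

lemma bv_transfer: "bv g < \<infinity> \<Longrightarrow> bv (transfer s g) \<le> (\<Sum>i. if t i = s then bv (push i g) else 0)"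
  unfolding transfer_def by (rule bv_collect[of "\<lambda>_. g" "enn2real (bv g)"]) (simp_all add: bv_bound push_measurable)

lemma sum_push_le:
  assumes g: "bv g < \<infinity>"
  shows "(\<Sum>i. ennreal (exp (\<theta> * real (t i))) * bv (push i g)) \<le> ennreal (5 * suminf N) * bv g"
proof -
  have "(\<Sum>i. ennreal (exp (\<theta> * real (t i))) * bv (push i g)) \<le> (\<Sum>i. ennreal (5 * N i) * bv g)"
    by (intro suminf_le bv_push_le g) auto
  also have "\<dots> = ennreal (\<Sum>i. 5 * N i) * bv g"
    using N_nonneg summable_mult[OF N_summable, of 5] by (simp add: suminf_ennreal2)
  also have "(\<Sum>i. 5 * N i) = 5 * suminf N" by (rule suminf_mult[OF N_summable])
  finally show ?thesis .
qed

lemma bv_transfer_finite: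
  assumes g: "bv g < \<infinity>" shows "bv (transfer s g) < \<infinity>"
proof -
  have "bv (transfer s g) \<le> (\<Sum>i. ennreal (exp (\<theta> * real (t i))) * bv (push i g))"
  proof (rule order_trans[OF bv_transfer[OF g]], intro suminf_le)
    fix i
    have "1 * bv (push i g) \<le> ennreal (exp (\<theta> * real (t i))) * bv (push i g)"
      using exp_t_ge_1[of i] by (intro mult_right_mono) (simp_all flip: ennreal_1)
    then show "(if t i = s then bv (push i g) else 0) \<le> ennreal (exp (\<theta> * real (t i))) * bv (push i g)" by auto
  qed auto
  also have "\<dots> \<le> ennreal (5 * suminf N) * bv g" by (rule sum_push_le[OF g])
  also have "\<dots> < \<infinity>" using g by (simp add: ennreal_mult_less_top)
  finally show ?thesis .
qed

text \<open>Branch \<open>i\<close> contributes to the summand \<open>s = t i - 1\<close> only.\<close>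

lemma sum_over_times:
  "(\<Sum>s. ennreal (exp (\<theta> * real s)) * (\<Sum>i. if t i = Suc s then a i else 0)) \<le>
     (\<Sum>i. ennreal (exp (\<theta> * real (t i))) * a i)"
proof -
  have "(\<Sum>s. ennreal (exp (\<theta> * real s)) * (\<Sum>i. if t i = Suc s then a i else 0)) =
      (\<Sum>s. \<Sum>i. if s = t i - 1 then ennreal (exp (\<theta> * real (t i - 1))) * a i else 0)"
  proof (intro suminf_cong, subst ennreal_suminf_cmult[symmetric], intro suminf_cong)
    fix s i
    have "t i = Suc s \<longleftrightarrow> s = t i - 1" using t_pos[of i] by auto
    then show "ennreal (exp (\<theta> * real s)) * (if t i = Suc s then a i else 0) =
      (if s = t i - 1 then ennreal (exp (\<theta> * real (t i - 1))) * a i else 0)" by auto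
  qed
  also have "\<dots> = (\<Sum>i. ennreal (exp (\<theta> * real (t i - 1))) * a i)"
    by (subst ennreal_suminf_swap) (simp add: suminf_single_ennreal)
  also have "\<dots> \<le> (\<Sum>i. ennreal (exp (\<theta> * real (t i))) * a i)"
    using \<theta>_pos by (intro suminf_le mult_right_mono ennreal_leI) auto
  finally show ?thesis .
qed

lemma sum_over_times':
  "(\<Sum>s. \<Sum>i. if t i = Suc s then a i else 0) = (\<Sum>i. a i :: ennreal)"
proof -
  have "(\<Sum>s. \<Sum>i. if t i = Suc s then a i else 0) = (\<Sum>s. \<Sum>i. if s = t i - 1 then a i else 0)"
  proof (intro suminf_cong)
    fix s i
    have "t i = Suc s \<longleftrightarrow> s = t i - 1" using t_pos[of i] by auto
    then show "(if t i = Suc s then a i else 0) = (if s = t i - 1 then a i else 0)" by auto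
  qed
  also have "\<dots> = (\<Sum>i. a i)"
    by (subst ennreal_suminf_swap) (simp add: suminf_single_ennreal)
  finally show ?thesis .
qed

lemma sum_L1_norm_push_le:
  assumes g: "integrable leb g"
  shows "(\<Sum>i. L1_norm (push i g)) \<le> L1_norm g"
proof -
  have "(\<Sum>i. L1_norm (push i g)) = (\<integral>\<^sup>+x. (\<Sum>i. ennreal \<bar>g x\<bar> * indicator (J i) x) \<partial>leb)"
    using g J_sets by (subst nn_integral_suminf) (auto simp: L1_norm_push[OF g])
  also have "\<dots> \<le> L1_norm g"
  proof (rule nn_integral_mono)
    fix x
    have "(\<Sum>i. ennreal \<bar>g x\<bar> * indicator (J i) x) = ennreal \<bar>g x\<bar> * (\<Sum>i. indicator (J i) x)"
      by (rule ennreal_suminf_cmult)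
    also have "(\<Sum>i. indicator (J i) x :: ennreal) = indicator (\<Union>i. J i) x"
      using J_disjoint by (rule suminf_indicator)
    also have "ennreal \<bar>g x\<bar> * indicator (\<Union>i. J i) x \<le> ennreal \<bar>g x\<bar>" by (simp add: indicator_def)
    finally show "(\<Sum>i. ennreal \<bar>g x\<bar> * indicator (J i) x) \<le> ennreal \<bar>g x\<bar>" .
  qed
  finally show ?thesis .
qed

lemma statesD:
  assumes G: "G \<in> states"
  shows "strong_norm G < \<infinity>" and "bv (G s) < \<infinity>" and "AE x in leb. h x = 0 \<longrightarrow> G s x = 0"
    and "G s \<in> borel_measurable leb" and "integrable leb (G s)"
    and "ennreal (exp (\<theta> * real s)) * bv (G s) \<le> strong_norm G" and "bv (G s) \<le> strong_norm G"
proof -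
  show n: "strong_norm G < \<infinity>" and "AE x in leb. h x = 0 \<longrightarrow> G s x = 0" using G by (auto simp: states_def)
  show le: "ennreal (exp (\<theta> * real s)) * bv (G s) \<le> strong_norm G"
    unfolding strong_norm_def using sum_le_suminf[of "\<lambda>s. ennreal (exp (\<theta> * real s)) * bv (G s)" "{s}"] by simp
  have "1 * bv (G s) \<le> ennreal (exp (\<theta> * real s)) * bv (G s)"
    using \<theta>_pos by (intro mult_right_mono) (simp_all flip: ennreal_1)
  then show le': "bv (G s) \<le> strong_norm G" using le by simp
  then show b: "bv (G s) < \<infinity>" using n by (rule le_less_trans)
  show "G s \<in> borel_measurable leb" "integrable leb (G s)" using bv_measurable[OF b] bv_integrable[OF b] .
qed

lemma weak_norm_le_strong_norm: "weak_norm G \<le> strong_norm G"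
  unfolding weak_norm_def strong_norm_def
proof (intro suminf_le)
  fix s
  have "L1_norm (G s) \<le> bv (G s)" by (simp add: bv_def)
  also have "1 * bv (G s) \<le> ennreal (exp (\<theta> * real s)) * bv (G s)"
    using \<theta>_pos by (intro mult_right_mono) (simp_all flip: ennreal_1)
  finally show "L1_norm (G s) \<le> ennreal (exp (\<theta> * real s)) * bv (G s)" by simp
qed auto

text \<open>Waiting mass gains the factor \<open>exp (- \<theta>)\<close> from the weights by coming nearer; for the departing mass this
  is the Lasota--Yorke inequality.\<close>

lemma strong_norm_step:
  assumes G: "G \<in> states" and \<rho>: "0 \<le> \<rho>" "\<rho> \<le> 1/4"
    and B: "\<And>g. bv g < \<infinity> \<Longrightarrow>
      (\<Sum>i. ennreal (exp (\<theta> * real (t i))) * bv (push i g)) \<le> ennreal (7 / 8) * bv g + ennreal B * L1_norm g"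
  shows "strong_norm (step G) \<le> ennreal (max (exp (- \<theta>)) (7/8)) * strong_norm G + ennreal B * weak_norm G"
proof -
  note D = statesD[OF G]
  let ?r = "max (exp (- \<theta>)) (7/8)"
  let ?e = "\<lambda>s. ennreal (exp (\<theta> * real s))"
  have tb: "bv (transfer (Suc s) (G 0)) < \<infinity>" for s by (rule bv_transfer_finite[OF D(2)])
  have "strong_norm (step G) \<le> (\<Sum>s. ?e s * bv (G (Suc s)) + ?e s * bv (transfer (Suc s) (G 0)))"
    unfolding strong_norm_def step_def distrib_left[symmetric]
    by (intro suminf_le mult_left_mono bv_add D bv_measurable[OF tb]) auto
  also have "\<dots> = (\<Sum>s. ?e s * bv (G (Suc s))) + (\<Sum>s. ?e s * bv (transfer (Suc s) (G 0)))"
    by (rule suminf_add[symmetric]) auto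
  also have "(\<Sum>s. ?e s * bv (transfer (Suc s) (G 0))) \<le> (\<Sum>s. ?e s * (\<Sum>i. if t i = Suc s then bv (push i (G 0)) else 0))"
    by (intro suminf_le mult_left_mono bv_transfer D) auto
  also have "\<dots> \<le> (\<Sum>i. ?e (t i) * bv (push i (G 0)))" by (rule sum_over_times)
  also have "\<dots> \<le> ennreal (7/8) * bv (G 0) + ennreal B * L1_norm (G 0)" by (rule B[OF D(2)])
  also have "\<dots> \<le> ennreal ?r * bv (G 0) + ennreal B * weak_norm G"
  proof (intro add_mono mult_mono)
    show "L1_norm (G 0) \<le> weak_norm G" unfolding weak_norm_def using sum_le_suminf[of "\<lambda>s. L1_norm (G s)" "{0}"] by simp
  qed (auto intro!: ennreal_leI)
  also have "(\<Sum>s. ?e s * bv (G (Suc s))) \<le> (\<Sum>s. ennreal ?r * (?e (Suc s) * bv (G (Suc s))))"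
  proof (intro suminf_le)
    fix s
    have "?e s = ennreal (exp (- \<theta>)) * ?e (Suc s)"
      by (subst ennreal_mult[symmetric]) (auto simp: exp_add[symmetric] algebra_simps)
    also have "\<dots> \<le> ennreal ?r * ?e (Suc s)" by (intro mult_right_mono ennreal_leI) auto
    finally show "?e s * bv (G (Suc s)) \<le> ennreal ?r * (?e (Suc s) * bv (G (Suc s)))"
      unfolding mult.assoc[symmetric] by (rule mult_right_mono) simp
  qed auto
  also have "(\<Sum>s. ennreal ?r * (?e (Suc s) * bv (G (Suc s)))) + (ennreal ?r * bv (G 0) + ennreal B * weak_norm G)
      = ennreal ?r * strong_norm G + ennreal B * weak_norm G"
  proof -
    have "strong_norm G = (\<Sum>s. ?e (s + 1) * bv (G (s + 1))) + (\<Sum>s<1. ?e s * bv (G s))"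
      unfolding strong_norm_def by (rule suminf_offset) auto
    then have "strong_norm G = (\<Sum>s. ?e (Suc s) * bv (G (Suc s))) + bv (G 0)" by simp
    then show ?thesis by (simp add: distrib_left add.assoc)
  qed
  finally show ?thesis by (simp add: add_mono)
qed

lemma weak_norm_step:
  assumes G: "G \<in> states" shows "weak_norm (step G) \<le> weak_norm G"
proof -
  note D = statesD[OF G]
  have "weak_norm (step G) \<le> (\<Sum>s. L1_norm (G (Suc s)) + L1_norm (transfer (Suc s) (G 0)))"
    unfolding weak_norm_def step_def
  proof (intro suminf_le)
    fix s
    have m: "transfer (Suc s) (G 0) \<in> borel_measurable leb" by (rule bv_measurable[OF bv_transfer_finite[OF D(2)]])
    have "L1_norm (\<lambda>x. G (Suc s) x + transfer (Suc s) (G 0) x) \<le> (\<integral>\<^sup>+x. ennreal \<bar>G (Suc s) x\<bar> + ennreal \<bar>transfer (Suc s) (G 0) x\<bar> \<partial>leb)"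
      by (intro nn_integral_mono) (simp flip: ennreal_plus)
    also have "\<dots> = L1_norm (G (Suc s)) + L1_norm (transfer (Suc s) (G 0))"
      using D(4) m by (intro nn_integral_add) auto
    finally show "L1_norm (\<lambda>x. G (Suc s) x + transfer (Suc s) (G 0) x) \<le> L1_norm (G (Suc s)) + L1_norm (transfer (Suc s) (G 0))" .
  qed auto
  also have "\<dots> = (\<Sum>s. L1_norm (G (Suc s))) + (\<Sum>s. L1_norm (transfer (Suc s) (G 0)))"
    by (rule suminf_add[symmetric]) auto
  also have "(\<Sum>s. L1_norm (transfer (Suc s) (G 0))) \<le> (\<Sum>s. \<Sum>i. if t i = Suc s then L1_norm (push i (G 0)) else 0)"
    by (intro suminf_le L1_norm_transfer D) auto
  also have "\<dots> = (\<Sum>i. L1_norm (push i (G 0)))" by (rule sum_over_times')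
  also have "\<dots> \<le> L1_norm (G 0)" by (rule sum_L1_norm_push_le[OF D(5)])
  also have "(\<Sum>s. L1_norm (G (Suc s))) + L1_norm (G 0) = weak_norm G"
    unfolding weak_norm_def using suminf_offset[of "\<lambda>s. L1_norm (G s)" 1] by simp
  finally show ?thesis by (simp add: add_mono)
qed

text \<open>By the change of variables, the transported mass on \<open>{y. h y = 0}\<close> is the mass that \<open>F\<close> sends there,
  which is zero as \<open>F\<close> preserves \<open>{x. h x \<noteq> 0}\<close> up to null sets.\<close>

lemma collect_vanishes:
  assumes gint: "\<And>i. integrable leb (g i)" and gh: "\<And>i. AE x in leb. h x = 0 \<longrightarrow> g i x = 0"
  shows "AE y in leb. h y = 0 \<longrightarrow> collect c g y = 0"
proof -
  define A where "A = {x \<in> space leb. h x = 0}"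
  have A: "A \<in> sets leb" unfolding A_def using h_measurable by measurable
  have "AE x in leb. x \<in> A \<longrightarrow> h x = 0" by (auto simp: A_def)
  from F_nonsingular[OF A this] have FA: "AE x in leb. h x \<noteq> 0 \<longrightarrow> F x \<notin> A" .
  have "AE y in leb. y \<in> A \<longrightarrow> push i (g i) y = 0" for i
  proof -
    have gi: "integrable leb (\<lambda>x. \<bar>g i x\<bar>)" using gint by simp
    have iA: "(indicator A :: real \<Rightarrow> real) \<in> borel_measurable leb" using A by simp
    note p = push_integral[OF gi iA, of 1 i]
    have "(\<integral>y. push i (\<lambda>x. \<bar>g i x\<bar>) y * indicator A y \<partial>leb) = (\<integral>x. indicator (J i) x * (\<bar>g i x\<bar> * indicator A (F x)) \<partial>leb)"
      by (rule p(2)) (simp add: indicator_def)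
    also have "\<dots> = 0"
    proof -
      have "AE x in leb. indicator (J i) x * (\<bar>g i x\<bar> * indicator A (F x)) = (0::real)"
        using FA gh[of i] by eventually_elim (auto simp: indicator_def)
      then show ?thesis by (rule integral_eq_zero_AE)
    qed
    finally have z: "(\<integral>y. \<bar>push i (g i) y\<bar> * indicator A y \<partial>leb) = 0" by (simp add: push_abs)
    have "integrable leb (\<lambda>y. \<bar>push i (g i) y\<bar> * indicator A y)"
      using p(1) by (simp add: push_abs indicator_def)
    then have "AE y in leb. \<bar>push i (g i) y\<bar> * indicator A y = 0"
      using z by (subst (asm) integral_nonneg_eq_0_iff_AE) auto
    then show ?thesis by eventually_elim (auto simp: indicator_def)
  qed
  then have "AE y in leb. \<forall>i. y \<in> A \<longrightarrow> push i (g i) y = 0" by (subst AE_all_countable) auto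
  moreover have "AE y in leb. y \<in> space leb" by (rule AE_space)
  ultimately show ?thesis
  proof eventually_elim
    case (elim y)
    show ?case
    proof
      assume "h y = 0"
      then have "push i (g i) y = 0" for i using elim by (auto simp: A_def)
      then have "(\<lambda>i. if c i then push i (g i) y else 0) = (\<lambda>_. 0)" by auto
      then show "collect c g y = 0" by (simp add: collect_def)
    qed
  qed
qed

lemma transfer_vanishes:
  "bv g < \<infinity> \<Longrightarrow> AE x in leb. h x = 0 \<longrightarrow> g x = 0 \<Longrightarrow> AE y in leb. h y = 0 \<longrightarrow> transfer s g y = 0"
  unfolding transfer_def by (intro collect_vanishes bv_integrable)

lemma step_states:
  assumes G: "G \<in> states" shows "step G \<in> states"
  unfolding states_def
proof (intro CollectI conjI allI)
  note D = statesD[OF G]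
  let ?e = "\<lambda>s. ennreal (exp (\<theta> * real s))"
  have "strong_norm (step G) \<le> (\<Sum>s. ?e s * bv (G (Suc s)) + ?e s * bv (transfer (Suc s) (G 0)))"
    unfolding strong_norm_def step_def distrib_left[symmetric]
    by (intro suminf_le mult_left_mono bv_add D bv_measurable[OF bv_transfer_finite[OF D(2)]]) auto
  also have "\<dots> = (\<Sum>s. ?e s * bv (G (Suc s))) + (\<Sum>s. ?e s * bv (transfer (Suc s) (G 0)))"
    by (rule suminf_add[symmetric]) auto
  also have "(\<Sum>s. ?e s * bv (transfer (Suc s) (G 0))) \<le> (\<Sum>s. ?e s * (\<Sum>i. if t i = Suc s then bv (push i (G 0)) else 0))"
    by (intro suminf_le mult_left_mono bv_transfer D) auto
  also have "\<dots> \<le> (\<Sum>i. ?e (t i) * bv (push i (G 0)))" by (rule sum_over_times)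
  also have "\<dots> \<le> ennreal (5 * suminf N) * bv (G 0)" by (rule sum_push_le[OF D(2)])
  also have "(\<Sum>s. ?e s * bv (G (Suc s))) \<le> (\<Sum>s. ?e (Suc s) * bv (G (Suc s)))"
    using \<theta>_pos by (intro suminf_le mult_right_mono ennreal_leI) auto
  also have "\<dots> \<le> strong_norm G"
    unfolding strong_norm_def using suminf_offset[of "\<lambda>s. ?e s * bv (G s)" 1] by simp
  finally have "strong_norm (step G) \<le> strong_norm G + ennreal (5 * suminf N) * bv (G 0)" by (simp add: add_mono)
  also have "\<dots> < \<infinity>" using D(1) D(2)[of 0] by (simp add: ennreal_mult_less_top)
  finally show "strong_norm (step G) < \<infinity>" .
  fix s
  show "AE x in leb. h x = 0 \<longrightarrow> step G s x = 0"
    using D(3)[of "Suc s"] transfer_vanishes[OF D(2,3), of "Suc s" 0]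
    by eventually_elim (auto simp: step_def)
qed

lemma transfer_diff:
  assumes "bv u < \<infinity>" "bv v < \<infinity>"
  shows "transfer s (\<lambda>x. u x - v x) y = transfer s u y - transfer s v y"
  unfolding transfer_def collect_def
  by (subst suminf_diff[OF summable_rabs_cancel[OF transfer_summable[OF assms(1)]]
        summable_rabs_cancel[OF transfer_summable[OF assms(2)]]])
    (auto simp: push_diff intro!: suminf_cong)

lemma bv_diff:
  assumes "u \<in> borel_measurable leb" "v \<in> borel_measurable leb"
  shows "bv (\<lambda>x. u x - v x) \<le> bv u + bv v"
  using bv_add[of u "\<lambda>x. (-1) * v x"] bv_cmult[of v "-1"] assms by simp

lemma strong_norm_diff:
  assumes "G \<in> states" "H \<in> states"
  shows "strong_norm (\<lambda>s x. G s x - H s x) \<le> strong_norm G + strong_norm H"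
proof -
  have "strong_norm (\<lambda>s x. G s x - H s x) \<le> (\<Sum>s. ennreal (exp (\<theta> * real s)) * bv (G s) + ennreal (exp (\<theta> * real s)) * bv (H s))"
    unfolding strong_norm_def distrib_left[symmetric]
    by (intro suminf_le mult_left_mono bv_diff statesD assms) auto
  also have "\<dots> = strong_norm G + strong_norm H" unfolding strong_norm_def by (rule suminf_add[symmetric]) auto
  finally show ?thesis .
qed

lemma diff_states:
  assumes "G \<in> states" "H \<in> states" shows "(\<lambda>s x. G s x - H s x) \<in> states"
  unfolding states_def
proof (intro CollectI conjI allI)
  show "strong_norm (\<lambda>s x. G s x - H s x) < \<infinity>"
    using strong_norm_diff[OF assms] statesD(1)[OF assms(1)] statesD(1)[OF assms(2)]
    by (auto intro: le_less_trans)
  show "AE x in leb. h x = 0 \<longrightarrow> G s x - H s x = 0" for s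
    using statesD(3)[OF assms(1), of s] statesD(3)[OF assms(2), of s] by eventually_elim auto
qed

lemma strong_norm_scale:
  assumes "G \<in> states" shows "strong_norm (\<lambda>s x. c * G s x) = ennreal \<bar>c\<bar> * strong_norm G"
  unfolding strong_norm_def
  by (subst ennreal_suminf_cmult[symmetric], intro suminf_cong)
    (simp add: bv_cmult[OF statesD(4)[OF assms]] mult.left_commute)

lemma scale_states:
  assumes "G \<in> states" shows "(\<lambda>s x. c * G s x) \<in> states"
  unfolding states_def
proof (intro CollectI conjI allI)
  show "strong_norm (\<lambda>s x. c * G s x) < \<infinity>"
    using strong_norm_scale[OF assms, of c] statesD(1)[OF assms] by (simp add: ennreal_mult_less_top)
  show "AE x in leb. h x = 0 \<longrightarrow> c * G s x = 0" for s
    using statesD(3)[OF assms, of s] by eventually_elim auto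
qed

lemma step_diff:
  assumes "G \<in> states" "H \<in> states"
  shows "step (\<lambda>s x. G s x - H s x) = (\<lambda>s x. step G s x - step H s x)"
  using transfer_diff[OF statesD(2)[OF assms(1)] statesD(2)[OF assms(2)]]
  by (simp add: step_def fun_eq_iff)

lemma weak_norm_triangle:
  assumes "G \<in> states" "H \<in> states" "Z \<in> states"
  shows "weak_norm (\<lambda>s x. G s x - H s x) \<le> weak_norm (\<lambda>s x. G s x - Z s x) + weak_norm (\<lambda>s x. H s x - Z s x)"
proof -
  have "L1_norm (\<lambda>x. G s x - H s x) \<le> L1_norm (\<lambda>x. G s x - Z s x) + L1_norm (\<lambda>x. H s x - Z s x)" for s
  proof -
    have "L1_norm (\<lambda>x. G s x - H s x) \<le> (\<integral>\<^sup>+x. ennreal \<bar>G s x - Z s x\<bar> + ennreal \<bar>H s x - Z s x\<bar> \<partial>leb)"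
      by (intro nn_integral_mono) (simp flip: ennreal_plus)
    also have "\<dots> = L1_norm (\<lambda>x. G s x - Z s x) + L1_norm (\<lambda>x. H s x - Z s x)"
      using statesD(4)[OF assms(1), of s] statesD(4)[OF assms(2), of s] statesD(4)[OF assms(3), of s]
      by (intro nn_integral_add) auto
    finally show ?thesis .
  qed
  then have "weak_norm (\<lambda>s x. G s x - H s x) \<le> (\<Sum>s. L1_norm (\<lambda>x. G s x - Z s x) + L1_norm (\<lambda>x. H s x - Z s x))"
    unfolding weak_norm_def by (intro suminf_le) auto
  also have "\<dots> = weak_norm (\<lambda>s x. G s x - Z s x) + weak_norm (\<lambda>s x. H s x - Z s x)"
    unfolding weak_norm_def by (rule suminf_add[symmetric]) auto
  finally show ?thesis .
qed

text \<open>The exponential weights leave little mass to arrive after a late time \<open>S\<close>, and the densities arriving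
  before are distinguished by their grid codes.\<close>

lemma states_net:
  assumes R: "R > 0" and e: "e > 0"
  shows "\<exists>U. finite U \<and> U \<subseteq> {G\<in>states. strong_norm G \<le> ennreal R} \<and>
     (\<forall>G\<in>states. strong_norm G \<le> ennreal R \<longrightarrow> (\<exists>H\<in>U. weak_norm (\<lambda>s x. G s x - H s x) \<le> ennreal e))"
proof -
  let ?Ball = "{G\<in>states. strong_norm G \<le> ennreal R}"
  have "(\<lambda>S. exp (- \<theta>) ^ S) \<longlonglongrightarrow> 0" using \<theta>_pos by (intro LIMSEQ_power_zero) auto
  then have "eventually (\<lambda>S. exp (- \<theta>) ^ S < e / (4 * R)) sequentially"
    using R e by (intro order_tendstoD) auto
  then obtain S where "exp (- \<theta>) ^ S < e / (4 * R)" by (auto simp: eventually_sequentially)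
  then have S: "exp (- \<theta> * real S) * (2 * R) \<le> e / 2"
    using R by (simp add: exp_of_nat_mult[symmetric] mult.commute field_simps)
  obtain K :: nat where "real S * (2 * R + 1) / (e / 2) < real K" using reals_Archimedean2 by blast
  then have K: "real S * ((2 * R + 1) / real (Suc K)) \<le> e / 2"
    using e by (simp add: field_simps)
  let ?c = "\<lambda>G. (\<lambda>s\<in>{..<S}. grid_code (Suc K) (G s))"
  have GR: "bv (G s) \<le> ennreal R" if "G \<in> ?Ball" for G s
    using statesD(7)[of G s] that by (auto intro: order_trans)
  have "finite (?c ` ?Ball)"
  proof (rule finite_subset)
    show "finite (PiE {..<S} (\<lambda>_. grid_code (Suc K) ` {g. \<forall>x\<in>{0..1}. \<bar>g x\<bar> \<le> R}))"
      by (intro finite_PiE grid_code_finite) auto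
    show "?c ` ?Ball \<subseteq> PiE {..<S} (\<lambda>_. grid_code (Suc K) ` {g. \<forall>x\<in>{0..1}. \<bar>g x\<bar> \<le> R})"
    proof clarify
      fix G assume G: "G \<in> states" "strong_norm G \<le> ennreal R"
      have "\<bar>G s x\<bar> \<le> R" if x: "x \<in> {0..1}" for s x
      proof -
        have "ennreal \<bar>G s x\<bar> \<le> ennreal R"
          using bv_sup[OF statesD(4)[OF G(1)] x, of s] GR[of G s] G by (auto intro: order_trans)
        then show ?thesis using R by (subst (asm) ennreal_le_iff) auto
      qed
      then show "?c G \<in> PiE {..<S} (\<lambda>_. grid_code (Suc K) ` {g. \<forall>x\<in>{0..1}. \<bar>g x\<bar> \<le> R})" by auto
    qed
  qed
  from finite_subset_image[OF this order_refl]
  obtain U where U: "U \<subseteq> ?Ball" "finite U" "?c ` ?Ball = ?c ` U" by (elim exE conjE)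
  have "\<exists>H\<in>U. weak_norm (\<lambda>s x. G s x - H s x) \<le> ennreal e" if G: "G \<in> states" "strong_norm G \<le> ennreal R" for G
  proof -
    have "?c G \<in> ?c ` U" using U(3) G by blast
    then obtain H where H: "H \<in> U" "?c G = ?c H" by auto
    have HB: "H \<in> states" "strong_norm H \<le> ennreal R" using H U(1) by auto
    let ?D = "\<lambda>s x. G s x - H s x"
    have D: "?D \<in> states" by (rule diff_states[OF G(1) HB(1)])
    have nD: "strong_norm ?D \<le> ennreal (2 * R)"
    proof -
      have "strong_norm ?D \<le> ennreal R + ennreal R" using strong_norm_diff[OF G(1) HB(1)] G HB by (meson add_mono order_trans)
      then show ?thesis using R by (simp flip: ennreal_plus)
    qed
    have low: "L1_norm (?D s) \<le> ennreal ((2 * R + 1) / real (Suc K))" if "s < S" for s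
    proof (rule grid_code_close)
      show "grid_code (Suc K) (G s) = grid_code (Suc K) (H s)" using fun_cong[OF H(2), of s] that by simp
      show "variation {0..1} (G s) \<le> ennreal R"
        by (rule order_trans[OF _ GR[of G s]]) (use G in \<open>auto simp: bv_def\<close>)
      show "variation {0..1} (H s) \<le> ennreal R"
        by (rule order_trans[OF _ GR[of H s]]) (use HB in \<open>auto simp: bv_def\<close>)
    qed (use R in auto)
    have high: "L1_norm (?D (s + S)) \<le> ennreal (exp (- \<theta> * real S)) * (ennreal (exp (\<theta> * real (s + S))) * bv (?D (s + S)))" for s
    proof -
      have "L1_norm (?D (s + S)) \<le> 1 * bv (?D (s + S))" by (simp add: bv_def)
      also have "1 \<le> ennreal (exp (- \<theta> * real S)) * ennreal (exp (\<theta> * real (s + S)))"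
        using \<theta>_pos by (subst ennreal_mult[symmetric]) (auto simp: exp_add[symmetric] algebra_simps simp flip: ennreal_1)
      finally show ?thesis by (simp add: mult.assoc mult_right_mono)
    qed
    have "weak_norm ?D = (\<Sum>s. L1_norm (?D (s + S))) + (\<Sum>s<S. L1_norm (?D s))"
      unfolding weak_norm_def by (rule suminf_offset) auto
    also have "\<dots> \<le> (\<Sum>s. ennreal (exp (- \<theta> * real S)) * (ennreal (exp (\<theta> * real (s + S))) * bv (?D (s + S))))
        + (\<Sum>s<S. ennreal ((2 * R + 1) / real (Suc K)))"
      by (intro add_mono suminf_le sum_mono high low) auto
    also have "(\<Sum>s. ennreal (exp (- \<theta> * real S)) * (ennreal (exp (\<theta> * real (s + S))) * bv (?D (s + S))))
        = ennreal (exp (- \<theta> * real S)) * (\<Sum>s. ennreal (exp (\<theta> * real (s + S))) * bv (?D (s + S)))"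
      by (rule ennreal_suminf_cmult)
    also have "(\<Sum>s. ennreal (exp (\<theta> * real (s + S))) * bv (?D (s + S))) \<le> strong_norm ?D"
      unfolding strong_norm_def using suminf_offset[of "\<lambda>s. ennreal (exp (\<theta> * real s)) * bv (?D s)" S] by simp
    also have "ennreal (exp (- \<theta> * real S)) * strong_norm ?D \<le> ennreal (exp (- \<theta> * real S)) * ennreal (2 * R)"
      using nD by (rule mult_left_mono) simp
    also have "\<dots> = ennreal (exp (- \<theta> * real S) * (2 * R))" using R by (subst ennreal_mult) auto
    also have "(\<Sum>s<S. ennreal ((2 * R + 1) / real (Suc K))) = ennreal (real S * ((2 * R + 1) / real (Suc K)))"
      using R by (subst sum_ennreal) auto
    finally have "weak_norm ?D \<le> ennreal (exp (- \<theta> * real S) * (2 * R)) + ennreal (real S * ((2 * R + 1) / real (Suc K)))"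
      by (simp add: add_mono mult_left_mono)
    also have "\<dots> \<le> ennreal (e / 2) + ennreal (e / 2)" by (intro add_mono ennreal_leI S K)
    also have "\<dots> = ennreal e" using e by (simp flip: ennreal_plus)
    finally show ?thesis using H(1) by blast
  qed
  then show ?thesis using U by blast
qed

end

section \<open>Observing the renewal process\<close>

context branch_scheme
begin

lemma fn_measurable: "(f ^^ n) \<in> measurable leb leb"
  by (induction n) (auto simp: comp_def intro: measurable_compose[OF _ f_measurable] measurable_ident)

lemma fn_unit: "x \<in> {0..1} \<Longrightarrow> (f ^^ n) x \<in> {0..1}"
  using measurable_space[OF fn_measurable, of x n] by simp

lemma observable_measurable: "w \<in> borel_measurable leb \<Longrightarrow> (\<lambda>x. w ((f ^^ n) x)) \<in> borel_measurable leb"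
  using measurable_compose[OF fn_measurable] .

lemma pairing_pointwise:
  fixes g w :: "real \<Rightarrow> real"
  assumes w: "\<And>x. x \<in> {0..1} \<Longrightarrow> \<bar>w x\<bar> \<le> 1" and x: "x \<in> {0..1}"
  shows "\<bar>g x * w ((f ^^ n) x)\<bar> \<le> \<bar>g x\<bar>"
  using mult_left_le[of "\<bar>w ((f ^^ n) x)\<bar>" "\<bar>g x\<bar>"] w[OF fn_unit[OF x, of n]] by (simp add: abs_mult)

lemma pairing_integrable:
  fixes g w :: "real \<Rightarrow> real"
  assumes g: "integrable leb g" and w: "w \<in> borel_measurable leb" "\<And>x. x \<in> {0..1} \<Longrightarrow> \<bar>w x\<bar> \<le> 1"
  shows "integrable leb (\<lambda>x. g x * w ((f ^^ n) x))"
proof (rule Bochner_Integration.integrable_bound)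
  show "integrable leb g" by (rule g)
  show "(\<lambda>x. g x * w ((f ^^ n) x)) \<in> borel_measurable leb"
    using g observable_measurable[OF w(1), of n] by simp
  show "AE x in leb. norm (g x * w ((f ^^ n) x)) \<le> norm (g x)"
    using pairing_pointwise[OF w(2)] by (intro AE_I2) simp
qed

lemma pairing_le:
  fixes g w :: "real \<Rightarrow> real"
  assumes g: "integrable leb g" and w: "w \<in> borel_measurable leb" "\<And>x. x \<in> {0..1} \<Longrightarrow> \<bar>w x\<bar> \<le> 1"
  shows "ennreal \<bar>\<integral>x. g x * w ((f ^^ n) x) \<partial>leb\<bar> \<le> L1_norm g"
proof -
  have "ennreal \<bar>\<integral>x. g x * w ((f ^^ n) x) \<partial>leb\<bar> \<le> (\<integral>\<^sup>+x. ennreal \<bar>g x * w ((f ^^ n) x)\<bar> \<partial>leb)"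
    using integral_norm_bound_ennreal[OF pairing_integrable[OF assms], of n] by simp
  also have "\<dots> \<le> L1_norm g"
    using pairing_pointwise[OF w(2)] by (intro nn_integral_mono ennreal_leI) simp
  finally show ?thesis .
qed

lemma observe_le:
  assumes G: "G \<in> states" and w: "w \<in> borel_measurable leb" "\<And>x. x \<in> {0..1} \<Longrightarrow> \<bar>w x\<bar> \<le> 1"
  shows "ennreal \<bar>observe n w G\<bar> \<le> weak_norm G"
proof -
  have "ennreal \<bar>observe n w G\<bar> \<le> ennreal (\<Sum>s\<le>n. \<bar>\<integral>x. G s x * w ((f ^^ (n - s)) x) \<partial>leb\<bar>)"
    unfolding observe_def by (intro ennreal_leI sum_abs)
  also have "\<dots> = (\<Sum>s\<le>n. ennreal \<bar>\<integral>x. G s x * w ((f ^^ (n - s)) x) \<partial>leb\<bar>)" by simp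
  also have "\<dots> \<le> (\<Sum>s\<le>n. L1_norm (G s))" by (intro sum_mono pairing_le statesD[OF G] w)
  also have "\<dots> \<le> weak_norm G" unfolding weak_norm_def by (intro sum_le_suminf) auto
  finally show ?thesis .
qed

lemma observe_diff:
  assumes "G \<in> states" "H \<in> states" and w: "w \<in> borel_measurable leb" "\<And>x. x \<in> {0..1} \<Longrightarrow> \<bar>w x\<bar> \<le> 1"
  shows "observe n w (\<lambda>s x. G s x - H s x) = observe n w G - observe n w H"
  unfolding observe_def sum_subtractf[symmetric]
  by (intro sum.cong refl, simp add: left_diff_distrib, intro Bochner_Integration.integral_diff pairing_integrable w statesD assms)

lemma observe_scale: "observe n w (\<lambda>s x. c * G s x) = c * observe n w G"
  unfolding observe_def sum_distrib_left by (simp add: mult.assoc)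

text \<open>The first \<open>t i\<close> steps of an orbit that starts in \<open>J i\<close> lead to \<open>F x\<close>; the rest is the change of variables.\<close>

lemma branch_pairing:
  assumes g: "integrable leb g" and w: "w \<in> borel_measurable leb" "\<And>x. x \<in> {0..1} \<Longrightarrow> \<bar>w x\<bar> \<le> 1" and n: "t i \<le> n"
  shows "(\<integral>y. push i g y * w ((f ^^ (n - t i)) y) \<partial>leb) = (\<integral>x. indicator (J i) x * (g x * w ((f ^^ n) x)) \<partial>leb)"
proof -
  have "(\<integral>y. push i g y * w ((f ^^ (n - t i)) y) \<partial>leb) = (\<integral>x. indicator (J i) x * (g x * w ((f ^^ (n - t i)) (F x))) \<partial>leb)"
    using push_integral(2)[OF g observable_measurable[OF w(1), of "n - t i"], of 1 i] w(2) fn_unit by blast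
  also have "\<dots> = (\<integral>x. indicator (J i) x * (g x * w ((f ^^ n) x)) \<partial>leb)"
  proof (rule Bochner_Integration.integral_cong[OF refl])
    fix x
    have "(f ^^ (n - t i)) (F x) = (f ^^ n) x" if "x \<in> J i"
    proof -
      have "(f ^^ n) x = (f ^^ (n - t i + t i)) x" using n by simp
      also have "\<dots> = (f ^^ (n - t i)) (F x)" unfolding funpow_add using F_eq[OF that] by simp
      finally show ?thesis by simp
    qed
    then show "indicator (J i) x * (g x * w ((f ^^ (n - t i)) (F x))) = indicator (J i) x * (g x * w ((f ^^ n) x))"
      by (simp add: indicator_def)
  qed
  finally show ?thesis .
qed

text \<open>Transporting the integrand along the branch exposes the weight.\<close>

lemma branch_integral_bound:
  fixes k :: "real \<Rightarrow> real"
  assumes k: "k \<in> borel_measurable leb" "\<And>x. x \<in> {0..1} \<Longrightarrow> \<bar>k x\<bar> \<le> b" and b: "0 \<le> b"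
  shows "\<bar>\<integral>x. indicator (J i) x * k x \<partial>leb\<bar> \<le> exp (- \<theta> * real (t i)) * (N i * b)"
proof -
  have ki: "integrable leb k" by (rule bounded_integrable_leb[OF k])
  have eq: "(\<integral>x. indicator (J i) x * k x \<partial>leb) = (\<integral>y. push i k y \<partial>leb)"
    using push_integral(2)[OF ki, of "\<lambda>_. 1" 1 i] by simp
  have bd: "\<bar>push i k y\<bar> \<le> exp (- \<theta> * real (t i)) * (N i * b)" for y
  proof -
    have "exp (- \<theta> * real (t i)) * (exp (\<theta> * real (t i)) * \<bar>push i k y\<bar>) \<le> exp (- \<theta> * real (t i)) * (N i * b)"
      using push_bound[where g=k and b=b and i=i and y=y, OF k(2) b] by (intro mult_left_mono) auto
    then show ?thesis by (simp add: exp_minus field_simps)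
  qed
  have "norm (\<integral>y. push i k y \<partial>leb) \<le> (\<integral>y. \<bar>push i k y\<bar> \<partial>leb)"
    using integral_norm_bound[of leb "push i k"] by simp
  also have "\<dots> \<le> (\<integral>y. exp (- \<theta> * real (t i)) * (N i * b) \<partial>leb)"
    using push_integrable[OF ki, of i] bd by (intro integral_mono) auto
  also have "\<dots> = exp (- \<theta> * real (t i)) * (N i * b)" using leb.prob_space by simp
  finally show ?thesis using eq by simp
qed

lemma indicator_sum:
  fixes c :: real
  shows "(\<lambda>i. indicator (J i) x * c) sums (indicator (\<Union>i. J i) x * c)"
proof (cases "\<exists>k. x \<in> J k")
  case True
  then obtain k where k: "x \<in> J k" by auto
  have 1: "(\<lambda>i. indicator (J i) x * c) = (\<lambda>i. if i = k then c else 0)"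
    using J_disjoint k by (auto simp: disjoint_family_on_def indicator_def fun_eq_iff)
  have 2: "indicator (\<Union>i. J i) x * c = c" using k by (auto simp: indicator_def)
  show ?thesis unfolding 1 2 by (rule sums_single)
next
  case False
  then show ?thesis by (auto simp: indicator_def)
qed

lemma integral_over_branches:
  fixes k :: "real \<Rightarrow> real"
  assumes k: "k \<in> borel_measurable leb" "\<And>x. x \<in> {0..1} \<Longrightarrow> \<bar>k x\<bar> \<le> b" and b: "0 \<le> b"
    and cov: "AE x in leb. k x \<noteq> 0 \<longrightarrow> x \<in> (\<Union>i. J i)"
  shows "(\<lambda>i. \<integral>x. indicator (J i) x * k x \<partial>leb) sums (\<integral>x. k x \<partial>leb)"
proof -
  have ki: "integrable leb k" by (rule bounded_integrable_leb[OF k(1,2)])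
  have "(\<lambda>i. \<integral>x. indicator (J i) x * k x \<partial>leb) sums (\<integral>x. (\<Sum>i. indicator (J i) x * k x) \<partial>leb)"
  proof (rule sums_integral)
    show "integrable leb (\<lambda>x. indicator (J i) x * k x)" for i
      using integrable_mult_indicator[OF J_sets ki, of i] by simp
    show "AE x in leb. summable (\<lambda>i. norm (indicator (J i) x * k x))"
    proof (rule AE_I2)
      fix x
      show "summable (\<lambda>i. norm (indicator (J i) x * k x))"
        using sums_summable[OF indicator_sum[of x "\<bar>k x\<bar>"]] by (simp add: abs_mult)
    qed
    show "summable (\<lambda>i. \<integral>x. norm (indicator (J i) x * k x) \<partial>leb)"
    proof (rule summable_comparison_test'[where N=0])
      show "summable (\<lambda>i. N i * b)" by (intro summable_mult2 N_summable)
      fix i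
      have "\<bar>\<integral>x. indicator (J i) x * \<bar>k x\<bar> \<partial>leb\<bar> \<le> exp (- \<theta> * real (t i)) * (N i * b)"
        using k b by (intro branch_integral_bound) auto
      also have "\<dots> \<le> 1 * (N i * b)"
        using \<theta>_pos N_nonneg[of i] b by (intro mult_right_mono) auto
      finally show "norm (\<integral>x. norm (indicator (J i) x * k x) \<partial>leb) \<le> N i * b"
        by (simp add: abs_mult)
    qed
  qed
  also have "(\<integral>x. (\<Sum>i. indicator (J i) x * k x) \<partial>leb) = (\<integral>x. k x \<partial>leb)"
  proof (rule integral_cong_AE)
    have eq: "(\<Sum>i. indicator (J i) x * k x) = indicator (\<Union>i. J i) x * k x" for x
      by (rule sums_unique[OF indicator_sum, symmetric])
    show "AE x in leb. (\<Sum>i. indicator (J i) x * k x) = k x"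
      unfolding eq using cov by eventually_elim (auto simp: indicator_def)
    have "(\<lambda>x. \<Sum>i. indicator (J i) x * k x) = (\<lambda>x. indicator (\<Union>i. J i) x * k x)"
      unfolding eq ..
    then show "(\<lambda>x. \<Sum>i. indicator (J i) x * k x) \<in> borel_measurable leb"
      using k(1) J_sets by (auto intro!: borel_measurable_times borel_measurable_indicator sets.countable_UN)
  qed (rule k)
  finally show ?thesis .
qed

lemma collect_pairing:
  assumes g: "\<And>i x. x \<in> {0..1} \<Longrightarrow> \<bar>g i x\<bar> \<le> b" and b: "0 \<le> b" and gi: "\<And>i. integrable leb (g i)"
    and w: "w \<in> borel_measurable leb" "\<And>x. x \<in> {0..1} \<Longrightarrow> \<bar>w x\<bar> \<le> 1"
  shows "(\<lambda>i. if c i then \<integral>y. push i (g i) y * w ((f ^^ n) y) \<partial>leb else 0) sums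
      (\<integral>y. collect c g y * w ((f ^^ n) y) \<partial>leb)"
proof -
  let ?u = "\<lambda>i y. (if c i then push i (g i) y else 0) * w ((f ^^ n) y)"
  have ub: "\<bar>?u i y\<bar> \<le> N i * b" if "y \<in> {0..1}" for i y
  proof -
    have "\<bar>push i (g i) y\<bar> \<le> N i * b"
      by (rule push_bound'[where g="g i" and i=i and y=y, OF g b])
    moreover have "\<bar>w ((f ^^ n) y)\<bar> \<le> 1" using w(2)[OF fn_unit[OF that]] .
    ultimately have "\<bar>push i (g i) y\<bar> * \<bar>w ((f ^^ n) y)\<bar> \<le> N i * b * 1"
      using N_nonneg[of i] b by (intro mult_mono) auto
    then show ?thesis using N_nonneg[of i] b by (auto simp: abs_mult)
  qed
  have ui: "integrable leb (?u i)" for i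
  proof (cases "c i")
    case True
    then show ?thesis using pairing_integrable[OF push_integrable[OF gi] w, of i i n] by simp
  qed simp
  have "(\<lambda>i. \<integral>y. ?u i y \<partial>leb) sums (\<integral>y. (\<Sum>i. ?u i y) \<partial>leb)"
  proof (rule sums_integral[OF ui])
    have sN: "summable (\<lambda>i. N i * b)" by (intro summable_mult2 N_summable)
    show "AE y in leb. summable (\<lambda>i. norm (?u i y))"
    proof (rule AE_I2)
      fix y assume "y \<in> space leb"
      then show "summable (\<lambda>i. norm (?u i y))"
        using ub by (intro summable_comparison_test'[where N=0, OF sN]) auto
    qed
    show "summable (\<lambda>i. \<integral>y. norm (?u i y) \<partial>leb)"
    proof (rule summable_comparison_test'[where N=0, OF sN])
      fix i
      have "(\<integral>y. norm (?u i y) \<partial>leb) \<le> (\<integral>y. N i * b \<partial>leb)"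
        using ub ui[of i] by (intro integral_mono) auto
      then show "norm (\<integral>y. norm (?u i y) \<partial>leb) \<le> N i * b"
        using leb.prob_space by simp
    qed
  qed
  also have "(\<integral>y. (\<Sum>i. ?u i y) \<partial>leb) = (\<integral>y. collect c g y * w ((f ^^ n) y) \<partial>leb)"
  proof (rule Bochner_Integration.integral_cong[OF refl])
    fix y
    have "summable (\<lambda>i. if c i then push i (g i) y else 0)"
      by (rule summable_rabs_cancel, rule collect_summable[of g b, OF g b])
    then show "(\<Sum>i. ?u i y) = collect c g y * w ((f ^^ n) y)"
      unfolding collect_def by (rule suminf_mult2[symmetric])
  qed
  finally have *: "(\<lambda>i. \<integral>y. ?u i y \<partial>leb) sums (\<integral>y. collect c g y * w ((f ^^ n) y) \<partial>leb)" .
  have "(\<integral>y. ?u i y \<partial>leb) = (if c i then \<integral>y. push i (g i) y * w ((f ^^ n) y) \<partial>leb else 0)" for i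
    by (cases "c i") simp_all
  then show ?thesis using * by (simp only:)
qed

lemma transfer_pairing:
  assumes g: "bv g < \<infinity>" and w: "w \<in> borel_measurable leb" "\<And>x. x \<in> {0..1} \<Longrightarrow> \<bar>w x\<bar> \<le> 1"
  shows "(\<lambda>i. if t i = s then \<integral>y. push i g y * w ((f ^^ n) y) \<partial>leb else 0) sums
      (\<integral>y. transfer s g y * w ((f ^^ n) y) \<partial>leb)"
  unfolding transfer_def
  by (rule collect_pairing[of "\<lambda>_. g" "enn2real (bv g)"]) (simp_all add: bv_bound[OF g] bv_integrable[OF g] w)

text \<open>The two observations differ by the branches that leave the base at time 0 and return after time \<open>n + 1\<close>. Each
  of them carries at most \<open>exp (- \<theta> * t i) * N i\<close> of the mass.\<close>

lemma observe_step:
  assumes G: "G \<in> states" and w: "w \<in> borel_measurable leb" "\<And>x. x \<in> {0..1} \<Longrightarrow> \<bar>w x\<bar> \<le> 1"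
  shows "\<bar>observe (Suc n) w G - observe n w (step G)\<bar> \<le> suminf N * exp (- \<theta>) ^ n * enn2real (strong_norm G)"
proof -
  note D = statesD[OF G]
  let ?g = "G 0" and ?b = "enn2real (bv (G 0))"
  let ?k = "\<lambda>x. ?g x * w ((f ^^ Suc n) x)"
  let ?c = "\<lambda>i. \<integral>x. indicator (J i) x * ?k x \<partial>leb"
  have km: "?k \<in> borel_measurable leb"
    using D(4)[of 0] observable_measurable[OF w(1), of "Suc n"] by (rule borel_measurable_times)
  have kb: "\<bar>?k x\<bar> \<le> ?b" if "x \<in> {0..1}" for x
  proof -
    have "\<bar>?g x\<bar> * \<bar>w ((f ^^ Suc n) x)\<bar> \<le> ?b * 1"
      using bv_bound[OF D(2) that] w(2)[OF fn_unit[OF that, of "Suc n"]] by (intro mult_mono) auto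
    then show ?thesis by (simp add: abs_mult)
  qed
  have b0: "0 \<le> ?b" by simp
  have "AE x in leb. ?k x \<noteq> 0 \<longrightarrow> x \<in> (\<Union>i. J i)"
    using J_cover D(3)[of 0] by eventually_elim auto
  from integral_over_branches[OF km kb b0 this]
  have I: "?c sums (\<integral>x. ?k x \<partial>leb)" .
  have T: "(\<lambda>i. if t i \<le> Suc n then ?c i else 0) sums
      (\<Sum>s\<le>n. \<integral>y. transfer (Suc s) ?g y * w ((f ^^ (n - s)) y) \<partial>leb)"
  proof -
    have "(\<lambda>i. \<Sum>s\<le>n. if t i = Suc s then \<integral>y. push i ?g y * w ((f ^^ (n - s)) y) \<partial>leb else 0) sums
      (\<Sum>s\<le>n. \<integral>y. transfer (Suc s) ?g y * w ((f ^^ (n - s)) y) \<partial>leb)"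
      by (intro sums_sum transfer_pairing D w)
    moreover have "(\<Sum>s\<le>n. if t i = Suc s then \<integral>y. push i ?g y * w ((f ^^ (n - s)) y) \<partial>leb else 0)
        = (if t i \<le> Suc n then ?c i else 0)" for i
    proof -
      have "(\<Sum>s\<le>n. if t i = Suc s then \<integral>y. push i ?g y * w ((f ^^ (n - s)) y) \<partial>leb else 0)
        = (\<Sum>s\<le>n. if s = t i - 1 then \<integral>y. push i ?g y * w ((f ^^ (Suc n - t i)) y) \<partial>leb else 0)"
        using t_pos[of i] by (intro sum.cong) auto
      also have "\<dots> = (if t i \<le> Suc n then \<integral>y. push i ?g y * w ((f ^^ (Suc n - t i)) y) \<partial>leb else 0)"
        using t_pos[of i] by (auto simp: sum.delta)
      also have "\<dots> = (if t i \<le> Suc n then ?c i else 0)"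
        using branch_pairing[OF D(5) w, of i "Suc n" 0] by auto
      finally show ?thesis .
    qed
    ultimately show ?thesis by simp
  qed
  have R: "(\<lambda>i. if Suc n < t i then ?c i else 0) sums
     ((\<integral>x. ?k x \<partial>leb) - (\<Sum>s\<le>n. \<integral>y. transfer (Suc s) ?g y * w ((f ^^ (n - s)) y) \<partial>leb))"
    using sums_diff[OF I T] by (rule sums_cong[THEN iffD1, rotated]) auto
  have bound: "norm (if Suc n < t i then ?c i else 0) \<le> N i * (exp (- \<theta>) ^ n * ?b)" for i
  proof (cases "Suc n < t i")
    case True
    have "\<bar>?c i\<bar> \<le> exp (- \<theta> * real (t i)) * (N i * ?b)"
      by (rule branch_integral_bound[OF km kb b0])
    also have "\<dots> \<le> exp (- \<theta> * real n) * (N i * ?b)"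
      using True \<theta>_pos N_nonneg[of i] by (intro mult_right_mono) auto
    also have "exp (- \<theta> * real n) = exp (- \<theta>) ^ n" by (metis exp_of_nat2_mult mult.commute)
    finally show ?thesis using True by (simp add: mult_ac)
  next
    case False then show ?thesis using N_nonneg[of i] by simp
  qed
  have "\<bar>(\<integral>x. ?k x \<partial>leb) - (\<Sum>s\<le>n. \<integral>y. transfer (Suc s) ?g y * w ((f ^^ (n - s)) y) \<partial>leb)\<bar>
      \<le> suminf N * (exp (- \<theta>) ^ n * ?b)"
  proof -
    have "summable (\<lambda>i. N i * (exp (- \<theta>) ^ n * ?b))" by (intro summable_mult2 N_summable)
    from norm_suminf_le[OF bound this] show ?thesis
      using sums_unique[OF R] suminf_mult2[OF N_summable, of "exp (- \<theta>) ^ n * ?b"] by simp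
  qed
  also have "\<dots> \<le> suminf N * exp (- \<theta>) ^ n * enn2real (strong_norm G)"
  proof -
    have "?b \<le> enn2real (strong_norm G)" using D(1) D(7)[of 0] by (intro enn2real_mono) auto
    moreover have "0 \<le> suminf N" using N_nonneg N_summable by (intro suminf_nonneg) auto
    ultimately show ?thesis by (simp add: mult.assoc mult_left_mono)
  qed
  also have "(\<integral>x. ?k x \<partial>leb) - (\<Sum>s\<le>n. \<integral>y. transfer (Suc s) ?g y * w ((f ^^ (n - s)) y) \<partial>leb)
      = observe (Suc n) w G - observe n w (step G)"
  proof -
    have "observe (Suc n) w G = (\<integral>x. ?k x \<partial>leb) + (\<Sum>s\<le>n. \<integral>x. G (Suc s) x * w ((f ^^ (n - s)) x) \<partial>leb)"
      unfolding observe_def by (subst sum.atMost_Suc_shift) simp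
    moreover have "observe n w (step G) = (\<Sum>s\<le>n. (\<integral>x. G (Suc s) x * w ((f ^^ (n - s)) x) \<partial>leb)
        + (\<integral>y. transfer (Suc s) ?g y * w ((f ^^ (n - s)) y) \<partial>leb))"
      unfolding observe_def step_def distrib_right
      by (intro sum.cong refl Bochner_Integration.integral_add pairing_integrable D w
          bv_integrable[OF bv_transfer_finite[OF D(2)]])
    ultimately show ?thesis by (simp add: sum.distrib)
  qed
  finally show ?thesis .
qed

text \<open>Dominated convergence over the arrival times, with the masses \<open>L1_norm (G s)\<close> as majorant.\<close>

lemma observe_null:
  assumes G: "G \<in> states" and w: "w \<in> borel_measurable leb" "\<And>x. x \<in> {0..1} \<Longrightarrow> \<bar>w x\<bar> \<le> 1"
    and null: "\<And>g. bv g < \<infinity> \<Longrightarrow> AE x in leb. h x = 0 \<longrightarrow> g x = 0 \<Longrightarrow>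
       (\<lambda>n. \<integral>x. g x * w ((f ^^ n) x) \<partial>leb) \<longlonglongrightarrow> 0"
  shows "(\<lambda>n. observe n w G) \<longlonglongrightarrow> 0"
proof -
  note D = statesD[OF G]
  let ?a = "\<lambda>s. enn2real (L1_norm (G s))"
  have fin: "weak_norm G < \<infinity>" using weak_norm_le_strong_norm D(1) by (rule le_less_trans)
  have La: "L1_norm (G s) = ennreal (?a s)" for s
  proof -
    have "L1_norm (G s) \<le> weak_norm G" unfolding weak_norm_def using sum_le_suminf[of "\<lambda>s. L1_norm (G s)" "{s}"] by simp
    then have "L1_norm (G s) < top" using fin by (auto intro: le_less_trans)
    then show ?thesis by simp
  qed
  have sa: "summable ?a"
    by (rule summable_suminf_not_top) (use fin in \<open>auto simp: La[symmetric] weak_norm_def less_top[symmetric]\<close>)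
  have obs: "observe n w G = (\<Sum>s. if s \<le> n then \<integral>x. G s x * w ((f ^^ (n - s)) x) \<partial>leb else 0)" for n
  proof -
    have "(\<Sum>s. if s \<le> n then \<integral>x. G s x * w ((f ^^ (n - s)) x) \<partial>leb else 0) =
       (\<Sum>s\<in>{..n}. if s \<le> n then \<integral>x. G s x * w ((f ^^ (n - s)) x) \<partial>leb else 0)"
      by (rule suminf_finite) auto
    then show ?thesis by (simp add: observe_def)
  qed
  have "(\<lambda>n. \<Sum>s. if s \<le> n then \<integral>x. G s x * w ((f ^^ (n - s)) x) \<partial>leb else 0) \<longlonglongrightarrow> (\<Sum>s::nat. 0)"
  proof (rule tannerys_theorem[THEN conjunct2, THEN conjunct2, of _ _ _ ?a])
    show "(\<lambda>n. if s \<le> n then \<integral>x. G s x * w ((f ^^ (n - s)) x) \<partial>leb else 0) \<longlonglongrightarrow> 0" for s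
    proof (rule LIMSEQ_offset[where k=s])
      show "(\<lambda>n. if s \<le> n + s then \<integral>x. G s x * w ((f ^^ (n + s - s)) x) \<partial>leb else 0) \<longlonglongrightarrow> 0"
        using null[OF D(2,3)] by simp
    qed
    show "summable ?a" by (rule sa)
    show "\<forall>\<^sub>F (s, n) in at_top \<times>\<^sub>F sequentially.
       norm (if s \<le> n then \<integral>x. G s x * w ((f ^^ (n - s)) x) \<partial>leb else 0) \<le> ?a s"
    proof (rule always_eventually, clarify)
      fix s n
      have "ennreal \<bar>\<integral>x. G s x * w ((f ^^ (n - s)) x) \<partial>leb\<bar> \<le> ennreal (?a s)"
        using pairing_le[OF D(5) w, of s "n - s"] by (simp add: La[symmetric])
      then show "norm (if s \<le> n then \<integral>x. G s x * w ((f ^^ (n - s)) x) \<partial>leb else 0) \<le> ?a s" by simp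
    qed
  qed auto
  then show ?thesis by (simp add: obs)
qed

theorem observe_exponential_decay:
  assumes \<rho>: "0 \<le> \<rho>" "\<rho> \<le> 1/4"
    and W: "\<And>w. w \<in> W \<Longrightarrow> w \<in> borel_measurable leb" "\<And>w x. w \<in> W \<Longrightarrow> x \<in> {0..1} \<Longrightarrow> \<bar>w x\<bar> \<le> 1"
    and null: "\<And>w g. w \<in> W \<Longrightarrow> bv g < \<infinity> \<Longrightarrow> AE x in leb. h x = 0 \<longrightarrow> g x = 0 \<Longrightarrow>
       (\<lambda>n. \<integral>x. g x * w ((f ^^ n) x) \<partial>leb) \<longlonglongrightarrow> 0"
  shows "\<exists>K\<ge>0. \<exists>p. 0 < p \<and> p < 1 \<and> (\<forall>G\<in>states. \<forall>w\<in>W. \<forall>n. \<bar>observe n w G\<bar> \<le> K * p ^ n * enn2real (strong_norm G))"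
proof -
  obtain B where B: "B \<ge> 0" "\<And>g. bv g < \<infinity> \<Longrightarrow>
      (\<Sum>i. ennreal (exp (\<theta> * real (t i))) * bv (push i g)) \<le> ennreal (7 / 8) * bv g + ennreal B * L1_norm g"
    using sum_push_lasota_yorke[OF \<rho>] by blast
  let ?r = "max (exp (- \<theta>)) (7/8 :: real)"
  have fin: "strong_norm G < \<infinity>" "weak_norm G < \<infinity>" if "G \<in> states" for G
    using statesD(1)[OF that] weak_norm_le_strong_norm[of G] by (auto intro: le_less_trans)
  interpret approximate_contraction states "\<lambda>G H s x. G s x - H s x" "\<lambda>c G s x. c * G s x"
    "\<lambda>G. enn2real (strong_norm G)" "\<lambda>G. enn2real (weak_norm G)" step W observe ?r B "suminf N" "exp (- \<theta>)"
  proof unfold_locales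
    show "0 \<le> ?r" "?r < 1" "0 \<le> B" "0 < exp (- \<theta>)" "exp (- \<theta>) < 1" using B(1) \<theta>_pos by auto
    show "0 \<le> suminf N" using N_nonneg N_summable by (intro suminf_nonneg) auto
  next
    fix G H assume GH: "G \<in> states" "H \<in> states"
    show "(\<lambda>s x. G s x - H s x) \<in> states" by (rule diff_states[OF GH])
    have "enn2real (strong_norm (\<lambda>s x. G s x - H s x)) \<le> enn2real (strong_norm G + strong_norm H)"
      using strong_norm_diff[OF GH] fin[OF GH(1)] fin[OF GH(2)] by (intro enn2real_mono) auto
    then show "enn2real (strong_norm (\<lambda>s x. G s x - H s x)) \<le> enn2real (strong_norm G) + enn2real (strong_norm H)"
      using fin[OF GH(1)] fin[OF GH(2)] by (simp add: enn2real_plus)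
    show "step (\<lambda>s x. G s x - H s x) = (\<lambda>s x. step G s x - step H s x)" by (rule step_diff[OF GH])
  next
    fix c G assume G: "G \<in> states"
    show "(\<lambda>s x. c * G s x) \<in> states" by (rule scale_states[OF G])
    show "enn2real (strong_norm (\<lambda>s x. c * G s x)) = \<bar>c\<bar> * enn2real (strong_norm G)" by (simp add: strong_norm_scale[OF G] enn2real_mult)
  next
    fix G assume G: "G \<in> states"
    show "step G \<in> states" by (rule step_states[OF G])
    show "0 \<le> enn2real (weak_norm G) \<and> enn2real (weak_norm G) \<le> enn2real (strong_norm G)"
      using fin[OF G] weak_norm_le_strong_norm[of G] by (auto intro: enn2real_mono)
    show "enn2real (weak_norm (step G)) \<le> enn2real (weak_norm G)"
      using fin[OF G] weak_norm_step[OF G] by (auto intro: enn2real_mono)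
    have "enn2real (strong_norm (step G)) \<le> enn2real (ennreal ?r * strong_norm G + ennreal B * weak_norm G)"
      using strong_norm_step[OF G \<rho> B(2)] fin[OF G] by (intro enn2real_mono) (auto simp: ennreal_mult_less_top)
    also have "\<dots> = ?r * enn2real (strong_norm G) + B * enn2real (weak_norm G)"
      using fin[OF G] B(1) by (subst enn2real_plus) (auto simp: enn2real_mult ennreal_mult_less_top)
    finally show "enn2real (strong_norm (step G)) \<le> ?r * enn2real (strong_norm G) + B * enn2real (weak_norm G)" .
  next
    fix G H Z assume GH: "G \<in> states" "H \<in> states" "Z \<in> states"
    note f = fin(2)[OF diff_states[OF GH(1,3)]] fin(2)[OF diff_states[OF GH(2,3)]]
    have "enn2real (weak_norm (\<lambda>s x. G s x - H s x)) \<le> enn2real (weak_norm (\<lambda>s x. G s x - Z s x) + weak_norm (\<lambda>s x. H s x - Z s x))"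
      using weak_norm_triangle[OF GH] f by (intro enn2real_mono) auto
    then show "enn2real (weak_norm (\<lambda>s x. G s x - H s x)) \<le> enn2real (weak_norm (\<lambda>s x. G s x - Z s x)) + enn2real (weak_norm (\<lambda>s x. H s x - Z s x))"
      using f by (simp add: enn2real_plus)
  next
    fix n w G H assume "w \<in> W" "G \<in> states" "H \<in> states"
    then show "observe n w (\<lambda>s x. G s x - H s x) = observe n w G - observe n w H"
      using W by (intro observe_diff) auto
  next
    fix n w c G
    show "observe n w (\<lambda>s x. c * G s x) = c * observe n w G" by (rule observe_scale)
  next
    fix n w G assume w: "w \<in> W" and G: "G \<in> states"
    have "ennreal \<bar>observe n w G\<bar> \<le> strong_norm G"
      using observe_le[OF G W(1)[OF w] W(2)[OF w], of n] weak_norm_le_strong_norm[of G] by (rule order_trans)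
    then have "enn2real (ennreal \<bar>observe n w G\<bar>) \<le> enn2real (strong_norm G)"
      using fin[OF G] by (intro enn2real_mono) auto
    then show "\<bar>observe n w G\<bar> \<le> enn2real (strong_norm G)" by simp
    show "\<bar>observe (Suc n) w G - observe n w (step G)\<bar> \<le> suminf N * exp (- \<theta>) ^ n * enn2real (strong_norm G)"
      by (rule observe_step[OF G W(1)[OF w] W(2)[OF w]])
  next
    fix R e :: real assume R: "R > 0" and e: "e > 0"
    obtain U where U: "finite U" "U \<subseteq> {G\<in>states. strong_norm G \<le> ennreal R}"
      "\<And>G. G \<in> states \<Longrightarrow> strong_norm G \<le> ennreal R \<Longrightarrow> \<exists>H\<in>U. weak_norm (\<lambda>s x. G s x - H s x) \<le> ennreal e"
      using states_net[OF R e] by blast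
    have "U \<subseteq> {G\<in>states. enn2real (strong_norm G) \<le> R}" using U(2) R by (auto intro: enn2real_leI)
    moreover have "\<exists>H\<in>U. enn2real (weak_norm (\<lambda>s x. G s x - H s x)) \<le> e" if "G \<in> states" "enn2real (strong_norm G) \<le> R" for G
    proof -
      have "strong_norm G = ennreal (enn2real (strong_norm G))" using fin(1)[OF that(1)] by simp
      also have "\<dots> \<le> ennreal R" using that(2) by (rule ennreal_leI)
      finally have "strong_norm G \<le> ennreal R" .
      from U(3)[OF that(1) this] obtain H where "H \<in> U" "weak_norm (\<lambda>s x. G s x - H s x) \<le> ennreal e" by blast
      then show ?thesis using e by (intro bexI[of _ H] enn2real_leI) auto
    qed
    ultimately show "\<exists>U. finite U \<and> U \<subseteq> {G\<in>states. enn2real (strong_norm G) \<le> R} \<and>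
       (\<forall>G\<in>states. enn2real (strong_norm G) \<le> R \<longrightarrow> (\<exists>H\<in>U. enn2real (weak_norm (\<lambda>s x. G s x - H s x)) \<le> e))"
      using U(1) by blast
  next
    fix w G assume w: "w \<in> W" and G: "G \<in> states"
    show "(\<lambda>n. observe n w G) \<longlonglongrightarrow> 0"
      by (rule observe_null[OF G W(1)[OF w] W(2)[OF w] null[OF w]])
  qed
  show ?thesis by (rule exponential_decay)
qed

end

section \<open>Composition of branch schemes\<close>

lemma summable_prod_decode:
  fixes a b :: "nat \<Rightarrow> real"
  assumes a: "summable a" "\<And>i. 0 \<le> a i" and b: "summable b" "\<And>i. 0 \<le> b i"
  shows "summable (\<lambda>n. a (fst (prod_decode n)) * b (snd (prod_decode n)))"
proof (rule summable_suminf_not_top)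
  show "0 \<le> a (fst (prod_decode n)) * b (snd (prod_decode n))" for n using a b by simp
  let ?f = "\<lambda>p. ennreal (a (fst p) * b (snd p))"
  have "(\<Sum>n. ?f (prod_decode n)) = (\<Sum>i. ennreal (a i) * (\<Sum>j. ennreal (b j)))"
  proof (rule suminf_ennreal_2dimen)
    fix m
    have "(\<Sum>n. ?f (m, n)) = (\<Sum>n. ennreal (a m) * ennreal (b n))"
      using a b by (intro suminf_cong) (simp add: ennreal_mult)
    then show "ennreal (a m) * (\<Sum>j. ennreal (b j)) = (\<Sum>n. ?f (m, n))" by simp
  qed
  also have "\<dots> = (\<Sum>i. ennreal (a i)) * (\<Sum>j. ennreal (b j))" by simp
  also have "\<dots> = ennreal (suminf a) * ennreal (suminf b)" using a b by (simp add: suminf_ennreal2)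
  also have "\<dots> \<noteq> top" by (simp add: ennreal_mult_eq_top_iff)
  finally show "(\<Sum>n. ?f (prod_decode n)) \<noteq> top" .
qed

text \<open>Contraction rates multiply, so that powers of \<open>F\<close> reach the small rates that the Lasota--Yorke inequality
  asks for. Return times add, and the bounds of the control functions multiply up to the factor 2 of the
  product rule.\<close>

theorem branch_scheme_compose:
  assumes S1: "branch_scheme f h \<theta> \<rho>\<^sub>1 F\<^sub>1 t\<^sub>1 J\<^sub>1 N\<^sub>1" and S2: "branch_scheme f h \<theta> \<rho>\<^sub>2 F\<^sub>2 t\<^sub>2 J\<^sub>2 N\<^sub>2"
  shows "branch_scheme f h \<theta> (\<rho>\<^sub>1 * \<rho>\<^sub>2) (F\<^sub>2 \<circ> F\<^sub>1)
     (\<lambda>n. case prod_decode n of (i, j) \<Rightarrow> t\<^sub>1 i + t\<^sub>2 j)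
     (\<lambda>n. case prod_decode n of (i, j) \<Rightarrow> J\<^sub>1 i \<inter> F\<^sub>1 -` J\<^sub>2 j)
     (\<lambda>n. 2 * (N\<^sub>1 (fst (prod_decode n)) * N\<^sub>2 (snd (prod_decode n))))"
proof -
  interpret S1: branch_scheme f h \<theta> \<rho>\<^sub>1 F\<^sub>1 t\<^sub>1 J\<^sub>1 N\<^sub>1 by (rule S1)
  interpret S2: branch_scheme f h \<theta> \<rho>\<^sub>2 F\<^sub>2 t\<^sub>2 J\<^sub>2 N\<^sub>2 by (rule S2)
  let ?F = "F\<^sub>2 \<circ> F\<^sub>1" and ?K = "\<lambda>i j. J\<^sub>1 i \<inter> F\<^sub>1 -` J\<^sub>2 j"
  let ?t = "\<lambda>n. case prod_decode n of (i, j) \<Rightarrow> t\<^sub>1 i + t\<^sub>2 j"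
  let ?J = "\<lambda>n. case prod_decode n of (i, j) \<Rightarrow> ?K i j"
  let ?N = "\<lambda>n. 2 * (N\<^sub>1 (fst (prod_decode n)) * N\<^sub>2 (snd (prod_decode n)))"
  have open_K: "open (?K i j)" for i j
    using S1.F_cont S1.J_open S2.J_open by (simp add: continuous_on_open_vimage Int_commute)
  have interval_K: "is_interval (?K i j)" for i j
    unfolding is_interval_1
  proof (intro ballI allI impI)
    fix x y z assume x: "x \<in> ?K i j" and y: "y \<in> ?K i j" and z: "x \<le> z \<and> z \<le> y"
    have zJ: "z \<in> J\<^sub>1 i" using mem_is_interval_1_I[OF S1.J_interval, of x i y z] x y z by auto
    have "F\<^sub>1 z \<in> J\<^sub>2 j"
    proof -
      from S1.F_mono[of i] have "F\<^sub>1 x \<le> F\<^sub>1 z \<and> F\<^sub>1 z \<le> F\<^sub>1 y \<or> F\<^sub>1 y \<le> F\<^sub>1 z \<and> F\<^sub>1 z \<le> F\<^sub>1 x"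
        unfolding monotone_map_on_def using x y z zJ by (auto simp: monotone_on_def)
      then show ?thesis
        using mem_is_interval_1_I[OF S2.J_interval, of "F\<^sub>1 x" j "F\<^sub>1 y" "F\<^sub>1 z"]
          mem_is_interval_1_I[OF S2.J_interval, of "F\<^sub>1 y" j "F\<^sub>1 x" "F\<^sub>1 z"] x y by auto
    qed
    then show "z \<in> ?K i j" using zJ by simp
  qed
  have mono_K: "monotone_map_on (?K i j) ?F" for i j
    using S1.F_mono[of i] S2.F_mono[of j] unfolding monotone_map_on_def
    by (auto simp: monotone_on_def)
  have der: "(?F has_real_derivative deriv F\<^sub>2 (F\<^sub>1 x) * deriv F\<^sub>1 x) (at x)" if "x \<in> ?K i j" for x i j
    using DERIV_chain[OF S2.F_deriv[of "F\<^sub>1 x" j] S1.F_deriv[of x i]] that by simp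
  have deriv_F: "deriv ?F x = deriv F\<^sub>2 (F\<^sub>1 x) * deriv F\<^sub>1 x" if "x \<in> ?K i j" for x i j
    using der[OF that] by (rule DERIV_imp_deriv)
  have weight: "exp (\<theta> * real (t\<^sub>1 i + t\<^sub>2 j)) * \<bar>1 / deriv ?F x\<bar> =
      (exp (\<theta> * real (t\<^sub>1 i)) * \<bar>1 / deriv F\<^sub>1 x\<bar>) * (exp (\<theta> * real (t\<^sub>2 j)) * \<bar>1 / deriv F\<^sub>2 (F\<^sub>1 x)\<bar>)"
    if "x \<in> ?K i j" for x i j
    by (simp add: deriv_F[OF that] abs_mult exp_add distrib_left)
  have control_K: "\<exists>W. continuous_on (?K i j) W \<and> controls W (?K i j) (\<lambda>x. \<bar>1 / deriv ?F x\<bar>) \<and>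
      (\<forall>x\<in>?K i j. 0 \<le> W x \<and> exp (\<theta> * real (t\<^sub>1 i + t\<^sub>2 j)) * W x \<le> 2 * (N\<^sub>1 i * N\<^sub>2 j))" for i j
  proof -
    define e\<^sub>1 e\<^sub>2 where "e\<^sub>1 = exp (\<theta> * real (t\<^sub>1 i))" and "e\<^sub>2 = exp (\<theta> * real (t\<^sub>2 j))"
    have e: "0 < e\<^sub>1" "0 < e\<^sub>2" "exp (\<theta> * real (t\<^sub>1 i + t\<^sub>2 j)) = e\<^sub>1 * e\<^sub>2"
      by (auto simp: e\<^sub>1_def e\<^sub>2_def exp_add distrib_left)
    define n\<^sub>1 n\<^sub>2 where "n\<^sub>1 = N\<^sub>1 i / e\<^sub>1" and "n\<^sub>2 = N\<^sub>2 j / e\<^sub>2"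
    have n: "0 \<le> n\<^sub>1" "0 \<le> n\<^sub>2" using S1.N_nonneg S2.N_nonneg e by (auto simp: n\<^sub>1_def n\<^sub>2_def)
    obtain W\<^sub>1 where W1: "continuous_on (J\<^sub>1 i) W\<^sub>1" "controls W\<^sub>1 (J\<^sub>1 i) (\<lambda>x. \<bar>1 / deriv F\<^sub>1 x\<bar>)"
        "\<forall>x\<in>J\<^sub>1 i. 0 \<le> W\<^sub>1 x \<and> e\<^sub>1 * W\<^sub>1 x \<le> N\<^sub>1 i"
      using S1.weight_control[of i] unfolding e\<^sub>1_def by blast
    obtain V where V: "continuous_on (J\<^sub>2 j) V" "controls V (J\<^sub>2 j) (\<lambda>x. \<bar>1 / deriv F\<^sub>2 x\<bar>)"
        "\<forall>x\<in>J\<^sub>2 j. 0 \<le> V x \<and> e\<^sub>2 * V x \<le> N\<^sub>2 j"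
      using S2.weight_control[of j] unfolding e\<^sub>2_def by blast
    have W1n: "0 \<le> W\<^sub>1 x \<and> W\<^sub>1 x \<le> n\<^sub>1" if "x \<in> J\<^sub>1 i" for x using W1(3) that e by (auto simp: n\<^sub>1_def field_simps)
    have Vn: "0 \<le> V x \<and> V x \<le> n\<^sub>2" if "x \<in> J\<^sub>2 j" for x using V(3) that e by (auto simp: n\<^sub>2_def field_simps)
    have \<phi>1: "\<bar>1 / deriv F\<^sub>1 x\<bar> \<le> n\<^sub>1" if "x \<in> J\<^sub>1 i" for x
      using S1.weight_le_N[OF that] e by (simp add: n\<^sub>1_def e\<^sub>1_def field_simps)
    have \<phi>2: "\<bar>1 / deriv F\<^sub>2 x\<bar> \<le> n\<^sub>2" if "x \<in> J\<^sub>2 j" for x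
      using S2.weight_le_N[OF that] e by (simp add: n\<^sub>2_def e\<^sub>2_def field_simps)
    \<comment> \<open>A control function of the second weight along \<open>F\<^sub>1\<close>, whatever the orientation of \<open>F\<^sub>1\<close>.\<close>
    obtain U where U: "continuous_on (?K i j) U" "controls U (?K i j) (\<lambda>x. \<bar>1 / deriv F\<^sub>2 (F\<^sub>1 x)\<bar>)"
        "\<forall>x\<in>?K i j. 0 \<le> U x \<and> U x \<le> n\<^sub>2"
    proof -
      have cont: "continuous_on (?K i j) (\<lambda>x. V (F\<^sub>1 x))"
        using continuous_on_compose2[OF V(1) continuous_on_subset[OF S1.F_cont, of "?K i j" i]] by auto
      from S1.F_mono[of i] show ?thesis unfolding monotone_map_on_def
      proof
        assume m: "mono_on (J\<^sub>1 i) F\<^sub>1"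
        have "controls (\<lambda>x. V (F\<^sub>1 x)) (?K i j) (\<lambda>x. \<bar>1 / deriv F\<^sub>2 (F\<^sub>1 x)\<bar>)"
          unfolding controls_def
        proof (intro ballI impI)
          fix x y assume xy: "x \<in> ?K i j" "y \<in> ?K i j" "x \<le> y"
          then have "F\<^sub>1 x \<le> F\<^sub>1 y" using mono_onD[OF m, of x y] by auto
          then show "\<bar>\<bar>1 / deriv F\<^sub>2 (F\<^sub>1 y)\<bar> - \<bar>1 / deriv F\<^sub>2 (F\<^sub>1 x)\<bar>\<bar> \<le> V (F\<^sub>1 y) - V (F\<^sub>1 x)"
            using controlsD[OF V(2), of "F\<^sub>1 x" "F\<^sub>1 y"] xy by auto
        qed
        then show ?thesis using that[OF cont] Vn by auto
      next
        assume m: "antimono_on (J\<^sub>1 i) F\<^sub>1"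
        have "controls (\<lambda>x. n\<^sub>2 - V (F\<^sub>1 x)) (?K i j) (\<lambda>x. \<bar>1 / deriv F\<^sub>2 (F\<^sub>1 x)\<bar>)"
          unfolding controls_def
        proof (intro ballI impI)
          fix x y assume xy: "x \<in> ?K i j" "y \<in> ?K i j" "x \<le> y"
          then have "F\<^sub>1 y \<le> F\<^sub>1 x" using m by (auto simp: monotone_on_def)
          then show "\<bar>\<bar>1 / deriv F\<^sub>2 (F\<^sub>1 y)\<bar> - \<bar>1 / deriv F\<^sub>2 (F\<^sub>1 x)\<bar>\<bar> \<le> n\<^sub>2 - V (F\<^sub>1 y) - (n\<^sub>2 - V (F\<^sub>1 x))"
            using controlsD[OF V(2), of "F\<^sub>1 y" "F\<^sub>1 x"] xy by (auto simp: abs_minus_commute)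
        qed
        moreover have "continuous_on (?K i j) (\<lambda>x. n\<^sub>2 - V (F\<^sub>1 x))" by (intro continuous_intros cont)
        ultimately show ?thesis using that[of "\<lambda>x. n\<^sub>2 - V (F\<^sub>1 x)"] Vn by auto
      qed
    qed
    let ?W = "\<lambda>x. n\<^sub>2 * W\<^sub>1 x + n\<^sub>1 * U x"
    have "continuous_on (?K i j) ?W"
      by (intro continuous_intros U(1) continuous_on_subset[OF W1(1)]) auto
    moreover have "controls ?W (?K i j) (\<lambda>x. \<bar>1 / deriv ?F x\<bar>)"
      unfolding controls_def
    proof (intro ballI impI)
      fix x y assume xy: "x \<in> ?K i j" "y \<in> ?K i j" "x \<le> y"
      let ?a = "\<lambda>x. \<bar>1 / deriv F\<^sub>1 x\<bar>" and ?b = "\<lambda>x. \<bar>1 / deriv F\<^sub>2 (F\<^sub>1 x)\<bar>"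
      have "\<bar>1 / deriv ?F y\<bar> - \<bar>1 / deriv ?F x\<bar> = ?b y * (?a y - ?a x) + ?a x * (?b y - ?b x)"
      proof -
        have "\<bar>1 / deriv ?F y\<bar> = ?b y * ?a y" "\<bar>1 / deriv ?F x\<bar> = ?b x * ?a x"
          by (simp_all add: deriv_F[OF xy(1)] deriv_F[OF xy(2)] abs_mult)
        then show ?thesis by (simp only: algebra_simps)
      qed
      then have "\<bar>\<bar>1 / deriv ?F y\<bar> - \<bar>1 / deriv ?F x\<bar>\<bar> \<le> \<bar>?b y * (?a y - ?a x)\<bar> + \<bar>?a x * (?b y - ?b x)\<bar>"
        by (simp only: abs_triangle_ineq)
      also have "\<dots> = ?b y * \<bar>?a y - ?a x\<bar> + ?a x * \<bar>?b y - ?b x\<bar>" by (simp only: abs_mult abs_abs)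
      also have "\<dots> \<le> n\<^sub>2 * (W\<^sub>1 y - W\<^sub>1 x) + n\<^sub>1 * (U y - U x)"
        using xy n \<phi>1[of x] \<phi>2[of "F\<^sub>1 y"] controlsD[OF W1(2), of x y] controlsD[OF U(2) xy]
        by (intro add_mono mult_mono) auto
      finally show "\<bar>\<bar>1 / deriv ?F y\<bar> - \<bar>1 / deriv ?F x\<bar>\<bar> \<le> ?W y - ?W x" by (simp add: algebra_simps)
    qed
    moreover have "0 \<le> ?W x \<and> exp (\<theta> * real (t\<^sub>1 i + t\<^sub>2 j)) * ?W x \<le> 2 * (N\<^sub>1 i * N\<^sub>2 j)" if x: "x \<in> ?K i j" for x
    proof
      have b: "0 \<le> W\<^sub>1 x" "W\<^sub>1 x \<le> n\<^sub>1" "0 \<le> U x" "U x \<le> n\<^sub>2" using W1n[of x] U(3) x by auto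
      show "0 \<le> ?W x" using b n by simp
      have "?W x \<le> n\<^sub>2 * n\<^sub>1 + n\<^sub>1 * n\<^sub>2" using b n by (intro add_mono mult_left_mono) auto
      then have "(e\<^sub>1 * e\<^sub>2) * ?W x \<le> (e\<^sub>1 * e\<^sub>2) * (n\<^sub>2 * n\<^sub>1 + n\<^sub>1 * n\<^sub>2)" using e by (intro mult_left_mono) auto
      also have "\<dots> = 2 * (N\<^sub>1 i * N\<^sub>2 j)" using e by (simp add: n\<^sub>1_def n\<^sub>2_def field_simps)
      finally show "exp (\<theta> * real (t\<^sub>1 i + t\<^sub>2 j)) * ?W x \<le> 2 * (N\<^sub>1 i * N\<^sub>2 j)" by (simp only: e(3))
    qed
    ultimately show ?thesis by blast
  qed
  show ?thesis
  proof unfold_locales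
    show "summable ?N"
      by (intro summable_mult summable_prod_decode S1.N_summable S2.N_summable S1.N_nonneg S2.N_nonneg)
    show "0 \<le> ?N n" for n using S1.N_nonneg S2.N_nonneg by simp
    show "open (?J n)" for n using open_K by (simp split: prod.split)
    show "is_interval (?J n)" for n using interval_K by (simp split: prod.split)
    show "?J n \<subseteq> {0..1}" for n using S1.J_unit by (auto split: prod.split)
    show "disjoint_family ?J"
      unfolding disjoint_family_on_def
    proof (intro ballI impI)
      fix m n :: nat assume "m \<noteq> n"
      obtain i j i' j' where ij: "prod_decode m = (i, j)" "prod_decode n = (i', j')" by fastforce
      have "(i, j) \<noteq> (i', j')" using \<open>m \<noteq> n\<close> ij by (metis prod_decode_inverse)
      then show "?J m \<inter> ?J n = {}"
      proof (cases "i = i'")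
        case True
        then have "J\<^sub>2 j \<inter> J\<^sub>2 j' = {}" using \<open>(i, j) \<noteq> (i', j')\<close> by (intro disjoint_family_onD[OF S2.J_disjoint]) auto
        then show ?thesis using ij by auto
      next
        case False
        then have "J\<^sub>1 i \<inter> J\<^sub>1 i' = {}" by (intro disjoint_family_onD[OF S1.J_disjoint]) auto
        then show ?thesis using ij by auto
      qed
    qed
    fix n x
    obtain i j where ij: "prod_decode n = (i, j)" by fastforce
    show "monotone_map_on (?J n) ?F" using mono_K ij by simp
    show "\<exists>W. continuous_on (?J n) W \<and> controls W (?J n) (\<lambda>x. \<bar>1 / deriv ?F x\<bar>) \<and>
      (\<forall>x\<in>?J n. 0 \<le> W x \<and> exp (\<theta> * real (?t n)) * W x \<le> ?N n)"
      using control_K[of i j] ij by simp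
    show "1 \<le> ?t n" using S1.t_pos[of i] ij by simp
    assume "x \<in> ?J n"
    then have x: "x \<in> ?K i j" using ij by simp
    show "?F x \<in> {0..1}" using x S2.F_unit by auto
    show "(?F has_real_derivative deriv ?F x) (at x)" using der[OF x] deriv_F[OF x] by simp
    show "deriv ?F x \<noteq> 0" using deriv_F[OF x] S1.F_deriv_nonzero S2.F_deriv_nonzero x by auto
    have 1: "exp (\<theta> * real (t\<^sub>1 i)) * \<bar>1 / deriv F\<^sub>1 x\<bar> \<le> \<rho>\<^sub>1" "exp (\<theta> * real (t\<^sub>1 i)) * \<bar>1 / deriv F\<^sub>1 x\<bar> \<le> N\<^sub>1 i"
      using S1.weight_le_\<rho> S1.weight_le_N x by auto
    have 2: "exp (\<theta> * real (t\<^sub>2 j)) * \<bar>1 / deriv F\<^sub>2 (F\<^sub>1 x)\<bar> \<le> \<rho>\<^sub>2" "exp (\<theta> * real (t\<^sub>2 j)) * \<bar>1 / deriv F\<^sub>2 (F\<^sub>1 x)\<bar> \<le> N\<^sub>2 j"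
      using S2.weight_le_\<rho> S2.weight_le_N x by auto
    have 0: "0 \<le> exp (\<theta> * real (t\<^sub>1 i)) * \<bar>1 / deriv F\<^sub>1 x\<bar>" "0 \<le> exp (\<theta> * real (t\<^sub>2 j)) * \<bar>1 / deriv F\<^sub>2 (F\<^sub>1 x)\<bar>"
      by auto
    have w\<rho>: "exp (\<theta> * real (t\<^sub>1 i + t\<^sub>2 j)) * \<bar>1 / deriv ?F x\<bar> \<le> \<rho>\<^sub>1 * \<rho>\<^sub>2"
      unfolding weight[OF x] using 0 1 2 by (intro mult_mono) linarith+
    show "exp (\<theta> * real (?t n)) * \<bar>1 / deriv ?F x\<bar> \<le> \<rho>\<^sub>1 * \<rho>\<^sub>2" using w\<rho> ij by simp
    have "exp (\<theta> * real (t\<^sub>1 i + t\<^sub>2 j)) * \<bar>1 / deriv ?F x\<bar> \<le> N\<^sub>1 i * N\<^sub>2 j"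
      unfolding weight[OF x] using 0 1 2 by (intro mult_mono) linarith+
    also have "\<dots> \<le> 2 * (N\<^sub>1 i * N\<^sub>2 j)" using S1.N_nonneg S2.N_nonneg by simp
    finally show "exp (\<theta> * real (?t n)) * \<bar>1 / deriv ?F x\<bar> \<le> ?N n" using ij by simp
    have "?F x = (f ^^ t\<^sub>2 j) ((f ^^ t\<^sub>1 i) x)" using S1.F_eq[of x i] S2.F_eq[of "F\<^sub>1 x" j] x by simp
    also have "\<dots> = (f ^^ (t\<^sub>2 j + t\<^sub>1 i)) x" by (simp only: funpow_add comp_apply)
    also have "t\<^sub>2 j + t\<^sub>1 i = t\<^sub>1 i + t\<^sub>2 j" by (rule add.commute)
    finally show "?F x = (f ^^ ?t n) x" using ij by simp
  next
    show "0 < \<theta>" by (rule S1.\<theta>_pos)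
    show "f \<in> measurable leb leb" by (rule S1.f_measurable)
    show "h \<in> borel_measurable leb" by (rule S1.h_measurable)
    show "?F \<in> measurable leb leb" by (rule measurable_comp[OF S1.F_measurable S2.F_measurable])
    have F1_unit: "F\<^sub>1 x \<in> {0..1}" if "x \<in> {0..1}" for x using measurable_space[OF S1.F_measurable, of x] that by simp
    show "AE x in leb. h x \<noteq> 0 \<longrightarrow> x \<in> (\<Union>n. ?J n)"
    proof -
      let ?A = "space leb - (\<Union>j. J\<^sub>2 j)"
      have A: "?A \<in> sets leb" using S2.J_sets by (intro sets.compl_sets sets.countable_UN) auto
      have "AE x in leb. x \<in> ?A \<longrightarrow> h x = 0" using S2.J_cover by eventually_elim auto
      from S1.F_nonsingular[OF A this] S1.J_cover AE_space[of leb] show ?thesis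
      proof eventually_elim
        case (elim x)
        show ?case
        proof
          assume "h x \<noteq> 0"
          then obtain i j where "x \<in> J\<^sub>1 i" "F\<^sub>1 x \<in> J\<^sub>2 j" using elim F1_unit[of x] by auto
          then have "x \<in> ?J (prod_encode (i, j))" by simp
          then show "x \<in> (\<Union>n. ?J n)" by (rule UN_I[OF UNIV_I])
        qed
      qed
    qed
    fix A assume A: "A \<in> sets leb" "AE x in leb. x \<in> A \<longrightarrow> h x = 0"
    let ?A = "F\<^sub>2 -` A \<inter> space leb"
    have A2: "?A \<in> sets leb" using S2.F_measurable A(1) by (rule measurable_sets)
    have "AE x in leb. x \<in> ?A \<longrightarrow> h x = 0" using S2.F_nonsingular[OF A] by eventually_elim auto
    from S1.F_nonsingular[OF A2 this] AE_space[of leb] show "AE x in leb. h x \<noteq> 0 \<longrightarrow> ?F x \<notin> A"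
      by eventually_elim (use F1_unit in auto)
  qed
qed

corollary branch_scheme_power:
  assumes "branch_scheme f h \<theta> \<rho> F t J N"
  shows "\<exists>t' J' N'. branch_scheme f h \<theta> (\<rho> ^ Suc k) (F ^^ Suc k) t' J' N'"
proof (induction k)
  case 0
  have "\<rho> ^ Suc 0 = \<rho>" "F ^^ Suc 0 = F" by simp_all
  then show ?case using assms by (simp only:) blast
next
  case (Suc k)
  then obtain t' J' N' where "branch_scheme f h \<theta> (\<rho> ^ Suc k) (F ^^ Suc k) t' J' N'" by blast
  from branch_scheme_compose[OF this assms]
  have "\<exists>t' J' N'. branch_scheme f h \<theta> (\<rho> ^ Suc k * \<rho>) (F \<circ> F ^^ Suc k) t' J' N'" by blast
  moreover have "\<rho> ^ Suc k * \<rho> = \<rho> ^ Suc (Suc k)" "F \<circ> F ^^ Suc k = F ^^ Suc (Suc k)" by simp_all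
  ultimately show ?case by (simp only:)
qed

section \<open>Mixing for functions\<close>

lemma tendsto_by_approximation:
  fixes a :: "nat \<Rightarrow> nat \<Rightarrow> real"
  assumes a: "\<And>i. (\<lambda>n. a i n) \<longlonglongrightarrow> A i"
    and close: "\<And>i n. \<bar>b n - a i n\<bar> \<le> e i" and limit_close: "\<And>i. \<bar>L - A i\<bar> \<le> e i" and e: "e \<longlonglongrightarrow> 0"
  shows "b \<longlonglongrightarrow> L"
proof (rule LIMSEQ_I)
  fix r :: real assume r: "r > 0"
  have "eventually (\<lambda>i. e i < r / 3) sequentially" using e r by (intro order_tendstoD(2)[OF e]) simp
  then obtain i where i: "e i < r / 3" by (auto simp: eventually_sequentially)
  from LIMSEQ_D[OF a[of i], of "r / 3"] r
  obtain n0 where n0: "\<And>n. n \<ge> n0 \<Longrightarrow> \<bar>a i n - A i\<bar> < r / 3" by auto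
  have "norm (b n - L) < r" if "n \<ge> n0" for n
    using n0[OF that] close[of n i] limit_close[of i] i unfolding real_norm_def by linarith
  then show "\<exists>n0. \<forall>n\<ge>n0. norm (b n - L) < r" by blast
qed

locale invariant_measure = prob_space \<mu> for \<mu> :: "real measure" +
  fixes T :: "real \<Rightarrow> real"
  assumes T_measurable: "T \<in> measurable \<mu> \<mu>" and T_distr: "distr \<mu> \<mu> T = \<mu>"
begin

lemma Tn_measurable: "(T ^^ n) \<in> measurable \<mu> \<mu>"
  by (induction n) (auto simp: comp_def intro: measurable_compose[OF _ T_measurable] measurable_ident)

lemma Tn_distr: "distr \<mu> \<mu> (T ^^ n) = \<mu>"
proof (induction n)
  case 0 then show ?case by (simp add: distr_id id_def)
next
  case (Suc n)
  have "distr \<mu> \<mu> (T ^^ Suc n) = distr (distr \<mu> \<mu> (T ^^ n)) \<mu> T"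
    using distr_distr[OF T_measurable Tn_measurable[of n]] by (simp add: comp_def)
  then show ?case using Suc T_distr by (simp add: comp_def)
qed

lemma integrable_Tn: "integrable \<mu> u \<Longrightarrow> integrable \<mu> (\<lambda>x. u ((T ^^ n) x) :: real)"
  by (rule integrable_distr[OF Tn_measurable]) (simp add: Tn_distr)

lemma integral_Tn: 
  assumes "u \<in> borel_measurable \<mu>" shows "(\<integral>x. u ((T ^^ n) x) \<partial>\<mu>) = (\<integral>x. u x \<partial>\<mu> :: real)"
  using integral_distr[OF Tn_measurable assms, of n] Tn_distr[of n] by simp

lemma L1_approximation:
  fixes u :: "real \<Rightarrow> real"
  assumes s: "\<And>i. integrable \<mu> (s i)" and lim: "\<And>x. x \<in> space \<mu> \<Longrightarrow> (\<lambda>i. s i x) \<longlonglongrightarrow> u x"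
    and bound: "\<And>i x. x \<in> space \<mu> \<Longrightarrow> norm (s i x) \<le> 2 * norm (u x)" and u: "integrable \<mu> u"
  shows "(\<lambda>i. \<integral>x. \<bar>u x - s i x\<bar> \<partial>\<mu>) \<longlonglongrightarrow> 0"
proof -
  have "(\<lambda>i. \<integral>x. \<bar>u x - s i x\<bar> \<partial>\<mu>) \<longlonglongrightarrow> (\<integral>x. 0 \<partial>\<mu>)"
  proof (rule integral_dominated_convergence[where w="\<lambda>x. 3 * \<bar>u x\<bar>"])
    show "integrable \<mu> (\<lambda>x. 3 * \<bar>u x\<bar>)" using u by simp
    show "AE x in \<mu>. (\<lambda>i. \<bar>u x - s i x\<bar>) \<longlonglongrightarrow> 0"
    proof (rule AE_I2)
      fix x assume "x \<in> space \<mu>"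
      then have "(\<lambda>i. \<bar>u x - s i x\<bar>) \<longlonglongrightarrow> \<bar>u x - u x\<bar>" by (intro tendsto_intros lim)
      then show "(\<lambda>i. \<bar>u x - s i x\<bar>) \<longlonglongrightarrow> 0" by simp
    qed
    show "AE x in \<mu>. norm \<bar>u x - s i x\<bar> \<le> 3 * \<bar>u x\<bar>" for i
    proof (rule AE_I2)
      fix x assume "x \<in> space \<mu>"
      then show "norm \<bar>u x - s i x\<bar> \<le> 3 * \<bar>u x\<bar>" using bound[of x i] by simp
    qed
  qed (use s u in auto)
  then show ?thesis by simp
qed

text \<open>Mixing extends from sets to integrable functions, here in the second argument, by approximation.\<close>

lemma mixing_indicator:
  assumes mix: "mixing T \<mu>" and A: "A \<in> sets \<mu>" and w: "integrable \<mu> (w :: real \<Rightarrow> real)"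
  shows "(\<lambda>n. \<integral>x. indicator A x * w ((T ^^ n) x) \<partial>\<mu>) \<longlonglongrightarrow> measure \<mu> A * (\<integral>x. w x \<partial>\<mu>)"
  using w
proof (induction w rule: integrable_induct)
  case (base B c)
  have "(\<lambda>n. measure \<mu> (A \<inter> ((T ^^ n) -` B \<inter> space \<mu>)) * c) \<longlonglongrightarrow> (measure \<mu> A * measure \<mu> B) * c"
    using mix A base(1) unfolding mixing_def by (intro tendsto_intros) auto
  moreover have "(\<integral>x. indicator A x * (indicator B ((T ^^ n) x) *\<^sub>R c) \<partial>\<mu>) = measure \<mu> (A \<inter> ((T ^^ n) -` B \<inter> space \<mu>)) * c" for n
  proof -
    have m: "A \<inter> ((T ^^ n) -` B \<inter> space \<mu>) \<in> sets \<mu>"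
      using A measurable_sets[OF Tn_measurable base(1), of n] by auto
    have "(\<integral>x. indicator A x * (indicator B ((T ^^ n) x) *\<^sub>R c) \<partial>\<mu>) =
        (\<integral>x. indicator (A \<inter> ((T ^^ n) -` B \<inter> space \<mu>)) x * c \<partial>\<mu>)"
      by (intro Bochner_Integration.integral_cong) (auto simp: indicator_def)
    also have "\<dots> = measure \<mu> (A \<inter> ((T ^^ n) -` B \<inter> space \<mu>)) * c" using m by simp
    finally show ?thesis .
  qed
  moreover have "(\<integral>x. indicator B x *\<^sub>R c \<partial>\<mu>) = measure \<mu> B * c"
    using base(1) sets.Int_space_eq2[OF base(1)] by simp
  ultimately show ?case by (simp only: mult.assoc)
next
  case (add u v)
  have "integrable \<mu> (\<lambda>x. indicator A x * u ((T ^^ n) x))" "integrable \<mu> (\<lambda>x. indicator A x * v ((T ^^ n) x))" for n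
    using integrable_mult_indicator[OF A integrable_Tn[OF add.hyps(1), of n]]
      integrable_mult_indicator[OF A integrable_Tn[OF add.hyps(2), of n]] by auto
  then have "(\<integral>x. indicator A x * (u ((T ^^ n) x) + v ((T ^^ n) x)) \<partial>\<mu>) =
     (\<integral>x. indicator A x * u ((T ^^ n) x) \<partial>\<mu>) + (\<integral>x. indicator A x * v ((T ^^ n) x) \<partial>\<mu>)" for n
    by (simp add: distrib_left)
  then show ?case using tendsto_add[OF add.IH] add.hyps by (simp add: distrib_left)
next
  case (lim u s)
  show ?case
  proof (rule tendsto_by_approximation[where a="\<lambda>i n. \<integral>x. indicator A x * s i ((T ^^ n) x) \<partial>\<mu>"])
    show "(\<lambda>n. \<integral>x. indicator A x * s i ((T ^^ n) x) \<partial>\<mu>) \<longlonglongrightarrow> measure \<mu> A * (\<integral>x. s i x \<partial>\<mu>)" for i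
      by (rule lim.IH)
    show "(\<lambda>i. \<integral>x. \<bar>u x - s i x\<bar> \<partial>\<mu>) \<longlonglongrightarrow> 0"
      by (rule L1_approximation[OF lim.hyps])
    fix i
    have ui: "integrable \<mu> (\<lambda>x. \<bar>u x - s i x\<bar>)" using lim.hyps(1,4) by auto
    have "\<bar>(\<integral>x. u x \<partial>\<mu>) - (\<integral>x. s i x \<partial>\<mu>)\<bar> \<le> (\<integral>x. \<bar>u x - s i x\<bar> \<partial>\<mu>)"
      using lim.hyps(1,4) integral_norm_bound[of \<mu> "\<lambda>x. u x - s i x"] by simp
    then have "\<bar>measure \<mu> A\<bar> * \<bar>(\<integral>x. u x \<partial>\<mu>) - (\<integral>x. s i x \<partial>\<mu>)\<bar> \<le> 1 * (\<integral>x. \<bar>u x - s i x\<bar> \<partial>\<mu>)"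
      using prob_le_1[of A] by (intro mult_mono) auto
    then show "\<bar>measure \<mu> A * (\<integral>x. u x \<partial>\<mu>) - measure \<mu> A * (\<integral>x. s i x \<partial>\<mu>)\<bar> \<le> (\<integral>x. \<bar>u x - s i x\<bar> \<partial>\<mu>)"
      by (simp only: abs_mult[symmetric] right_diff_distrib mult_1)
    fix n
    have i1: "integrable \<mu> (\<lambda>x. indicator A x * u ((T ^^ n) x))" and i2: "integrable \<mu> (\<lambda>x. indicator A x * s i ((T ^^ n) x))"
      using integrable_mult_indicator[OF A integrable_Tn[OF lim.hyps(4), of n]]
        integrable_mult_indicator[OF A integrable_Tn[OF lim.hyps(1), of i n]] by auto
    have "\<bar>(\<integral>x. indicator A x * u ((T ^^ n) x) \<partial>\<mu>) - (\<integral>x. indicator A x * s i ((T ^^ n) x) \<partial>\<mu>)\<bar>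
      = \<bar>\<integral>x. indicator A x * u ((T ^^ n) x) - indicator A x * s i ((T ^^ n) x) \<partial>\<mu>\<bar>" using i1 i2 by simp
    also have "\<dots> \<le> (\<integral>x. \<bar>indicator A x * u ((T ^^ n) x) - indicator A x * s i ((T ^^ n) x)\<bar> \<partial>\<mu>)"
      using integral_norm_bound[of \<mu> "\<lambda>x. indicator A x * u ((T ^^ n) x) - indicator A x * s i ((T ^^ n) x)"] by simp
    also have "\<dots> \<le> (\<integral>x. \<bar>u ((T ^^ n) x) - s i ((T ^^ n) x)\<bar> \<partial>\<mu>)"
      using i1 i2 integrable_Tn[OF ui, of n] by (intro integral_mono) (auto simp: indicator_def)
    also have "\<dots> = (\<integral>x. \<bar>u x - s i x\<bar> \<partial>\<mu>)" using integral_Tn[of "\<lambda>x. \<bar>u x - s i x\<bar>" n] ui by simp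
    finally show "\<bar>(\<integral>x. indicator A x * u ((T ^^ n) x) \<partial>\<mu>) - (\<integral>x. indicator A x * s i ((T ^^ n) x) \<partial>\<mu>)\<bar>
      \<le> (\<integral>x. \<bar>u x - s i x\<bar> \<partial>\<mu>)" .
  qed
qed

lemma mixing_functions:
  assumes mix: "mixing T \<mu>" and \<phi>: "integrable \<mu> (\<phi> :: real \<Rightarrow> real)"
    and w: "w \<in> borel_measurable \<mu>" "\<And>x. x \<in> space \<mu> \<Longrightarrow> \<bar>w x\<bar> \<le> (1::real)"
  shows "(\<lambda>n. \<integral>x. \<phi> x * w ((T ^^ n) x) \<partial>\<mu>) \<longlonglongrightarrow> (\<integral>x. \<phi> x \<partial>\<mu>) * (\<integral>x. w x \<partial>\<mu>)"
  using \<phi>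
proof (induction \<phi> rule: integrable_induct)
  have wi: "integrable \<mu> w" using w by (intro integrable_const_bound[of _ 1] AE_I2) auto
  case (base A c)
  have "(\<lambda>n. c * (\<integral>x. indicator A x * w ((T ^^ n) x) \<partial>\<mu>)) \<longlonglongrightarrow> c * (measure \<mu> A * (\<integral>x. w x \<partial>\<mu>))"
    by (intro tendsto_intros mixing_indicator mix base wi)
  then show ?case using base(1) by (simp add: mult_ac)
next
  case (add u v)
  have wT: "\<bar>w ((T ^^ n) x)\<bar> \<le> 1" if "x \<in> space \<mu>" for n x
    using w(2) measurable_space[OF Tn_measurable that, of n] .
  have int: "integrable \<mu> (\<lambda>x. u x * w ((T ^^ n) x))" if u: "integrable \<mu> (u :: real \<Rightarrow> real)" for u n
  proof (rule Bochner_Integration.integrable_bound)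
    show "integrable \<mu> u" by (rule u)
    show "(\<lambda>x. u x * w ((T ^^ n) x)) \<in> borel_measurable \<mu>"
      using u measurable_compose[OF Tn_measurable w(1), of n] by simp
    show "AE x in \<mu>. norm (u x * w ((T ^^ n) x)) \<le> norm (u x)"
      using wT by (intro AE_I2) (simp add: abs_mult mult_left_le)
  qed
  have "(\<integral>x. (u x + v x) * w ((T ^^ n) x) \<partial>\<mu>) = (\<integral>x. u x * w ((T ^^ n) x) \<partial>\<mu>) + (\<integral>x. v x * w ((T ^^ n) x) \<partial>\<mu>)" for n
    using int[OF \<open>integrable \<mu> u\<close>, of n] int[OF \<open>integrable \<mu> v\<close>, of n] by (simp add: distrib_right)
  moreover have "(\<lambda>n. (\<integral>x. u x * w ((T ^^ n) x) \<partial>\<mu>) + (\<integral>x. v x * w ((T ^^ n) x) \<partial>\<mu>)) \<longlonglongrightarrow>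
      (\<integral>x. u x \<partial>\<mu>) * (\<integral>x. w x \<partial>\<mu>) + (\<integral>x. v x \<partial>\<mu>) * (\<integral>x. w x \<partial>\<mu>)"
    by (rule tendsto_add) fact+
  ultimately show ?case using \<open>integrable \<mu> u\<close> \<open>integrable \<mu> v\<close> by (simp add: distrib_right)
next
  case (lim u s)
  have wT: "\<bar>w ((T ^^ n) x)\<bar> \<le> 1" if "x \<in> space \<mu>" for n x
    using w(2) measurable_space[OF Tn_measurable that, of n] .
  have pw: "norm (u x * w ((T ^^ n) x)) \<le> norm (u x)" if "x \<in> space \<mu>" for u :: "real \<Rightarrow> real" and n x
    using wT[OF that, of n] by (simp add: abs_mult mult_left_le)
  have int: "integrable \<mu> (\<lambda>x. u x * w ((T ^^ n) x))" if u: "integrable \<mu> (u :: real \<Rightarrow> real)" for u n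
  proof (rule Bochner_Integration.integrable_bound)
    show "integrable \<mu> u" by (rule u)
    show "(\<lambda>x. u x * w ((T ^^ n) x)) \<in> borel_measurable \<mu>"
      using u measurable_compose[OF Tn_measurable w(1), of n] by simp
    show "AE x in \<mu>. norm (u x * w ((T ^^ n) x)) \<le> norm (u x)"
      using pw by (intro AE_I2)
  qed
  have wi: "integrable \<mu> w" using w by (intro integrable_const_bound[of _ 1] AE_I2) auto
  have w1: "\<bar>\<integral>x. w x \<partial>\<mu>\<bar> \<le> 1"
  proof -
    have "norm (\<integral>x. w x \<partial>\<mu>) \<le> (\<integral>x. \<bar>w x\<bar> \<partial>\<mu>)" using integral_norm_bound[of \<mu> w] by simp
    also have "\<dots> \<le> (\<integral>x. 1 \<partial>\<mu>)" using wi w(2) by (intro integral_mono) auto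
    finally show ?thesis by (simp add: prob_space)
  qed
  show ?case
  proof (rule tendsto_by_approximation[where a="\<lambda>i n. \<integral>x. s i x * w ((T ^^ n) x) \<partial>\<mu>"])
    show "(\<lambda>n. \<integral>x. s i x * w ((T ^^ n) x) \<partial>\<mu>) \<longlonglongrightarrow> (\<integral>x. s i x \<partial>\<mu>) * (\<integral>x. w x \<partial>\<mu>)" for i
      by (rule lim.IH)
    show "(\<lambda>i. \<integral>x. \<bar>u x - s i x\<bar> \<partial>\<mu>) \<longlonglongrightarrow> 0"
      by (rule L1_approximation[OF lim.hyps])
    fix i
    have ui: "integrable \<mu> (\<lambda>x. u x - s i x)" using lim.hyps(1,4) by auto
    have "\<bar>(\<integral>x. u x \<partial>\<mu>) - (\<integral>x. s i x \<partial>\<mu>)\<bar> \<le> (\<integral>x. \<bar>u x - s i x\<bar> \<partial>\<mu>)"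
      using lim.hyps(1,4) integral_norm_bound[of \<mu> "\<lambda>x. u x - s i x"] by simp
    then have "\<bar>(\<integral>x. u x \<partial>\<mu>) - (\<integral>x. s i x \<partial>\<mu>)\<bar> * \<bar>\<integral>x. w x \<partial>\<mu>\<bar> \<le> (\<integral>x. \<bar>u x - s i x\<bar> \<partial>\<mu>) * 1"
      using w1 by (intro mult_mono) auto
    then show "\<bar>(\<integral>x. u x \<partial>\<mu>) * (\<integral>x. w x \<partial>\<mu>) - (\<integral>x. s i x \<partial>\<mu>) * (\<integral>x. w x \<partial>\<mu>)\<bar> \<le> (\<integral>x. \<bar>u x - s i x\<bar> \<partial>\<mu>)"
      by (simp only: abs_mult[symmetric] left_diff_distrib mult_1_right)
    fix n
    have "\<bar>(\<integral>x. u x * w ((T ^^ n) x) \<partial>\<mu>) - (\<integral>x. s i x * w ((T ^^ n) x) \<partial>\<mu>)\<bar>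
      = \<bar>\<integral>x. (u x - s i x) * w ((T ^^ n) x) \<partial>\<mu>\<bar>"
      using int[OF lim.hyps(4), of n] int[OF lim.hyps(1), of i n] by (simp add: left_diff_distrib)
    also have "\<dots> \<le> (\<integral>x. \<bar>(u x - s i x) * w ((T ^^ n) x)\<bar> \<partial>\<mu>)"
      using integral_norm_bound[of \<mu> "\<lambda>x. (u x - s i x) * w ((T ^^ n) x)"] by simp
    also have "\<dots> \<le> (\<integral>x. \<bar>u x - s i x\<bar> \<partial>\<mu>)"
      using int[OF ui, of n] ui pw[of _ "\<lambda>x. u x - s i x" n] by (intro integral_mono) auto
    finally show "\<bar>(\<integral>x. u x * w ((T ^^ n) x) \<partial>\<mu>) - (\<integral>x. s i x * w ((T ^^ n) x) \<partial>\<mu>)\<bar>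
      \<le> (\<integral>x. \<bar>u x - s i x\<bar> \<partial>\<mu>)" .
  qed
qed

text \<open>A Lebesgue density that vanishes on \<open>\<mu>\<close>-null sets is a density with respect to \<open>\<mu>\<close> (Radon--Nikodym), to which
  mixing applies.\<close>

lemma mixing_pairing_null_nonneg:
  fixes g w :: "real \<Rightarrow> real"
  assumes mix: "mixing T \<mu>" and sets_eq: "sets \<mu> = sets leb"
    and g: "integrable leb g" "\<And>x. 0 \<le> g x"
    and ac: "\<And>A. A \<in> sets leb \<Longrightarrow> emeasure \<mu> A = 0 \<Longrightarrow> AE x in leb. x \<in> A \<longrightarrow> g x = 0"
    and w: "w \<in> borel_measurable leb" "\<And>x. x \<in> {0..1} \<Longrightarrow> \<bar>w x\<bar> \<le> 1" and w0: "(\<integral>x. w x \<partial>\<mu>) = 0"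
  shows "(\<lambda>n. \<integral>x. g x * w ((T ^^ n) x) \<partial>leb) \<longlonglongrightarrow> 0"
proof -
  let ?\<nu> = "density leb (\<lambda>x. ennreal (g x))"
  have gm: "g \<in> borel_measurable leb" using g by auto
  have sp: "space \<mu> = {0..1}" using sets_eq_imp_space_eq[OF sets_eq] by simp
  have meas_eq: "borel_measurable \<mu> = (borel_measurable leb :: (real \<Rightarrow> real) set)"
    by (rule measurable_cong_sets[OF sets_eq refl])
  have acont: "absolutely_continuous \<mu> ?\<nu>"
    unfolding absolutely_continuous_def
  proof
    fix A assume "A \<in> null_sets \<mu>"
    then have A: "A \<in> sets leb" "emeasure \<mu> A = 0" using sets_eq by auto
    have "AE x in leb. x \<in> A \<longrightarrow> ennreal (g x) = 0" using ac[OF A] by eventually_elim auto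
    then show "A \<in> null_sets ?\<nu>" using A gm by (subst null_sets_density_iff) auto
  qed
  have fin: "emeasure ?\<nu> (space ?\<nu>) \<noteq> top"
  proof -
    have "emeasure ?\<nu> (space ?\<nu>) = (\<integral>\<^sup>+x. ennreal (g x) \<partial>leb)"
      using gm by (simp add: emeasure_density cong: nn_integral_cong_simp)
    also have "\<dots> = ennreal (\<integral>x. g x \<partial>leb)" using g by (intro nn_integral_eq_integral) auto
    finally show ?thesis by simp
  qed
  have fm: "finite_measure ?\<nu>" using fin by (intro finite_measureI) auto
  have sn: "sets ?\<nu> = sets \<mu>" using sets_eq by simp
  obtain \<kappa> where \<kappa>: "\<kappa> \<in> borel_measurable \<mu>" "AE x in \<mu>. RN_deriv \<mu> ?\<nu> x = ennreal (\<kappa> x)" "\<And>x. 0 \<le> \<kappa> x"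
    using real_RN_deriv[OF fm acont sn] by blast
  have dens: "density \<mu> (\<lambda>x. ennreal (\<kappa> x)) = ?\<nu>"
  proof -
    have "density \<mu> (\<lambda>x. ennreal (\<kappa> x)) = density \<mu> (RN_deriv \<mu> ?\<nu>)"
      using \<kappa> by (intro density_cong) auto
    then show ?thesis using density_RN_deriv[OF acont sn] by simp
  qed
  have conv: "(\<integral>x. g x * u x \<partial>leb) = (\<integral>x. \<kappa> x * u x \<partial>\<mu>)" if u: "u \<in> borel_measurable leb" for u :: "real \<Rightarrow> real"
  proof -
    have "(\<integral>x. g x * u x \<partial>leb) = (\<integral>x. u x \<partial>?\<nu>)"
      using u gm g by (subst integral_density) auto
    also have "\<dots> = (\<integral>x. \<kappa> x * u x \<partial>\<mu>)"
      unfolding dens[symmetric] using u \<kappa> by (subst integral_density) (auto simp: meas_eq)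
    finally show ?thesis .
  qed
  have \<kappa>i: "integrable \<mu> \<kappa>"
  proof (rule integrableI_nonneg)
    have "(\<integral>\<^sup>+x. ennreal (\<kappa> x) \<partial>\<mu>) = emeasure (density \<mu> (\<lambda>x. ennreal (\<kappa> x))) (space \<mu>)"
      using \<kappa> by (simp add: emeasure_density cong: nn_integral_cong_simp)
    also have "\<dots> < \<infinity>" unfolding dens using fin sp by (simp add: less_top)
    finally show "(\<integral>\<^sup>+x. ennreal (\<kappa> x) \<partial>\<mu>) < \<infinity>" .
  qed (use \<kappa> in auto)
  have wm: "w \<in> borel_measurable \<mu>" using w meas_eq by auto
  have "(\<lambda>n. \<integral>x. \<kappa> x * w ((T ^^ n) x) \<partial>\<mu>) \<longlonglongrightarrow> (\<integral>x. \<kappa> x \<partial>\<mu>) * (\<integral>x. w x \<partial>\<mu>)"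
    by (rule mixing_functions[OF mix \<kappa>i wm]) (use w(2) sp in auto)
  moreover have "(\<integral>x. g x * w ((T ^^ n) x) \<partial>leb) = (\<integral>x. \<kappa> x * w ((T ^^ n) x) \<partial>\<mu>)" for n
    using measurable_compose[OF Tn_measurable wm, of n] meas_eq by (intro conv) auto
  ultimately show ?thesis using w0 by simp
qed

lemma mixing_pairing_null:
  fixes g w :: "real \<Rightarrow> real"
  assumes mix: "mixing T \<mu>" and sets_eq: "sets \<mu> = sets leb"
    and g: "integrable leb g"
    and ac: "\<And>A. A \<in> sets leb \<Longrightarrow> emeasure \<mu> A = 0 \<Longrightarrow> AE x in leb. x \<in> A \<longrightarrow> g x = 0"
    and w: "w \<in> borel_measurable leb" "\<And>x. x \<in> {0..1} \<Longrightarrow> \<bar>w x\<bar> \<le> 1" and w0: "(\<integral>x. w x \<partial>\<mu>) = 0"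
  shows "(\<lambda>n. \<integral>x. g x * w ((T ^^ n) x) \<partial>leb) \<longlonglongrightarrow> 0"
proof -
  have sp: "space \<mu> = {0..1}" using sets_eq_imp_space_eq[OF sets_eq] by simp
  have Tm: "(T ^^ n) \<in> measurable leb leb" for n
    using Tn_measurable[of n] measurable_cong_sets[OF sets_eq sets_eq] by auto
  have Tu: "(T ^^ n) x \<in> {0..1}" if "x \<in> {0..1}" for n x using measurable_space[OF Tm, of x n] that by simp
  have lim: "(\<lambda>n. \<integral>x. max (c * g x) 0 * w ((T ^^ n) x) \<partial>leb) \<longlonglongrightarrow> 0" for c :: real
  proof (rule mixing_pairing_null_nonneg[OF mix sets_eq _ _ _ w w0])
    show "AE x in leb. x \<in> A \<longrightarrow> max (c * g x) 0 = 0" if "A \<in> sets leb" "emeasure \<mu> A = 0" for A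
      using ac[OF that] by eventually_elim auto
  qed (use g in auto)
  have int: "integrable leb (\<lambda>x. max (c * g x) 0 * w ((T ^^ n) x))" for c n
  proof (rule Bochner_Integration.integrable_bound)
    show "integrable leb (\<lambda>x. max (c * g x) 0)" using g by auto
    show "(\<lambda>x. max (c * g x) 0 * w ((T ^^ n) x)) \<in> borel_measurable leb"
      using g measurable_compose[OF Tm w(1), of n] by (intro borel_measurable_times) auto
    show "AE x in leb. norm (max (c * g x) 0 * w ((T ^^ n) x)) \<le> norm (max (c * g x) 0)"
    proof (rule AE_I2)
      fix x assume "x \<in> space leb"
      then have "\<bar>w ((T ^^ n) x)\<bar> \<le> 1" using w(2) Tu by simp
      then show "norm (max (c * g x) 0 * w ((T ^^ n) x)) \<le> norm (max (c * g x) 0)"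
        by (simp add: abs_mult mult_left_le)
    qed
  qed
  have "(\<integral>x. g x * w ((T ^^ n) x) \<partial>leb) =
     (\<integral>x. max (1 * g x) 0 * w ((T ^^ n) x) \<partial>leb) - (\<integral>x. max (- 1 * g x) 0 * w ((T ^^ n) x) \<partial>leb)" for n
    unfolding Bochner_Integration.integral_diff[OF int int, symmetric]
    by (intro Bochner_Integration.integral_cong) (auto simp: max_def algebra_simps)
  then show ?thesis using tendsto_diff[OF lim[of 1] lim[of "-1"]] by simp
qed

end

section \<open>Recurrence of critical orbits is subexponential\<close>

definition unit_sides :: "one_sided set" where
  "unit_sides = RightOf ` {0..<1} \<union> LeftOf ` {0<..1}"

lemma side_nontrivial [simp]: "side p \<noteq> bot"
  by (cases p) (auto simp: trivial_limit_at_right_real trivial_limit_at_left_real)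

lemma eventually_side: "eventually Q (side p) \<longleftrightarrow> (\<exists>\<eta>>0. \<forall>x\<in>\<Delta>1 p \<eta>. Q x)"
proof (cases p)
  case (RightOf a)
  have "eventually Q (at_right a) \<longleftrightarrow> (\<exists>b>a. \<forall>y>a. y < b \<longrightarrow> Q y)" by (rule eventually_at_right_field)
  also have "\<dots> \<longleftrightarrow> (\<exists>\<eta>>0. \<forall>x\<in>{a<..<a + \<eta>}. Q x)"
  proof safe
    fix b assume "b > a" "\<forall>y>a. y < b \<longrightarrow> Q y"
    then show "\<exists>\<eta>>0. \<forall>x\<in>{a<..<a + \<eta>}. Q x" by (intro exI[of _ "b - a"]) auto
  next
    fix \<eta> :: real assume "\<eta> > 0" "\<forall>x\<in>{a<..<a + \<eta>}. Q x"
    then show "\<exists>b>a. \<forall>y>a. y < b \<longrightarrow> Q y" by (intro exI[of _ "a + \<eta>"]) auto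
  qed
  finally show ?thesis using RightOf by simp
next
  case (LeftOf a)
  have "eventually Q (at_left a) \<longleftrightarrow> (\<exists>b<a. \<forall>y>b. y < a \<longrightarrow> Q y)" by (rule eventually_at_left_field)
  also have "\<dots> \<longleftrightarrow> (\<exists>\<eta>>0. \<forall>x\<in>{a - \<eta><..<a}. Q x)"
  proof safe
    fix b assume "b < a" "\<forall>y>b. y < a \<longrightarrow> Q y"
    then show "\<exists>\<eta>>0. \<forall>x\<in>{a - \<eta><..<a}. Q x" by (intro exI[of _ "a - b"]) auto
  next
    fix \<eta> :: real assume "\<eta> > 0" "\<forall>x\<in>{a - \<eta><..<a}. Q x"
    then show "\<exists>b<a. \<forall>y>b. y < a \<longrightarrow> Q y" by (intro exI[of _ "a - \<eta>"]) auto
  qed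
  finally show ?thesis using LeftOf by simp
qed

lemma \<Delta>1_subset: "\<eta> \<le> \<eta>' \<Longrightarrow> \<Delta>1 p \<eta> \<subseteq> \<Delta>1 p \<eta>'"
  by (cases p) auto

lemma eventually_\<Delta>1: "\<eta> > 0 \<Longrightarrow> eventually (\<lambda>x. x \<in> \<Delta>1 p \<eta>) (side p)"
  unfolding eventually_side by blast

lemma \<Delta>1_interval: "is_interval (\<Delta>1 p \<eta>)" and \<Delta>1_open: "open (\<Delta>1 p \<eta>)"
  by (cases p; simp add: is_interval_1)+

lemma \<Delta>1_dist: "x \<in> \<Delta>1 p \<eta> \<Longrightarrow> 0 < \<bar>x - pt p\<bar> \<and> \<bar>x - pt p\<bar> < \<eta>"
  by (cases p) auto

lemma side_le_nhds: "side p \<le> nhds (pt p)"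
  by (cases p) (auto simp: at_within_def)

lemma side_tendsto_pt: "((\<lambda>x. x) \<longlongrightarrow> pt p) (side p)"
  using side_le_nhds by (simp add: filterlim_def)

lemma eventually_unit: "p \<in> unit_sides \<Longrightarrow> eventually (\<lambda>x. x \<in> {0..1}) (side p)"
proof -
  assume "p \<in> unit_sides"
  then have "\<exists>\<eta>>0. \<forall>x\<in>\<Delta>1 p \<eta>. x \<in> {0..1}"
  proof (cases p)
    case (RightOf a) with \<open>p \<in> unit_sides\<close> show ?thesis by (intro exI[of _ "1 - a"]) (auto simp: unit_sides_def)
  next
    case (LeftOf a) with \<open>p \<in> unit_sides\<close> show ?thesis by (intro exI[of _ a]) (auto simp: unit_sides_def)
  qed
  then show ?thesis by (simp add: eventually_side)
qed

lemma pt_unit: "p \<in> unit_sides \<Longrightarrow> pt p \<in> {0..1}"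
  by (auto simp: unit_sides_def)

lemma frequently_interval_side:
  assumes J: "is_interval J" and fr: "frequently (\<lambda>x. x \<in> J) (side p)"
  shows "eventually (\<lambda>x. x \<in> interior J) (side p)"
proof -
  have ex: "\<exists>y\<in>\<Delta>1 p \<eta>. y \<in> J" if "\<eta> > 0" for \<eta>
  proof -
    have "frequently (\<lambda>x. x \<in> J \<and> x \<in> \<Delta>1 p \<eta>) (side p)"
      by (rule frequently_eventually_frequently[OF fr eventually_\<Delta>1[OF that]])
    then show ?thesis by (auto dest: frequently_ex)
  qed
  obtain y where y: "y \<in> \<Delta>1 p 1" "y \<in> J" using ex[of 1] by auto
  define \<eta> where "\<eta> = \<bar>y - pt p\<bar>"
  have \<eta>: "\<eta> > 0" using \<Delta>1_dist[OF y(1)] by (simp add: \<eta>_def)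
  have "\<Delta>1 p \<eta> \<subseteq> J"
  proof
    fix z assume z: "z \<in> \<Delta>1 p \<eta>"
    obtain y' where y': "y' \<in> \<Delta>1 p \<bar>z - pt p\<bar>" "y' \<in> J" using ex[of "\<bar>z - pt p\<bar>"] \<Delta>1_dist[OF z] by auto
    show "z \<in> J"
    proof (cases p)
      case (RightOf a)
      then show ?thesis using mem_is_interval_1_I[OF J y'(2) y(2), of z] y' y z by (auto simp: \<eta>_def)
    next
      case (LeftOf a)
      then show ?thesis using mem_is_interval_1_I[OF J y(2) y'(2), of z] y' y z by (auto simp: \<eta>_def)
    qed
  qed
  then have "\<Delta>1 p \<eta> \<subseteq> interior J" using \<Delta>1_open by (rule interior_maximal)
  then show ?thesis using eventually_\<Delta>1[OF \<eta>, of p] by (auto elim: eventually_mono)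
qed

text \<open>Near the one-sided point \<open>p\<close>, the distance of \<open>g\<close> to its limit \<open>z\<close> is comparable to the power \<open>e\<close> of the
  distance to \<open>p\<close>, and the derivative is at most of the corresponding order.\<close>

definition power_law :: "(real \<Rightarrow> real) \<Rightarrow> one_sided \<Rightarrow> real \<Rightarrow> real \<Rightarrow> bool" where
  "power_law g p z e \<longleftrightarrow> (\<exists>K\<^sub>1>0. \<exists>K\<^sub>2>0. eventually (\<lambda>x. g field_differentiable at x \<and>
      K\<^sub>1 * \<bar>x - pt p\<bar> powr e \<le> \<bar>g x - z\<bar> \<and> \<bar>g x - z\<bar> \<le> K\<^sub>2 * \<bar>x - pt p\<bar> powr e \<and>
      \<bar>deriv g x\<bar> \<le> K\<^sub>2 * \<bar>x - pt p\<bar> powr (e - 1)) (side p))"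

lemma power_lawD:
  assumes "power_law g p z e"
  shows "eventually (\<lambda>x. g field_differentiable at x) (side p)"
    and "\<exists>K>0. eventually (\<lambda>x. K * \<bar>x - pt p\<bar> powr e \<le> \<bar>g x - z\<bar>) (side p)"
    and "\<exists>K>0. eventually (\<lambda>x. \<bar>deriv g x\<bar> \<le> K * \<bar>x - pt p\<bar> powr (e - 1)) (side p)"
proof -
  obtain K\<^sub>1 K\<^sub>2 where K: "K\<^sub>1 > 0" "K\<^sub>2 > 0" and ev: "eventually (\<lambda>x. g field_differentiable at x \<and>
      K\<^sub>1 * \<bar>x - pt p\<bar> powr e \<le> \<bar>g x - z\<bar> \<and> \<bar>g x - z\<bar> \<le> K\<^sub>2 * \<bar>x - pt p\<bar> powr e \<and>
      \<bar>deriv g x\<bar> \<le> K\<^sub>2 * \<bar>x - pt p\<bar> powr (e - 1)) (side p)"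
    using assms unfolding power_law_def by blast
  show "eventually (\<lambda>x. g field_differentiable at x) (side p)" using ev by (rule eventually_mono) simp
  have "eventually (\<lambda>x. K\<^sub>1 * \<bar>x - pt p\<bar> powr e \<le> \<bar>g x - z\<bar>) (side p)" using ev by (rule eventually_mono) simp
  then show "\<exists>K>0. eventually (\<lambda>x. K * \<bar>x - pt p\<bar> powr e \<le> \<bar>g x - z\<bar>) (side p)" using K(1) by blast
  have "eventually (\<lambda>x. \<bar>deriv g x\<bar> \<le> K\<^sub>2 * \<bar>x - pt p\<bar> powr (e - 1)) (side p)" using ev by (rule eventually_mono) simp
  then show "\<exists>K>0. eventually (\<lambda>x. \<bar>deriv g x\<bar> \<le> K * \<bar>x - pt p\<bar> powr (e - 1)) (side p)" using K(2) by blast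
qed

text \<open>The exponents of the derivative bounds add up to \<open>e * (e' - 1) + (e - 1) = e * e' - 1\<close>, as they should.\<close>

lemma power_law_compose:
  assumes gp: "power_law g p (pt q) e" and gq: "filterlim g (side q) (side p)"
    and fq: "power_law f q z e'" and e': "e' > 0"
  shows "power_law (\<lambda>x. f (g x)) p z (e * e')"
proof -
  obtain K\<^sub>1 K\<^sub>2 where K: "K\<^sub>1 > 0" "K\<^sub>2 > 0" and evg: "eventually (\<lambda>x. g field_differentiable at x \<and>
      K\<^sub>1 * \<bar>x - pt p\<bar> powr e \<le> \<bar>g x - pt q\<bar> \<and> \<bar>g x - pt q\<bar> \<le> K\<^sub>2 * \<bar>x - pt p\<bar> powr e \<and>
      \<bar>deriv g x\<bar> \<le> K\<^sub>2 * \<bar>x - pt p\<bar> powr (e - 1)) (side p)"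
    using gp unfolding power_law_def by blast
  obtain L\<^sub>1 L\<^sub>2 where L: "L\<^sub>1 > 0" "L\<^sub>2 > 0" and evf: "eventually (\<lambda>y. f field_differentiable at y \<and>
      L\<^sub>1 * \<bar>y - pt q\<bar> powr e' \<le> \<bar>f y - z\<bar> \<and> \<bar>f y - z\<bar> \<le> L\<^sub>2 * \<bar>y - pt q\<bar> powr e' \<and>
      \<bar>deriv f y\<bar> \<le> L\<^sub>2 * \<bar>y - pt q\<bar> powr (e' - 1)) (side q)"
    using fq unfolding power_law_def by blast
  define m where "m = max (K\<^sub>1 powr (e' - 1)) (K\<^sub>2 powr (e' - 1))"
  define M\<^sub>1 M\<^sub>2 where "M\<^sub>1 = L\<^sub>1 * K\<^sub>1 powr e'" and "M\<^sub>2 = max (L\<^sub>2 * K\<^sub>2 powr e') (L\<^sub>2 * m * K\<^sub>2)"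
  have pos: "0 < M\<^sub>1" "0 < M\<^sub>2" "0 < m" using K L by (auto simp: M\<^sub>1_def M\<^sub>2_def m_def less_max_iff_disj)
  have "eventually (\<lambda>x. (\<lambda>x. f (g x)) field_differentiable at x \<and>
      M\<^sub>1 * \<bar>x - pt p\<bar> powr (e * e') \<le> \<bar>f (g x) - z\<bar> \<and> \<bar>f (g x) - z\<bar> \<le> M\<^sub>2 * \<bar>x - pt p\<bar> powr (e * e') \<and>
      \<bar>deriv (\<lambda>x. f (g x)) x\<bar> \<le> M\<^sub>2 * \<bar>x - pt p\<bar> powr (e * e' - 1)) (side p)"
    using evg filterlim_iff[THEN iffD1, OF gq, rule_format, OF evf] eventually_\<Delta>1[of 1 p, OF zero_less_one]
  proof eventually_elim
    case (elim x)
    define r where "r = \<bar>x - pt p\<bar>"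
    define s where "s = \<bar>g x - pt q\<bar>"
    have r: "r > 0" using \<Delta>1_dist elim(3) by (auto simp: r_def)
    have s: "K\<^sub>1 * r powr e \<le> s" "s \<le> K\<^sub>2 * r powr e" using elim(1) by (auto simp: r_def s_def)
    have "0 < K\<^sub>1 * r powr e" using K r by simp
    then have s0: "s > 0" using s(1) by linarith
    have sl: "K\<^sub>1 powr e' * r powr (e * e') \<le> s powr e'"
    proof -
      have "(K\<^sub>1 * r powr e) powr e' \<le> s powr e'" using s(1) K r e' by (intro powr_mono2) auto
      then show ?thesis using K r by (simp add: powr_mult powr_powr)
    qed
    have su: "s powr e' \<le> K\<^sub>2 powr e' * r powr (e * e')"
    proof -
      have "s powr e' \<le> (K\<^sub>2 * r powr e) powr e'" using s(2) s0 e' by (intro powr_mono2) auto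
      then show ?thesis using K r by (simp add: powr_mult powr_powr)
    qed
    have sd: "s powr (e' - 1) \<le> m * r powr (e * (e' - 1))"
    proof (cases "e' \<ge> 1")
      case True
      have "s powr (e' - 1) \<le> (K\<^sub>2 * r powr e) powr (e' - 1)" using s(2) s0 True by (intro powr_mono2) auto
      also have "\<dots> = K\<^sub>2 powr (e' - 1) * r powr (e * (e' - 1))" using K r by (simp add: powr_mult powr_powr)
      also have "\<dots> \<le> m * r powr (e * (e' - 1))" by (intro mult_right_mono) (auto simp: m_def)
      finally show ?thesis .
    next
      case False
      have "s powr (e' - 1) \<le> (K\<^sub>1 * r powr e) powr (e' - 1)"
        using s(1) K r False by (intro powr_mono2') auto
      also have "\<dots> = K\<^sub>1 powr (e' - 1) * r powr (e * (e' - 1))" using K r by (simp add: powr_mult powr_powr)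
      also have "\<dots> \<le> m * r powr (e * (e' - 1))" by (intro mult_right_mono) (auto simp: m_def)
      finally show ?thesis .
    qed
    have dg: "\<bar>deriv g x\<bar> \<le> K\<^sub>2 * r powr (e - 1)" using elim(1) by (simp add: r_def)
    have df: "\<bar>deriv f (g x)\<bar> \<le> L\<^sub>2 * s powr (e' - 1)" using elim(2) by (simp add: s_def)
    have diff: "(\<lambda>x. f (g x)) field_differentiable at x" and
      chain: "deriv (\<lambda>x. f (g x)) x = deriv f (g x) * deriv g x"
      using field_differentiable_compose[of g x f] deriv_chain[of g x f] elim(1,2) by (auto simp: comp_def)
    have "\<bar>deriv (\<lambda>x. f (g x)) x\<bar> \<le> (L\<^sub>2 * (m * r powr (e * (e' - 1)))) * (K\<^sub>2 * r powr (e - 1))"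
      unfolding chain abs_mult using df sd dg L pos
      by (intro mult_mono order_trans[OF df] mult_left_mono) auto
    also have "\<dots> = L\<^sub>2 * m * K\<^sub>2 * (r powr (e * (e' - 1)) * r powr (e - 1))" by (simp add: mult_ac)
    also have "r powr (e * (e' - 1)) * r powr (e - 1) = r powr (e * e' - 1)"
      by (simp add: powr_add[symmetric] algebra_simps)
    also have "L\<^sub>2 * m * K\<^sub>2 * r powr (e * e' - 1) \<le> M\<^sub>2 * r powr (e * e' - 1)"
      by (intro mult_right_mono) (auto simp: M\<^sub>2_def)
    finally have 3: "\<bar>deriv (\<lambda>x. f (g x)) x\<bar> \<le> M\<^sub>2 * r powr (e * e' - 1)" .
    have "M\<^sub>1 * r powr (e * e') = L\<^sub>1 * (K\<^sub>1 powr e' * r powr (e * e'))" by (simp add: M\<^sub>1_def)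
    also have "\<dots> \<le> L\<^sub>1 * s powr e'" using sl L by (intro mult_left_mono) auto
    also have "\<dots> \<le> \<bar>f (g x) - z\<bar>" using elim(2) by (simp add: s_def)
    finally have 1: "M\<^sub>1 * r powr (e * e') \<le> \<bar>f (g x) - z\<bar>" .
    have "\<bar>f (g x) - z\<bar> \<le> L\<^sub>2 * s powr e'" using elim(2) by (simp add: s_def)
    also have "\<dots> \<le> L\<^sub>2 * (K\<^sub>2 powr e' * r powr (e * e'))" using su L by (intro mult_left_mono) auto
    also have "\<dots> = L\<^sub>2 * K\<^sub>2 powr e' * r powr (e * e')" by simp
    also have "\<dots> \<le> M\<^sub>2 * r powr (e * e')" by (intro mult_right_mono) (auto simp: M\<^sub>2_def)
    finally have 2: "\<bar>f (g x) - z\<bar> \<le> M\<^sub>2 * r powr (e * e')" .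
    show ?case using diff 1 2 3 by (simp add: r_def)
  qed
  then show ?thesis unfolding power_law_def using pos(1,2) by blast
qed

text \<open>Since \<open>e > 0\<close>, the exponent \<open>e - 1\<close> exceeds \<open>-1\<close>.\<close>

lemma power_law_derivative_bound:
  assumes "power_law g p z e" "e > 0"
  shows "\<exists>C>0. \<exists>\<eta>>0. \<forall>x\<in>\<Delta>1 p \<eta>. \<bar>deriv g x\<bar> \<le> C / \<bar>x - pt p\<bar>"
proof -
  obtain K\<^sub>2 where K: "K\<^sub>2 > 0" and ev: "eventually (\<lambda>x. \<bar>deriv g x\<bar> \<le> K\<^sub>2 * \<bar>x - pt p\<bar> powr (e - 1)) (side p)"
    using power_lawD(3)[OF assms(1)] by blast
  from ev eventually_\<Delta>1[of 1 p, OF zero_less_one]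
  have "eventually (\<lambda>x. \<bar>deriv g x\<bar> \<le> K\<^sub>2 / \<bar>x - pt p\<bar>) (side p)"
  proof eventually_elim
    case (elim x)
    have r: "0 < \<bar>x - pt p\<bar>" "\<bar>x - pt p\<bar> < 1" using \<Delta>1_dist[OF elim(2)] by auto
    have "\<bar>x - pt p\<bar> powr (e - 1) \<le> \<bar>x - pt p\<bar> powr (- 1)"
      using r assms(2) by (intro powr_mono') auto
    also have "\<dots> = 1 / \<bar>x - pt p\<bar>" using r by (simp add: powr_minus_divide)
    finally have "K\<^sub>2 * \<bar>x - pt p\<bar> powr (e - 1) \<le> K\<^sub>2 * (1 / \<bar>x - pt p\<bar>)" using K by (intro mult_left_mono) auto
    then show ?case using elim(1) by simp
  qed
  then show ?thesis using K unfolding eventually_side by blast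
qed

locale critical_map =
  fixes f :: "real \<Rightarrow> real" and l :: "one_sided \<Rightarrow> real"
  assumes smooth: "piecewise_smooth f" and finite_crit: "finite (crit f)" and A1: "A1 f l"
begin

lemma crit_unit_sides: "crit f \<subseteq> unit_sides"
  by (auto simp: crit_def unit_sides_def)

lemma f_unit: "x \<in> {0..1} \<Longrightarrow> f x \<in> {0..1}"
  using smooth unfolding piecewise_smooth_def by blast

lemma one_sided_smooth:
  assumes p: "p \<in> unit_sides"
  obtains J g where "eventually (\<lambda>x. x \<in> interior J) (side p)" "is_interval J" "C2_on f (interior J)"
    "continuous_on (closure J) g" "\<And>x. x \<in> interior J \<Longrightarrow> g x = f x"
proof -
  obtain \<J> where \<J>: "finite \<J>" "\<Union>\<J> = {0..1}" "\<And>J. J \<in> \<J> \<Longrightarrow> is_interval J \<and> C2_on f (interior J) \<and>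
      (\<exists>g. continuous_on (closure J) g \<and> (\<forall>x\<in>interior J. g x = f x))"
    using smooth unfolding piecewise_smooth_def by blast
  have "eventually (\<lambda>x. \<exists>J\<in>\<J>. x \<in> J) (side p)"
    using eventually_unit[OF p] \<J>(2) by (auto elim!: eventually_mono)
  then have "frequently (\<lambda>x. \<exists>J\<in>\<J>. x \<in> J) (side p)" by (rule eventually_frequently[OF side_nontrivial])
  then obtain J where J: "J \<in> \<J>" "frequently (\<lambda>x. x \<in> J) (side p)"
    using \<J>(1) by (auto simp: frequently_bex_finite_distrib)
  then show ?thesis using that frequently_interval_side[OF _ J(2)] \<J>(3)[OF J(1)] by blast
qed

lemma one_sided_limit:
  assumes p: "p \<in> unit_sides"
  shows "(f \<longlongrightarrow> Lim (side p) f) (side p)" and "eventually (\<lambda>x. f field_differentiable at x) (side p)"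
    and "Lim (side p) f \<in> {0..1}"
proof -
  obtain J g where J: "eventually (\<lambda>x. x \<in> interior J) (side p)" "C2_on f (interior J)"
    "continuous_on (closure J) g" "\<And>x. x \<in> interior J \<Longrightarrow> g x = f x"
    using one_sided_smooth[OF p] by metis
  have inJ: "eventually (\<lambda>x. x \<in> closure J - {pt p}) (side p)"
    using J(1) eventually_\<Delta>1[of 1 p, OF zero_less_one]
  proof eventually_elim
    case (elim x)
    then show ?case using \<Delta>1_dist[of x p 1] interior_subset[of J] closure_subset[of J] by auto
  qed
  have le: "side p \<le> at (pt p) within closure J"
    unfolding at_within_def using side_le_nhds inJ by (simp add: le_principal)
  have "pt p \<in> closure J"
  proof (rule Lim_in_closed_set[OF closed_closure _ side_nontrivial side_tendsto_pt])
    show "eventually (\<lambda>x. x \<in> closure J) (side p)" using inJ by (auto elim: eventually_mono)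
  qed
  then have "(g \<longlongrightarrow> g (pt p)) (at (pt p) within closure J)" using J(3) by (simp add: continuous_on_def)
  then have "(g \<longlongrightarrow> g (pt p)) (side p)" using le by (rule tendsto_mono[rotated])
  then have lim: "(f \<longlongrightarrow> g (pt p)) (side p)"
    by (rule Lim_transform_eventually) (use J(1,4) in \<open>auto elim: eventually_mono\<close>)
  then have L: "Lim (side p) f = g (pt p)" by (rule tendsto_Lim[OF side_nontrivial])
  show "(f \<longlongrightarrow> Lim (side p) f) (side p)" using lim L by simp
  show "eventually (\<lambda>x. f field_differentiable at x) (side p)"
    using J(1) by eventually_elim (use J(2) in \<open>auto simp: C2_on_def field_differentiable_def\<close>)
  have "eventually (\<lambda>x. f x \<in> {0..1}) (side p)" using eventually_unit[OF p] by eventually_elim (rule f_unit)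
  then show "Lim (side p) f \<in> {0..1}"
    unfolding L using lim by (intro Lim_in_closed_set[OF _ _ side_nontrivial lim]) auto
qed

lemma regular_limit:
  assumes "p \<in> unit_sides" "p \<notin> crit f"
  shows "(deriv f \<longlongrightarrow> Lim (side p) (deriv f)) (side p)" "Lim (side p) (deriv f) \<noteq> 0"
proof -
  obtain L where L: "L \<noteq> 0" "(deriv f \<longlongrightarrow> L) (side p)" using assms by (auto simp: crit_def unit_sides_def)
  then have "Lim (side p) (deriv f) = L" by (intro tendsto_Lim side_nontrivial)
  then show "(deriv f \<longlongrightarrow> Lim (side p) (deriv f)) (side p)" "Lim (side p) (deriv f) \<noteq> 0" using L by auto
qed

text \<open>At the points of \<open>crit f\<close> this is the nondegeneracy condition \<open>A1\<close>. At regular points the exponent is 1 by the mean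
  value theorem.\<close>

lemma power_law_f:
  assumes p: "p \<in> unit_sides"
  shows "\<exists>e>0. power_law f p (Lim (side p) f) e"
proof (cases "p \<in> crit f")
  case True
  obtain \<delta> where \<delta>: "\<delta> > 0" and l: "l p > 0"
    and c1: "comparable_on (\<Delta>1 p \<delta>) (\<lambda>x. \<bar>f x - Lim (side p) f\<bar>) (\<lambda>x. \<bar>x - pt p\<bar> powr l p)"
    and c2: "comparable_on (\<Delta>1 p \<delta>) (\<lambda>x. \<bar>deriv f x\<bar>) (\<lambda>x. \<bar>x - pt p\<bar> powr (l p - 1))"
    using A1 True unfolding A1_def by blast
  obtain a b where ab: "a > 0" "\<And>x. x \<in> \<Delta>1 p \<delta> \<Longrightarrow> a \<le> \<bar>f x - Lim (side p) f\<bar> / \<bar>x - pt p\<bar> powr l p \<and>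
      \<bar>f x - Lim (side p) f\<bar> / \<bar>x - pt p\<bar> powr l p \<le> b"
    using c1 unfolding comparable_on_def by blast
  obtain b' where b': "\<And>x. x \<in> \<Delta>1 p \<delta> \<Longrightarrow> \<bar>deriv f x\<bar> / \<bar>x - pt p\<bar> powr (l p - 1) \<le> b'"
    using c2 unfolding comparable_on_def by blast
  define K where "K = max 1 (max b b')"
  have "eventually (\<lambda>x. f field_differentiable at x \<and>
      a * \<bar>x - pt p\<bar> powr l p \<le> \<bar>f x - Lim (side p) f\<bar> \<and> \<bar>f x - Lim (side p) f\<bar> \<le> K * \<bar>x - pt p\<bar> powr l p \<and>
      \<bar>deriv f x\<bar> \<le> K * \<bar>x - pt p\<bar> powr (l p - 1)) (side p)"
    using one_sided_limit(2)[OF p] eventually_\<Delta>1[OF \<delta>, of p]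
  proof eventually_elim
    case (elim x)
    have r: "0 < \<bar>x - pt p\<bar>" using \<Delta>1_dist[OF elim(2)] by auto
    then have pos: "0 < \<bar>x - pt p\<bar> powr l p" "0 < \<bar>x - pt p\<bar> powr (l p - 1)" by auto
    have 1: "a * \<bar>x - pt p\<bar> powr l p \<le> \<bar>f x - Lim (side p) f\<bar>"
      using ab(2)[OF elim(2)] pos(1) by (simp add: le_divide_eq)
    have "\<bar>f x - Lim (side p) f\<bar> \<le> b * \<bar>x - pt p\<bar> powr l p"
      using ab(2)[OF elim(2)] pos(1) by (simp add: divide_le_eq)
    also have "\<dots> \<le> K * \<bar>x - pt p\<bar> powr l p" by (intro mult_right_mono) (auto simp: K_def)
    finally have 2: "\<bar>f x - Lim (side p) f\<bar> \<le> K * \<bar>x - pt p\<bar> powr l p" .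
    have "\<bar>deriv f x\<bar> \<le> b' * \<bar>x - pt p\<bar> powr (l p - 1)"
      using b'[OF elim(2)] pos(2) by (simp add: divide_le_eq)
    also have "\<dots> \<le> K * \<bar>x - pt p\<bar> powr (l p - 1)" by (intro mult_right_mono) (auto simp: K_def)
    finally show ?case using elim(1) 1 2 by simp
  qed
  moreover have "K > 0" by (simp add: K_def)
  ultimately show ?thesis using l ab(1) unfolding power_law_def by blast
next
  case False
  let ?L = "Lim (side p) (deriv f)" and ?z = "Lim (side p) f"
  note R = regular_limit[OF p False]
  have "((\<lambda>x. \<bar>deriv f x\<bar>) \<longlongrightarrow> \<bar>?L\<bar>) (side p)" using R(1) by (intro tendsto_intros)
  then have "eventually (\<lambda>x. \<bar>?L\<bar> / 2 < \<bar>deriv f x\<bar>) (side p)" "eventually (\<lambda>x. \<bar>deriv f x\<bar> < 2 * \<bar>?L\<bar>) (side p)"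
    by (rule order_tendstoD; use R(2) in simp)+
  then have "eventually (\<lambda>x. f field_differentiable at x \<and> \<bar>?L\<bar> / 2 \<le> \<bar>deriv f x\<bar> \<and> \<bar>deriv f x\<bar> \<le> 2 * \<bar>?L\<bar>) (side p)"
    using one_sided_limit(2)[OF p] by eventually_elim auto
  then obtain \<eta> where \<eta>: "\<eta> > 0" and b: "\<And>x. x \<in> \<Delta>1 p \<eta> \<Longrightarrow> f field_differentiable at x \<and> \<bar>?L\<bar> / 2 \<le> \<bar>deriv f x\<bar> \<and> \<bar>deriv f x\<bar> \<le> 2 * \<bar>?L\<bar>"
    unfolding eventually_side by blast
  have der: "(f has_real_derivative deriv f x) (at x)" if "x \<in> \<Delta>1 p \<eta>" for x
    using b[OF that] by (simp add: DERIV_deriv_iff_field_differentiable)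
  have mvt: "\<bar>?L\<bar> / 2 * \<bar>x - y\<bar> \<le> \<bar>f x - f y\<bar> \<and> \<bar>f x - f y\<bar> \<le> 2 * \<bar>?L\<bar> * \<bar>x - y\<bar>"
    if xy: "x \<in> \<Delta>1 p \<eta>" "y \<in> \<Delta>1 p \<eta>" for x y
  proof -
    have *: "\<bar>?L\<bar> / 2 * \<bar>x - y\<bar> \<le> \<bar>f x - f y\<bar> \<and> \<bar>f x - f y\<bar> \<le> 2 * \<bar>?L\<bar> * \<bar>x - y\<bar>"
      if xy: "x \<in> \<Delta>1 p \<eta>" "y \<in> \<Delta>1 p \<eta>" and "x < y" for x y
    proof -
      have sub: "z \<in> \<Delta>1 p \<eta>" if "x \<le> z" "z \<le> y" for z
        using mem_is_interval_1_I[OF \<Delta>1_interval xy that] .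
      obtain z where z: "x < z" "z < y" "f y - f x = (y - x) * deriv f z"
        using MVT2[OF \<open>x < y\<close>, of f "deriv f"] der sub by blast
      have "\<bar>f x - f y\<bar> = \<bar>x - y\<bar> * \<bar>deriv f z\<bar>" using z(3) by (metis abs_minus_commute abs_mult)
      moreover have "\<bar>?L\<bar> / 2 \<le> \<bar>deriv f z\<bar>" "\<bar>deriv f z\<bar> \<le> 2 * \<bar>?L\<bar>" using b sub[of z] z by auto
      ultimately show ?thesis
        using mult_left_mono[of "\<bar>?L\<bar> / 2" "\<bar>deriv f z\<bar>" "\<bar>x - y\<bar>"] mult_left_mono[of "\<bar>deriv f z\<bar>" "2 * \<bar>?L\<bar>" "\<bar>x - y\<bar>"]
        by (simp add: mult.commute)
    qed
    consider "x < y" | "x = y" | "y < x" by linarith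
    then show ?thesis using *[OF xy] *[OF xy(2,1)] by cases (auto simp: abs_minus_commute)
  qed
  have law: "\<bar>?L\<bar> / 2 * \<bar>x - pt p\<bar> \<le> \<bar>f x - ?z\<bar> \<and> \<bar>f x - ?z\<bar> \<le> 2 * \<bar>?L\<bar> * \<bar>x - pt p\<bar>" if x: "x \<in> \<Delta>1 p \<eta>" for x
  proof
    have 1: "((\<lambda>y. \<bar>f x - f y\<bar>) \<longlongrightarrow> \<bar>f x - ?z\<bar>) (side p)" by (intro tendsto_intros one_sided_limit(1)[OF p])
    have 2: "((\<lambda>y. c * \<bar>x - y\<bar>) \<longlongrightarrow> c * \<bar>x - pt p\<bar>) (side p)" for c by (intro tendsto_intros side_tendsto_pt)
    show "\<bar>?L\<bar> / 2 * \<bar>x - pt p\<bar> \<le> \<bar>f x - ?z\<bar>"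
      by (rule tendsto_le[OF side_nontrivial 1 2]) (use eventually_\<Delta>1[OF \<eta>, of p] mvt[OF x] in \<open>auto elim!: eventually_mono\<close>)
    show "\<bar>f x - ?z\<bar> \<le> 2 * \<bar>?L\<bar> * \<bar>x - pt p\<bar>"
      by (rule tendsto_le[OF side_nontrivial 2 1]) (use eventually_\<Delta>1[OF \<eta>, of p] mvt[OF x] in \<open>auto elim!: eventually_mono\<close>)
  qed
  have "eventually (\<lambda>x. f field_differentiable at x \<and>
      \<bar>?L\<bar> / 2 * \<bar>x - pt p\<bar> powr 1 \<le> \<bar>f x - ?z\<bar> \<and> \<bar>f x - ?z\<bar> \<le> 2 * \<bar>?L\<bar> * \<bar>x - pt p\<bar> powr 1 \<and>
      \<bar>deriv f x\<bar> \<le> 2 * \<bar>?L\<bar> * \<bar>x - pt p\<bar> powr (1 - 1)) (side p)"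
    using eventually_\<Delta>1[OF \<eta>, of p]
  proof eventually_elim
    case (elim x)
    then show ?case using law[OF elim] b[OF elim] \<Delta>1_dist[OF elim] by auto
  qed
  moreover have "0 < \<bar>?L\<bar> / 2" "0 < 2 * \<bar>?L\<bar>" using R(2) by auto
  ultimately have "power_law f p ?z 1" unfolding power_law_def by blast
  then show ?thesis by (intro exI[of _ 1]) simp
qed

text \<open>By its power law \<open>f\<close> omits its limit near a one-sided point, so it approaches the limit from one side only:
  \<open>f\<close> induces a map \<open>nxt\<close> on one-sided points.\<close>

lemma next_side_exists:
  assumes p: "p \<in> unit_sides"
  shows "\<exists>q\<in>unit_sides. filterlim f (side q) (side p)"
proof -
  let ?z = "Lim (side p) f"
  obtain e where e: "power_law f p ?z e" using power_law_f[OF p] by blast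
  obtain K\<^sub>1 where K: "K\<^sub>1 > 0" and ev: "eventually (\<lambda>x. K\<^sub>1 * \<bar>x - pt p\<bar> powr e \<le> \<bar>f x - ?z\<bar>) (side p)"
    using power_lawD(2)[OF e] by blast
  have "eventually (\<lambda>x. f field_differentiable at x \<and> f x \<noteq> ?z \<and> f x \<in> {0..1}) (side p)"
    using ev eventually_\<Delta>1[of 1 p, OF zero_less_one] eventually_unit[OF p] power_lawD(1)[OF e]
  proof eventually_elim
    case (elim x)
    have "0 < K\<^sub>1 * \<bar>x - pt p\<bar> powr e" using K \<Delta>1_dist[OF elim(2)] by simp
    then show ?case using elim(1,4) f_unit[OF elim(3)] by auto
  qed
  then obtain \<eta> where \<eta>: "\<eta> > 0" and A: "\<And>x. x \<in> \<Delta>1 p \<eta> \<Longrightarrow> f field_differentiable at x \<and> f x \<noteq> ?z \<and> f x \<in> {0..1}"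
    unfolding eventually_side by blast
  have "continuous_on (\<Delta>1 p \<eta>) f"
    using A by (meson continuous_at_imp_continuous_on field_differentiable_imp_continuous_at)
  then have I: "is_interval (f ` \<Delta>1 p \<eta>)"
    using \<Delta>1_interval by (metis connected_continuous_image is_interval_connected_1)
  have z01: "?z \<in> {0..1}" by (rule one_sided_limit(3)[OF p])
  have "(\<forall>x\<in>\<Delta>1 p \<eta>. f x > ?z) \<or> (\<forall>x\<in>\<Delta>1 p \<eta>. f x < ?z)"
  proof (rule ccontr)
    assume "\<not> ?thesis"
    then obtain x y where xy: "x \<in> \<Delta>1 p \<eta>" "y \<in> \<Delta>1 p \<eta>" "f x \<le> ?z" "?z \<le> f y" by (auto simp: not_less)
    then have "?z \<in> f ` \<Delta>1 p \<eta>" using mem_is_interval_1_I[OF I, of "f x" "f y" ?z] by blast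
    then obtain x where x: "x \<in> \<Delta>1 p \<eta>" "f x = ?z" by auto
    then show False using A[OF x(1)] by simp
  qed
  then show ?thesis
  proof
    assume gt: "\<forall>x\<in>\<Delta>1 p \<eta>. f x > ?z"
    have "?z < 1"
    proof -
      obtain x where "x \<in> \<Delta>1 p \<eta>"
        using eventually_happens'[OF side_nontrivial eventually_\<Delta>1[OF \<eta>, of p]] by blast
      then show ?thesis using gt A by fastforce
    qed
    then have "RightOf ?z \<in> unit_sides" using z01 by (auto simp: unit_sides_def)
    moreover have "filterlim f (side (RightOf ?z)) (side p)"
      unfolding side.simps filterlim_at
      using one_sided_limit(1)[OF p] eventually_\<Delta>1[OF \<eta>, of p] gt by (auto elim!: eventually_mono)
    ultimately show ?thesis by blast
  next
    assume lt: "\<forall>x\<in>\<Delta>1 p \<eta>. f x < ?z"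
    have "?z > 0"
    proof -
      obtain x where "x \<in> \<Delta>1 p \<eta>"
        using eventually_happens'[OF side_nontrivial eventually_\<Delta>1[OF \<eta>, of p]] by blast
      then show ?thesis using lt A by fastforce
    qed
    then have "LeftOf ?z \<in> unit_sides" using z01 by (auto simp: unit_sides_def)
    moreover have "filterlim f (side (LeftOf ?z)) (side p)"
      unfolding side.simps filterlim_at
      using one_sided_limit(1)[OF p] eventually_\<Delta>1[OF \<eta>, of p] lt by (auto elim!: eventually_mono)
    ultimately show ?thesis by blast
  qed
qed

definition nxt :: "one_sided \<Rightarrow> one_sided" where
  "nxt p = (SOME q. q \<in> unit_sides \<and> filterlim f (side q) (side p))"

lemma nxt: "p \<in> unit_sides \<Longrightarrow> nxt p \<in> unit_sides" "p \<in> unit_sides \<Longrightarrow> filterlim f (side (nxt p)) (side p)"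
proof -
  have "nxt p \<in> unit_sides \<and> filterlim f (side (nxt p)) (side p)" if "p \<in> unit_sides"
    unfolding nxt_def by (rule someI_ex) (use next_side_exists[OF that] in blast)
  then show "p \<in> unit_sides \<Longrightarrow> nxt p \<in> unit_sides" "p \<in> unit_sides \<Longrightarrow> filterlim f (side (nxt p)) (side p)" by auto
qed

lemma nxt_n: "p \<in> unit_sides \<Longrightarrow> (nxt ^^ n) p \<in> unit_sides"
  by (induction n) (auto intro: nxt)

lemma filterlim_fn: "p \<in> unit_sides \<Longrightarrow> filterlim (f ^^ n) (side ((nxt ^^ n) p)) (side p)"
proof (induction n)
  case 0 then show ?case by (simp add: filterlim_ident id_def)
next
  case (Suc n)
  have "filterlim (\<lambda>x. f ((f ^^ n) x)) (side (nxt ((nxt ^^ n) p))) (side p)"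
    by (rule filterlim_compose[OF nxt(2)[OF nxt_n[OF Suc.prems]] Suc.IH[OF Suc.prems]])
  then show ?case by (simp add: comp_def)
qed

lemma pt_nxt_n:
  assumes "p \<in> unit_sides" shows "Lim (side p) (f ^^ n) = pt ((nxt ^^ n) p)"
proof (rule tendsto_Lim[OF side_nontrivial])
  show "((f ^^ n) \<longlongrightarrow> pt ((nxt ^^ n) p)) (side p)"
    using filterlim_fn[OF assms, of n] side_le_nhds by (rule filterlim_mono[OF _ _ order_refl])
qed

lemma power_law_fn:
  assumes p: "p \<in> unit_sides"
  shows "\<exists>e>0. power_law (f ^^ n) p (pt ((nxt ^^ n) p)) e"
proof (induction n)
  case 0
  have "power_law (\<lambda>x. x) p (pt p) 1" unfolding power_law_def
  proof (intro exI[of _ 1] conjI)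
    show "\<forall>\<^sub>F x in side p. (\<lambda>x. x) field_differentiable at x \<and>
       1 * \<bar>x - pt p\<bar> powr 1 \<le> \<bar>x - pt p\<bar> \<and> \<bar>x - pt p\<bar> \<le> 1 * \<bar>x - pt p\<bar> powr 1 \<and>
       \<bar>deriv (\<lambda>x. x) x\<bar> \<le> 1 * \<bar>x - pt p\<bar> powr (1 - 1)"
      using eventually_\<Delta>1[of 1 p, OF zero_less_one]
    proof eventually_elim
      case (elim x) then show ?case using \<Delta>1_dist[OF elim] by simp
    qed
  qed auto
  then show ?case by (intro exI[of _ 1]) (simp add: id_def)
next
  case (Suc n)
  then obtain e where e: "e > 0" "power_law (f ^^ n) p (pt ((nxt ^^ n) p)) e" by blast
  let ?q = "(nxt ^^ n) p"
  have q: "?q \<in> unit_sides" by (rule nxt_n[OF p])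
  obtain e' where e': "e' > 0" "power_law f ?q (Lim (side ?q) f) e'" using power_law_f[OF q] by blast
  have "Lim (side ?q) f = pt (nxt ?q)" using pt_nxt_n[OF q, of 1] by simp
  with power_law_compose[OF e(2) filterlim_fn[OF p] e'(2,1)]
  have "power_law (\<lambda>x. f ((f ^^ n) x)) p (pt (nxt ?q)) (e * e')" by (simp only:)
  moreover have "f ^^ Suc n = (\<lambda>x. f ((f ^^ n) x))" "(nxt ^^ Suc n) p = nxt ?q" by (simp_all add: comp_def)
  moreover have "0 < e * e'" using e(1) e'(1) by simp
  ultimately have "0 < e * e' \<and> power_law (f ^^ Suc n) p (pt ((nxt ^^ Suc n) p)) (e * e')" by (simp only:)
  then show ?case by (rule exI[of _ "e * e'"])
qed

lemma fn_differentiable: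
  assumes p: "p \<in> unit_sides" shows "eventually (\<lambda>x. (f ^^ n) field_differentiable at x) (side p)"
proof -
  obtain e where "power_law (f ^^ n) p (pt ((nxt ^^ n) p)) e" using power_law_fn[OF p] by blast
  then show ?thesis by (rule power_lawD(1))
qed

lemma deriv_fn_limit:
  assumes p: "p \<in> unit_sides" and reg: "\<And>i. i < n \<Longrightarrow> (nxt ^^ i) p \<notin> crit f"
  shows "(deriv (f ^^ n) \<longlongrightarrow> (\<Prod>i<n. Lim (side ((nxt ^^ i) p)) (deriv f))) (side p)"
  using reg
proof (induction n)
  case 0 then show ?case by (simp add: id_def)
next
  case (Suc n)
  let ?q = "(nxt ^^ n) p"
  have q: "?q \<in> unit_sides" by (rule nxt_n[OF p])
  have 1: "((\<lambda>x. deriv f ((f ^^ n) x)) \<longlongrightarrow> Lim (side ?q) (deriv f)) (side p)"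
    by (rule filterlim_compose[OF regular_limit(1)[OF q] filterlim_fn[OF p]]) (use Suc.prems in auto)
  have 2: "(deriv (f ^^ n) \<longlongrightarrow> (\<Prod>i<n. Lim (side ((nxt ^^ i) p)) (deriv f))) (side p)"
    by (rule Suc.IH) (use Suc.prems in auto)
  have "eventually (\<lambda>x. f field_differentiable at ((f ^^ n) x)) (side p)"
    using filterlim_iff[THEN iffD1, OF filterlim_fn[OF p, of n], rule_format, OF one_sided_limit(2)[OF q]] .
  then have "eventually (\<lambda>x. deriv (f ^^ n) x * deriv f ((f ^^ n) x) = deriv (f ^^ Suc n) x) (side p)"
    using fn_differentiable[OF p, of n]
  proof eventually_elim
    case (elim x)
    then show ?case using deriv_chain[of "f ^^ n" x f] by (simp add: mult.commute)
  qed
  from Lim_transform_eventually[OF tendsto_mult[OF 2 1] this] show ?case by (simp add: comp_def)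
qed

lemma crit_dist_eq:
  assumes "crit f \<noteq> {}" shows "crit_dist f x = ereal (Min ((\<lambda>c. \<bar>x - pt c\<bar>) ` crit f))"
proof -
  let ?S = "(\<lambda>c. \<bar>x - pt c\<bar>) ` crit f"
  have fin: "finite ?S" and ne: "?S \<noteq> {}" using finite_crit assms by auto
  have "Min ?S \<in> ?S" by (rule Min_in[OF fin ne])
  then obtain c where c: "c \<in> crit f" "Min ?S = \<bar>x - pt c\<bar>" by auto
  show ?thesis unfolding crit_dist_def
  proof (rule antisym)
    show "(INF c\<in>crit f. ereal \<bar>x - pt c\<bar>) \<le> ereal (Min ?S)" using c by (auto intro: INF_lower2)
    show "ereal (Min ?S) \<le> (INF c\<in>crit f. ereal \<bar>x - pt c\<bar>)"
      using fin by (intro INF_greatest) auto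
  qed
qed

text \<open>Away from \<open>crit f\<close> the derivative has finite one-sided limits everywhere, so it is locally bounded;
  the points in question form a compact set.\<close>

lemma deriv_bounded_away:
  assumes \<eta>: "\<eta> > 0"
  shows "\<exists>B\<ge>1. \<forall>q\<in>unit_sides. (\<forall>c\<in>crit f. \<eta> \<le> \<bar>pt q - pt c\<bar>) \<longrightarrow> \<bar>Lim (side q) (deriv f)\<bar> \<le> B"
proof -
  define S where "S = {x\<in>{0..1}. \<forall>c\<in>crit f. \<eta> \<le> \<bar>x - pt c\<bar>}"
  have "S = {0..1} \<inter> (\<Inter>c\<in>crit f. {x. \<eta> \<le> \<bar>x - pt c\<bar>})" by (auto simp: S_def)
  moreover have "closed {x. \<eta> \<le> \<bar>x - pt c\<bar>}" for c by (intro closed_Collect_le continuous_intros)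
  ultimately have S: "compact S" by (auto intro!: compact_Int_closed closed_INT)
  have loc: "\<exists>\<epsilon>>0. \<exists>B. \<forall>y\<in>{0..1}. y \<noteq> x \<longrightarrow> \<bar>y - x\<bar> < \<epsilon> \<longrightarrow> \<bar>deriv f y\<bar> \<le> B" if x: "x \<in> S" for x
  proof -
    have one: "\<exists>\<epsilon>>0. \<exists>B. \<forall>y\<in>\<Delta>1 p \<epsilon> \<inter> {0..1}. \<bar>deriv f y\<bar> \<le> B" if p: "pt p = x" for p
    proof (cases "p \<in> unit_sides")
      case True
      have "p \<notin> crit f" using x p \<eta> by (force simp: S_def)
      note R = regular_limit[OF True this]
      have "((\<lambda>y. \<bar>deriv f y\<bar>) \<longlongrightarrow> \<bar>Lim (side p) (deriv f)\<bar>) (side p)" using R(1) by (intro tendsto_intros)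
      then have "eventually (\<lambda>y. \<bar>deriv f y\<bar> < \<bar>Lim (side p) (deriv f)\<bar> + 1) (side p)" by (rule order_tendstoD) simp
      then show ?thesis unfolding eventually_side by (meson IntD1 less_imp_le)
    next
      case False
      then have "\<Delta>1 p 1 \<inter> {0..1} = {}" using x p by (cases p) (auto simp: S_def unit_sides_def)
      then show ?thesis by (intro exI[of _ 1]) auto
    qed
    obtain \<epsilon>\<^sub>1 B\<^sub>1 where 1: "\<epsilon>\<^sub>1 > 0" "\<And>y. y \<in> {x<..<x + \<epsilon>\<^sub>1} \<inter> {0..1} \<Longrightarrow> \<bar>deriv f y\<bar> \<le> B\<^sub>1"
      using one[of "RightOf x"] unfolding pt.simps \<Delta>1.simps by blast
    obtain \<epsilon>\<^sub>2 B\<^sub>2 where 2: "\<epsilon>\<^sub>2 > 0" "\<And>y. y \<in> {x - \<epsilon>\<^sub>2<..<x} \<inter> {0..1} \<Longrightarrow> \<bar>deriv f y\<bar> \<le> B\<^sub>2"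
      using one[of "LeftOf x"] unfolding pt.simps \<Delta>1.simps by blast
    have "\<bar>deriv f y\<bar> \<le> max B\<^sub>1 B\<^sub>2" if y: "y \<in> {0..1}" "y \<noteq> x" "\<bar>y - x\<bar> < min \<epsilon>\<^sub>1 \<epsilon>\<^sub>2" for y
    proof (cases "y > x")
      case True then show ?thesis using 1(2)[of y] y by (simp add: le_max_iff_disj)
    next
      case False then show ?thesis using 2(2)[of y] y by (simp add: le_max_iff_disj)
    qed
    moreover have "min \<epsilon>\<^sub>1 \<epsilon>\<^sub>2 > 0" using 1(1) 2(1) by simp
    ultimately show ?thesis by blast
  qed
  then obtain \<epsilon> B where \<epsilon>: "\<And>x. x \<in> S \<Longrightarrow> \<epsilon> x > 0"
    and B: "\<And>x y. x \<in> S \<Longrightarrow> y \<in> {0..1} \<Longrightarrow> y \<noteq> x \<Longrightarrow> \<bar>y - x\<bar> < \<epsilon> x \<Longrightarrow> \<bar>deriv f y\<bar> \<le> B x"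
    by metis
  obtain C where C: "C \<subseteq> S" "finite C" "S \<subseteq> (\<Union>x\<in>C. ball x (\<epsilon> x))"
    by (rule compactE_image[OF S, of S "\<lambda>x. ball x (\<epsilon> x)"]) (use \<epsilon> in auto)
  define M where "M = Max (insert 1 (B ` C))"
  have M: "1 \<le> M" "\<And>x. x \<in> C \<Longrightarrow> B x \<le> M" using C(2) by (auto simp: M_def)
  have "\<bar>Lim (side q) (deriv f)\<bar> \<le> M" if q: "q \<in> unit_sides" "\<forall>c\<in>crit f. \<eta> \<le> \<bar>pt q - pt c\<bar>" for q
  proof -
    have "pt q \<in> S" using q pt_unit by (auto simp: S_def)
    then obtain x where x: "x \<in> C" "pt q \<in> ball x (\<epsilon> x)" using C(3) by blast
    have xS: "x \<in> S" using x C(1) by auto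
    have "q \<notin> crit f" using q(2) \<eta> by force
    note R = regular_limit(1)[OF q(1) this]
    have "eventually (\<lambda>y. y \<in> ball x (\<epsilon> x)) (side q)"
      using topological_tendstoD[OF side_tendsto_pt open_ball x(2)] .
    moreover have "eventually (\<lambda>y. y \<noteq> x) (side q)"
    proof (cases "pt q = x")
      case True
      show ?thesis using eventually_\<Delta>1[of 1 q, OF zero_less_one]
      proof eventually_elim
        case (elim y)
        then show ?case using \<Delta>1_dist[OF elim] True by auto
      qed
    next
      case False
      then show ?thesis using topological_tendstoD[OF side_tendsto_pt, of "- {x}" q] by auto
    qed
    ultimately have "eventually (\<lambda>y. \<bar>deriv f y\<bar> \<le> M) (side q)" using eventually_unit[OF q(1)]
    proof eventually_elim
      case (elim y)
      have "\<bar>y - x\<bar> < \<epsilon> x" using elim(1) by (simp add: dist_real_def abs_minus_commute)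
      then show ?case using B[OF xS elim(3,2)] M(2)[OF x(1)] by simp
    qed
    then show ?thesis using tendsto_rabs[OF R] by (intro tendsto_upperbound[OF _ _ side_nontrivial]) auto
  qed
  then show ?thesis using M(1) by blast
qed

text \<open>Each of finitely many iterates obeys a power law at each of the finitely many one-sided points over \<open>crit f\<close>. The
  bound has the same order \<open>1 / distance\<close> whatever the exponents are.\<close>

lemma derivative_bound_near_crit:
  "\<exists>C\<ge>1. \<exists>\<eta>>0. \<forall>p\<in>unit_sides. pt p \<in> pt ` crit f \<longrightarrow> (\<forall>m\<le>N. \<forall>x\<in>\<Delta>1 p \<eta>. \<bar>deriv (f ^^ m) x\<bar> \<le> C / \<bar>x - pt p\<bar>)"
proof -
  define S where "S = {p\<in>unit_sides. pt p \<in> pt ` crit f} \<times> {..N}"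
  have "{p\<in>unit_sides. pt p \<in> pt ` crit f} \<subseteq> RightOf ` pt ` crit f \<union> LeftOf ` pt ` crit f"
    by (auto simp: unit_sides_def)
  then have S: "finite S" unfolding S_def using finite_crit by (auto intro: finite_subset)
  have "\<forall>s\<in>S. \<exists>C \<eta>. \<eta> > 0 \<and> (\<forall>x\<in>\<Delta>1 (fst s) \<eta>. \<bar>deriv (f ^^ snd s) x\<bar> \<le> C / \<bar>x - pt (fst s)\<bar>)"
  proof
    fix s assume "s \<in> S"
    then have p: "fst s \<in> unit_sides" by (auto simp: S_def)
    obtain e where e: "e > 0" "power_law (f ^^ snd s) (fst s) (pt ((nxt ^^ snd s) (fst s))) e"
      using power_law_fn[OF p] by blast
    show "\<exists>C \<eta>. \<eta> > 0 \<and> (\<forall>x\<in>\<Delta>1 (fst s) \<eta>. \<bar>deriv (f ^^ snd s) x\<bar> \<le> C / \<bar>x - pt (fst s)\<bar>)"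
      using power_law_derivative_bound[OF e(2,1)] by blast
  qed
  from bchoice[OF this] obtain C where "\<forall>s\<in>S. \<exists>\<eta>. \<eta> > 0 \<and> (\<forall>x\<in>\<Delta>1 (fst s) \<eta>. \<bar>deriv (f ^^ snd s) x\<bar> \<le> C s / \<bar>x - pt (fst s)\<bar>)" ..
  from bchoice[OF this] obtain \<eta> where \<eta>: "\<And>s. s \<in> S \<Longrightarrow> \<eta> s > 0"
    and C: "\<And>s x. s \<in> S \<Longrightarrow> x \<in> \<Delta>1 (fst s) (\<eta> s) \<Longrightarrow> \<bar>deriv (f ^^ snd s) x\<bar> \<le> C s / \<bar>x - pt (fst s)\<bar>" by blast
  define C' where "C' = Max (insert 1 (C ` S))"
  define \<eta>' where "\<eta>' = Min (insert 1 (\<eta> ` S))"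
  have C': "1 \<le> C'" "\<And>s. s \<in> S \<Longrightarrow> C s \<le> C'" using S by (auto simp: C'_def)
  have \<eta>': "0 < \<eta>'" "\<And>s. s \<in> S \<Longrightarrow> \<eta>' \<le> \<eta> s" using S \<eta> by (auto simp: \<eta>'_def)
  have "\<bar>deriv (f ^^ m) x\<bar> \<le> C' / \<bar>x - pt p\<bar>"
    if p: "p \<in> unit_sides" "pt p \<in> pt ` crit f" and m: "m \<le> N" and x: "x \<in> \<Delta>1 p \<eta>'" for p m x
  proof -
    have s: "(p, m) \<in> S" using p m by (simp add: S_def)
    have "x \<in> \<Delta>1 p (\<eta> (p, m))" using x \<Delta>1_subset[OF \<eta>'(2)[OF s], of p] by blast
    then have "\<bar>deriv (f ^^ m) x\<bar> \<le> C (p, m) / \<bar>x - pt p\<bar>" using C[OF s] by simp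
    also have "\<dots> \<le> C' / \<bar>x - pt p\<bar>" using C'(2)[OF s] by (intro divide_right_mono) auto
    finally show ?thesis .
  qed
  then show ?thesis using C'(1) \<eta>'(1) by blast
qed

end

locale critical_orbit = critical_map +
  fixes c :: one_sided and c\<^sub>0 C\<^sub>0 :: real
  assumes c: "c \<in> crit f" and l_gt_1: "l c > 1" and c\<^sub>0: "c\<^sub>0 > 0" and C\<^sub>0: "C\<^sub>0 > 0"
    and growth: "\<And>n. n \<ge> 1 \<Longrightarrow> d f c n * E f l c n \<ge> C\<^sub>0 * exp (c\<^sub>0 * real n)"
begin

definition orb :: "nat \<Rightarrow> one_sided" where "orb n = (nxt ^^ n) c"

lemma orb_unit: "orb n \<in> unit_sides"
  unfolding orb_def by (rule nxt_n) (use c crit_unit_sides in blast)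

lemma E_nonneg: "0 \<le> E f l c n" by (simp add: E_def)

lemma d_pos: "n \<ge> 1 \<Longrightarrow> 0 < d f c n"
proof -
  assume "n \<ge> 1"
  from growth[OF this] have "0 < d f c n * E f l c n" using C\<^sub>0 by (smt (verit) mult_pos_pos exp_gt_zero)
  then show ?thesis using E_nonneg[of n] by (simp add: zero_less_mult_iff)
qed

lemma d_eq: "d f c n = Min ((\<lambda>c'. \<bar>pt (orb n) - pt c'\<bar>) ` crit f)"
proof -
  have "Lim (side c) (f ^^ n) = pt (orb n)" unfolding orb_def by (rule pt_nxt_n) (use c crit_unit_sides in blast)
  moreover have "crit_dist f (pt (orb n)) = ereal (Min ((\<lambda>c'. \<bar>pt (orb n) - pt c'\<bar>) ` crit f))"
    using c by (intro crit_dist_eq) auto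
  ultimately show ?thesis unfolding d_def by simp
qed

lemma d_le: "c' \<in> crit f \<Longrightarrow> d f c n \<le> \<bar>pt (orb n) - pt c'\<bar>"
  unfolding d_eq using finite_crit by (intro Min_le) auto

lemma d_attained: "\<exists>c'\<in>crit f. d f c n = \<bar>pt (orb n) - pt c'\<bar>"
proof -
  have "d f c n \<in> (\<lambda>c'. \<bar>pt (orb n) - pt c'\<bar>) ` crit f"
    unfolding d_eq using finite_crit c by (intro Min_in) auto
  then show ?thesis by auto
qed

lemma d_le_1: "d f c n \<le> 1"
  using d_le[OF c, of n] pt_unit[OF orb_unit, of n] pt_unit[of c] c crit_unit_sides by (auto simp: subset_iff abs_le_iff)

lemma orb_regular: "n \<ge> 1 \<Longrightarrow> orb n \<notin> crit f"
  using d_pos[of n] d_le[of "orb n" n] by auto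

lemma D_eq: "D f c n = (\<Prod>i<n. \<bar>Lim (side (orb (Suc i))) (deriv f)\<bar>)"
proof -
  have cu: "c \<in> unit_sides" using c crit_unit_sides by blast
  have sw: "(nxt ^^ i) (nxt c) = orb (Suc i)" for i by (simp add: orb_def funpow_swap1)
  have "(deriv (f ^^ n) \<longlongrightarrow> (\<Prod>i<n. Lim (side ((nxt ^^ i) (nxt c))) (deriv f))) (side (nxt c))"
    by (rule deriv_fn_limit[OF nxt(1)[OF cu]]) (use sw orb_regular in auto)
  then have "((\<lambda>x. deriv (f ^^ n) (f x)) \<longlongrightarrow> (\<Prod>i<n. Lim (side ((nxt ^^ i) (nxt c))) (deriv f))) (side c)"
    by (rule filterlim_compose[OF _ nxt(2)[OF cu]])
  then have "Lim (side c) (\<lambda>x. deriv (f ^^ n) (f x)) = (\<Prod>i<n. Lim (side ((nxt ^^ i) (nxt c))) (deriv f))"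
    by (rule tendsto_Lim[OF side_nontrivial])
  then show ?thesis by (simp add: D_def sw abs_prod)
qed

lemma D_nonneg: "0 \<le> D f c n" by (simp add: D_def)

text \<open>The exponent \<open>1 / (2 * l c - 1)\<close> lies between 0 and 1 at a critical point.\<close>

lemma E_le: "E f l c n \<le> max 1 (D f c (n - 1))"
proof -
  have a: "0 < 1 / (2 * l c - 1)" "1 / (2 * l c - 1) \<le> 1" using l_gt_1 by auto
  show ?thesis
  proof (cases "D f c (n - 1) \<le> 1")
    case True
    then have "D f c (n - 1) powr (1 / (2 * l c - 1)) \<le> 1"
      using a D_nonneg[of "n - 1"] by (intro powr_le1) auto
    then show ?thesis by (simp add: E_def)
  next
    case False
    then have "D f c (n - 1) powr (1 / (2 * l c - 1)) \<le> D f c (n - 1) powr 1"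
      using a by (intro powr_mono) auto
    then show ?thesis using False by (simp add: E_def)
  qed
qed

lemma inverse_d_le: "n \<ge> 1 \<Longrightarrow> 1 / d f c n \<le> max 1 (D f c (n - 1)) / C\<^sub>0"
proof -
  assume n: "n \<ge> 1"
  have "C\<^sub>0 * 1 \<le> C\<^sub>0 * exp (c\<^sub>0 * real n)" using C\<^sub>0 c\<^sub>0 by (intro mult_left_mono) auto
  also have "\<dots> \<le> d f c n * E f l c n" by (rule growth[OF n])
  also have "\<dots> \<le> d f c n * max 1 (D f c (n - 1))" using d_pos[OF n] E_le by (intro mult_left_mono) auto
  finally show ?thesis using d_pos[OF n] C\<^sub>0 by (simp add: field_simps)
qed

text \<open>A block of \<open>N\<close> steps at most squares the derivative, up to a constant. As long as the orbit stays away from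
  \<open>crit f\<close>, each step contributes a bounded factor. From the first close approach on, at distance \<open>d\<close>, the
  remaining steps of the block together contribute at most \<open>C / d\<close>, even if further close approaches occur
  among them; and \<open>1 / d\<close> is bounded by the derivative accumulated so far, through the growth condition.\<close>

lemma D_block: "\<exists>C\<ge>1. \<forall>n. max 1 (D f c (n + N)) \<le> C * (max 1 (D f c n))\<^sup>2"
proof -
  obtain C \<eta> where C: "C \<ge> 1" and \<eta>: "\<eta> > 0" and near: "\<And>p m x. p \<in> unit_sides \<Longrightarrow> pt p \<in> pt ` crit f \<Longrightarrow>
      m \<le> N \<Longrightarrow> x \<in> \<Delta>1 p \<eta> \<Longrightarrow> \<bar>deriv (f ^^ m) x\<bar> \<le> C / \<bar>x - pt p\<bar>"
    using derivative_bound_near_crit[of N] by blast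
  obtain B where B: "B \<ge> 1" and away: "\<And>q. q \<in> unit_sides \<Longrightarrow> (\<And>c'. c' \<in> crit f \<Longrightarrow> \<eta> \<le> \<bar>pt q - pt c'\<bar>) \<Longrightarrow>
      \<bar>Lim (side q) (deriv f)\<bar> \<le> B"
    using deriv_bounded_away[OF \<eta>] by blast
  let ?slope = "\<lambda>i. \<bar>Lim (side (orb (Suc i))) (deriv f)\<bar>"
  have split: "D f c (n + k) = D f c n * (\<Prod>i<k. ?slope (n + i))" for n k
    unfolding D_eq by (induction k) (simp_all add: mult_ac)
  have far: "(\<Prod>i<k. ?slope (n + i)) \<le> B ^ k" if "\<And>i. i < k \<Longrightarrow> \<eta> \<le> d f c (Suc (n + i))" for n k
  proof -
    have "(\<Prod>i<k. ?slope (n + i)) \<le> (\<Prod>i<k. B)"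
    proof (rule prod_mono, intro conjI)
      fix i assume "i \<in> {..<k}"
      then have "\<eta> \<le> d f c (Suc (n + i))" using that by simp
      then show "?slope (n + i) \<le> B"
        using d_le[of _ "Suc (n + i)"] by (intro away orb_unit) (meson order_trans)
    qed simp
    then show ?thesis by simp
  qed
  have close: "(\<Prod>i<k. ?slope (n + i)) \<le> C / d f c (Suc n)" if "d f c (Suc n) < \<eta>" "k \<le> N" for n k
  proof -
    let ?y = "orb (Suc n)"
    obtain c' where c': "c' \<in> crit f" "d f c (Suc n) = \<bar>pt ?y - pt c'\<bar>" using d_attained by blast
    have dp: "0 < \<bar>pt ?y - pt c'\<bar>" using d_pos[of "Suc n"] c'(2) by simp
    \<comment> \<open>The one-sided point over \<open>pt c'\<close> that faces the orbit point; it need not be \<open>c'\<close> itself.\<close>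
    define p where "p = (if pt ?y > pt c' then RightOf (pt c') else LeftOf (pt c'))"
    have pp: "pt p = pt c'" by (simp add: p_def)
    have y01: "pt ?y \<in> {0..1}" "pt c' \<in> {0..1}" using pt_unit[OF orb_unit] pt_unit c'(1) crit_unit_sides by auto
    have pu: "p \<in> unit_sides" using y01 dp by (auto simp: p_def unit_sides_def)
    have y: "pt ?y \<in> \<Delta>1 p \<eta>" using dp that(1) c'(2) by (auto simp: p_def)
    have "eventually (\<lambda>x. x \<in> \<Delta>1 p \<eta>) (side ?y)"
      by (rule topological_tendstoD[OF side_tendsto_pt \<Delta>1_open y])
    then have ev: "eventually (\<lambda>x. \<bar>deriv (f ^^ k) x\<bar> \<le> C / \<bar>x - pt p\<bar>) (side ?y)"
      by eventually_elim (rule near[OF pu _ that(2)], use pp c'(1) in auto)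
    have "(nxt ^^ i) ?y = orb (Suc (n + i))" for i
      by (simp add: orb_def add.commute[of n] funpow_add funpow_swap1)
    then have L: "(deriv (f ^^ k) \<longlongrightarrow> (\<Prod>i<k. Lim (side (orb (Suc (n + i)))) (deriv f))) (side ?y)"
      using deriv_fn_limit[OF orb_unit, of k "Suc n"] orb_regular by simp
    have "\<bar>\<Prod>i<k. Lim (side (orb (Suc (n + i)))) (deriv f)\<bar> \<le> C / \<bar>pt ?y - pt p\<bar>"
    proof (rule tendsto_le[OF side_nontrivial _ tendsto_rabs[OF L] ev])
      show "((\<lambda>x. C / \<bar>x - pt p\<bar>) \<longlongrightarrow> C / \<bar>pt ?y - pt p\<bar>) (side ?y)"
        using dp pp by (intro tendsto_intros side_tendsto_pt) auto
    qed
    then show ?thesis using c'(2) pp by (simp add: abs_prod)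
  qed
  define C' where "C' = B ^ N * (C * B ^ N / C\<^sub>0 + 1)"
  have BN: "1 \<le> B ^ k" for k using B by simp
  have C'1: "1 \<le> C'"
  proof -
    have "1 * 1 \<le> B ^ N * (C * B ^ N / C\<^sub>0 + 1)" using BN C C\<^sub>0 B by (intro mult_mono) auto
    then show ?thesis by (simp add: C'_def)
  qed
  have main: "D f c (n + N) \<le> C' * (max 1 (D f c n))\<^sup>2" for n
  proof -
    let ?M = "max 1 (D f c n)"
    have "1 \<le> ?M" by simp
    from self_le_power[OF this, of 2] have M: "1 \<le> ?M" "D f c n \<le> ?M" "?M \<le> ?M\<^sup>2" by auto
    show ?thesis
    proof (cases "\<forall>i<N. \<eta> \<le> d f c (Suc (n + i))")
      case True
      have "D f c (n + N) \<le> ?M * B ^ N"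
        unfolding split using M far[of N n] True D_nonneg by (intro mult_mono prod_nonneg) auto
      also have "\<dots> \<le> ?M\<^sup>2 * C'"
      proof (intro mult_mono M(3))
        have "B ^ N * 1 \<le> C'" unfolding C'_def using C C\<^sub>0 B by (intro mult_left_mono) auto
        then show "B ^ N \<le> C'" by simp
      qed (use B in auto)
      finally show ?thesis by (simp add: mult.commute)
    next
      case False
      \<comment> \<open>The first close approach within the block.\<close>
      define i where "i = (LEAST i. i < N \<and> d f c (Suc (n + i)) < \<eta>)"
      have "\<exists>i. i < N \<and> d f c (Suc (n + i)) < \<eta>" using False by (auto simp: not_le)
      from LeastI_ex[OF this] have i: "i < N" "d f c (Suc (n + i)) < \<eta>" by (auto simp: i_def)
      have before: "\<eta> \<le> d f c (Suc (n + j))" if "j < i" for j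
        using not_less_Least[of j "\<lambda>i. i < N \<and> d f c (Suc (n + i)) < \<eta>"] that i(1) by (auto simp: i_def)
      have D1: "D f c (n + i) \<le> ?M * B ^ N"
      proof -
        have "D f c (n + i) \<le> ?M * B ^ i"
          unfolding split using M far[of i n] before D_nonneg by (intro mult_mono prod_nonneg) auto
        also have "\<dots> \<le> ?M * B ^ N" using B i(1) by (intro mult_left_mono power_increasing) auto
        finally show ?thesis .
      qed
      have P: "(\<Prod>j<N - i. ?slope (n + i + j)) \<le> C / d f c (Suc (n + i))" by (rule close[OF i(2)]) simp
      have "1 / d f c (Suc (n + i)) \<le> max 1 (D f c (n + i)) / C\<^sub>0" using inverse_d_le[of "Suc (n + i)"] by simp
      also have "\<dots> \<le> ?M * B ^ N / C\<^sub>0"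
      proof (intro divide_right_mono)
        have "1 * 1 \<le> ?M * B ^ N" using M BN by (intro mult_mono) auto
        then show "max 1 (D f c (n + i)) \<le> ?M * B ^ N" using D1 by simp
      qed (use C\<^sub>0 in simp)
      finally have "C * (1 / d f c (Suc (n + i))) \<le> C * (?M * B ^ N / C\<^sub>0)" using C by (intro mult_left_mono) auto
      then have P': "(\<Prod>j<N - i. ?slope (n + i + j)) \<le> C * (?M * B ^ N / C\<^sub>0)" using P by simp
      have "D f c (n + N) = D f c (n + i) * (\<Prod>j<N - i. ?slope (n + i + j))"
        using split[of "n + i" "N - i"] i(1) by simp
      also have "\<dots> \<le> (?M * B ^ N) * (C * (?M * B ^ N / C\<^sub>0))"
        using D1 P' M B by (intro mult_mono prod_nonneg) auto
      also have "\<dots> = (B ^ N * (C * B ^ N / C\<^sub>0)) * ?M\<^sup>2" by (simp add: power2_eq_square)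
      also have "\<dots> \<le> C' * ?M\<^sup>2"
        unfolding C'_def using B by (intro mult_right_mono mult_left_mono) auto
      finally show ?thesis .
    qed
  qed
  have "max 1 (D f c (n + N)) \<le> C' * (max 1 (D f c n))\<^sup>2" for n
  proof -
    have "1 * 1 \<le> C' * (max 1 (D f c n))\<^sup>2" using C'1 by (intro mult_mono) (auto simp: one_le_power)
    then show ?thesis using main[of n] by simp
  qed
  then show ?thesis using C'1 by blast
qed

text \<open>By the block estimate the logarithm of the derivative at most doubles every \<open>N\<close> steps, up to a constant, and
  \<open>N\<close> is arbitrary.\<close>

lemma log_D_subexponential:
  assumes \<epsilon>: "\<epsilon> > 0"
  shows "\<exists>K\<ge>0. \<forall>n. ln (max 1 (D f c n)) \<le> K * exp (\<epsilon> * real n)"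
proof -
  obtain N :: nat where N: "ln 2 / \<epsilon> < real N" using reals_Archimedean2 by blast
  then have N2: "2 \<le> exp (\<epsilon> * real N)" and N0: "N > 0"
  proof -
    have "ln 2 < \<epsilon> * real N" using N \<epsilon> by (simp add: field_simps)
    then have "exp (ln 2) \<le> exp (\<epsilon> * real N)" by (subst exp_le_cancel_iff) simp
    then show "2 \<le> exp (\<epsilon> * real N)" by simp
    have "0 < ln 2 / \<epsilon>" using \<epsilon> by simp
    then show "N > 0" using N by (cases N) auto
  qed
  obtain C where C: "C \<ge> 1" "\<And>n. max 1 (D f c (n + N)) \<le> C * (max 1 (D f c n))\<^sup>2" using D_block[of N] by blast
  define m where "m = (\<lambda>n. ln (max 1 (D f c n)) + ln C)"
  have lnC: "0 \<le> ln C" using C by simp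
  have m0: "0 \<le> m n" for n using lnC by (simp add: m_def)
  have step: "m (n + N) \<le> 2 * m n" for n
  proof -
    have "ln (max 1 (D f c (n + N))) \<le> ln (C * (max 1 (D f c n))\<^sup>2)" using C(1) C(2)[of n] by (subst ln_le_cancel_iff) auto
    also have "\<dots> = ln C + 2 * ln (max 1 (D f c n))" using C(1) by (subst ln_mult) (auto simp: ln_realpow)
    finally show ?thesis by (simp add: m_def)
  qed
  \<comment> \<open>The first \<open>N\<close> values start the induction, which advances by \<open>N\<close>.\<close>
  define K where "K = (\<Sum>r<N. m r)"
  have K0: "0 \<le> K" using m0 by (auto simp: K_def intro: sum_nonneg)
  have "m n \<le> K * exp (\<epsilon> * real n)" for n
  proof (induction n rule: less_induct)
    case (less n)
    show ?case
    proof (cases "n < N")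
      case True
      then have "m n \<le> K" unfolding K_def using m0 by (intro member_le_sum) auto
      also have "\<dots> \<le> K * exp (\<epsilon> * real n)" using K0 \<epsilon> mult_left_mono[of 1 "exp (\<epsilon> * real n)" K] by simp
      finally show ?thesis .
    next
      case False
      then have k: "n = (n - N) + N" by simp
      define k where "k = n - N"
      with k have k: "n = k + N" by simp
      have "m n \<le> 2 * m k" using step k by simp
      also have "\<dots> \<le> exp (\<epsilon> * real N) * (K * exp (\<epsilon> * real k))"
        using less[of k] k N0 N2 m0 by (intro mult_mono) auto
      also have "\<dots> = K * exp (\<epsilon> * real n)" by (simp add: k exp_add[symmetric] algebra_simps)
      finally show ?thesis .
    qed
  qed
  then have a: "ln (max 1 (D f c n)) + ln C \<le> K * exp (\<epsilon> * real n)" for n unfolding m_def .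
  have "ln (max 1 (D f c n)) \<le> K * exp (\<epsilon> * real n)" for n using a[of n] lnC by linarith
  then show ?thesis using K0 by blast
qed

text \<open>The growth condition bounds \<open>1 / d\<close> by \<open>E\<close>, hence by the derivative.\<close>

theorem log_dist_subexponential:
  assumes \<epsilon>: "\<epsilon> > 0"
  shows "\<exists>K\<ge>0. \<forall>n\<ge>1. 0 \<le> ln (inverse (d f c n)) \<and> ln (inverse (d f c n)) \<le> K * exp (\<epsilon> * real n)"
proof -
  obtain K where K: "K \<ge> 0" "\<And>n. ln (max 1 (D f c n)) \<le> K * exp (\<epsilon> * real n)"
    using log_D_subexponential[OF \<epsilon>] by blast
  have "0 \<le> ln (inverse (d f c n)) \<and> ln (inverse (d f c n)) \<le> (K + \<bar>ln C\<^sub>0\<bar>) * exp (\<epsilon> * real n)" if n: "n \<ge> 1" for n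
  proof
    have i1: "1 \<le> inverse (d f c n)" using d_pos[OF n] d_le_1[of n] by (simp add: one_le_inverse)
    then show "0 \<le> ln (inverse (d f c n))" by (rule ln_ge_zero)
    have "inverse (d f c n) \<le> max 1 (D f c (n - 1)) / C\<^sub>0" using inverse_d_le[OF n] by (simp add: inverse_eq_divide)
    then have "ln (inverse (d f c n)) \<le> ln (max 1 (D f c (n - 1)) / C\<^sub>0)" using i1 C\<^sub>0 d_pos[OF n] by (subst ln_le_cancel_iff) auto
    also have "\<dots> = ln (max 1 (D f c (n - 1))) - ln C\<^sub>0" using C\<^sub>0 by (subst ln_div) auto
    also have "\<dots> \<le> K * exp (\<epsilon> * real (n - 1)) + \<bar>ln C\<^sub>0\<bar> * 1" using K(2)[of "n - 1"] by simp
    also have "\<dots> \<le> K * exp (\<epsilon> * real n) + \<bar>ln C\<^sub>0\<bar> * exp (\<epsilon> * real n)"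
      using K(1) \<epsilon> by (intro add_mono mult_left_mono) auto
    finally show "ln (inverse (d f c n)) \<le> (K + \<bar>ln C\<^sub>0\<bar>) * exp (\<epsilon> * real n)" by (simp add: algebra_simps)
  qed
  moreover have "0 \<le> K + \<bar>ln C\<^sub>0\<bar>" using K(1) by simp
  ultimately show ?thesis by blast
qed

text \<open>The first bound follows from the second because distances in the unit interval are at most 1.\<close>

lemma inverse_E_le: 
  assumes n: "n \<ge> 1" shows "inverse (E f l c n) \<le> inverse C\<^sub>0 * exp (- c\<^sub>0 * real n)"
    and "inverse (d f c n) * inverse (E f l c n) \<le> inverse C\<^sub>0 * exp (- c\<^sub>0 * real n)"
proof -
  have pos: "0 < C\<^sub>0 * exp (c\<^sub>0 * real n)" using C\<^sub>0 by simp
  have "inverse (d f c n * E f l c n) \<le> inverse (C\<^sub>0 * exp (c\<^sub>0 * real n))"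
    using growth[OF n] pos by (rule le_imp_inverse_le)
  also have "\<dots> = inverse C\<^sub>0 * exp (- c\<^sub>0 * real n)" by (simp add: exp_minus)
  finally show 2: "inverse (d f c n) * inverse (E f l c n) \<le> inverse C\<^sub>0 * exp (- c\<^sub>0 * real n)" by simp
  have "1 * inverse (E f l c n) \<le> inverse (d f c n) * inverse (E f l c n)"
    using d_pos[OF n] d_le_1[of n] E_nonneg[of n] by (intro mult_right_mono) (auto simp: one_le_inverse)
  then show "inverse (E f l c n) \<le> inverse C\<^sub>0 * exp (- c\<^sub>0 * real n)" using 2 by simp
qed

end

section \<open>The branch scheme of the return map\<close>

lemma C1_locally_lipschitz:
  fixes D :: "real \<Rightarrow> real"
  assumes S: "open S" and D: "D C1_differentiable_on S" and x: "x \<in> S"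
  shows "\<exists>r>0. \<exists>L\<ge>0. ball x r \<subseteq> S \<and> (\<forall>y\<in>ball x r. \<forall>z\<in>ball x r. \<bar>D y - D z\<bar> \<le> L * \<bar>y - z\<bar>)"
    (is "\<exists>r>0. \<exists>L\<ge>0. ?P r L")
proof -
  obtain D' where D': "\<And>x. x \<in> S \<Longrightarrow> (D has_vector_derivative D' x) (at x)" "continuous_on S D'"
    using D unfolding C1_differentiable_on_def by blast
  obtain r where r: "r > 0" "cball x r \<subseteq> S" using S x open_contains_cball by blast
  have "bounded (D' ` cball x r)"
    using D'(2) r(2) by (intro compact_imp_bounded compact_continuous_image) (auto intro: continuous_on_subset)
  then obtain L where L: "\<forall>y\<in>cball x r. \<bar>D' y\<bar> \<le> L" unfolding bounded_real by blast
  have "x \<in> cball x r" using r(1) by simp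
  then have "\<bar>D' x\<bar> \<le> L" using L by blast
  then have L0: "0 \<le> L" by simp
  have "\<bar>D y - D z\<bar> \<le> L * \<bar>y - z\<bar>" if "y \<in> ball x r" "z \<in> ball x r" for y z
  proof -
    have "norm (D y - D z) \<le> L * norm (y - z)"
    proof (rule field_differentiable_bound[of "cball x r" D D' L])
      show "convex (cball x r)" by simp
      show "(D has_field_derivative D' u) (at u within cball x r)" if "u \<in> cball x r" for u
      proof -
        have "u \<in> S" using r(2) that by blast
        from has_vector_derivative_at_within[OF D'(1)[OF this]] show ?thesis
          by (simp add: has_real_derivative_iff_has_vector_derivative)
      qed
      show "norm (D' u) \<le> L" if "u \<in> cball x r" for u using L that by auto
    qed (use that in auto)
    then show ?thesis by simp
  qed
  then have "?P r L" using r by (auto intro: subset_trans[OF ball_subset_cball])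
  then show ?thesis using r(1) L0 by blast
qed

text \<open>The variation over \<open>J \<inter> {..x}\<close> is a control function, and its increments are bounded by those of \<open>x\<close> times a
  local Lipschitz constant.\<close>

lemma continuous_control:
  assumes J: "open J" and v: "variation J \<phi> \<le> ennreal V" and V: "0 \<le> V"
    and lip: "\<And>x. x \<in> J \<Longrightarrow> \<exists>r>0. \<exists>L\<ge>0. ball x r \<subseteq> J \<and> (\<forall>y\<in>ball x r. \<forall>z\<in>ball x r. \<bar>\<phi> y - \<phi> z\<bar> \<le> L * \<bar>y - z\<bar>)"
  shows "\<exists>W. continuous_on J W \<and> controls W J \<phi> \<and> (\<forall>x\<in>J. 0 \<le> W x \<and> W x \<le> V)"
proof -
  have fin: "variation J \<phi> < \<infinity>" using v by (auto intro: le_less_trans)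
  let ?W = "\<lambda>x. enn2real (variation (J \<inter> {..x}) \<phi>)"
  note W = variation_controls[OF fin]
  have fx: "variation (J \<inter> {..x}) \<phi> < \<infinity>" for x
    using fin variation_mono[of "J \<inter> {..x}" J \<phi>] by (auto intro: le_less_trans)
  have mono: "?W y \<le> ?W z" if "y \<le> z" for y z
    using that fx[of z] by (intro enn2real_mono variation_mono) auto
  have "isCont ?W x" if x: "x \<in> J" for x
  proof -
    obtain r L where r: "r > 0" and L: "L \<ge> 0" and b: "ball x r \<subseteq> J"
      and l: "\<And>y z. y \<in> ball x r \<Longrightarrow> z \<in> ball x r \<Longrightarrow> \<bar>\<phi> y - \<phi> z\<bar> \<le> L * \<bar>y - z\<bar>"
      using lip[OF x] by blast
    have up: "?W z \<le> ?W y + L * (z - y)" if yz: "y \<in> ball x r" "z \<in> ball x r" "y \<le> z" for y z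
    proof -
      have between: "u \<in> ball x r" if "y \<le> u" "u \<le> z" for u
        using yz that by (auto simp: dist_real_def)
      have "variation (J \<inter> {..z}) \<phi> \<le> variation (J \<inter> {..z} \<inter> {..y}) \<phi> + variation (J \<inter> {..z} \<inter> {y..}) \<phi>"
        using yz b by (intro variation_glue) auto
      also have "J \<inter> {..z} \<inter> {..y} = J \<inter> {..y}" using yz(3) by auto
      also have "variation (J \<inter> {..z} \<inter> {y..}) \<phi> \<le> ennreal (L * (z - y))"
      proof (rule variation_leI[of "\<lambda>u. L * (u - y)"])
        show "controls (\<lambda>u. L * (u - y)) (J \<inter> {..z} \<inter> {y..}) \<phi>"
          unfolding controls_def
        proof (intro ballI impI)
          fix u u' assume u: "u \<in> J \<inter> {..z} \<inter> {y..}" "u' \<in> J \<inter> {..z} \<inter> {y..}" "u \<le> u'"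
          have "\<bar>\<phi> u' - \<phi> u\<bar> \<le> L * \<bar>u' - u\<bar>" using u by (intro l between) auto
          then show "\<bar>\<phi> u' - \<phi> u\<bar> \<le> L * (u' - y) - L * (u - y)" using u(3) by (simp add: algebra_simps)
        qed
        show "0 \<le> L * (u - y) \<and> L * (u - y) \<le> L * (z - y)" if "u \<in> J \<inter> {..z} \<inter> {y..}" for u
          using that L by (auto intro!: mult_left_mono)
      qed
      finally have "variation (J \<inter> {..z}) \<phi> \<le> variation (J \<inter> {..y}) \<phi> + ennreal (L * (z - y))"
        by (simp add: add_left_mono)
      then have "?W z \<le> enn2real (variation (J \<inter> {..y}) \<phi> + ennreal (L * (z - y)))"
        using fx[of y] by (intro enn2real_mono) auto
      also have "\<dots> = ?W y + L * (z - y)" using fx[of y] L yz(3) by (subst enn2real_plus) auto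
      finally show ?thesis .
    qed
    have lipW: "\<bar>?W z - ?W y\<bar> \<le> L * \<bar>z - y\<bar>" if "y \<in> ball x r" "z \<in> ball x r" for y z
    proof (cases "y \<le> z")
      case True then show ?thesis using up[OF that] mono[of y z] by simp
    next
      case False then show ?thesis using up[OF that(2,1)] mono[of z y] by simp
    qed
    have "((\<lambda>y. ?W y - ?W x) \<longlongrightarrow> 0) (at x)"
    proof (rule Lim_null_comparison[where g="\<lambda>y. L * \<bar>y - x\<bar>"])
      have "eventually (\<lambda>y. y \<in> ball x r) (at x)"
        using r by (intro eventually_at_in_open') auto
      then show "eventually (\<lambda>y. norm (?W y - ?W x) \<le> L * \<bar>y - x\<bar>) (at x)"
        by eventually_elim (use lipW[of x] r in auto)
      have "((\<lambda>y. L * \<bar>y - x\<bar>) \<longlongrightarrow> L * \<bar>x - x\<bar>) (at x)" by (intro tendsto_intros)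
      then show "((\<lambda>y. L * \<bar>y - x\<bar>) \<longlongrightarrow> 0) (at x)" by simp
    qed
    then show ?thesis unfolding isCont_def by (rule LIM_zero_cancel)
  qed
  then have "continuous_on J ?W" by (simp add: continuous_at_imp_continuous_on)
  moreover have "enn2real (variation J \<phi>) \<le> V" using v V by (intro enn2real_leI) auto
  then have "\<forall>x\<in>J. 0 \<le> ?W x \<and> ?W x \<le> V" using W(3) by (auto intro: order_trans)
  ultimately show ?thesis using W(1) by blast
qed

lemma inverse_abs_lipschitz:
  fixes a b :: real
  assumes "1 \<le> \<bar>a\<bar>" "1 \<le> \<bar>b\<bar>" shows "\<bar>\<bar>1 / a\<bar> - \<bar>1 / b\<bar>\<bar> \<le> \<bar>a - b\<bar>"
proof -
  have ne: "a \<noteq> 0" "b \<noteq> 0" using assms by auto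
  have "\<bar>1 / a\<bar> - \<bar>1 / b\<bar> = (\<bar>b\<bar> - \<bar>a\<bar>) / (\<bar>a\<bar> * \<bar>b\<bar>)" using ne by (simp add: field_simps)
  then have "\<bar>\<bar>1 / a\<bar> - \<bar>1 / b\<bar>\<bar> = \<bar>\<bar>b\<bar> - \<bar>a\<bar>\<bar> / (\<bar>a\<bar> * \<bar>b\<bar>)" by (simp add: abs_mult)
  also have "\<dots> \<le> \<bar>\<bar>b\<bar> - \<bar>a\<bar>\<bar> / 1"
  proof (rule divide_left_mono)
    have "1 * 1 \<le> \<bar>a\<bar> * \<bar>b\<bar>" using assms by (intro mult_mono) auto
    then show "1 \<le> \<bar>a\<bar> * \<bar>b\<bar>" "0 < \<bar>a\<bar> * \<bar>b\<bar> * 1" by auto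
  qed simp
  also have "\<dots> \<le> \<bar>a - b\<bar>" by (simp add: abs_if)
  finally show ?thesis .
qed

text \<open>Interpolation: \<open>exp (s * \<theta>\<^sub>0 * n) * y\<close> is the geometric mean, with weights \<open>s\<close> and \<open>1 - s\<close>, of
  \<open>exp (\<theta>\<^sub>0 * n) * y \<le> exp w\<close> and \<open>y \<le> 1 / \<sigma>\<close>; it is below 1 if \<open>s\<close> is small.\<close>

lemma small_rate:
  fixes \<sigma> \<theta>\<^sub>0 w :: real
  assumes \<sigma>: "\<sigma> > 1" and \<theta>\<^sub>0: "\<theta>\<^sub>0 > 0" and w: "w \<ge> 0"
  shows "\<exists>\<theta>>0. \<exists>\<rho>\<ge>0. \<theta> \<le> \<theta>\<^sub>0 \<and> \<rho> < 1 \<and> (\<forall>n y. 0 < y \<longrightarrow> y \<le> 1 / \<sigma> \<longrightarrow>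
           exp (\<theta>\<^sub>0 * real n) * y \<le> exp w \<longrightarrow> exp (\<theta> * real n) * y \<le> \<rho>)"
proof -
  define L where "L = ln \<sigma>"
  have L: "L > 0" using \<sigma> by (simp add: L_def)
  define s where "s = L / (2 * (w + L))"
  have s: "0 < s" "s \<le> 1 / 2" "s * (w + L) = L / 2" using L w by (auto simp: s_def field_simps)
  have "exp (s * \<theta>\<^sub>0 * real n) * y \<le> exp (- L / 2)"
    if y: "0 < y" "y \<le> 1 / \<sigma>" and W: "exp (\<theta>\<^sub>0 * real n) * y \<le> exp w" for n y
  proof -
    have ly: "ln y \<le> - L"
    proof -
      have "ln y \<le> ln (1 / \<sigma>)" using y \<sigma> by (subst ln_le_cancel_iff) auto
      then show ?thesis using \<sigma> by (simp add: L_def ln_div)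
    qed
    have "ln (exp (\<theta>\<^sub>0 * real n) * y) \<le> ln (exp w)" using W y by (subst ln_le_cancel_iff) auto
    then have lw: "\<theta>\<^sub>0 * real n + ln y \<le> w" using y by (simp add: ln_mult)
    have "s * (\<theta>\<^sub>0 * real n + ln y) + (1 - s) * ln y \<le> s * w + (1 - s) * (- L)"
      using s ly lw by (intro add_mono mult_left_mono) auto
    also have "\<dots> = - L / 2" using s(3) by (simp add: algebra_simps)
    finally have "s * \<theta>\<^sub>0 * real n + ln y \<le> - L / 2" by (simp add: algebra_simps)
    then have "exp (s * \<theta>\<^sub>0 * real n + ln y) \<le> exp (- L / 2)" by (subst exp_le_cancel_iff)
    then show ?thesis using y by (simp add: exp_add)
  qed
  moreover have "s * \<theta>\<^sub>0 \<le> 1 * \<theta>\<^sub>0" using s \<theta>\<^sub>0 by (intro mult_right_mono) auto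
  moreover have "0 < s * \<theta>\<^sub>0" "exp (- L / 2) < 1" using s \<theta>\<^sub>0 L by auto
  ultimately show ?thesis by (intro exI[of _ "s * \<theta>\<^sub>0"] conjI exI[of _ "exp (- L / 2)"]) auto
qed

context inducing_scheme
begin

definition bind :: "real set \<Rightarrow> nat" where
  "bind a = binding f \<delta> b q\<^sub>0 (SOME x. x \<in> a)"

definition ret :: "real set \<Rightarrow> nat" where
  "ret a = \<tau> (SOME x. x \<in> a)"

lemma some_in: "a \<in> \<alpha> \<Longrightarrow> (SOME x. x \<in> a) \<in> a"
  using \<alpha>_intervals[of a] by (auto intro: someI)

lemma bind_eq: "a \<in> \<alpha> \<Longrightarrow> x \<in> a \<Longrightarrow> binding f \<delta> b q\<^sub>0 x = bind a"
  using binding_constant[of a] some_in[of a] unfolding bind_def constant_on_def by metis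

lemma ret_eq: "a \<in> \<alpha> \<Longrightarrow> x \<in> a \<Longrightarrow> \<tau> x = ret a"
  using \<tau>_constant[of a] some_in[of a] unfolding ret_def constant_on_def by metis

lemma entry_attained:
  assumes "entry_time f \<delta> x < enat q\<^sub>0"
  shows "entry_time f \<delta> x = enat (the_enat (entry_time f \<delta> x))" "(f ^^ the_enat (entry_time f \<delta> x)) x \<in> \<Delta> f \<delta>"
proof -
  let ?S = "{j. (f ^^ j) x \<in> \<Delta> f \<delta>}"
  have ne: "enat ` ?S \<noteq> {}"
  proof
    assume "enat ` ?S = {}"
    then have "entry_time f \<delta> x = \<infinity>" unfolding entry_time_def Inf_enat_def by simp
    then show False using assms by simp
  qed
  then have "(LEAST y. y \<in> enat ` ?S) \<in> enat ` ?S" by (auto intro: LeastI)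
  then have "entry_time f \<delta> x \<in> enat ` ?S" unfolding entry_time_def Inf_enat_def using ne by auto
  then show "entry_time f \<delta> x = enat (the_enat (entry_time f \<delta> x))" "(f ^^ the_enat (entry_time f \<delta> x)) x \<in> \<Delta> f \<delta>" by auto
qed

lemma \<tau>_bounds: "1 \<le> \<tau> x" "\<tau> x \<le> binding f \<delta> b q\<^sub>0 x + q\<^sub>0"
proof -
  show "1 \<le> \<tau> x"
  proof (cases "entry_time f \<delta> x \<ge> enat q\<^sub>0")
    case True then show ?thesis using q\<^sub>0_ge_1 by (simp add: \<tau>_def tau_def)
  next
    case False
    then have "\<tau> x = the_enat (entry_time f \<delta> x) + b ((f ^^ the_enat (entry_time f \<delta> x)) x)"
      by (simp add: \<tau>_def tau_def)
    then show ?thesis using b_ge_1[OF entry_attained(2)[of x]] False by (simp add: not_le)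
  qed
  show "\<tau> x \<le> binding f \<delta> b q\<^sub>0 x + q\<^sub>0"
  proof (cases "entry_time f \<delta> x \<ge> enat q\<^sub>0")
    case True then show ?thesis by (simp add: \<tau>_def tau_def binding_def)
  next
    case False
    then have "enat (the_enat (entry_time f \<delta> x)) < enat q\<^sub>0" using entry_attained(1)[of x] by simp
    then show ?thesis using False by (simp add: \<tau>_def tau_def binding_def)
  qed
qed

lemma ret_bounds: "a \<in> \<alpha> \<Longrightarrow> 1 \<le> ret a \<and> ret a \<le> bind a + q\<^sub>0"
  using \<tau>_bounds[of "SOME x. x \<in> a"] by (simp add: ret_def bind_def)

lemma \<alpha>b_iff: "a \<in> \<alpha>b k \<longleftrightarrow> a \<in> \<alpha> \<and> bind a = k"
  using bind_eq some_in by (auto simp: \<alpha>b_def)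

text \<open>The quantities \<open>1 / E\<close> and \<open>1 / (d * E)\<close> decay at rate \<open>c\<^sub>0\<close>. The factor $\log d^{-1}$ is subexponential and costs half
  of this rate.\<close>

lemma exponential_weights:
  assumes map: "critical_map f l" and c\<^sub>0: "c\<^sub>0 > 0" and C\<^sub>0: "C\<^sub>0 > 0"
    and growth: "\<And>c n. c \<in> crit f \<Longrightarrow> l c > 1 \<Longrightarrow> n \<ge> 1 \<Longrightarrow> d f c n * E f l c n \<ge> C\<^sub>0 * exp (c\<^sub>0 * real n)"
  shows "\<exists>A>0. \<forall>a\<in>\<alpha>. (\<forall>x\<in>a. \<bar>1 / deriv F x\<bar> \<le> A * exp (- (c\<^sub>0 / 2) * real (bind a))) \<and>
      variation a (\<lambda>x. \<bar>1 / deriv F x\<bar>) \<le> ennreal (A * exp (- (c\<^sub>0 / 2) * real (bind a)))"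
proof -
  interpret map: critical_map f l by (rule map)
  let ?crit = "{c\<in>crit f. l c > 1}"
  have orbit: "critical_orbit f l c c\<^sub>0 C\<^sub>0" if "c \<in> ?crit" for c
    using that c\<^sub>0 C\<^sub>0 growth by unfold_locales auto
  have "\<forall>c\<in>?crit. \<exists>K\<ge>0. \<forall>n\<ge>1. 0 \<le> ln (inverse (d f c n)) \<and> ln (inverse (d f c n)) \<le> K * exp (c\<^sub>0 / 2 * real n)"
  proof (intro ballI)
    fix c :: one_sided assume "c \<in> ?crit"
    from critical_orbit.log_dist_subexponential[OF orbit[OF this], of "c\<^sub>0 / 2"] c\<^sub>0
    show "\<exists>K\<ge>0. \<forall>n\<ge>1. 0 \<le> ln (inverse (d f c n)) \<and> ln (inverse (d f c n)) \<le> K * exp (c\<^sub>0 / 2 * real n)"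
      by simp
  qed
  from bchoice[OF this] obtain K where K: "\<And>c. c \<in> ?crit \<Longrightarrow> K c \<ge> 0" "\<And>c n. c \<in> ?crit \<Longrightarrow> n \<ge> 1 \<Longrightarrow>
      0 \<le> ln (inverse (d f c n)) \<and> ln (inverse (d f c n)) \<le> K c * exp (c\<^sub>0 / 2 * real n)" by blast
  define L where "L = (\<Sum>c\<in>?crit. K c)"
  have fin: "finite ?crit" using map.finite_crit by simp
  have L: "0 \<le> L" "\<And>c. c \<in> ?crit \<Longrightarrow> K c \<le> L"
    using K(1) fin by (auto simp: L_def intro: sum_nonneg member_le_sum)
  obtain C :: real where C: "C > 0" and b2: "\<forall>k\<ge>2. \<forall>a\<in>\<alpha>b k. \<exists>c\<in>crit f. l c > 1 \<and>
          (\<forall>x\<in>a. \<bar>1 / deriv F x\<bar> \<le> C * inverse (E f l c k)) \<and>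
          variation a (\<lambda>x. \<bar>1 / deriv F x\<bar>)
            \<le> ennreal (C * (1 + ln (inverse (d f c (k - 1)))) *
                         inverse (d f c (k - 1)) * inverse (E f l c (k - 1)))"
    and b1: "\<forall>k\<le>1. \<forall>a\<in>\<alpha>b k.
          (\<forall>x\<in>a. \<bar>1 / deriv F x\<bar> \<le> C) \<and> variation a (\<lambda>x. \<bar>1 / deriv F x\<bar>) \<le> ennreal C"
    using bounds by (elim exE conjE) (rule that)
  define \<gamma> where "\<gamma> = c\<^sub>0 / 2"
  have \<gamma>: "\<gamma> > 0" "c\<^sub>0 = 2 * \<gamma>" using c\<^sub>0 by (auto simp: \<gamma>_def)
  \<comment> \<open>The factor \<open>exp \<gamma>\<close> pays for the index \<open>k - 1\<close> in the bound of the variation, the summand 1 for binding periods below 2.\<close>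
  define A where "A = C * exp \<gamma> * ((1 + L) * inverse C\<^sub>0 + 1)"
  have A: "A > 0" using C L C\<^sub>0 by (simp add: A_def add_nonneg_pos)
  have e1: "1 \<le> exp \<gamma>" using \<gamma> by simp
  have iC: "0 < inverse C\<^sub>0" using C\<^sub>0 by simp
  have "(\<forall>x\<in>a. \<bar>1 / deriv F x\<bar> \<le> A * exp (- \<gamma> * real (bind a))) \<and>
      variation a (\<lambda>x. \<bar>1 / deriv F x\<bar>) \<le> ennreal (A * exp (- \<gamma> * real (bind a)))" if a: "a \<in> \<alpha>" for a
  proof (cases "bind a \<le> 1")
    case True
    have "C \<le> A * exp (- \<gamma> * real (bind a))"
    proof -
      have "C * 1 \<le> C * (exp \<gamma> * exp (- \<gamma> * real (bind a)))"
      proof (intro mult_left_mono)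
        have "0 \<le> \<gamma> + - \<gamma> * real (bind a)" using True \<gamma> mult_left_mono[of "real (bind a)" 1 \<gamma>] by simp
        then have "1 \<le> exp (\<gamma> + - \<gamma> * real (bind a))" by simp
        then show "1 \<le> exp \<gamma> * exp (- \<gamma> * real (bind a))" by (simp only: exp_add)
      qed (use C in simp)
      also have "\<dots> = C * exp \<gamma> * 1 * exp (- \<gamma> * real (bind a))" by simp
      also have "\<dots> \<le> A * exp (- \<gamma> * real (bind a))"
        unfolding A_def using C L iC by (intro mult_right_mono mult_left_mono) auto
      finally show ?thesis by simp
    qed
    moreover have "(\<forall>x\<in>a. \<bar>1 / deriv F x\<bar> \<le> C)" "variation a (\<lambda>x. \<bar>1 / deriv F x\<bar>) \<le> ennreal C"
      using b1[rule_format, OF True, of a] a \<alpha>b_iff[of a "bind a"] by simp_all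
    ultimately show ?thesis by (auto intro: order_trans ennreal_leI)
  next
    case False
    define k where "k = bind a"
    have k: "k \<ge> 2" "k - 1 \<ge> 1" "a \<in> \<alpha>b k" using False a \<alpha>b_iff by (auto simp: k_def)
    obtain c where c: "c \<in> crit f" "l c > 1" and sup: "\<And>x. x \<in> a \<Longrightarrow> \<bar>1 / deriv F x\<bar> \<le> C * inverse (E f l c k)"
      and var: "variation a (\<lambda>x. \<bar>1 / deriv F x\<bar>) \<le> ennreal (C * (1 + ln (inverse (d f c (k - 1)))) *
                         inverse (d f c (k - 1)) * inverse (E f l c (k - 1)))"
      using b2[rule_format, OF k(1,3)] by blast
    have cc: "c \<in> ?crit" using c by simp
    interpret orbit: critical_orbit f l c c\<^sub>0 C\<^sub>0 by (rule orbit[OF cc])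
    have exps: "exp (- c\<^sub>0 * real k) \<le> exp (- \<gamma> * real k)" using \<gamma> by simp
    have "C * inverse (E f l c k) \<le> C * (inverse C\<^sub>0 * exp (- \<gamma> * real k))"
      using orbit.inverse_E_le(1)[of k] k exps iC C by (intro mult_left_mono order_trans[OF orbit.inverse_E_le(1)]) auto
    also have "\<dots> = C * 1 * (inverse C\<^sub>0) * exp (- \<gamma> * real k)" by simp
    also have "\<dots> \<le> C * exp \<gamma> * ((1 + L) * inverse C\<^sub>0 + 1) * exp (- \<gamma> * real k)"
    proof (intro mult_right_mono mult_mono)
      have "1 * inverse C\<^sub>0 \<le> (1 + L) * inverse C\<^sub>0" using L iC by (intro mult_right_mono) auto
      then show "inverse C\<^sub>0 \<le> (1 + L) * inverse C\<^sub>0 + 1" by simp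
    qed (use C e1 iC L in auto)
    finally have s: "C * inverse (E f l c k) \<le> A * exp (- \<gamma> * real k)" by (simp add: A_def)
    let ?l = "ln (inverse (d f c (k - 1)))"
    have l: "0 \<le> ?l" "?l \<le> L * exp (\<gamma> * real (k - 1))"
    proof -
      show "0 \<le> ?l" using K(2)[OF cc k(2)] by simp
      have "?l \<le> K c * exp (\<gamma> * real (k - 1))" using K(2)[OF cc k(2)] by (simp add: \<gamma>_def)
      also have "\<dots> \<le> L * exp (\<gamma> * real (k - 1))" using L(2)[OF cc] by (intro mult_right_mono) auto
      finally show "?l \<le> L * exp (\<gamma> * real (k - 1))" .
    qed
    have "C * (1 + ?l) * inverse (d f c (k - 1)) * inverse (E f l c (k - 1))
        = (C * (1 + ?l)) * (inverse (d f c (k - 1)) * inverse (E f l c (k - 1)))" by simp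
    also have "\<dots> \<le> (C * ((1 + L) * exp (\<gamma> * real (k - 1)))) * (inverse C\<^sub>0 * exp (- c\<^sub>0 * real (k - 1)))"
    proof (rule mult_mono)
      have "0 \<le> \<gamma> * real (k - 1)" using \<gamma> by simp
      then have "1 \<le> exp (\<gamma> * real (k - 1))" by (subst one_le_exp_iff)
      then have "1 + ?l \<le> (1 + L) * exp (\<gamma> * real (k - 1))" unfolding distrib_right mult_1 using l(2) by (rule add_mono)
      then show "C * (1 + ?l) \<le> C * ((1 + L) * exp (\<gamma> * real (k - 1)))" using C by (intro mult_left_mono) auto
      show "inverse (d f c (k - 1)) * inverse (E f l c (k - 1)) \<le> inverse C\<^sub>0 * exp (- c\<^sub>0 * real (k - 1))"
        by (rule orbit.inverse_E_le(2)[OF k(2)])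
      show "0 \<le> inverse (d f c (k - 1)) * inverse (E f l c (k - 1))"
        using orbit.d_pos[OF k(2)] orbit.E_nonneg by simp
    qed (use C L in auto)
    also have "\<dots> = C * ((1 + L) * inverse C\<^sub>0) * (exp (\<gamma> * real (k - 1)) * exp (- c\<^sub>0 * real (k - 1)))" by simp
    also have "exp (\<gamma> * real (k - 1)) * exp (- c\<^sub>0 * real (k - 1)) = exp \<gamma> * exp (- \<gamma> * real k)"
    proof -
      have "\<gamma> * real (k - 1) + - c\<^sub>0 * real (k - 1) = \<gamma> + - \<gamma> * real k" using k(1) \<gamma>(2) by (simp add: of_nat_diff algebra_simps)
      then show ?thesis by (simp only: exp_add[symmetric])
    qed
    also have "C * ((1 + L) * inverse C\<^sub>0) * (exp \<gamma> * exp (- \<gamma> * real k)) =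
        (C * exp \<gamma>) * ((1 + L) * inverse C\<^sub>0) * exp (- \<gamma> * real k)" by simp
    also have "\<dots> \<le> A * exp (- \<gamma> * real k)"
      unfolding A_def using C by (intro mult_right_mono mult_left_mono) auto
    finally have v: "C * (1 + ?l) * inverse (d f c (k - 1)) * inverse (E f l c (k - 1)) \<le> A * exp (- \<gamma> * real k)" .
    show ?thesis
      using order_trans[OF sup s] order_trans[OF var ennreal_leI[OF v]] unfolding k_def by blast
  qed
  then show ?thesis using A unfolding \<gamma>_def by blast
qed

lemma F_unit_interval: "F \<in> measurable leb leb" and f_measurable_leb: "f \<in> measurable leb leb"
  and h_measurable_leb: "h \<in> borel_measurable leb"
proof -
  have s: "sets (density_measure h) = sets leb" and F: "F \<in> measurable (density_measure h) (density_measure h)"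
    using F_acip by (auto simp: acip_def)
  show "F \<in> measurable leb leb" using F measurable_cong_sets[OF s s] by auto
  have s: "sets (lifted_measure f \<tau> (density_measure h)) = sets leb"
    and f: "f \<in> measurable (lifted_measure f \<tau> (density_measure h)) (lifted_measure f \<tau> (density_measure h))"
    using f_acip by (auto simp: acip_def)
  show "f \<in> measurable leb leb" using f measurable_cong_sets[OF s s] by auto
  show "h \<in> borel_measurable leb" using h_BV by (intro BV_measurable) (simp add: BV_def)
qed

lemma density_null:
  assumes A: "A \<in> sets leb"
  shows "emeasure (density_measure h) A = 0 \<longleftrightarrow> (AE x in leb. x \<in> A \<longrightarrow> h x = 0)"
proof -
  have "emeasure (density_measure h) A = 0 \<longleftrightarrow> A \<in> null_sets (density_measure h)"
    using A by (auto simp: density_measure_def)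
  also have "\<dots> \<longleftrightarrow> (AE x in leb. x \<in> A \<longrightarrow> ennreal (h x) = 0)"
    unfolding density_measure_def using A h_measurable_leb by (subst null_sets_density_iff) auto
  also have "\<dots> \<longleftrightarrow> (AE x in leb. x \<in> A \<longrightarrow> h x = 0)"
  proof
    assume "AE x in leb. x \<in> A \<longrightarrow> ennreal (h x) = 0"
    then show "AE x in leb. x \<in> A \<longrightarrow> h x = 0" using AE_space[of leb]
      by eventually_elim (use h_nonneg in \<open>auto simp: ennreal_eq_0_iff intro: antisym\<close>)
  next
    assume "AE x in leb. x \<in> A \<longrightarrow> h x = 0"
    then show "AE x in leb. x \<in> A \<longrightarrow> ennreal (h x) = 0" by eventually_elim simp
  qed
  finally show ?thesis .
qed

text \<open>The measure with density \<open>h\<close> is \<open>F\<close>-invariant.\<close>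

lemma F_quasi_invariant:
  assumes A: "A \<in> sets leb" and z: "AE x in leb. x \<in> A \<longrightarrow> h x = 0"
  shows "AE x in leb. h x \<noteq> 0 \<longrightarrow> F x \<notin> A"
proof -
  let ?\<mu> = "density_measure h"
  have s: "sets ?\<mu> = sets leb" "F \<in> measurable ?\<mu> ?\<mu>" "distr ?\<mu> ?\<mu> F = ?\<mu>" using F_acip by (auto simp: acip_def)
  have sp: "space ?\<mu> = {0..1}" using sets_eq_imp_space_eq[OF s(1)] by simp
  have "emeasure ?\<mu> (F -` A \<inter> space ?\<mu>) = emeasure (distr ?\<mu> ?\<mu> F) A"
    using A s by (intro emeasure_distr[symmetric]) auto
  also have "\<dots> = 0" using s(3) density_null[OF A] z by simp
  finally have "emeasure ?\<mu> (F -` A \<inter> {0..1}) = 0" by (simp add: sp)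
  moreover have "F -` A \<inter> {0..1} \<in> sets leb" using measurable_sets[OF s(2), of A] A s(1) sp by simp
  ultimately have "AE x in leb. x \<in> F -` A \<inter> {0..1} \<longrightarrow> h x = 0" by (subst (asm) density_null)
  then show ?thesis using AE_space[of leb] by eventually_elim auto
qed

text \<open>The partition, enumerated; all other indices carry the empty set.\<close>

definition idx :: "nat set" where "idx = to_nat_on \<alpha> ` \<alpha>"

definition piece :: "nat \<Rightarrow> real set" where
  "piece n = (if n \<in> idx then from_nat_into \<alpha> n else {})"

definition time :: "nat \<Rightarrow> nat" where
  "time n = (if n \<in> idx then ret (piece n) else 1)"

lemma piece_\<alpha>: "n \<in> idx \<Longrightarrow> piece n \<in> \<alpha>"
  using from_nat_into_to_nat_on[OF \<alpha>_countable] by (auto simp: piece_def idx_def)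

lemma piece_cases: "x \<in> piece n \<Longrightarrow> n \<in> idx" by (auto simp: piece_def split: if_splits)

lemma piece_inj: "inj_on piece idx"
  using from_nat_into_to_nat_on[OF \<alpha>_countable] by (auto simp: inj_on_def piece_def idx_def)

lemma piece_disjoint: "disjoint_family piece"
  unfolding disjoint_family_on_def
proof (intro ballI impI)
  fix m n :: nat assume "m \<noteq> n"
  show "piece m \<inter> piece n = {}"
  proof (cases "m \<in> idx \<and> n \<in> idx")
    case True
    then have "piece m \<noteq> piece n" using inj_onD[OF piece_inj] \<open>m \<noteq> n\<close> by blast
    then show ?thesis using \<alpha>_disjoint piece_\<alpha> True by (auto simp: disjoint_def)
  next
    case False then show ?thesis by (auto simp: piece_def)
  qed
qed

lemma piece_Union: "(\<Union>n. piece n) = \<Union>\<alpha>"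
proof
  show "(\<Union>n. piece n) \<subseteq> \<Union>\<alpha>"
  proof (rule UN_least)
    fix n
    show "piece n \<subseteq> \<Union>\<alpha>" using piece_\<alpha>[of n] by (cases "n \<in> idx") (auto simp: piece_def)
  qed
  show "\<Union>\<alpha> \<subseteq> (\<Union>n. piece n)"
  proof
    fix x assume "x \<in> \<Union>\<alpha>"
    then obtain a where a: "a \<in> \<alpha>" "x \<in> a" by auto
    then have "piece (to_nat_on \<alpha> a) = a" using from_nat_into_to_nat_on[OF \<alpha>_countable] by (auto simp: piece_def idx_def)
    with a(2) have "x \<in> piece (to_nat_on \<alpha> a)" by simp
    then show "x \<in> (\<Union>n. piece n)" by (rule UN_I[OF UNIV_I])
  qed
qed

lemma \<tau>_piece: "x \<in> piece n \<Longrightarrow> \<tau> x = time n"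
  using ret_eq[OF piece_\<alpha>, of n x] piece_cases[of x n] by (simp add: time_def)

lemma time_pos: "1 \<le> time n"
  using ret_bounds[OF piece_\<alpha>, of n] by (simp add: time_def)

text \<open>Return times exceed binding periods by at most \<open>q\<^sub>0\<close>, and boundedly many elements share a binding period,
  so the sum is dominated by a geometric series.\<close>

lemma weights_summable:
  assumes \<gamma>: "\<gamma> > 0" and A: "A \<ge> 0"
  shows "summable (\<lambda>n. if n \<in> idx then exp (\<gamma> / 2 * real (time n)) * (A * exp (- \<gamma> * real (bind (piece n)))) else 0)"
proof -
  obtain m :: nat where m: "m > 0" "\<forall>k. finite (\<alpha>b k) \<and> card (\<alpha>b k) \<le> m"
    using bounds by (elim exE conjE) blast
  define M where "M = real m"
  have M: "\<And>k. finite (\<alpha>b k)" "\<And>k. real (card (\<alpha>b k)) \<le> M" "M > 0" using m by (auto simp: M_def)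
  let ?w = "\<lambda>a. exp (\<gamma> / 2 * real (ret a)) * (A * exp (- \<gamma> * real (bind a)))"
  define c where "c = exp (\<gamma> / 2 * real q\<^sub>0) * A"
  have c: "c \<ge> 0" using A by (simp add: c_def)
  let ?r = "\<lambda>k. exp (- \<gamma> / 2) ^ k"
  have wle: "?w a \<le> c * ?r (bind a)" if a: "a \<in> \<alpha>" for a
  proof -
    have "?w a \<le> exp (\<gamma> / 2 * real (bind a + q\<^sub>0)) * (A * exp (- \<gamma> * real (bind a)))"
      using ret_bounds[OF a] \<gamma> A by (intro mult_right_mono) auto
    also have "\<dots> = c * exp (\<gamma> / 2 * real (bind a) + - \<gamma> * real (bind a))"
      by (simp add: c_def exp_add[symmetric] distrib_left)
    also have "\<gamma> / 2 * real (bind a) + - \<gamma> * real (bind a) = real (bind a) * (- \<gamma> / 2)" by (simp add: field_simps)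
    finally show ?thesis by (simp only: exp_of_nat_mult)
  qed
  have sr: "summable ?r" using \<gamma> by (intro summable_geometric) auto
  show ?thesis
  proof (rule summableI_nonneg_bounded)
    fix n
    show "0 \<le> (if n \<in> idx then exp (\<gamma> / 2 * real (time n)) * (A * exp (- \<gamma> * real (bind (piece n)))) else 0)"
      using A by simp
    let ?S = "piece ` ({..<n} \<inter> idx)"
    have S: "finite ?S" "?S \<subseteq> \<alpha>" using piece_\<alpha> by auto
    have "(\<Sum>i<n. if i \<in> idx then exp (\<gamma> / 2 * real (time i)) * (A * exp (- \<gamma> * real (bind (piece i)))) else 0)
        = (\<Sum>i\<in>{..<n} \<inter> idx. ?w (piece i))"
      by (subst sum.inter_restrict) (auto simp: time_def intro!: sum.cong)
    also have "\<dots> = (\<Sum>a\<in>?S. ?w a)"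
      using inj_on_subset[OF piece_inj] by (subst sum.reindex) auto
    also have "\<dots> \<le> (\<Sum>a\<in>?S. c * ?r (bind a))" using wle S(2) by (intro sum_mono) auto
    also have "\<dots> = (\<Sum>k\<in>bind ` ?S. \<Sum>a\<in>{a\<in>?S. bind a = k}. c * ?r (bind a))"
      by (rule sum.image_gen[OF S(1)])
    also have "\<dots> \<le> (\<Sum>k\<in>bind ` ?S. M * (c * ?r k))"
    proof (rule sum_mono)
      fix k
      have sub: "{a\<in>?S. bind a = k} \<subseteq> \<alpha>b k" using S(2) \<alpha>b_iff by auto
      have "(\<Sum>a\<in>{a\<in>?S. bind a = k}. c * ?r (bind a)) = real (card {a\<in>?S. bind a = k}) * (c * ?r k)" by simp
      also have "\<dots> \<le> M * (c * ?r k)"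
        using card_mono[OF M(1) sub] M(2)[of k] c by (intro mult_right_mono) auto
      finally show "(\<Sum>a\<in>{a\<in>?S. bind a = k}. c * ?r (bind a)) \<le> M * (c * ?r k)" .
    qed
    also have "\<dots> \<le> (\<Sum>k. M * (c * ?r k))"
      using S(1) M(3) c by (intro sum_le_suminf summable_mult sr) auto
    finally show "(\<Sum>i<n. if i \<in> idx then exp (\<gamma> / 2 * real (time i)) * (A * exp (- \<gamma> * real (bind (piece i)))) else 0)
      \<le> (\<Sum>k. M * (c * ?r k))" .
  qed
qed

text \<open>The rate \<open>\<gamma> / 2\<close> keeps the weights summable but may spoil the expansion; the smaller rate \<open>\<theta>\<close> keeps both.\<close>

theorem base_branch_scheme:
  assumes map: "critical_map f l" and c\<^sub>0: "c\<^sub>0 > 0" and C\<^sub>0: "C\<^sub>0 > 0"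
    and growth: "\<And>c n. c \<in> crit f \<Longrightarrow> l c > 1 \<Longrightarrow> n \<ge> 1 \<Longrightarrow> d f c n * E f l c n \<ge> C\<^sub>0 * exp (c\<^sub>0 * real n)"
  shows "\<exists>\<theta> \<rho> N. 0 \<le> \<rho> \<and> \<rho> < 1 \<and> branch_scheme f h \<theta> \<rho> F time piece N"
proof -
  obtain A where A: "A > 0" and sup: "\<And>a x. a \<in> \<alpha> \<Longrightarrow> x \<in> a \<Longrightarrow> \<bar>1 / deriv F x\<bar> \<le> A * exp (- (c\<^sub>0 / 2) * real (bind a))"
    and var: "\<And>a. a \<in> \<alpha> \<Longrightarrow> variation a (\<lambda>x. \<bar>1 / deriv F x\<bar>) \<le> ennreal (A * exp (- (c\<^sub>0 / 2) * real (bind a)))"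
    using exponential_weights[OF assms] by blast
  define \<gamma> where "\<gamma> = c\<^sub>0 / 2"
  have \<gamma>: "\<gamma> > 0" using c\<^sub>0 by (simp add: \<gamma>_def)
  obtain \<sigma> where \<sigma>: "\<sigma> > 1" "\<And>a x. a \<in> \<alpha> \<Longrightarrow> x \<in> a \<Longrightarrow> \<bar>deriv F x\<bar> \<ge> \<sigma>" using F_expanding by blast
  let ?N0 = "\<lambda>n. if n \<in> idx then exp (\<gamma> / 2 * real (time n)) * (A * exp (- \<gamma> * real (bind (piece n)))) else 0"
  define w where "w = ln (max 1 (suminf ?N0))"
  have N0s: "summable ?N0" using weights_summable[OF \<gamma>, of A] A by simp
  have N00: "0 \<le> ?N0 n" for n using A by simp
  have w: "0 \<le> w" "exp w = max 1 (suminf ?N0)" by (auto simp: w_def)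
  have N0w: "?N0 n \<le> exp w" for n
    using sum_le_suminf[OF N0s, of "{n}"] N00 w(2) by auto
  obtain \<theta> \<rho> where \<theta>: "\<theta> > 0" "\<theta> \<le> \<gamma> / 2" and \<rho>: "0 \<le> \<rho>" "\<rho> < 1"
    and rate: "\<And>n y. 0 < y \<Longrightarrow> y \<le> 1 / \<sigma> \<Longrightarrow> exp (\<gamma> / 2 * real n) * y \<le> exp w \<Longrightarrow> exp (\<theta> * real n) * y \<le> \<rho>"
    using small_rate[OF \<sigma>(1), of "\<gamma> / 2" w] \<gamma> w(1) by auto
  have rate_le: "exp (\<theta> * real (time n)) \<le> exp (\<gamma> / 2 * real (time n))" for n
    unfolding exp_le_cancel_iff by (rule mult_right_mono[OF \<theta>(2)]) simp
  have "branch_scheme f h \<theta> \<rho> F time piece ?N0"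
  proof unfold_locales
    show "0 < \<theta>" by (rule \<theta>(1))
    show "summable ?N0" by (rule N0s)
    show "0 \<le> ?N0 n" for n by (rule N00)
    show "disjoint_family piece" by (rule piece_disjoint)
    show "f \<in> measurable leb leb" "F \<in> measurable leb leb" "h \<in> borel_measurable leb"
      by (rule f_measurable_leb F_unit_interval h_measurable_leb)+
    have "AE x in leb. x \<notin> {0..1} - \<Union>\<alpha>" using \<alpha>_covers by (rule AE_not_in)
    then show "AE x in leb. h x \<noteq> 0 \<longrightarrow> x \<in> (\<Union>n. piece n)"
      using AE_space[of leb] by eventually_elim (auto simp: piece_Union)
    show "AE x in leb. h x \<noteq> 0 \<longrightarrow> F x \<notin> A" if "A \<in> sets leb" "AE x in leb. x \<in> A \<longrightarrow> h x = 0" for A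
      by (rule F_quasi_invariant[OF that])
    show "1 \<le> time n" for n by (rule time_pos)
    show "open (piece n)" "is_interval (piece n)" "piece n \<subseteq> {0..1}" for n
      using \<alpha>_intervals[OF piece_\<alpha>, of n] by (auto simp: piece_def)
    show "monotone_map_on (piece n) F" for n
    proof (cases "n \<in> idx")
      case True then show ?thesis using F_smooth[OF piece_\<alpha>] by simp
    next
      case False then show ?thesis by (simp add: piece_def monotone_map_on_def monotone_on_def)
    qed
    fix n x assume x: "x \<in> piece n"
    have i: "n \<in> idx" and a: "piece n \<in> \<alpha>" using piece_cases[OF x] piece_\<alpha> by auto
    have x01: "x \<in> {0..1}" using \<alpha>_intervals[OF a] x by auto
    show "F x \<in> {0..1}" using measurable_space[OF F_unit_interval, of x] x01 by simp
    obtain D where D: "\<And>x. x \<in> piece n \<Longrightarrow> (F has_real_derivative D x) (at x)" "D C1_differentiable_on piece n"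
      using F_smooth[OF a] unfolding C2_on_def by blast
    show "(F has_real_derivative deriv F x) (at x)" using D(1)[OF x] DERIV_imp_deriv by fastforce
    have s: "\<bar>deriv F x\<bar> \<ge> \<sigma>" by (rule \<sigma>(2)[OF a x])
    then show "deriv F x \<noteq> 0" using \<sigma>(1) by auto
    have y: "0 < \<bar>1 / deriv F x\<bar>" "\<bar>1 / deriv F x\<bar> \<le> 1 / \<sigma>" using s \<sigma>(1) by (auto simp: frac_le)
    have g: "exp (\<gamma> / 2 * real (time n)) * \<bar>1 / deriv F x\<bar> \<le> ?N0 n"
    proof -
      have "exp (\<gamma> / 2 * real (time n)) * \<bar>1 / deriv F x\<bar> \<le> exp (\<gamma> / 2 * real (time n)) * (A * exp (- \<gamma> * real (bind (piece n))))"
        unfolding \<gamma>_def by (rule mult_left_mono[OF sup[OF a x]]) simp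
      then show ?thesis using i by simp
    qed
    show "exp (\<theta> * real (time n)) * \<bar>1 / deriv F x\<bar> \<le> \<rho>"
      using g N0w[of n] by (intro rate y) linarith
    have "exp (\<theta> * real (time n)) * \<bar>1 / deriv F x\<bar> \<le> exp (\<gamma> / 2 * real (time n)) * \<bar>1 / deriv F x\<bar>"
      using rate_le[of n] by (intro mult_right_mono) auto
    then show "exp (\<theta> * real (time n)) * \<bar>1 / deriv F x\<bar> \<le> ?N0 n" using g by linarith
    show "F x = (f ^^ time n) x" using \<tau>_piece[OF x] by (simp add: F_def induced_def)
  next
    fix n
    show "\<exists>W. continuous_on (piece n) W \<and> controls W (piece n) (\<lambda>x. \<bar>1 / deriv F x\<bar>) \<and>
        (\<forall>x\<in>piece n. 0 \<le> W x \<and> exp (\<theta> * real (time n)) * W x \<le> ?N0 n)"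
    proof (cases "n \<in> idx")
      case False then show ?thesis by (intro exI[of _ "\<lambda>_. 0"]) (simp add: piece_def controls_def)
    next
      case True
      note a = piece_\<alpha>[OF True]
      let ?V = "A * exp (- \<gamma> * real (bind (piece n)))"
      obtain D where D: "\<And>x. x \<in> piece n \<Longrightarrow> (F has_real_derivative D x) (at x)" "D C1_differentiable_on piece n"
        using F_smooth[OF a] unfolding C2_on_def by blast
      have dD: "deriv F x = D x" if "x \<in> piece n" for x using D(1)[OF that] by (rule DERIV_imp_deriv)
      have "\<exists>W. continuous_on (piece n) W \<and> controls W (piece n) (\<lambda>x. \<bar>1 / deriv F x\<bar>) \<and> (\<forall>x\<in>piece n. 0 \<le> W x \<and> W x \<le> ?V)"
      proof (rule continuous_control)
        show op: "open (piece n)" using \<alpha>_intervals[OF a] by simp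
        show "variation (piece n) (\<lambda>x. \<bar>1 / deriv F x\<bar>) \<le> ennreal ?V" using var[OF a] by (simp add: \<gamma>_def)
        show "0 \<le> ?V" using A by simp
        fix x assume x: "x \<in> piece n"
        obtain r L where r: "r > 0" "L \<ge> 0" "ball x r \<subseteq> piece n"
          and l: "\<And>y z. y \<in> ball x r \<Longrightarrow> z \<in> ball x r \<Longrightarrow> \<bar>D y - D z\<bar> \<le> L * \<bar>y - z\<bar>"
          using C1_locally_lipschitz[OF op D(2) x] by blast
        have "\<bar>\<bar>1 / deriv F y\<bar> - \<bar>1 / deriv F z\<bar>\<bar> \<le> L * \<bar>y - z\<bar>" if yz: "y \<in> ball x r" "z \<in> ball x r" for y z
        proof -
          have p: "y \<in> piece n" "z \<in> piece n" using yz r(3) by auto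
          have "1 \<le> \<bar>deriv F y\<bar>" "1 \<le> \<bar>deriv F z\<bar>" using \<sigma>(2)[OF a p(1)] \<sigma>(2)[OF a p(2)] \<sigma>(1) by auto
          then have "\<bar>\<bar>1 / deriv F y\<bar> - \<bar>1 / deriv F z\<bar>\<bar> \<le> \<bar>deriv F y - deriv F z\<bar>" by (rule inverse_abs_lipschitz)
          also have "\<dots> \<le> L * \<bar>y - z\<bar>" using l[OF yz] dD[OF p(1)] dD[OF p(2)] by simp
          finally show ?thesis .
        qed
        then show "\<exists>r>0. \<exists>L\<ge>0. ball x r \<subseteq> piece n \<and>
          (\<forall>y\<in>ball x r. \<forall>z\<in>ball x r. \<bar>\<bar>1 / deriv F y\<bar> - \<bar>1 / deriv F z\<bar>\<bar> \<le> L * \<bar>y - z\<bar>)" using r by blast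
      qed
      then obtain W where W: "continuous_on (piece n) W" "controls W (piece n) (\<lambda>x. \<bar>1 / deriv F x\<bar>)"
        "\<And>x. x \<in> piece n \<Longrightarrow> 0 \<le> W x \<and> W x \<le> ?V" by blast
      have "exp (\<theta> * real (time n)) * W x \<le> ?N0 n" if x: "x \<in> piece n" for x
      proof -
        have "exp (\<theta> * real (time n)) * W x \<le> exp (\<gamma> / 2 * real (time n)) * ?V"
          using W(3)[OF x] rate_le[of n] by (intro mult_mono) auto
        then show ?thesis using True by simp
      qed
      then show ?thesis using W by blast
    qed
  qed
  then show ?thesis using \<rho> by blast
qed

end

section \<open>Integration against the lifted measure\<close>

lemma sums_of_ennreal_suminf:
  assumes a: "\<And>i. 0 \<le> a i" and x: "0 \<le> x" and eq: "(\<Sum>i. ennreal (a i)) = ennreal x"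
  shows "a sums x"
proof -
  have "(\<lambda>i. ennreal (a i)) sums ennreal x"
    using summableI[of "\<lambda>i. ennreal (a i)"] eq by (metis summable_sums)
  then show ?thesis by (simp add: sums_ennreal a x)
qed

context inducing_scheme
begin

abbreviation lifted :: "real measure" where "lifted \<equiv> lifted_measure f \<tau> (density_measure h)"

abbreviation mean_time :: ennreal where "mean_time \<equiv> \<integral>\<^sup>+x. of_nat (\<tau> x) \<partial>density_measure h"

lemma iterate_measurable: "(f ^^ j) \<in> measurable leb leb"
  by (induction j) (auto simp: comp_def intro: measurable_compose[OF _ f_measurable_leb] measurable_ident)

lemma level_sets: "{x \<in> {0..1}. j < \<tau> x} \<in> sets leb"
proof -
  have "(\<lambda>x. real (\<tau> x)) \<in> borel_measurable leb" using \<tau>_integrable by auto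
  then have "{x \<in> space leb. real j < real (\<tau> x)} \<in> sets leb" by measurable
  then show ?thesis by simp
qed

text \<open>A measure specification whose set function is not a measure denotes the zero measure; this is excluded by
  the total mass 1.\<close>

lemma lifted_emeasure:
  assumes A: "A \<in> sets leb"
  shows "emeasure lifted A = (\<Sum>j. emeasure (density_measure h) ({x\<in>{0..1}. \<tau> x > j} \<inter> (f ^^ j) -` A)) / mean_time"
proof -
  interpret prob_space lifted using f_acip(1) by (simp add: acip_def)
  have ss: "sigma_sets {0..1} (sets leb) = sets leb" using sets.sigma_sets_eq[of leb] by simp
  let ?m = "\<lambda>A. (\<Sum>j. emeasure (density_measure h) ({x\<in>{0..1}. \<tau> x > j} \<inter> (f ^^ j) -` A)) / mean_time"
  note conv = emeasure_measure_of_conv[of "{0..1}" "sets leb" ?m, unfolded ss, folded lifted_measure_def]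
  have "emeasure lifted (space lifted) \<noteq> 0" using emeasure_space_1 by simp
  then have "measure_space {0..1} (sets leb) ?m"
    unfolding conv by (auto split: if_splits)
  then show ?thesis using A by (simp add: conv)
qed

lemma lifted_sets: "sets lifted = sets leb" and lifted_space: "space lifted = {0..1}"
proof -
  show s: "sets lifted = sets leb" using f_acip(1) by (simp add: acip_def)
  show "space lifted = {0..1}" using sets_eq_imp_space_eq[OF s] by simp
qed

text \<open>Dividing by 0 or \<open>\<infinity>\<close> never gives the value 1.\<close>

lemma mean_time_finite: "mean_time \<noteq> 0" "mean_time \<noteq> \<infinity>"
proof -
  interpret prob_space lifted using f_acip(1) by (simp add: acip_def)
  have s: "space lifted \<in> sets leb" using lifted_space by (metis sets.top space_leb)
  have "emeasure lifted (space lifted) = 1" by (rule emeasure_space_1)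
  then have *: "(\<Sum>j. emeasure (density_measure h) ({x\<in>{0..1}. \<tau> x > j} \<inter> (f ^^ j) -` space lifted)) / mean_time = 1"
    using lifted_emeasure[OF s] by simp
  have "t \<noteq> 0 \<and> t \<noteq> \<infinity>" if "s / t = 1" for s t :: ennreal
    using that by (cases "s = 0") (auto simp: divide_ennreal_def ennreal_mult_top)
  from this[OF *] show "mean_time \<noteq> 0" "mean_time \<noteq> \<infinity>" by auto
qed

lemma lifted_emeasure_scaled:
  assumes A: "A \<in> sets leb"
  shows "mean_time * emeasure lifted A = (\<Sum>j. emeasure (density_measure h) ({x\<in>{0..1}. \<tau> x > j} \<inter> (f ^^ j) -` A))"
  unfolding lifted_emeasure[OF A] ennreal_times_divide
  by (subst mult.commute, rule mult_divide_eq_ennreal) (use mean_time_finite in auto)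

text \<open>Level 0 of the tower carries the measure with density \<open>h\<close>, because \<open>\<tau> \<ge> 1\<close>.\<close>

lemma lifted_null:
  assumes A: "A \<in> sets leb" and n: "emeasure lifted A = 0"
  shows "AE x in leb. x \<in> A \<longrightarrow> h x = 0"
proof -
  have "(\<Sum>j. emeasure (density_measure h) ({x\<in>{0..1}. \<tau> x > j} \<inter> (f ^^ j) -` A)) = 0"
    using lifted_emeasure_scaled[OF A] n by simp
  then have "emeasure (density_measure h) ({x\<in>{0..1}. \<tau> x > 0} \<inter> (f ^^ 0) -` A) = 0"
    by (simp only: suminf_eq_zero_iff[OF summableI] zero_le) 
  moreover have "{x\<in>{0..1}. \<tau> x > 0} \<inter> (f ^^ 0) -` A = A"
    using \<tau>_bounds(1) sets.sets_into_space[OF A] by (auto simp: Suc_le_eq)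
  ultimately show ?thesis using density_null[OF A] by simp
qed

lemma lifted_nn_integral_levels:
  fixes \<phi> :: "real \<Rightarrow> ennreal"
  assumes "\<phi> \<in> borel_measurable leb"
  shows "mean_time * (\<integral>\<^sup>+x. \<phi> x \<partial>lifted) =
    (\<Sum>j. \<integral>\<^sup>+x. indicator {x\<in>{0..1}. j < \<tau> x} x * \<phi> ((f ^^ j) x) \<partial>density_measure h)"
  using assms
proof (induction \<phi> rule: borel_measurable_induct)
  case (cong \<phi> \<psi>)
  have 1: "(\<integral>\<^sup>+x. \<phi> x \<partial>lifted) = (\<integral>\<^sup>+x. \<psi> x \<partial>lifted)"
    using cong(3) by (intro nn_integral_cong) (simp add: lifted_space)
  have 2: "(\<integral>\<^sup>+x. indicator {x\<in>{0..1}. j < \<tau> x} x * \<phi> ((f ^^ j) x) \<partial>density_measure h) =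
      (\<integral>\<^sup>+x. indicator {x\<in>{0..1}. j < \<tau> x} x * \<psi> ((f ^^ j) x) \<partial>density_measure h)" for j
  proof (intro nn_integral_cong)
    fix x assume "x \<in> space (density_measure h)"
    then have "(f ^^ j) x \<in> space leb" using measurable_space[OF iterate_measurable, of x j] by (simp add: density_measure_def)
    then show "indicator {x\<in>{0..1}. j < \<tau> x} x * \<phi> ((f ^^ j) x) = indicator {x\<in>{0..1}. j < \<tau> x} x * \<psi> ((f ^^ j) x)"
      using cong(3) by simp
  qed
  show ?case using cong.IH by (simp only: 1 2) 
next
  case (set A)
  have "(\<integral>\<^sup>+x. indicator A x \<partial>lifted) = emeasure lifted A" using set by (simp add: lifted_sets)
  moreover have "(\<integral>\<^sup>+x. indicator {x\<in>{0..1}. j < \<tau> x} x * indicator A ((f ^^ j) x) \<partial>density_measure h) =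
      emeasure (density_measure h) ({x\<in>{0..1}. \<tau> x > j} \<inter> (f ^^ j) -` A)" for j
  proof -
    have "{x\<in>{0..1}. \<tau> x > j} \<inter> (f ^^ j) -` A = {x\<in>{0..1}. \<tau> x > j} \<inter> ((f ^^ j) -` A \<inter> space leb)" by auto
    then have "{x\<in>{0..1}. \<tau> x > j} \<inter> (f ^^ j) -` A \<in> sets (density_measure h)"
      using level_sets[of j] measurable_sets[OF iterate_measurable set, of j] by (simp add: density_measure_def)
    then have "emeasure (density_measure h) ({x\<in>{0..1}. \<tau> x > j} \<inter> (f ^^ j) -` A) =
      (\<integral>\<^sup>+x. indicator ({x\<in>{0..1}. \<tau> x > j} \<inter> (f ^^ j) -` A) x \<partial>density_measure h)"
      by simp
    also have "\<dots> = (\<integral>\<^sup>+x. indicator {x\<in>{0..1}. j < \<tau> x} x * indicator A ((f ^^ j) x) \<partial>density_measure h)"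
      by (intro nn_integral_cong) (auto simp: indicator_def)
    finally show ?thesis by simp
  qed
  ultimately show ?case using lifted_emeasure_scaled[OF set] by simp
next
  case (mult u c)
  have m: "(\<lambda>x. indicator {x\<in>{0..1}. j < \<tau> x} x * u ((f ^^ j) x)) \<in> borel_measurable (density_measure h)" for j
    unfolding density_measure_def
    using measurable_compose[OF iterate_measurable mult.hyps(2)] level_sets by simp
  have "(\<integral>\<^sup>+x. c * u x \<partial>lifted) = c * (\<integral>\<^sup>+x. u x \<partial>lifted)"
    using mult by (intro nn_integral_cmult) (simp add: measurable_cong_sets[OF lifted_sets refl])
  moreover have "(\<integral>\<^sup>+x. indicator {x\<in>{0..1}. j < \<tau> x} x * (c * u ((f ^^ j) x)) \<partial>density_measure h) =
     c * (\<integral>\<^sup>+x. indicator {x\<in>{0..1}. j < \<tau> x} x * u ((f ^^ j) x) \<partial>density_measure h)" for j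
    using nn_integral_cmult[OF m, of c j] by (simp add: mult.left_commute)
  ultimately show ?case using mult.IH by (simp add: ennreal_suminf_cmult mult.left_commute)
next
  case (add u v)
  have m: "(\<lambda>x. indicator {x\<in>{0..1}. j < \<tau> x} x * k ((f ^^ j) x)) \<in> borel_measurable (density_measure h)" 
    if "k \<in> borel_measurable leb" for j and k :: "real \<Rightarrow> ennreal"
    unfolding density_measure_def
    using measurable_compose[OF iterate_measurable that] level_sets by simp
  have "(\<integral>\<^sup>+x. v x + u x \<partial>lifted) = (\<integral>\<^sup>+x. v x \<partial>lifted) + (\<integral>\<^sup>+x. u x \<partial>lifted)"
    using add by (intro nn_integral_add) (simp_all add: measurable_cong_sets[OF lifted_sets refl])
  moreover have "(\<integral>\<^sup>+x. indicator {x\<in>{0..1}. j < \<tau> x} x * (v ((f ^^ j) x) + u ((f ^^ j) x)) \<partial>density_measure h) =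
     (\<integral>\<^sup>+x. indicator {x\<in>{0..1}. j < \<tau> x} x * v ((f ^^ j) x) \<partial>density_measure h) +
     (\<integral>\<^sup>+x. indicator {x\<in>{0..1}. j < \<tau> x} x * u ((f ^^ j) x) \<partial>density_measure h)" for j
    using nn_integral_add[OF m[OF add.hyps(3), of j] m[OF add.hyps(1), of j]] by (simp add: distrib_left)
  ultimately show ?case using add.IH by (simp add: distrib_left suminf_add[OF summableI summableI])
next
  case (seq U)
  have m: "(\<lambda>x. indicator {x\<in>{0..1}. j < \<tau> x} x * U i ((f ^^ j) x)) \<in> borel_measurable (density_measure h)" for i j
    unfolding density_measure_def
    using measurable_compose[OF iterate_measurable seq.hyps(1)] level_sets by simp
  have inc: "incseq (\<lambda>i x. indicator {x\<in>{0..1}. j < \<tau> x} x * U i ((f ^^ j) x))" for j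
    using seq.hyps(3) by (auto simp: incseq_def le_fun_def intro!: mult_left_mono)
  have "(\<integral>\<^sup>+x. (SUP i. U i) x \<partial>lifted) = (SUP i. \<integral>\<^sup>+x. U i x \<partial>lifted)"
    unfolding SUP_apply
    using seq by (intro nn_integral_monotone_convergence_SUP) (simp_all add: measurable_cong_sets[OF lifted_sets refl])
  moreover have "(\<integral>\<^sup>+x. indicator {x\<in>{0..1}. j < \<tau> x} x * (SUP i. U i) ((f ^^ j) x) \<partial>density_measure h) =
     (SUP i. \<integral>\<^sup>+x. indicator {x\<in>{0..1}. j < \<tau> x} x * U i ((f ^^ j) x) \<partial>density_measure h)" for j
    using nn_integral_monotone_convergence_SUP[OF inc m, of j] by (simp add: SUP_mult_left_ennreal SUP_apply image_comp)
  moreover have "(\<Sum>j. SUP i. \<integral>\<^sup>+x. indicator {x\<in>{0..1}. j < \<tau> x} x * U i ((f ^^ j) x) \<partial>density_measure h) =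
     (SUP i. \<Sum>j. \<integral>\<^sup>+x. indicator {x\<in>{0..1}. j < \<tau> x} x * U i ((f ^^ j) x) \<partial>density_measure h)"
  proof (rule ennreal_suminf_SUP_eq)
    show "incseq (\<lambda>i. \<integral>\<^sup>+x. indicator {x\<in>{0..1}. j < \<tau> x} x * U i ((f ^^ j) x) \<partial>density_measure h)" for j
      using inc[of j] by (auto simp: incseq_def le_fun_def intro!: nn_integral_mono)
  qed
  ultimately show ?case using seq.IH by (simp add: SUP_mult_left_ennreal)
qed

lemma h_bv: "bv h < \<infinity>"
proof -
  interpret prob_space "density_measure h" using F_acip(1) by (simp add: acip_def)
  have "L1_norm h = (\<integral>\<^sup>+x. ennreal (h x) * indicator (space leb) x \<partial>leb)"
    using h_nonneg by (intro nn_integral_cong) simp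
  also have "\<dots> = emeasure (density_measure h) (space leb)"
    unfolding density_measure_def using h_measurable_leb by (intro emeasure_density[symmetric]) auto
  also have "\<dots> = 1" using emeasure_space_1 by (simp add: density_measure_def)
  finally show ?thesis using h_BV by (simp add: bv_def BV_def)
qed

lemma piece_sets: "piece i \<in> sets leb" and piece_unit: "piece i \<subseteq> {0..1}"
proof -
  have "is_interval (piece i) \<and> piece i \<subseteq> {0..1}"
    using \<alpha>_intervals[OF piece_\<alpha>] by (cases "i \<in> idx") (auto simp: piece_def)
  then show "piece i \<in> sets leb" "piece i \<subseteq> {0..1}" using interval_sets_leb by auto
qed

lemma nn_integral_over_pieces:
  fixes k :: "real \<Rightarrow> ennreal"
  assumes k: "k \<in> borel_measurable leb"
  shows "(\<integral>\<^sup>+x. k x \<partial>leb) = (\<Sum>i. \<integral>\<^sup>+x. indicator (piece i) x * k x \<partial>leb)"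
proof -
  have "AE x in leb. x \<notin> {0..1} - \<Union>\<alpha>" by (rule AE_not_in[OF \<alpha>_covers])
  then have "AE x in leb. k x = (\<Sum>i. indicator (piece i) x * k x)"
    using AE_space[of leb]
  proof eventually_elim
    case (elim x)
    then have "x \<in> (\<Union>n. piece n)" using piece_Union by simp
    then obtain n where n: "x \<in> piece n" by (elim UN_E)
    have "(\<Sum>i. indicator (piece i) x) = (1 :: ennreal)"
      using suminf_indicator[OF piece_disjoint, of x] \<open>x \<in> (\<Union>n. piece n)\<close> by simp
    then show ?case by (simp add: ennreal_suminf_multc)
  qed
  then have "(\<integral>\<^sup>+x. k x \<partial>leb) = (\<integral>\<^sup>+x. (\<Sum>i. indicator (piece i) x * k x) \<partial>leb)"
    by (rule nn_integral_cong_AE)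
  also have "\<dots> = (\<Sum>i. \<integral>\<^sup>+x. indicator (piece i) x * k x \<partial>leb)"
    using k piece_sets by (intro nn_integral_suminf) auto
  finally show ?thesis .
qed

lemma lifted_nn_integral:
  fixes \<phi> :: "real \<Rightarrow> ennreal"
  assumes \<phi>: "\<phi> \<in> borel_measurable leb"
  shows "mean_time * (\<integral>\<^sup>+x. \<phi> x \<partial>lifted) =
    (\<Sum>i. \<Sum>j<time i. \<integral>\<^sup>+x. indicator (piece i) x * (\<phi> ((f ^^ j) x) * ennreal (h x)) \<partial>leb)"
proof -
  let ?U = "\<lambda>j. {x\<in>{0..1}. j < \<tau> x}"
  let ?k = "\<lambda>j x. \<phi> ((f ^^ j) x) * ennreal (h x)"
  have fm: "(\<lambda>x. \<phi> ((f ^^ j) x)) \<in> borel_measurable leb" for j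
    using measurable_compose[OF iterate_measurable \<phi>] .
  have km: "(\<lambda>x. indicator (?U j) x * ?k j x) \<in> borel_measurable leb" for j
    using fm h_measurable_leb level_sets by (intro borel_measurable_times_ennreal) auto
  have "(\<integral>\<^sup>+x. indicator (?U j) x * \<phi> ((f ^^ j) x) \<partial>density_measure h) =
      (\<Sum>i. if j < time i then \<integral>\<^sup>+x. indicator (piece i) x * ?k j x \<partial>leb else 0)" for j
  proof -
    have "(\<integral>\<^sup>+x. indicator (?U j) x * \<phi> ((f ^^ j) x) \<partial>density_measure h) =
        (\<integral>\<^sup>+x. ennreal (h x) * (indicator (?U j) x * \<phi> ((f ^^ j) x)) \<partial>leb)"
      unfolding density_measure_def
      using h_measurable_leb fm level_sets by (intro nn_integral_density borel_measurable_times_ennreal) auto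
    also have "\<dots> = (\<integral>\<^sup>+x. indicator (?U j) x * ?k j x \<partial>leb)"
      by (intro nn_integral_cong) (simp add: mult_ac)
    also have "\<dots> = (\<Sum>i. \<integral>\<^sup>+x. indicator (piece i) x * (indicator (?U j) x * ?k j x) \<partial>leb)"
      by (rule nn_integral_over_pieces[OF km])
    also have "\<dots> = (\<Sum>i. if j < time i then \<integral>\<^sup>+x. indicator (piece i) x * ?k j x \<partial>leb else 0)"
    proof (rule suminf_cong)
      fix i
      have "(\<integral>\<^sup>+x. indicator (piece i) x * (indicator (?U j) x * ?k j x) \<partial>leb) =
        (\<integral>\<^sup>+x. (if j < time i then indicator (piece i) x * ?k j x else 0) \<partial>leb)"
        using \<tau>_piece piece_unit by (intro nn_integral_cong) (auto simp: indicator_def)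
      then show "(\<integral>\<^sup>+x. indicator (piece i) x * (indicator (?U j) x * ?k j x) \<partial>leb) =
        (if j < time i then \<integral>\<^sup>+x. indicator (piece i) x * ?k j x \<partial>leb else 0)" by simp
    qed
    finally show ?thesis .
  qed
  then have "mean_time * (\<integral>\<^sup>+x. \<phi> x \<partial>lifted) =
      (\<Sum>j. \<Sum>i. if j < time i then \<integral>\<^sup>+x. indicator (piece i) x * ?k j x \<partial>leb else 0)"
    using lifted_nn_integral_levels[OF \<phi>] by simp
  also have "\<dots> = (\<Sum>i. \<Sum>j. if j < time i then \<integral>\<^sup>+x. indicator (piece i) x * ?k j x \<partial>leb else 0)"
    by (rule ennreal_suminf_swap)
  also have "\<dots> = (\<Sum>i. \<Sum>j<time i. \<integral>\<^sup>+x. indicator (piece i) x * ?k j x \<partial>leb)"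
  proof (rule suminf_cong)
    fix i
    show "(\<Sum>j. if j < time i then \<integral>\<^sup>+x. indicator (piece i) x * ?k j x \<partial>leb else 0) =
        (\<Sum>j<time i. \<integral>\<^sup>+x. indicator (piece i) x * ?k j x \<partial>leb)"
      by (subst suminf_finite[of "{..<time i}"]) auto
  qed
  finally show ?thesis .
qed

text \<open>Integrals against the lifted measure as sums over the levels \<open>j < time i\<close> of the tower above the branches. The
  formula for nonnegative functions is applied to \<open>\<phi> + B\<close> and to \<open>B\<close>.\<close>

lemma lifted_integral:
  fixes \<phi> :: "real \<Rightarrow> real"
  assumes \<phi>: "\<phi> \<in> borel_measurable leb" "\<And>x. x \<in> {0..1} \<Longrightarrow> \<bar>\<phi> x\<bar> \<le> B"
  shows "(\<lambda>i. \<Sum>j<time i. \<integral>x. indicator (piece i) x * (\<phi> ((f ^^ j) x) * h x) \<partial>leb) sums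
      (enn2real mean_time * (\<integral>x. \<phi> x \<partial>lifted))"
proof -
  interpret prob_space lifted using f_acip(1) by (simp add: acip_def)
  have iu: "(f ^^ j) x \<in> {0..1}" if "x \<in> {0..1}" for j x
    using measurable_space[OF iterate_measurable, of x j] that by simp
  have li: "integrable lifted u" if "u \<in> borel_measurable leb" "\<And>x. x \<in> {0..1} \<Longrightarrow> \<bar>u x\<bar> \<le> b" for u :: "real \<Rightarrow> real" and b
    using that by (intro integrable_const_bound[where B=b]) (auto simp: lifted_space measurable_cong_sets[OF lifted_sets refl])
  have bi: "integrable leb (\<lambda>x. indicator (piece i) x * (u ((f ^^ j) x) * h x))"
    if u: "u \<in> borel_measurable leb" "\<And>x. x \<in> {0..1} \<Longrightarrow> \<bar>u x\<bar> \<le> b" for u :: "real \<Rightarrow> real" and b i j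
  proof -
    have "integrable leb (\<lambda>x. u ((f ^^ j) x) * h x)"
    proof (rule Bochner_Integration.integrable_bound[of leb "\<lambda>x. b * h x"])
      show "integrable leb (\<lambda>x. b * h x)" using bv_integrable[OF h_bv] by simp
      show "(\<lambda>x. u ((f ^^ j) x) * h x) \<in> borel_measurable leb"
        using measurable_compose[OF iterate_measurable u(1)] h_measurable_leb by simp
      show "AE x in leb. norm (u ((f ^^ j) x) * h x) \<le> norm (b * h x)"
      proof (rule AE_I2)
        fix x assume "x \<in> space leb"
        then have "\<bar>u ((f ^^ j) x)\<bar> \<le> \<bar>b\<bar>" using u(2)[OF iu, of x j] by simp
        then show "norm (u ((f ^^ j) x) * h x) \<le> norm (b * h x)" by (simp add: abs_mult mult_right_mono)
      qed
    qed
    from integrable_mult_indicator[OF piece_sets this, of i] show ?thesis by simp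
  qed
  have nonneg: "(\<lambda>i. \<Sum>j<time i. \<integral>x. indicator (piece i) x * (u ((f ^^ j) x) * h x) \<partial>leb) sums
      (enn2real mean_time * (\<integral>x. u x \<partial>lifted))"
    if u: "u \<in> borel_measurable leb" "\<And>x. x \<in> {0..1} \<Longrightarrow> \<bar>u x\<bar> \<le> b" "\<And>x. x \<in> {0..1} \<Longrightarrow> 0 \<le> u x" for u :: "real \<Rightarrow> real" and b
  proof (rule sums_of_ennreal_suminf)
    have pos: "0 \<le> indicator (piece i) x * (u ((f ^^ j) x) * h x)" if "x \<in> {0..1}" for i j x
      using u(3)[OF iu[OF that]] h_nonneg[OF that] by simp
    show "0 \<le> (\<Sum>j<time i. \<integral>x. indicator (piece i) x * (u ((f ^^ j) x) * h x) \<partial>leb)" for i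
      using pos by (intro sum_nonneg Bochner_Integration.integral_nonneg) simp
    show "0 \<le> enn2real mean_time * (\<integral>x. u x \<partial>lifted)"
      using u(3) by (intro mult_nonneg_nonneg Bochner_Integration.integral_nonneg) (auto simp: lifted_space)
    have b: "(\<integral>\<^sup>+x. indicator (piece i) x * (ennreal (u ((f ^^ j) x)) * ennreal (h x)) \<partial>leb) =
       ennreal (\<integral>x. indicator (piece i) x * (u ((f ^^ j) x) * h x) \<partial>leb)" for i j
    proof -
      have "(\<integral>\<^sup>+x. indicator (piece i) x * (ennreal (u ((f ^^ j) x)) * ennreal (h x)) \<partial>leb) =
         (\<integral>\<^sup>+x. ennreal (indicator (piece i) x * (u ((f ^^ j) x) * h x)) \<partial>leb)"
        using u(3)[OF iu] h_nonneg by (intro nn_integral_cong) (auto simp: indicator_def ennreal_mult')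
      also have "\<dots> = ennreal (\<integral>x. indicator (piece i) x * (u ((f ^^ j) x) * h x) \<partial>leb)"
        using pos by (intro nn_integral_eq_integral bi[OF u(1,2)] AE_I2) simp_all
      finally show ?thesis .
    qed
    have "(\<Sum>i. ennreal (\<Sum>j<time i. \<integral>x. indicator (piece i) x * (u ((f ^^ j) x) * h x) \<partial>leb)) =
       (\<Sum>i. \<Sum>j<time i. \<integral>\<^sup>+x. indicator (piece i) x * (ennreal (u ((f ^^ j) x)) * ennreal (h x)) \<partial>leb)"
      unfolding b using pos by (intro suminf_cong sum_ennreal[symmetric] Bochner_Integration.integral_nonneg) simp
    also have "\<dots> = mean_time * (\<integral>\<^sup>+x. ennreal (u x) \<partial>lifted)"
      using u(1) by (subst lifted_nn_integral) auto
    also have "(\<integral>\<^sup>+x. ennreal (u x) \<partial>lifted) = ennreal (\<integral>x. u x \<partial>lifted)"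
      using u(3) by (intro nn_integral_eq_integral li[OF u(1,2)] AE_I2) (simp_all add: lifted_space)
    also have "mean_time * \<dots> = ennreal (enn2real mean_time * (\<integral>x. u x \<partial>lifted))"
      using mean_time_finite(2) by (simp add: ennreal_mult' less_top)
    finally show "(\<Sum>i. ennreal (\<Sum>j<time i. \<integral>x. indicator (piece i) x * (u ((f ^^ j) x) * h x) \<partial>leb)) =
       ennreal (enn2real mean_time * (\<integral>x. u x \<partial>lifted))" .
  qed
  have B: "0 \<le> B" using \<phi>(2)[of 0] by simp
  have p: "(\<lambda>x. \<phi> x + B) \<in> borel_measurable leb" "\<And>x. x \<in> {0..1} \<Longrightarrow> \<bar>\<phi> x + B\<bar> \<le> 2 * B" "\<And>x. x \<in> {0..1} \<Longrightarrow> 0 \<le> \<phi> x + B"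
  proof -
    show "(\<lambda>x. \<phi> x + B) \<in> borel_measurable leb" using \<phi>(1) by simp
    fix x :: real assume "x \<in> {0..1}"
    then have "\<bar>\<phi> x\<bar> \<le> B" by (rule \<phi>(2))
    then show "\<bar>\<phi> x + B\<bar> \<le> 2 * B" "0 \<le> \<phi> x + B" by linarith+
  qed
  have c: "(\<lambda>_. B) \<in> borel_measurable leb" "\<And>x. x \<in> {0..1} \<Longrightarrow> \<bar>B\<bar> \<le> B" using B by auto
  have "(\<lambda>i. (\<Sum>j<time i. \<integral>x. indicator (piece i) x * ((\<phi> ((f ^^ j) x) + B) * h x) \<partial>leb) -
        (\<Sum>j<time i. \<integral>x. indicator (piece i) x * (B * h x) \<partial>leb)) sums
      (enn2real mean_time * (\<integral>x. \<phi> x + B \<partial>lifted) - enn2real mean_time * (\<integral>x. B \<partial>lifted))"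
    using nonneg[OF p] nonneg[OF c] B by (intro sums_diff) simp_all
  moreover have "(\<Sum>j<time i. \<integral>x. indicator (piece i) x * ((\<phi> ((f ^^ j) x) + B) * h x) \<partial>leb) -
        (\<Sum>j<time i. \<integral>x. indicator (piece i) x * (B * h x) \<partial>leb) =
      (\<Sum>j<time i. \<integral>x. indicator (piece i) x * (\<phi> ((f ^^ j) x) * h x) \<partial>leb)" for i
    unfolding sum_subtractf[symmetric]
  proof (rule sum.cong[OF refl])
    fix j
    have 1: "integrable leb (\<lambda>x. indicator (piece i) x * ((\<phi> ((f ^^ j) x) + B) * h x))" by (rule bi[OF p(1,2)])
    have 2: "integrable leb (\<lambda>x. indicator (piece i) x * (B * h x))" by (rule bi[OF c])
    show "(\<integral>x. indicator (piece i) x * ((\<phi> ((f ^^ j) x) + B) * h x) \<partial>leb) - (\<integral>x. indicator (piece i) x * (B * h x) \<partial>leb) =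
        (\<integral>x. indicator (piece i) x * (\<phi> ((f ^^ j) x) * h x) \<partial>leb)"
      unfolding Bochner_Integration.integral_diff[OF 1 2, symmetric]
      by (intro Bochner_Integration.integral_cong) (auto simp: algebra_simps)
  qed
  moreover have "(\<integral>x. \<phi> x + B \<partial>lifted) - (\<integral>x. B \<partial>lifted) = (\<integral>x. \<phi> x \<partial>lifted)"
    using li[OF \<phi>] by (simp add: prob_space)
  ultimately show ?thesis by (simp flip: right_diff_distrib)
qed

lemma mean_time_pos: "0 < enn2real mean_time"
  using mean_time_finite by (simp add: enn2real_positive_iff less_top zero_less_iff_neq_zero)

end

section \<open>Correlations as observations of the renewal process\<close>

lemma sum_geometric_le:
  fixes q :: real
  assumes "0 \<le> q" "q < 1"
  shows "(\<Sum>s\<in>{1..m}. q ^ (m - s)) \<le> 1 / (1 - q)"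
proof -
  have "(\<Sum>s\<in>{1..m}. q ^ (m - s)) = (\<Sum>k<m. q ^ k)"
    by (rule sum.reindex_bij_witness[where i="\<lambda>k. m - k" and j="\<lambda>s. m - s"]) auto
  also have "\<dots> \<le> (\<Sum>k. q ^ k)" using assms by (intro sum_le_suminf summable_geometric) auto
  also have "\<dots> = 1 / (1 - q)" using assms by (intro suminf_geometric) auto
  finally show ?thesis .
qed

lemma mult_exp_le: 
  fixes \<theta> :: real
  assumes "\<theta> > 0" shows "real m * exp (- \<theta> * real m) \<le> 1 / \<theta>"
proof -
  have "\<theta> * real m \<le> exp (\<theta> * real m)" using exp_ge_add_one_self[of "\<theta> * real m"] by linarith
  then have "\<theta> * real m * exp (- (\<theta> * real m)) \<le> 1" by (simp add: exp_minus field_simps)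
  then show ?thesis using assms by (simp add: field_simps)
qed

text \<open>The tower above a branch scheme has \<open>t i\<close> levels above \<open>J i\<close>, and \<open>\<mu>\<close> is the image of its normalised measure;
  \<open>m\<close> is the mean return time.\<close>

locale branch_tower = branch_scheme f h \<theta> \<rho> F t J N + invariant_measure \<mu> f
  for f h \<theta> \<rho> F t J N \<mu> +
  fixes m :: real
  assumes h_bv: "bv h < \<infinity>"
    and iterate_monotone: "\<And>i j. j \<le> t i \<Longrightarrow> monotone_map_on (J i) (f ^^ j)"
    and sets_\<mu>: "sets \<mu> = sets leb"
    and \<mu>_null: "\<And>A. A \<in> sets leb \<Longrightarrow> emeasure \<mu> A = 0 \<Longrightarrow> AE x in leb. x \<in> A \<longrightarrow> h x = 0"
    and m_pos: "m > 0"
    and tower_integral: "\<And>\<phi> b. \<phi> \<in> borel_measurable leb \<Longrightarrow> (\<And>x. x \<in> {0..1} \<Longrightarrow> \<bar>\<phi> x\<bar> \<le> b) \<Longrightarrow>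
       (\<lambda>i. \<Sum>j<t i. \<integral>x. indicator (J i) x * (\<phi> ((f ^^ j) x) * h x) \<partial>leb) sums (m * (\<integral>x. \<phi> x \<partial>\<mu>))"
begin

text \<open>The density \<open>v\<close> is carried by all levels of the tower at once. Mass that returns after \<open>s\<close> steps is on level \<open>t i - s\<close>,
  where it sees the value of \<open>v\<close> after \<open>t i - s\<close> steps from the base. Even the mass on level 0
  counts as in transit, with \<open>t i \<ge> 1\<close> steps to go, so that nothing arrives at time 0.\<close>

definition level :: "(real \<Rightarrow> real) \<Rightarrow> nat \<Rightarrow> nat \<Rightarrow> real \<Rightarrow> real" where
  "level v s i x = v ((f ^^ (t i - s)) x) * h x"

definition release :: "(real \<Rightarrow> real) \<Rightarrow> nat \<Rightarrow> real \<Rightarrow> real" where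
  "release v s = (if s = 0 then (\<lambda>_. 0) else collect (\<lambda>i. s \<le> t i) (level v s))"

abbreviation bound_h :: real where "bound_h \<equiv> enn2real (bv h)"

context
  fixes v :: "real \<Rightarrow> real" and B :: real
  assumes v: "\<And>x. x \<in> {0..1} \<Longrightarrow> \<bar>v x\<bar> \<le> B" "variation {0..1} v \<le> ennreal B"
begin

lemma B_nonneg: "0 \<le> B" using v(1)[of 0] by simp

lemma v_measurable: "v \<in> borel_measurable leb"
  using v(2) by (intro BV_measurable) (auto intro: le_less_trans)

lemma level_bound: "x \<in> {0..1} \<Longrightarrow> \<bar>level v s i x\<bar> \<le> B * bound_h"
  unfolding level_def abs_mult
  using v(1)[OF fn_unit] bv_bound[OF h_bv] B_nonneg by (intro mult_mono) auto

lemma level_integrable: "integrable leb (level v s i)"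
proof (rule bounded_integrable_leb[where b="B * bound_h"])
  show "level v s i \<in> borel_measurable leb"
    unfolding level_def using observable_measurable[OF v_measurable] h_measurable by simp
qed (rule level_bound)

lemma variation_level: "variation (J i) (level v s i) \<le> ennreal (2 * B * bound_h)"
proof -
  have vh: "variation (J i) h \<le> ennreal bound_h"
  proof -
    have "variation (J i) h \<le> bv h"
      unfolding bv_def using variation_mono[OF J_unit, of i h] by (meson add_increasing2 zero_le)
    then show ?thesis using h_bv by simp
  qed
  have vv: "variation (J i) (\<lambda>x. v ((f ^^ (t i - s)) x)) \<le> ennreal B"
  proof -
    have "(f ^^ (t i - s)) ` J i \<subseteq> {0..1}" using J_unit fn_unit by blast
    from variation_comp[OF iterate_monotone this, of v] have "variation (J i) (\<lambda>x. v ((f ^^ (t i - s)) x)) \<le> variation {0..1} v"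
      by (simp add: comp_def)
    then show ?thesis using v(2) by (rule order_trans)
  qed
  have pt: "\<bar>v ((f ^^ (t i - s)) x)\<bar> \<le> B" "\<bar>h x\<bar> \<le> bound_h" if "x \<in> J i" for x
  proof -
    have "x \<in> {0..1}" using that J_unit by blast
    then show "\<bar>v ((f ^^ (t i - s)) x)\<bar> \<le> B" "\<bar>h x\<bar> \<le> bound_h" by (rule v(1)[OF fn_unit], rule bv_bound[OF h_bv])
  qed
  have "variation (J i) (level v s i) \<le>
      ennreal B * variation (J i) h + ennreal bound_h * variation (J i) (\<lambda>x. v ((f ^^ (t i - s)) x))"
    unfolding level_def
    using vv vh pt by (intro variation_mult) (auto intro: le_less_trans)
  also have "\<dots> \<le> ennreal B * ennreal bound_h + ennreal bound_h * ennreal B"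
    using vv vh by (intro add_mono mult_left_mono) auto
  also have "\<dots> = ennreal (B * bound_h + bound_h * B)"
    using B_nonneg by (simp only: ennreal_plus ennreal_mult mult_nonneg_nonneg enn2real_nonneg)
  finally show ?thesis by (simp add: algebra_simps)
qed

lemma bv_push_level: "bv (push i (level v s i)) \<le> ennreal (exp (- \<theta>) ^ t i * (10 * N i * (B * bound_h)))"
proof -
  have b: "0 \<le> B * bound_h" using B_nonneg by simp
  have "ennreal (exp (\<theta> * real (t i))) * bv (push i (level v s i)) \<le> ennreal (5 * N i * (2 * B * bound_h))"
  proof (rule bv_push_le_local)
    fix x assume "x \<in> J i"
    then have "x \<in> {0..1}" using J_unit by blast
    then have "\<bar>level v s i x\<bar> \<le> B * bound_h" by (rule level_bound)
    then show "\<bar>level v s i x\<bar> \<le> 2 * B * bound_h" using b by simp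
  qed (use b variation_level in auto)
  then have "ennreal (exp (- \<theta>) ^ t i) * (ennreal (exp (\<theta> * real (t i))) * bv (push i (level v s i)))
      \<le> ennreal (exp (- \<theta>) ^ t i) * ennreal (5 * N i * (2 * B * bound_h))"
    by (rule mult_left_mono) simp
  moreover have "ennreal (exp (- \<theta>) ^ t i) * ennreal (exp (\<theta> * real (t i))) = 1"
    by (simp add: ennreal_mult[symmetric] exp_of_nat_mult[symmetric] exp_add[symmetric] mult.commute)
  ultimately have "bv (push i (level v s i)) \<le> ennreal (exp (- \<theta>) ^ t i) * ennreal (5 * N i * (2 * B * bound_h))"
    by (simp only: mult.assoc[symmetric] mult_1)
  also have "\<dots> = ennreal (exp (- \<theta>) ^ t i * (10 * N i * (B * bound_h)))"
    using N_nonneg[of i] B_nonneg by (subst ennreal_mult[symmetric]) (auto simp: mult_ac)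
  finally show ?thesis .
qed

text \<open>The levels of branch \<open>i\<close> return at the times \<open>1, \<dots>, t i\<close>. Relative to \<open>exp (\<theta> * t i)\<close>, which the weight of the branch
  compensates, their exponential weights form a geometric series.\<close>

lemma strong_norm_release: "strong_norm (release v) \<le> ennreal (10 * suminf N * bound_h / (1 - exp (- \<theta>)) * B)"
proof -
  let ?q = "exp (- \<theta>)"
  have q: "0 \<le> ?q" "?q < 1" using \<theta>_pos by auto
  have b: "0 \<le> B * bound_h" using B_nonneg by simp
  let ?c = "\<lambda>i. 10 * N i * (B * bound_h)"
  have c: "0 \<le> ?c i" for i using N_nonneg b by simp
  let ?a = "\<lambda>s i. if 1 \<le> s \<and> s \<le> t i then ennreal (?q ^ (t i - s)) * ennreal (?c i) else 0"
  have "ennreal (exp (\<theta> * real s)) * bv (release v s) \<le> (\<Sum>i. ?a s i)" for s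
  proof (cases "s = 0")
    case True
    have "bv (\<lambda>_. 0) = 0" by (simp add: bv_def variation_def)
    then show ?thesis using True by (simp add: release_def)
  next
    case False
    have "bv (release v s) \<le> (\<Sum>i. if s \<le> t i then bv (push i (level v s i)) else 0)"
      using False b level_bound push_integrable[OF level_integrable]
      by (simp add: release_def) (intro bv_collect, auto)
    also have "\<dots> \<le> (\<Sum>i. if s \<le> t i then ennreal (?q ^ t i * ?c i) else 0)"
      using bv_push_level by (intro suminf_le) auto
    finally have "ennreal (exp (\<theta> * real s)) * bv (release v s) \<le>
        ennreal (exp (\<theta> * real s)) * (\<Sum>i. if s \<le> t i then ennreal (?q ^ t i * ?c i) else 0)"
      by (rule mult_left_mono) simp
    also have "\<dots> = (\<Sum>i. ennreal (exp (\<theta> * real s)) * (if s \<le> t i then ennreal (?q ^ t i * ?c i) else 0))"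
      by simp
    also have "\<dots> = (\<Sum>i. ?a s i)"
    proof (rule suminf_cong)
      fix i
      have "exp (\<theta> * real s) * ?q ^ t i = ?q ^ (t i - s)" if "s \<le> t i"
        using that by (simp add: exp_of_nat_mult[symmetric] exp_add[symmetric] of_nat_diff algebra_simps)
      then have "exp (\<theta> * real s) * (?q ^ t i * ?c i) = ?q ^ (t i - s) * ?c i" if "s \<le> t i"
        using that by (simp only: mult.assoc[symmetric])
      then show "ennreal (exp (\<theta> * real s)) * (if s \<le> t i then ennreal (?q ^ t i * ?c i) else 0) = ?a s i"
        using False c[of i] q by (auto simp: ennreal_mult[symmetric] simp del: ennreal_mult'')
    qed
    finally show ?thesis .
  qed
  then have "strong_norm (release v) \<le> (\<Sum>s. \<Sum>i. ?a s i)"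
    unfolding strong_norm_def by (intro suminf_le) auto
  also have "\<dots> = (\<Sum>i. \<Sum>s. ?a s i)" by (rule ennreal_suminf_swap)
  also have "\<dots> \<le> (\<Sum>i. ennreal (1 / (1 - ?q) * ?c i))"
  proof (rule suminf_le)
    fix i
    have "(\<Sum>s. ?a s i) = (\<Sum>s\<in>{1..t i}. ?a s i)" by (rule suminf_finite) auto
    also have "\<dots> = (\<Sum>s\<in>{1..t i}. ennreal (?q ^ (t i - s) * ?c i))"
      using c[of i] q by (intro sum.cong) (auto simp: ennreal_mult)
    also have "\<dots> = ennreal (\<Sum>s\<in>{1..t i}. ?q ^ (t i - s) * ?c i)"
      by (intro sum_ennreal mult_nonneg_nonneg[OF _ c]) simp
    also have "(\<Sum>s\<in>{1..t i}. ?q ^ (t i - s) * ?c i) = (\<Sum>s\<in>{1..t i}. ?q ^ (t i - s)) * ?c i"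
      by (rule sum_distrib_right[symmetric])
    also have "\<dots> \<le> 1 / (1 - ?q) * ?c i" using sum_geometric_le[OF q] c[of i] by (rule mult_right_mono)
    finally show "(\<Sum>s. ?a s i) \<le> ennreal (1 / (1 - ?q) * ?c i)" by (simp add: ennreal_leI)
  qed auto
  also have "\<dots> = ennreal (\<Sum>i. 1 / (1 - ?q) * ?c i)"
    using q by (intro suminf_ennreal2 summable_mult summable_mult2 N_summable mult_nonneg_nonneg[OF _ c]) auto
  also have "(\<Sum>i. 1 / (1 - ?q) * ?c i) = (\<Sum>i. N i * (10 * (B * bound_h) / (1 - ?q)))"
    by (simp add: mult_ac)
  also have "\<dots> = suminf N * (10 * (B * bound_h) / (1 - ?q))" by (rule suminf_mult2[OF N_summable, symmetric])
  also have "\<dots> = 10 * suminf N * bound_h / (1 - ?q) * B" by simp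
  finally show ?thesis .
qed

lemma release_states: "release v \<in> states"
proof -
  have "strong_norm (release v) < \<infinity>" using strong_norm_release by (auto intro: le_less_trans)
  moreover have "AE x in leb. h x = 0 \<longrightarrow> release v s x = 0" for s
  proof (cases "s = 0")
    case False
    have "AE x in leb. h x = 0 \<longrightarrow> collect (\<lambda>i. s \<le> t i) (level v s) x = 0"
      by (intro collect_vanishes level_integrable AE_I2) (simp add: level_def)
    then show ?thesis using False by (simp add: release_def)
  qed (simp add: release_def)
  ultimately show ?thesis by (simp add: states_def)
qed

text \<open>Both sides are sums over the levels of all branches. The observation misses the \<open>t i - n\<close> levels of a branch that
  return after time \<open>n\<close>, and each of these carries at most \<open>exp (- \<theta> * t i) * N i\<close> of the mass.\<close>

lemma tower_observe:
  assumes w: "w \<in> borel_measurable leb" "\<And>x. x \<in> {0..1} \<Longrightarrow> \<bar>w x\<bar> \<le> 1"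
  shows "\<bar>m * (\<integral>x. v x * w ((f ^^ n) x) \<partial>\<mu>) - observe n w (release v)\<bar>
      \<le> suminf N * bound_h / \<theta> * B * exp (- \<theta>) ^ n"
proof -
  let ?k = "\<lambda>j x. v ((f ^^ j) x) * w ((f ^^ n) ((f ^^ j) x)) * h x"
  let ?X = "\<lambda>i j. \<integral>x. indicator (J i) x * ?k j x \<partial>leb"
  have b: "0 \<le> B * bound_h" using B_nonneg by simp
  have \<phi>b: "\<bar>v x * w ((f ^^ n) x)\<bar> \<le> B" if "x \<in> {0..1}" for x
  proof -
    have "\<bar>v x\<bar> * \<bar>w ((f ^^ n) x)\<bar> \<le> B * 1"
      using v(1)[OF that] w(2)[OF fn_unit[OF that, of n]] B_nonneg by (intro mult_mono) auto
    then show ?thesis by (simp add: abs_mult)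
  qed
  have Xb: "\<bar>?X i j\<bar> \<le> exp (- \<theta> * real (t i)) * (N i * (B * bound_h))" for i j
  proof (rule branch_integral_bound[OF _ _ b])
    show "?k j \<in> borel_measurable leb"
      using observable_measurable[OF v_measurable] observable_measurable[OF observable_measurable[OF w(1)]] h_measurable by simp
    fix x :: real assume x: "x \<in> {0..1}"
    have "\<bar>v ((f ^^ j) x) * w ((f ^^ n) ((f ^^ j) x))\<bar> * \<bar>h x\<bar> \<le> B * bound_h"
      using \<phi>b[OF fn_unit[OF x]] bv_bound[OF h_bv x] B_nonneg by (intro mult_mono) auto
    then show "\<bar>?k j x\<bar> \<le> B * bound_h" by (simp add: abs_mult)
  qed
  have total: "(\<lambda>i. \<Sum>j<t i. ?X i j) sums (m * (\<integral>x. v x * w ((f ^^ n) x) \<partial>\<mu>))"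
    using v_measurable observable_measurable[OF w(1), of n] \<phi>b by (intro tower_integral[where b=B]) auto
  have obs: "(\<lambda>i. \<Sum>s\<in>{1..n}. if s \<le> t i then ?X i (t i - s) else 0) sums observe n w (release v)"
  proof -
    have "(\<lambda>i. if s \<le> t i then ?X i (t i - s) else 0) sums (\<integral>y. release v s y * w ((f ^^ (n - s)) y) \<partial>leb)"
      if s: "s \<in> {1..n}" for s
    proof -
      have "(\<lambda>i. if s \<le> t i then \<integral>y. push i (level v s i) y * w ((f ^^ (n - s)) y) \<partial>leb else 0) sums
        (\<integral>y. collect (\<lambda>i. s \<le> t i) (level v s) y * w ((f ^^ (n - s)) y) \<partial>leb)"
        by (rule collect_pairing[where b="B * bound_h"]) (use level_bound b level_integrable w in auto)
      moreover have "(\<integral>y. push i (level v s i) y * w ((f ^^ (n - s)) y) \<partial>leb) = ?X i (t i - s)" if st: "s \<le> t i" for i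
      proof -
        have "(\<integral>y. push i (level v s i) y * w ((f ^^ (n - s)) y) \<partial>leb) =
            (\<integral>x. indicator (J i) x * (level v s i x * w ((f ^^ (n - s)) (F x))) \<partial>leb)"
          using push_integral(2)[OF level_integrable observable_measurable[OF w(1), of "n - s"], of 1 i] w(2) fn_unit by blast
        also have "\<dots> = ?X i (t i - s)"
        proof (rule Bochner_Integration.integral_cong[OF refl])
          fix x
          have "(f ^^ (n - s)) (F x) = (f ^^ n) ((f ^^ (t i - s)) x)" if "x \<in> J i"
          proof -
            have "n - s + t i = n + (t i - s)" using s st by simp
            then have "(f ^^ (n - s)) ((f ^^ t i) x) = (f ^^ n) ((f ^^ (t i - s)) x)"
              using fun_cong[OF funpow_add[of "n - s" "t i" f], of x] fun_cong[OF funpow_add[of n "t i - s" f], of x] by simp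
            then show ?thesis using F_eq[OF that] by simp
          qed
          then show "indicator (J i) x * (level v s i x * w ((f ^^ (n - s)) (F x))) = indicator (J i) x * ?k (t i - s) x"
            by (simp add: indicator_def level_def)
        qed
        finally show ?thesis .
      qed
      ultimately show ?thesis using s by (simp add: release_def cong: if_cong)
    qed
    then have "(\<lambda>i. \<Sum>s\<in>{1..n}. if s \<le> t i then ?X i (t i - s) else 0) sums
        (\<Sum>s\<in>{1..n}. \<integral>y. release v s y * w ((f ^^ (n - s)) y) \<partial>leb)"
      by (rule sums_sum)
    also have "(\<Sum>s\<in>{1..n}. \<integral>y. release v s y * w ((f ^^ (n - s)) y) \<partial>leb) = observe n w (release v)"
      unfolding observe_def by (rule sum.mono_neutral_left) (auto simp: release_def)
    finally show ?thesis .
  qed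
  let ?R = "suminf N * (B * bound_h / \<theta> * exp (- \<theta>) ^ n)"
  have diff: "\<bar>(\<Sum>j<t i. ?X i j) - (\<Sum>s\<in>{1..n}. if s \<le> t i then ?X i (t i - s) else 0)\<bar>
      \<le> N i * (B * bound_h / \<theta> * exp (- \<theta>) ^ n)" for i
  proof -
    have "(\<Sum>j<t i. ?X i j) = (\<Sum>s\<in>{1..t i}. ?X i (t i - s))"
      by (rule sum.reindex_bij_witness[where j="\<lambda>k. t i - k" and i="\<lambda>s. t i - s"]) auto
    moreover have "(\<Sum>s\<in>{1..n}. if s \<le> t i then ?X i (t i - s) else 0) = (\<Sum>s\<in>{1..min n (t i)}. ?X i (t i - s))"
      by (rule sum.mono_neutral_cong_right) auto
    moreover have "(\<Sum>s\<in>{1..t i}. ?X i (t i - s)) = (\<Sum>s\<in>{1..min n (t i)}. ?X i (t i - s)) + (\<Sum>s\<in>{n<..t i}. ?X i (t i - s))"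
      by (subst sum.union_disjoint[symmetric]) (auto intro!: sum.cong)
    ultimately have "\<bar>(\<Sum>j<t i. ?X i j) - (\<Sum>s\<in>{1..n}. if s \<le> t i then ?X i (t i - s) else 0)\<bar>
        = \<bar>\<Sum>s\<in>{n<..t i}. ?X i (t i - s)\<bar>" by simp
    also have "\<dots> \<le> (\<Sum>s\<in>{n<..t i}. \<bar>?X i (t i - s)\<bar>)" by (rule sum_abs)
    also have "\<dots> \<le> (\<Sum>s\<in>{n<..t i}. exp (- \<theta> * real (t i)) * (N i * (B * bound_h)))"
      by (intro sum_mono Xb)
    also have "\<dots> = real (t i - n) * exp (- \<theta> * real (t i)) * (N i * (B * bound_h))" by simp
    also have "\<dots> \<le> (1 / \<theta> * exp (- \<theta>) ^ n) * (N i * (B * bound_h))"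
    proof (rule mult_right_mono)
      show "real (t i - n) * exp (- \<theta> * real (t i)) \<le> 1 / \<theta> * exp (- \<theta>) ^ n"
      proof (cases "n \<le> t i")
        case True
        then have "exp (- \<theta> * real (t i)) = exp (- \<theta> * real (t i - n)) * exp (- \<theta>) ^ n"
          by (simp add: exp_of_nat_mult[symmetric] exp_add[symmetric] of_nat_diff algebra_simps)
        then show ?thesis
          using mult_right_mono[OF mult_exp_le[OF \<theta>_pos, of "t i - n"], of "exp (- \<theta>) ^ n"] by (simp add: mult.assoc)
      qed (use \<theta>_pos in simp)
      show "0 \<le> N i * (B * bound_h)" using N_nonneg b by simp
    qed
    also have "\<dots> = N i * (B * bound_h / \<theta> * exp (- \<theta>) ^ n)" by simp
    finally show ?thesis .
  qed
  have "\<bar>m * (\<integral>x. v x * w ((f ^^ n) x) \<partial>\<mu>) - observe n w (release v)\<bar> \<le> ?R"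
  proof -
    have s: "(\<lambda>i. (\<Sum>j<t i. ?X i j) - (\<Sum>s\<in>{1..n}. if s \<le> t i then ?X i (t i - s) else 0)) sums
        (m * (\<integral>x. v x * w ((f ^^ n) x) \<partial>\<mu>) - observe n w (release v))"
      by (rule sums_diff[OF total obs])
    have R: "(\<lambda>i. N i * (B * bound_h / \<theta> * exp (- \<theta>) ^ n)) sums ?R"
      by (intro sums_mult2 summable_sums N_summable)
    show ?thesis
      by (rule abs_leI[OF sums_le[OF abs_le_D1[OF diff] s R] sums_le[OF abs_le_D2[OF diff] sums_minus[OF s] R]])
  qed
  then show ?thesis by (simp add: mult_ac)
qed

end

text \<open>States, their norm and their observation depend on \<open>f\<close>, \<open>h\<close> and \<open>\<theta>\<close> only. So the state released by \<open>F\<close> may be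
  fed into the renewal process of a power of \<open>F\<close>, whose contraction rate is small enough.\<close>

theorem correlation_decay:
  assumes \<rho>: "0 \<le> \<rho>" "\<rho> < 1" and mix: "mixing f \<mu>"
  shows "\<exists>K\<ge>0. \<exists>p. 0 < p \<and> p < 1 \<and> (\<forall>v B w n.
    (\<forall>x\<in>{0..1}. \<bar>v x\<bar> \<le> B) \<longrightarrow> variation {0..1} v \<le> ennreal B \<longrightarrow>
    w \<in> borel_measurable leb \<longrightarrow> (\<forall>x\<in>{0..1}. \<bar>w x\<bar> \<le> 1) \<longrightarrow> (\<integral>x. w x \<partial>\<mu>) = 0 \<longrightarrow>
    \<bar>\<integral>x. v x * w ((f ^^ n) x) \<partial>\<mu>\<bar> \<le> K * B * p ^ n)"
proof -
  obtain k where "\<rho> ^ k < 1 / 4" using real_arch_pow_inv[of "1/4" \<rho>] \<rho> by auto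
  then have k: "\<rho> ^ Suc k \<le> 1 / 4" using power_decreasing[of k "Suc k" \<rho>] \<rho> by linarith
  obtain t' J' N' where "branch_scheme f h \<theta> (\<rho> ^ Suc k) (F ^^ Suc k) t' J' N'"
    using branch_scheme_power[OF branch_scheme_axioms, of k] by blast
  then interpret S: branch_scheme f h \<theta> "\<rho> ^ Suc k" "F ^^ Suc k" t' J' N' .
  define W where "W = {w \<in> borel_measurable leb. (\<forall>x\<in>{0..1}. \<bar>w x\<bar> \<le> 1) \<and> (\<integral>x. w x \<partial>\<mu>) = (0 :: real)}"
  have W: "w \<in> borel_measurable leb" "\<And>x. x \<in> {0..1} \<Longrightarrow> \<bar>w x\<bar> \<le> 1" "(\<integral>x. w x \<partial>\<mu>) = 0" if "w \<in> W" for w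
    using that by (auto simp: W_def)
  have "\<exists>K\<ge>0. \<exists>p. 0 < p \<and> p < 1 \<and> (\<forall>G\<in>states. \<forall>w\<in>W. \<forall>n. \<bar>observe n w G\<bar> \<le> K * p ^ n * enn2real (strong_norm G))"
  proof (rule S.observe_exponential_decay)
    show "0 \<le> \<rho> ^ Suc k" using \<rho> by simp
    show "(\<lambda>n. \<integral>x. g x * w ((f ^^ n) x) \<partial>leb) \<longlonglongrightarrow> 0"
      if w: "w \<in> W" and g: "bv g < \<infinity>" "AE x in leb. h x = 0 \<longrightarrow> g x = 0" for w g
    proof (rule mixing_pairing_null[OF mix sets_\<mu> bv_integrable[OF g(1)] _ W[OF w]])
      fix A assume A: "A \<in> sets leb" "emeasure \<mu> A = 0"
      show "AE x in leb. x \<in> A \<longrightarrow> g x = 0"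
        using \<mu>_null[OF A] g(2) by eventually_elim auto
    qed
  qed (use k W in auto)
  then obtain K p where K: "K \<ge> 0" and p: "0 < p" "p < 1"
    and dec: "\<And>G w n. G \<in> states \<Longrightarrow> w \<in> W \<Longrightarrow> \<bar>observe n w G\<bar> \<le> K * p ^ n * enn2real (strong_norm G)" by blast
  define c1 where "c1 = 10 * suminf N * bound_h / (1 - exp (- \<theta>))"
  define c2 where "c2 = suminf N * bound_h / \<theta>"
  define r where "r = max p (exp (- \<theta>))"
  have sN: "0 \<le> suminf N" using N_nonneg N_summable by (intro suminf_nonneg) auto
  have c: "0 \<le> c1" "0 \<le> c2" using sN \<theta>_pos by (auto simp: c1_def c2_def)
  have r: "0 < r" "r < 1" using p \<theta>_pos by (auto simp: r_def)
  have main: "\<bar>\<integral>x. v x * w ((f ^^ n) x) \<partial>\<mu>\<bar> \<le> (K * c1 + c2) / m * B * r ^ n"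
    if v: "\<forall>x\<in>{0..1}. \<bar>v x\<bar> \<le> B" "variation {0..1} v \<le> ennreal B" 
      and w: "w \<in> borel_measurable leb" "\<forall>x\<in>{0..1}. \<bar>w x\<bar> \<le> 1" "(\<integral>x. w x \<partial>\<mu>) = 0" for v w :: "real \<Rightarrow> real" and B n
  proof -
    let ?I = "\<integral>x. v x * w ((f ^^ n) x) \<partial>\<mu>"
    have v': "\<And>x. x \<in> {0..1} \<Longrightarrow> \<bar>v x\<bar> \<le> B" using v(1) by blast
    have w': "\<And>x. x \<in> {0..1} \<Longrightarrow> \<bar>w x\<bar> \<le> 1" using w(2) by blast
    have B: "0 \<le> B" by (rule B_nonneg[OF v' v(2)])
    have wW: "w \<in> W" using w by (simp add: W_def)
    have "\<bar>observe n w (release v)\<bar> \<le> K * p ^ n * enn2real (strong_norm (release v))"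
      by (rule dec[OF release_states[OF v' v(2)] wW])
    also have "\<dots> \<le> K * r ^ n * (c1 * B)"
    proof (intro mult_mono)
      show "p ^ n \<le> r ^ n" using p by (intro power_mono) (auto simp: r_def)
      show "enn2real (strong_norm (release v)) \<le> c1 * B"
        by (rule enn2real_leI[OF mult_nonneg_nonneg[OF c(1) B] strong_norm_release[OF v' v(2), folded c1_def]])
    qed (use K p r in auto)
    finally have 1: "\<bar>observe n w (release v)\<bar> \<le> K * c1 * B * r ^ n" by (simp add: mult_ac)
    have "\<bar>m * ?I - observe n w (release v)\<bar> \<le> c2 * B * exp (- \<theta>) ^ n"
      using tower_observe[OF v' v(2) w(1) w'] by (simp add: c2_def)
    also have "\<dots> \<le> c2 * B * r ^ n"
      using c B by (intro mult_left_mono power_mono) (auto simp: r_def)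
    finally have 2: "\<bar>m * ?I - observe n w (release v)\<bar> \<le> c2 * B * r ^ n" .
    have "\<bar>m * ?I\<bar> \<le> K * c1 * B * r ^ n + c2 * B * r ^ n" using 1 2 by linarith
    also have "\<dots> = (K * c1 + c2) * B * r ^ n" by (simp add: algebra_simps)
    finally have "m * \<bar>?I\<bar> \<le> (K * c1 + c2) * B * r ^ n" using m_pos by (simp add: abs_mult)
    then show ?thesis using m_pos by (simp add: field_simps)
  qed
  show ?thesis
  proof (rule exI[of _ "(K * c1 + c2) / m"], rule conjI, goal_cases)
    case 1
    show ?case using K c m_pos by simp
  next
    case 2
    show ?case by (rule exI[of _ r]) (use r main in blast)
  qed
qed

end

section \<open>Exponential decay of correlations\<close>

lemma Linf_norm:
  assumes "w \<in> Linf"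
  shows "0 \<le> Linf_norm w" and "AE x in leb. \<bar>w x\<bar> \<le> Linf_norm w"
proof -
  let ?E = "esssup leb (\<lambda>x. ereal \<bar>w x\<bar>)"
  have w: "w \<in> borel_measurable leb" "?E < \<infinity>" using assms by (auto simp: Linf_def)
  have "emeasure leb (space leb) \<noteq> 0" using leb.emeasure_space_1 by simp
  then have "0 = esssup leb (\<lambda>x. 0 :: ereal)" by (intro esssup_const[symmetric])
  also have "\<dots> \<le> ?E" by (intro esssup_mono) auto
  finally have E: "0 \<le> ?E" .
  have eq: "ereal (Linf_norm w) = ?E" unfolding Linf_norm_def using E w(2) by (intro ereal_real') auto
  show "0 \<le> Linf_norm w" using E unfolding eq[symmetric] by simp
  have "AE x in leb. ereal \<bar>w x\<bar> \<le> ?E" by (rule esssup_AE)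
  then show "AE x in leb. \<bar>w x\<bar> \<le> Linf_norm w" unfolding eq[symmetric] by simp
qed

text \<open>At some point \<open>\<bar>v\<bar>\<close> is at most its essential supremum, and the variation bounds the rest.\<close>

lemma BV_norm_bounds:
  assumes "v \<in> BV"
  shows "v \<in> borel_measurable leb" and "x \<in> {0..1} \<Longrightarrow> \<bar>v x\<bar> \<le> BV_norm v"
    and "variation {0..1} v \<le> ennreal (BV_norm v)"
proof -
  let ?V = "enn2real (variation {0..1} v)"
  have fin: "variation {0..1} v < \<infinity>" using assms by (simp add: BV_def)
  show vm: "v \<in> borel_measurable leb" using fin by (rule BV_measurable)
  obtain W where W: "controls W {0..1} v" "\<And>x. x \<in> {0..1} \<Longrightarrow> 0 \<le> W x \<and> W x \<le> ?V"
    using variation_controlE[OF fin] by blast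
  have up: "\<bar>v y - v x\<bar> \<le> ?V" if "x \<in> {0..1}" "y \<in> {0..1}" "x \<le> y" for x y
    using controlsD[OF W(1) that] W(2)[OF that(1)] W(2)[OF that(2)] by linarith
  have osc: "\<bar>v x\<bar> \<le> \<bar>v y\<bar> + ?V" if "x \<in> {0..1}" "y \<in> {0..1}" for x y
    using up[OF that] up[OF that(2,1)] by (cases "x \<le> y") auto
  have "AE x in leb. ereal \<bar>v x\<bar> \<le> ereal (\<bar>v 0\<bar> + ?V)"
    using osc[of _ 0] by (intro AE_I2) simp
  then have "esssup leb (\<lambda>x. ereal \<bar>v x\<bar>) \<le> ereal (\<bar>v 0\<bar> + ?V)"
    using vm by (intro esssup_I) auto
  then have L: "v \<in> Linf" using vm by (auto simp: Linf_def intro: le_less_trans)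
  have "\<exists>y\<in>{0..1}. \<bar>v y\<bar> \<le> Linf_norm v"
    using eventually_happens'[OF leb.ae_filter_bot eventually_conj[OF AE_space Linf_norm(2)[OF L]]] by auto
  then obtain y where "y \<in> {0..1}" "\<bar>v y\<bar> \<le> Linf_norm v" by blast
  then show "\<bar>v x\<bar> \<le> BV_norm v" if "x \<in> {0..1}" using osc[OF that, of y] by (simp add: BV_norm_def)
  have "variation {0..1} v = ennreal ?V" using fin by simp
  then show "variation {0..1} v \<le> ennreal (BV_norm v)"
    using Linf_norm(1)[OF L] by (simp add: BV_norm_def ennreal_leI)
qed

context invariant_measure
begin

lemma bounded_integrable:
  assumes "sets \<mu> = sets leb" and u: "u \<in> borel_measurable leb" "\<And>x. x \<in> {0..1} \<Longrightarrow> \<bar>u x\<bar> \<le> b"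
  shows "integrable \<mu> (u :: real \<Rightarrow> real)"
  using u sets_eq_imp_space_eq[OF assms(1)]
  by (intro integrable_const_bound[where B=b]) (auto simp: measurable_cong_sets[OF assms(1) refl])

text \<open>Truncating \<open>w\<close> at its norm changes it on a null set only. The correlation is not affected by subtracting
  from \<open>w\<close> its mean, which leaves a single integral.\<close>

lemma correlation_reduction:
  fixes v w :: "real \<Rightarrow> real"
  assumes s: "sets \<mu> = sets leb" and ac: "absolutely_continuous leb \<mu>"
    and v: "v \<in> borel_measurable leb" "\<And>x. x \<in> {0..1} \<Longrightarrow> \<bar>v x\<bar> \<le> B"
    and w: "w \<in> borel_measurable leb" "AE x in leb. \<bar>w x\<bar> \<le> M" and M: "0 \<le> M"
  shows "\<exists>u. u \<in> borel_measurable leb \<and> (\<forall>x\<in>{0..1}. \<bar>u x\<bar> \<le> 1) \<and> (\<integral>x. u x \<partial>\<mu>) = 0 \<and>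
    (\<forall>n. correlation T \<mu> v w n = 2 * M * (\<integral>x. v x * u ((T ^^ n) x) \<partial>\<mu>))"
proof -
  note bm = measurable_cong_sets[OF s refl]
  have sp: "space \<mu> = {0..1}" using sets_eq_imp_space_eq[OF s] by simp
  have Tu: "(T ^^ n) x \<in> {0..1}" if "x \<in> {0..1}" for n x using measurable_space[OF Tn_measurable, of x n] that sp by simp
  define w' where "w' x = max (- M) (min M (w x))" for x
  define e where "e = (\<integral>x. w' x \<partial>\<mu>)"
  have w'm: "w' \<in> borel_measurable leb" unfolding w'_def using w(1) by measurable
  have w'b: "\<bar>w' x\<bar> \<le> M" for x using M by (auto simp: w'_def)
  have wi: "integrable \<mu> w'" using bounded_integrable[OF s w'm w'b] .
  have e: "\<bar>e\<bar> \<le> M"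
  proof -
    have "\<bar>e\<bar> \<le> (\<integral>x. \<bar>w' x\<bar> \<partial>\<mu>)" unfolding e_def using integral_norm_bound[of \<mu> w'] by simp
    also have "\<dots> \<le> (\<integral>x. M \<partial>\<mu>)" using wi w'b by (intro integral_mono) auto
    finally show ?thesis by (simp add: prob_space)
  qed
  have "AE x in leb. w x = w' x" using w(2) by eventually_elim (auto simp: w'_def)
  then have ae: "AE x in \<mu>. w x = w' x" by (rule absolutely_continuous_AE[OF s ac])
  have aen: "AE x in \<mu>. w ((T ^^ n) x) = w' ((T ^^ n) x)" for n
    using AE_distrD[OF Tn_measurable, of "\<lambda>x. w x = w' x" n] ae unfolding Tn_distr .
  define u where "u x = (w' x - e) / (2 * M)" for x
  have um: "u \<in> borel_measurable leb" unfolding u_def using w'm by simp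
  have ub: "\<bar>u x\<bar> \<le> 1" for x
  proof (cases "M = 0")
    case False
    then have "\<bar>w' x - e\<bar> \<le> 2 * M" using w'b[of x] e by linarith
    then show ?thesis using False M by (simp add: u_def abs_divide divide_le_eq)
  qed (simp add: u_def)
  have u0: "(\<integral>x. u x \<partial>\<mu>) = 0" unfolding u_def using wi by (simp add: prob_space e_def)
  have w'u: "w' x - e = 2 * M * u x" for x
  proof (cases "M = 0")
    case True
    then show ?thesis using w'b[of x] e by simp
  qed (simp add: u_def)
  have "correlation T \<mu> v w n = 2 * M * (\<integral>x. v x * u ((T ^^ n) x) \<partial>\<mu>)" for n
  proof -
    have Tm: "(\<lambda>x. k ((T ^^ n) x)) \<in> borel_measurable leb" if "k \<in> borel_measurable leb" for k :: "real \<Rightarrow> real"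
      using measurable_compose[OF Tn_measurable, of k borel n] that unfolding bm .
    have B: "0 \<le> B" using v(2)[of 0] by simp
    have i1: "integrable \<mu> (\<lambda>x. v x * w' ((T ^^ n) x))"
    proof (rule bounded_integrable[OF s])
      show "(\<lambda>x. v x * w' ((T ^^ n) x)) \<in> borel_measurable leb" using v(1) Tm[OF w'm] by simp
      show "\<bar>v x * w' ((T ^^ n) x)\<bar> \<le> B * M" if "x \<in> {0..1}" for x
        unfolding abs_mult using v(2)[OF that] w'b B by (intro mult_mono) auto
    qed
    have i2: "integrable \<mu> (\<lambda>x. v x * e)" using bounded_integrable[OF s v] by simp
    have 1: "(\<integral>x. v x * w ((T ^^ n) x) \<partial>\<mu>) = (\<integral>x. v x * w' ((T ^^ n) x) \<partial>\<mu>)"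
      using aen[of n] v(1) Tm[OF w(1)] Tm[OF w'm] by (intro integral_cong_AE) (auto simp: bm)
    have 2: "(\<integral>x. w x \<partial>\<mu>) = e"
      unfolding e_def using ae w(1) w'm by (intro integral_cong_AE) (auto simp: bm)
    have "correlation T \<mu> v w n = (\<integral>x. v x * w' ((T ^^ n) x) \<partial>\<mu>) - (\<integral>x. v x * e \<partial>\<mu>)"
      unfolding correlation_def 1 2 by simp
    also have "\<dots> = (\<integral>x. v x * w' ((T ^^ n) x) - v x * e \<partial>\<mu>)"
      by (rule Bochner_Integration.integral_diff[OF i1 i2, symmetric])
    also have "\<dots> = (\<integral>x. 2 * M * (v x * u ((T ^^ n) x)) \<partial>\<mu>)"
    proof (rule Bochner_Integration.integral_cong[OF refl])
      fix x
      have "v x * w' ((T ^^ n) x) - v x * e = v x * (w' ((T ^^ n) x) - e)" by (simp add: right_diff_distrib)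
      then show "v x * w' ((T ^^ n) x) - v x * e = 2 * M * (v x * u ((T ^^ n) x))" by (simp add: w'u)
    qed
    also have "\<dots> = 2 * M * (\<integral>x. v x * u ((T ^^ n) x) \<partial>\<mu>)" by simp
    finally show ?thesis .
  qed
  then show ?thesis using um ub u0 by blast
qed

end

context inducing_scheme
begin

theorem exponential_mixing:
  assumes cm: "critical_map f l" and pos: "c\<^sub>0 > 0" "C\<^sub>0 > 0"
    and growth: "\<And>c n. c \<in> crit f \<Longrightarrow> l c > 1 \<Longrightarrow> n \<ge> 1 \<Longrightarrow> d f c n * E f l c n \<ge> C\<^sub>0 * exp (c\<^sub>0 * real n)"
    and mix: "mixing f lifted"
  shows "\<exists>c>0. \<exists>C>0. \<forall>v\<in>BV. \<forall>w\<in>Linf. \<forall>n\<ge>1.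
     \<bar>correlation f lifted v w n\<bar> \<le> C * BV_norm v * Linf_norm w * exp (- c * real n)"
proof -
  obtain \<theta> \<rho> N where \<rho>: "0 \<le> \<rho>" "\<rho> < 1" and S: "branch_scheme f h \<theta> \<rho> F time piece N"
    using base_branch_scheme[OF cm pos growth] by blast
  have I: "invariant_measure lifted f"
    using f_acip(1) by (auto simp: acip_def invariant_measure_def invariant_measure_axioms_def)
  interpret branch_tower f h \<theta> \<rho> F time piece N lifted "enn2real mean_time"
  proof (intro branch_tower.intro S I branch_tower_axioms.intro)
    show "bv h < \<infinity>" by (rule h_bv)
    show "sets lifted = sets leb" by (rule lifted_sets)
    show "0 < enn2real mean_time" by (rule mean_time_pos)
    show "AE x in leb. x \<in> A \<longrightarrow> h x = 0" if "A \<in> sets leb" "emeasure lifted A = 0" for A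
      by (rule lifted_null[OF that])
    show "(\<lambda>i. \<Sum>j<time i. \<integral>x. indicator (piece i) x * (\<phi> ((f ^^ j) x) * h x) \<partial>leb) sums
        (enn2real mean_time * (\<integral>x. \<phi> x \<partial>lifted))"
      if "\<phi> \<in> borel_measurable leb" "\<And>x. x \<in> {0..1} \<Longrightarrow> \<bar>\<phi> x\<bar> \<le> b" for \<phi> b
      by (rule lifted_integral[OF that])
    fix i j assume j: "j \<le> time i"
    show "monotone_map_on (piece i) (f ^^ j)"
    proof (cases "piece i = {}")
      case True
      then show ?thesis by (simp add: monotone_map_on_def mono_on_def)
    next
      case False
      then obtain x where x: "x \<in> piece i" by blast
      show ?thesis using iterates[OF piece_\<alpha>[OF piece_cases[OF x]] x] j \<tau>_piece[OF x] by simp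
    qed
  qed
  obtain K p where K: "K \<ge> 0" and p: "0 < p" "p < 1" and decay: "\<And>v B w n.
    \<lbrakk>\<forall>x\<in>{0..1}. \<bar>v x\<bar> \<le> B; variation {0..1} v \<le> ennreal B;
    w \<in> borel_measurable leb; \<forall>x\<in>{0..1}. \<bar>w x\<bar> \<le> 1; (\<integral>x. w x \<partial>lifted) = 0\<rbrakk> \<Longrightarrow>
    \<bar>\<integral>x. v x * w ((f ^^ n) x) \<partial>lifted\<bar> \<le> K * B * p ^ n"
    using correlation_decay[OF \<rho> mix] by blast
  have ac: "absolutely_continuous leb lifted" using f_acip(1) by (simp add: acip_def)
  show ?thesis
  proof (rule exI[of _ "- ln p"], rule conjI[OF _ exI[of _ "2 * K + 1"]], goal_cases)
    case 1
    show ?case using p by (simp add: ln_less_zero)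
  next
    case 2
    have "\<bar>correlation f lifted v w n\<bar> \<le> (2 * K + 1) * BV_norm v * Linf_norm w * exp (- (- ln p) * real n)"
      if v: "v \<in> BV" and w: "w \<in> Linf" for v w n
    proof -
      note V = BV_norm_bounds[OF v]
      note M = Linf_norm[OF w]
      have wm: "w \<in> borel_measurable leb" using w by (simp add: Linf_def)
      obtain u where u: "u \<in> borel_measurable leb" "\<forall>x\<in>{0..1}. \<bar>u x\<bar> \<le> 1" "(\<integral>x. u x \<partial>lifted) = 0"
        and cu: "\<And>n. correlation f lifted v w n = 2 * Linf_norm w * (\<integral>x. v x * u ((f ^^ n) x) \<partial>lifted)"
        using correlation_reduction[OF lifted_sets ac V(1,2) wm M(2,1)] by blast
      have "\<bar>\<integral>x. v x * u ((f ^^ n) x) \<partial>lifted\<bar> \<le> K * BV_norm v * p ^ n"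
        using V by (intro decay u) auto
      also have "\<dots> \<le> (2 * K + 1) / 2 * BV_norm v * p ^ n"
        using V(2)[of 0] p by (intro mult_right_mono) auto
      finally have "2 * Linf_norm w * \<bar>\<integral>x. v x * u ((f ^^ n) x) \<partial>lifted\<bar> \<le>
          2 * Linf_norm w * ((2 * K + 1) / 2 * BV_norm v * p ^ n)"
        using M(1) by (intro mult_left_mono) auto
      also have "\<dots> = (2 * K + 1) * BV_norm v * Linf_norm w * p ^ n" by (simp add: field_simps)
      also have "p ^ n = exp (- (- ln p) * real n)"
        using p by (simp add: mult.commute exp_of_nat_mult)
      finally show ?thesis unfolding cu using M(1) by (simp add: abs_mult)
    qed
    then show ?case using K by auto
  qed
qed

end

theorem theorem1p5:
  fixes f :: "real \<Rightarrow> real" and l :: "one_sided \<Rightarrow> real"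
    and \<delta> :: real and b :: "real \<Rightarrow> nat" and q\<^sub>0 :: nat and \<alpha> :: "real set set"
    and h :: "real \<Rightarrow> real" and \<mu> :: "real measure" and c\<^sub>0 C\<^sub>0 :: real
  assumes "piecewise_smooth f" and "finite (crit f)"
    and "A1 f l" and "A2 f"
    and "c\<^sub>0 > 0" and "C\<^sub>0 > 0"
    and "\<And>c n. c \<in> crit f \<Longrightarrow> l c > 1 \<Longrightarrow> n \<ge> 1 \<Longrightarrow>
           d f c n * E f l c n \<ge> C\<^sub>0 * exp (c\<^sub>0 * real n)"
    and "inducing_scheme f l \<delta> b q\<^sub>0 \<alpha> h"
    and "\<mu> = lifted_measure f (tau f \<delta> b q\<^sub>0) (density_measure h)"
    and "mixing f \<mu>"
  shows "\<exists>c>0. \<exists>C>0. \<forall>v\<in>BV. \<forall>w\<in>Linf. \<forall>n\<ge>1.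
           \<bar>correlation f \<mu> v w n\<bar> \<le> C * BV_norm v * Linf_norm w * exp (- c * real n)"
proof -
  have "critical_map f l" using assms(1-3) by unfold_locales
  from inducing_scheme.exponential_mixing[OF assms(8) this assms(5,6,7)] assms(10)
  show ?thesis unfolding assms(9) by simp
qed

end
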